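(* Let $A_1,A_2$ be positive $\zeta$-comparable operators with spectral cut $R_\pi$ ($\theta=\pi$), with resolvent decay $\|(A_i-\lambda)^{-1}\|=O(|\lambda|^{-1})$ valid in $\Lambda_\pi$ with $\delta>\pi/2$. Put $\zeta_{\rm rel}(0)=\zeta_\pi(A_1,A_2,0)$ and $\mathcal S=\mathcal S_0$. Then as $\varepsilon\to0^+$ there is an asymptotic expansion $$\int_\varepsilon^\infty-\frac1t\mathrm{Tr}(e^{-tA_1}-e^{-tA_2})\,dt\ \sim\ \log\det{}_F\mathcal S-\mathrm{LIM}_{\mu\to\infty}\log\det{}_F\mathcal S_{-\mu}-\zeta_{\rm rel}(0)\Gamma'(1)+\zeta_{\rm rel}(0)\log\varepsilon+\sum_{j\ge0,\,j\ne J}\sum_{k=0}^1c'_{j,k}\,\varepsilon^{\alpha_j-1}\log^k\varepsilon$$ for some constants $c'_{j,k}$. Hence $$\log\det{}_{heat}(A_1,A_2)=\log\det{}_F\mathcal S-\mathrm{LIM}_{\lambda\to\infty}\log\det{}_F\mathcal S_{-\lambda}-\zeta_{\rm rel}(0)\Gamma'(1),$$ and $$\det{}_\zeta(A_1,A_2)=\det{}_{heat}(A_1,A_2)\,e^{\zeta_{\rm rel}(0)\Gamma'(1)}.$$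
   Context: $H$ is a complex Hilbert space. $R_\pi=(-\infty,0]$ is a spectral cut for an invertible closed operator $A$ on $H$ if there are $\delta,\varrho>0$ such that $(A-\lambda)^{-1}$ exists and is holomorphic on $\Lambda_\pi=\{z:|\arg z-\pi|<\delta\text{ or }|z|<\varrho\}$, with $\|(A-\lambda)^{-1}\|=O(|\lambda|^{-1})$ as $\lambda\to\infty$ in $\Lambda_\pi$. Here $\delta>\pi/2$, so the spectra of $A_1,A_2$ lie in a sector of the right half-plane. Powers and logarithms use $-\pi\le\arg<\pi$. $\zeta$-comparable (for $\theta=\pi$): a pair $(A_1,A_2)$ of invertible closed operators with spectral cut $R_\pi$ such that for $\lambda\in\Lambda_\pi$: (I) $(A_1-\lambda)^{-1}-(A_2-\lambda)^{-1}$ is trace class with $\mathrm{Tr}((A_1-\lambda)^{-1}-(A_2-\lambda)^{-1})=-\frac{\partial}{\partial\lambda}\log\det_F\mathcal S_\lambda$, where the scattering operator $\mathcal S_\lambda=\mathrm{Id}+W_\lambda$ acts on a Hilbert space $\mathcal H_\lambda\subseteq H$ with $W_\lambda$ trace class, $\det_F$ being the Fredholm determinant on $\mathcal H_\lambda$ ($\log\det_F\mathcal S_\lambda$ is a fixed smooth branch on $\Lambda_\pi$); (II) as $\lambda\to\infty$ in $\Lambda_\pi$, $\mathrm{Tr}((A_1-\lambda)^{-1}-(A_2-\lambda)^{-1})\sim\sum_{j\ge0,j\ne J}\sum_{k=0}^1b_{j,k}(-\lambda)^{-\alpha_j}\log^k(-\lambda)+b_{J,0}(-\lambda)^{-1}$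 with $0<\alpha_0<\dots<\alpha_j\nearrow+\infty$, $\alpha_J=1$. (The remainder after the terms $j<N$ is $O(|\lambda|^{-\alpha_N+\epsilon})$ for all $\epsilon>0$ and large $N$.) Relative $\zeta$-function: $\zeta_\pi(A_1,A_2,s)=\mathrm{Tr}(A_1^{-s}-A_2^{-s})$ for $\mathrm{Re}(s)>1$, where the complex powers $A_i^{-s}=\frac{i}{2\pi}\int_{C_\pi}\lambda^{-s}(A_i-\lambda)^{-1}d\lambda$ are defined with the cut $R_\pi$ ($C_\pi$ comes in along $\arg\lambda=\pi$, runs clockwise around a small circle about $0$, and leaves along $\arg\lambda=-\pi$); it extends meromorphically to $\mathbb C$, regular at $0$, and $\det_\zeta(A_1,A_2)=\exp(-\zeta_\pi'(A_1,A_2,0))$. Heat operators: $e^{-tA_i}=\frac{i}{2\pi}\int_{\mathcal C}e^{-t\lambda}(A_i-\lambda)^{-1}d\lambda$, $t>0$, with $\mathcal C$ a contour surrounding the spectra of $A_1,A_2$, coming in on a ray with argument in $(0,\pi/2)$, encircling the origin, and leaving on a ray with argument in $(-\pi/2,0)$. $\mathrm{LIM}_{\mu\to\infty}\log\det_F\mathcal S_{-\mu}$ ($\mu>0$) is the constant term in the expansion of $\log\det_F\mathcal S_\lambda$, $\lambda=-\mu\to\infty$, in terms $(-\lambda)^{1-\alpha_j}\log^k(-\lambda)$ ($j\neq J$), $\log(-\lambda)$, and $1$. Likewise $\mathrm{LIM}_{\varepsilon\to0}f(\varepsilon)$ is the constant term in the expansion of $f(\varepsilon)$ in $\varepsilon^{\alpha_j-1}\log^k\varepsilon$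 ($j\ne J$), $\log\varepsilon$ and $1$. The relative heat cut-off determinant is defined by $\log\det_{heat}(A_1,A_2)=\mathrm{LIM}_{\varepsilon\to0}\int_\varepsilon^\infty-\frac1t\mathrm{Tr}(e^{-tA_1}-e^{-tA_2})\,dt$. $\Gamma$ is the Gamma function. *)

theory Defs
  imports "HOL-Complex_Analysis.Complex_Analysis" "HOL-Library.Landau_Symbols"
begin

section \<open>Complex Hilbert spaces\<close>

text \<open>The inner product is linear in its first argument. The axiom \<open>cinner_self\<close> says at once
  that it is positive definite and that it induces the norm, for which the space is complete.\<close>

class complex_hilbert = banach +
  fixes scaleC :: "complex \<Rightarrow> 'a \<Rightarrow> 'a" (infixr "*\<^sub>C" 75)
    and cinner :: "'a \<Rightarrow> 'a \<Rightarrow> complex"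
  assumes scaleC_add_right: "c *\<^sub>C (x + y) = c *\<^sub>C x + c *\<^sub>C y"
    and scaleC_add_left: "(c + d) *\<^sub>C x = c *\<^sub>C x + d *\<^sub>C x"
    and scaleC_scaleC: "c *\<^sub>C d *\<^sub>C x = (c * d) *\<^sub>C x"
    and scaleC_of_real: "complex_of_real r *\<^sub>C x = r *\<^sub>R x"
    and cinner_commute: "cinner x y = cnj (cinner y x)"
    and cinner_add_left: "cinner (x + y) z = cinner x z + cinner y z"
    and cinner_scaleC_left: "cinner (c *\<^sub>C x) y = c * cinner x y"
    and cinner_self: "cinner x x = complex_of_real ((norm x)\<^sup>2)"

lemma norm_scaleC: "norm (c *\<^sub>C x) = cmod c * norm (x :: 'a::complex_hilbert)"
proof -
  have "cinner (c *\<^sub>C x) (c *\<^sub>C x) = c * cnj c * cinner x x"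
    using cinner_scaleC_left[of c x "c *\<^sub>C x"] cinner_commute[of x "c *\<^sub>C x"]
      cinner_scaleC_left[of c x x] cinner_self[of x]
    by simp
  then have "complex_of_real ((norm (c *\<^sub>C x))\<^sup>2) = complex_of_real ((cmod c * norm x)\<^sup>2)"
    unfolding cinner_self complex_norm_square[symmetric] by (simp add: power_mult_distrib)
  then have "(norm (c *\<^sub>C x))\<^sup>2 = (cmod c * norm x)\<^sup>2"
    by (simp only: of_real_eq_iff)
  then show ?thesis
    by (simp add: power2_eq_iff_nonneg)
qed

lift_definition scaleC_op ::
    "complex \<Rightarrow> ('a::complex_hilbert \<Rightarrow>\<^sub>L 'a) \<Rightarrow> ('a \<Rightarrow>\<^sub>L 'a)"
  is "\<lambda>c T x. c *\<^sub>C T x"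
proof -
  fix c and T :: "'a \<Rightarrow> 'a"
  assume T: "bounded_linear T"
  have "c *\<^sub>C r *\<^sub>R x = r *\<^sub>R c *\<^sub>C x" for r and x :: 'a
    by (metis scaleC_of_real scaleC_scaleC mult.commute)
  then have "bounded_linear (\<lambda>x::'a. c *\<^sub>C x)"
    by (intro bounded_linear_intro[where K = "cmod c"])
      (simp_all add: scaleC_add_right norm_scaleC mult.commute)
  then show "bounded_linear (\<lambda>x. c *\<^sub>C T x)"
    using T by (rule bounded_linear_compose)
qed

definition closed_csubspace :: "'a::complex_hilbert set \<Rightarrow> bool" where
  "closed_csubspace M \<longleftrightarrow> 0 \<in> M \<and> (\<forall>x\<in>M. \<forall>y\<in>M. x + y \<in> M) \<and>
     (\<forall>c. \<forall>x\<in>M. c *\<^sub>C x \<in> M) \<and> closed M"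

definition onb_on :: "'a::complex_hilbert set \<Rightarrow> 'a set \<Rightarrow> bool" where
  "onb_on M B \<longleftrightarrow> B \<subseteq> M \<and> (\<forall>e\<in>B. norm e = 1) \<and>
     (\<forall>e\<in>B. \<forall>f\<in>B. e \<noteq> f \<longrightarrow> cinner e f = 0) \<and>
     (\<forall>x\<in>M. (\<forall>e\<in>B. cinner x e = 0) \<longrightarrow> x = 0)"

definition some_onb :: "'a::complex_hilbert set \<Rightarrow> 'a set" where
  "some_onb M = (SOME B. onb_on M B)"


section \<open>Trace class operators and the Fredholm determinant\<close>

text \<open>An operator on a closed subspace \<open>M\<close> is a function of which only the values on \<open>M\<close>
  matter; operators on the whole space have \<open>M = UNIV\<close>.\<close>

definition bounded_op_on :: "'a::complex_hilbert set \<Rightarrow> ('a \<Rightarrow> 'a) \<Rightarrow> bool" where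
  "bounded_op_on M T \<longleftrightarrow> (\<forall>x\<in>M. T x \<in> M) \<and> (\<forall>x\<in>M. \<forall>y\<in>M. T (x + y) = T x + T y) \<and>
     (\<forall>c. \<forall>x\<in>M. T (c *\<^sub>C x) = c *\<^sub>C T x) \<and> (\<exists>K. \<forall>x\<in>M. norm (T x) \<le> K * norm x)"

text \<open>\<open>P\<close> is the absolute value of \<open>T\<close>: \<open>P\<close> is positive and \<open>P P = T\<^sup>* T\<close>, the latter being
  tested against vectors.\<close>

definition is_abs_on ::
    "'a::complex_hilbert set \<Rightarrow> ('a \<Rightarrow> 'a) \<Rightarrow> ('a \<Rightarrow> 'a) \<Rightarrow> bool" where
  "is_abs_on M T P \<longleftrightarrow> bounded_op_on M P \<and> (\<forall>x\<in>M. cinner (P x) x \<in> nonneg_Reals) \<and>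
     (\<forall>x\<in>M. \<forall>y\<in>M. cinner (P (P x)) y = cinner (T x) (T y))"

definition trace_class_on :: "'a::complex_hilbert set \<Rightarrow> ('a \<Rightarrow> 'a) \<Rightarrow> bool" where
  "trace_class_on M T \<longleftrightarrow> bounded_op_on M T \<and>
     (\<exists>P B. is_abs_on M T P \<and> onb_on M B \<and> (\<lambda>e. cinner (P e) e) summable_on B)"

definition trace_on :: "'a::complex_hilbert set \<Rightarrow> ('a \<Rightarrow> 'a) \<Rightarrow> complex" where
  "trace_on M T = (\<Sum>\<^sub>\<infinity>e\<in>some_onb M. cinner (T e) e)"

definition finite_det :: "'i set \<Rightarrow> ('i \<Rightarrow> 'i \<Rightarrow> complex) \<Rightarrow> complex" where
  "finite_det F m = (\<Sum>p | p permutes F. of_int (sign p) * (\<Prod>i\<in>F. m i (p i)))"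

text \<open>The trace of the \<open>k\<close>-th exterior power of \<open>W\<close>, computed in the orthonormal basis of the
  exterior power whose members are the wedge products of \<open>k\<close> distinct elements of the basis
  of \<open>M\<close>.\<close>

definition trace_exterior_power ::
    "'a::complex_hilbert set \<Rightarrow> nat \<Rightarrow> ('a \<Rightarrow> 'a) \<Rightarrow> complex" where
  "trace_exterior_power M k W =
     (\<Sum>\<^sub>\<infinity>F\<in>{F. F \<subseteq> some_onb M \<and> finite F \<and> card F = k}. finite_det F (\<lambda>e f. cinner (W e) f))"

text \<open>The argument \<open>S\<close> is the operator \<open>Id + W\<close> itself, with \<open>W\<close> trace class.\<close>

definition fredholm_det_on :: "'a::complex_hilbert set \<Rightarrow> ('a \<Rightarrow> 'a) \<Rightarrow> complex" where
  "fredholm_det_on M S = (\<Sum>k. trace_exterior_power M k (\<lambda>x. S x - x))"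

abbreviation trace_class :: "('a::complex_hilbert \<Rightarrow>\<^sub>L 'a) \<Rightarrow> bool" where
  "trace_class T \<equiv> trace_class_on UNIV (blinfun_apply T)"

abbreviation Tr :: "('a::complex_hilbert \<Rightarrow>\<^sub>L 'a) \<Rightarrow> complex" where
  "Tr T \<equiv> trace_on UNIV (blinfun_apply T)"


section \<open>Closed operators, resolvents and spectral cuts\<close>

text \<open>An unbounded operator is represented by its graph.\<close>

definition closed_operator :: "('a::complex_hilbert \<times> 'a) set \<Rightarrow> bool" where
  "closed_operator A \<longleftrightarrow> (0, 0) \<in> A \<and>
     (\<forall>x y x' y'. (x, y) \<in> A \<longrightarrow> (x', y') \<in> A \<longrightarrow> (x + x', y + y') \<in> A) \<and>
     (\<forall>c x y. (x, y) \<in> A \<longrightarrow> (c *\<^sub>C x, c *\<^sub>C y) \<in> A) \<and>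
     single_valued A \<and> closed A"

definition positive_operator :: "('a::complex_hilbert \<times> 'a) set \<Rightarrow> bool" where
  "positive_operator A \<longleftrightarrow> (\<forall>x y. (x, y) \<in> A \<longrightarrow> cinner y x \<in> nonneg_Reals)"

text \<open>\<open>R\<close> is a bounded two-sided inverse of \<open>A - z\<close>; its complex linearity is inherited from
  the graph \<open>A\<close>.\<close>

definition is_resolvent ::
    "('a::complex_hilbert \<times> 'a) set \<Rightarrow> complex \<Rightarrow> ('a \<Rightarrow>\<^sub>L 'a) \<Rightarrow> bool" where
  "is_resolvent A z R \<longleftrightarrow> (\<forall>x y. (x, y) \<in> A \<longrightarrow> R (y - z *\<^sub>C x) = x) \<and>
     (\<forall>u. \<exists>y. (R u, y) \<in> A \<and> y - z *\<^sub>C R u = u)"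

definition resolvent ::
    "('a::complex_hilbert \<times> 'a) set \<Rightarrow> complex \<Rightarrow> ('a \<Rightarrow>\<^sub>L 'a)" where
  "resolvent A z = (THE R. is_resolvent A z R)"

definition holomorphic_op_on ::
    "(complex \<Rightarrow> ('a::complex_hilbert \<Rightarrow>\<^sub>L 'a)) \<Rightarrow> complex set \<Rightarrow> bool" where
  "holomorphic_op_on f S \<longleftrightarrow>
     (\<forall>z\<in>S. \<exists>D. (f has_derivative (\<lambda>h. scaleC_op h D)) (at z within S))"

text \<open>\<open>\<bar>arg z - \<pi>\<bar> < \<delta>\<close> is meant for the argument of \<open>z\<close> in \<open>[0, 2\<pi>)\<close>, so that
  \<open>arg z - \<pi>\<close> is, up to sign at its extreme value, the principal argument of \<open>- z\<close>.\<close>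

definition cut_region :: "real \<Rightarrow> real \<Rightarrow> complex set" where
  "cut_region \<delta> \<rho> = {z. z \<noteq> 0 \<and> \<bar>Arg (- z)\<bar> < \<delta> \<or> cmod z < \<rho>}"

abbreviation infinity_in :: "complex set \<Rightarrow> complex filter" where
  "infinity_in S \<equiv> inf at_infinity (principal S)"

text \<open>Invertibility of \<open>A\<close> is the existence of the resolvent at \<open>0\<close>, a point of the region.\<close>

definition spectral_cut ::
    "real \<Rightarrow> real \<Rightarrow> ('a::complex_hilbert \<times> 'a) set \<Rightarrow> bool" where
  "spectral_cut \<delta> \<rho> A \<longleftrightarrow> \<delta> > 0 \<and> \<rho> > 0 \<and>
     (\<forall>z\<in>cut_region \<delta> \<rho>. \<exists>R. is_resolvent A z R) \<and>
     holomorphic_op_on (resolvent A) (cut_region \<delta> \<rho>) \<and>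
     (\<lambda>z. norm (resolvent A z)) \<in> O[infinity_in (cut_region \<delta> \<rho>)](\<lambda>z. 1 / cmod z)"


section \<open>Asymptotic expansions\<close>

definition exponents :: "(nat \<Rightarrow> real) \<Rightarrow> nat \<Rightarrow> bool" where
  "exponents \<alpha> J \<longleftrightarrow>
     \<alpha> 0 > 0 \<and> strict_mono \<alpha> \<and> filterlim \<alpha> at_top sequentially \<and> \<alpha> J = 1"

definition power_log_sum ::
    "(nat \<Rightarrow> real) \<Rightarrow> nat \<Rightarrow> (nat \<Rightarrow> nat \<Rightarrow> complex) \<Rightarrow> nat \<Rightarrow> complex \<Rightarrow> complex" where
  "power_log_sum \<beta> J c N z =
     (\<Sum>j\<in>{..<N} - {J}. \<Sum>k\<le>1. c j k * z powr of_real (\<beta> j) * Ln z ^ k)"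

definition resolvent_trace_expansion ::
    "complex set \<Rightarrow> (nat \<Rightarrow> real) \<Rightarrow> nat \<Rightarrow> (nat \<Rightarrow> nat \<Rightarrow> complex) \<Rightarrow> (complex \<Rightarrow> complex) \<Rightarrow> bool"
  where
  "resolvent_trace_expansion \<Lambda> \<alpha> J b f \<longleftrightarrow>
     (\<forall>\<^sub>F N in sequentially. \<forall>\<eta>>0.
        (\<lambda>z. cmod (f z - (power_log_sum (\<lambda>j. - \<alpha> j) J b N (- z) + b J 0 * inverse (- z))))
          \<in> O[infinity_in \<Lambda>](\<lambda>z. cmod z powr (- \<alpha> N + \<eta>)))"

definition expansion_at_infinity ::
    "(nat \<Rightarrow> real) \<Rightarrow> nat \<Rightarrow> (real \<Rightarrow> complex) \<Rightarrow> complex \<Rightarrow> complex \<Rightarrow> (nat \<Rightarrow> nat \<Rightarrow> complex) \<Rightarrow> bool"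
  where
  "expansion_at_infinity \<alpha> J f c d a \<longleftrightarrow>
     (\<forall>\<^sub>F N in sequentially. \<forall>\<eta>>0.
        (\<lambda>\<mu>. cmod (f \<mu> - (c + d * of_real (ln \<mu>)
                        + power_log_sum (\<lambda>j. 1 - \<alpha> j) J a N (of_real \<mu>))))
          \<in> O[at_top](\<lambda>\<mu>. \<mu> powr (1 - \<alpha> N + \<eta>)))"

definition LIM_at_infinity :: "(nat \<Rightarrow> real) \<Rightarrow> nat \<Rightarrow> (real \<Rightarrow> complex) \<Rightarrow> complex" where
  "LIM_at_infinity \<alpha> J f = (THE c. \<exists>d a. expansion_at_infinity \<alpha> J f c d a)"

definition expansion_at_zero ::
    "(nat \<Rightarrow> real) \<Rightarrow> nat \<Rightarrow> (real \<Rightarrow> complex) \<Rightarrow> complex \<Rightarrow> complex \<Rightarrow> (nat \<Rightarrow> nat \<Rightarrow> complex) \<Rightarrow> bool"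
  where
  "expansion_at_zero \<alpha> J f c d a \<longleftrightarrow>
     (\<forall>\<^sub>F N in sequentially. \<forall>\<eta>>0.
        (\<lambda>\<epsilon>. cmod (f \<epsilon> - (c + d * of_real (ln \<epsilon>)
                        + power_log_sum (\<lambda>j. \<alpha> j - 1) J a N (of_real \<epsilon>))))
          \<in> O[at_right 0](\<lambda>\<epsilon>. \<epsilon> powr (\<alpha> N - 1 - \<eta>)))"

definition LIM_at_zero :: "(nat \<Rightarrow> real) \<Rightarrow> nat \<Rightarrow> (real \<Rightarrow> complex) \<Rightarrow> complex" where
  "LIM_at_zero \<alpha> J f = (THE c. \<exists>d a. expansion_at_zero \<alpha> J f c d a)"


section \<open>Zeta-comparable operators\<close>

text \<open>\<open>S z\<close> is the scattering operator on \<open>\<H> z\<close>, and \<open>L\<close> is the chosen branch of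
  \<open>log det\<^sub>F S z\<close>.\<close>

definition zeta_comparable ::
    "real \<Rightarrow> real \<Rightarrow> ('a::complex_hilbert \<times> 'a) set \<Rightarrow> ('a \<times> 'a) set \<Rightarrow>
     (complex \<Rightarrow> 'a set) \<Rightarrow> (complex \<Rightarrow> 'a \<Rightarrow> 'a) \<Rightarrow> (complex \<Rightarrow> complex) \<Rightarrow>
     (nat \<Rightarrow> real) \<Rightarrow> nat \<Rightarrow> (nat \<Rightarrow> nat \<Rightarrow> complex) \<Rightarrow> bool"
  where
  "zeta_comparable \<delta> \<rho> A1 A2 \<H> S L \<alpha> J b \<longleftrightarrow>
     closed_operator A1 \<and> closed_operator A2 \<and>
     spectral_cut \<delta> \<rho> A1 \<and> spectral_cut \<delta> \<rho> A2 \<and>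
     (\<forall>z\<in>cut_region \<delta> \<rho>.
        trace_class (resolvent A1 z - resolvent A2 z) \<and>
        closed_csubspace (\<H> z) \<and>
        trace_class_on (\<H> z) (\<lambda>x. S z x - x) \<and>
        exp (L z) = fredholm_det_on (\<H> z) (S z) \<and>
        (L has_field_derivative - Tr (resolvent A1 z - resolvent A2 z)) (at z)) \<and>
     exponents \<alpha> J \<and>
     resolvent_trace_expansion (cut_region \<delta> \<rho>) \<alpha> J b
       (\<lambda>z. Tr (resolvent A1 z - resolvent A2 z))"


section \<open>Complex powers and heat operators\<close>

text \<open>The integral of \<open>w R\<close> along the contour that comes in on the ray of argument \<open>a\<close> to
  radius \<open>r\<close>, follows the circle of radius \<open>r\<close> from argument \<open>a\<close> to argument \<open>b\<close>
  (clockwise if \<open>b < a\<close>), and leaves on the ray of argument \<open>b\<close>. The weight \<open>w\<close> is a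
  function of modulus and argument, because on the two sides of a branch cut it takes different
  values at the same point.\<close>

definition contour_integral_op ::
    "real \<Rightarrow> real \<Rightarrow> real \<Rightarrow> (real \<Rightarrow> real \<Rightarrow> complex) \<Rightarrow>
     (complex \<Rightarrow> ('a::complex_hilbert \<Rightarrow>\<^sub>L 'a)) \<Rightarrow> ('a \<Rightarrow>\<^sub>L 'a)"
  where
  "contour_integral_op r a b w R =
     - integral {r..} (\<lambda>x. scaleC_op (cis a * w x a) (R (rcis x a)))
     + integral {0..1} (\<lambda>t. let \<theta> = a + t * (b - a) in
         scaleC_op (\<i> * of_real (b - a) * rcis r \<theta> * w r \<theta>) (R (rcis r \<theta>)))
     + integral {r..} (\<lambda>x. scaleC_op (cis b * w x b) (R (rcis x b)))"

text \<open>\<open>A\<^sup>-\<^sup>s\<close> (note the sign of the exponent).\<close>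

definition power_minus ::
    "real \<Rightarrow> ('a::complex_hilbert \<times> 'a) set \<Rightarrow> complex \<Rightarrow> ('a \<Rightarrow>\<^sub>L 'a)" where
  "power_minus r A s = scaleC_op (\<i> / (2 * of_real pi))
     (contour_integral_op r pi (- pi) (\<lambda>x \<theta>. exp (- s * Complex (ln x) \<theta>)) (resolvent A))"

definition rel_zeta ::
    "real \<Rightarrow> ('a::complex_hilbert \<times> 'a) set \<Rightarrow> ('a \<times> 'a) set \<Rightarrow> complex \<Rightarrow> complex" where
  "rel_zeta r A1 A2 = (THE f. f nicely_meromorphic_on UNIV \<and>
     (\<forall>s. Re s > 1 \<longrightarrow> f s = Tr (power_minus r A1 s - power_minus r A2 s)))"

definition det_zeta ::
    "real \<Rightarrow> ('a::complex_hilbert \<times> 'a) set \<Rightarrow> ('a \<times> 'a) set \<Rightarrow> complex" where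
  "det_zeta r A1 A2 = exp (- deriv (rel_zeta r A1 A2) 0)"

text \<open>The contour comes in on the ray of argument \<open>\<phi>\<close> and leaves on the ray of argument
  \<open>- \<psi>\<close>, written \<open>2\<pi> - \<psi>\<close> so that the arc passes to the left of the origin.\<close>

definition heat_op ::
    "real \<Rightarrow> real \<Rightarrow> real \<Rightarrow> ('a::complex_hilbert \<times> 'a) set \<Rightarrow> real \<Rightarrow> ('a \<Rightarrow>\<^sub>L 'a)" where
  "heat_op r \<phi> \<psi> A t = scaleC_op (\<i> / (2 * of_real pi))
     (contour_integral_op r \<phi> (2 * pi - \<psi>) (\<lambda>x \<theta>. exp (- of_real t * rcis x \<theta>)) (resolvent A))"

definition heat_integrand ::
    "real \<Rightarrow> real \<Rightarrow> real \<Rightarrow> ('a::complex_hilbert \<times> 'a) set \<Rightarrow> ('a \<times> 'a) set \<Rightarrow> real \<Rightarrow> complex" where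
  "heat_integrand r \<phi> \<psi> A1 A2 t =
     - (1 / of_real t) * Tr (heat_op r \<phi> \<psi> A1 t - heat_op r \<phi> \<psi> A2 t)"

definition heat_cutoff ::
    "real \<Rightarrow> real \<Rightarrow> real \<Rightarrow> ('a::complex_hilbert \<times> 'a) set \<Rightarrow> ('a \<times> 'a) set \<Rightarrow> real \<Rightarrow> complex" where
  "heat_cutoff r \<phi> \<psi> A1 A2 \<epsilon> = integral {\<epsilon>..} (heat_integrand r \<phi> \<psi> A1 A2)"

definition log_det_heat ::
    "(nat \<Rightarrow> real) \<Rightarrow> nat \<Rightarrow> real \<Rightarrow> real \<Rightarrow> real \<Rightarrow>
     ('a::complex_hilbert \<times> 'a) set \<Rightarrow> ('a \<times> 'a) set \<Rightarrow> complex" where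
  "log_det_heat \<alpha> J r \<phi> \<psi> A1 A2 = LIM_at_zero \<alpha> J (heat_cutoff r \<phi> \<psi> A1 A2)"

definition det_heat ::
    "(nat \<Rightarrow> real) \<Rightarrow> nat \<Rightarrow> real \<Rightarrow> real \<Rightarrow> real \<Rightarrow>
     ('a::complex_hilbert \<times> 'a) set \<Rightarrow> ('a \<times> 'a) set \<Rightarrow> complex" where
  "det_heat \<alpha> J r \<phi> \<psi> A1 A2 = exp (log_det_heat \<alpha> J r \<phi> \<psi> A1 A2)"

end

theory Submission imports Defs "HOL-Real_Asymp.Real_Asymp"
begin

text \<open>Write \<open>f z = Tr ((A\<^sub>1 - z)\<^sup>-\<^sup>1 - (A\<^sub>2 - z)\<^sup>-\<^sup>1)\<close>, so that \<open>f = - L'\<close>. Since the resolvent difference is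
  \<open>(1 + z (A\<^sub>1 - z)\<^sup>-\<^sup>1) (A\<^sub>1\<^sup>-\<^sup>1 - A\<^sub>2\<^sup>-\<^sup>1) (1 + z (A\<^sub>2 - z)\<^sup>-\<^sup>1)\<close>, its trace norm is bounded uniformly outside a sector
  around the positive axis, and the trace may be taken under the contour integrals. Both the zeta function
  and the heat trace thus become scalar integrals of \<open>f\<close>.

  Integrating the expansion of \<open>f\<close> along rays gives the expansion of \<open>L\<close>, with constant term \<open>l\<close>. For the heat
  trace, integration by parts shows that \<open>L 0 + (\<i>/2\<pi>) \<integral> e\<^sup>-\<^sup>t\<^sup>z L z / z dz\<close> is a primitive of \<open>Tr (\<dots>) / t\<close> vanishing at
  infinity; on the contour of radius \<open>1 / t\<close> the expansion of \<open>L\<close> is integrated term by term, and Hankel's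
  integral for \<open>1 / \<Gamma>\<close> produces \<open>\<Gamma>' 1\<close> from the logarithmic term. For the zeta function, the two sides of the
  cut combine to \<open>sin (\<pi> s) / \<pi>\<close> times a Mellin transform of \<open>f\<close>, whose pole at \<open>0\<close> and finite part there
  yield the value \<open>b\<^sub>J\<^sub>,\<^sub>0\<close> and the derivative \<open>l - L 0\<close>.\<close>

section \<open>Inner products and orthonormal bases\<close>

text \<open>The definition of trace class through the absolute value does not pass to sums or
  integrals. It is therefore traded for a bound on bilinear sums over Bessel families and recovered
  for the finished contour integrals. Both conversions need adjoints. Positivity supplies them: it
  makes the operators symmetric, so the resolvents at \<open>z\<close> and \<open>cnj z\<close> are
  adjoint, and resolvents are studied on a set invariant under conjugation. Unbounded contours are
  handled by \<open>z = - exp w\<close>, which unrolls the plane off a sector around the positive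
  axis into a convex strip. There even \<open>L z / z\<close> has a primitive, in spite of its pole
  at 0, and a contour integral becomes a limit of differences of one primitive; changes of radius
  and dilations then need no homotopy. Since \<delta> > pi / 2, the rays of the heat contour can lie
  in the open right half-plane, where \<open>exp (- t z)\<close> decays, and still inside the region
  of the resolvents. The radius \<open>r\<close> must drop out of the zeta function at 0:
  \<open>ln r\<close> and \<open>L (- r)\<close> appear in the ray integrals and are cancelled by
  the derivative of \<open>exp (- s ln r)\<close> and by the circle.\<close>

lemma cinner_add_right: "cinner x (y + z) = cinner x y + cinner x z"
  for x y z :: "'a::complex_hilbert"
  by (metis cinner_add_left cinner_commute complex_cnj_add)

lemma cinner_scaleC_right: "cinner x (c *\<^sub>C y) = cnj c * cinner x y"
  for x y :: "'a::complex_hilbert"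
  by (metis cinner_commute cinner_scaleC_left complex_cnj_mult)

lemma cinner_scaleR_left: "cinner (a *\<^sub>R x) y = a *\<^sub>R cinner x y"
  for x y :: "'a::complex_hilbert"
  by (metis cinner_scaleC_left scaleC_of_real scaleR_conv_of_real)

lemma cinner_scaleR_right: "cinner x (a *\<^sub>R y) = a *\<^sub>R cinner x y"
  for x y :: "'a::complex_hilbert"
  by (metis cinner_scaleC_right scaleC_of_real complex_cnj_complex_of_real scaleR_conv_of_real)

lemma cinner_zero_left [simp]: "cinner 0 y = 0" for y :: "'a::complex_hilbert"
  using cinner_scaleR_left[of 0 0 y] by simp

lemma cinner_zero_right [simp]: "cinner y 0 = 0" for y :: "'a::complex_hilbert"
  using cinner_scaleR_right[of y 0 0] by simp

lemma cinner_minus_left: "cinner (- x) y = - cinner x y" for x y :: "'a::complex_hilbert"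
  using cinner_scaleR_left[of "-1" x y] by simp

lemma cinner_minus_right: "cinner x (- y) = - cinner x y" for x y :: "'a::complex_hilbert"
  using cinner_scaleR_right[of x "-1" y] by simp

lemma cinner_diff_left: "cinner (x - y) z = cinner x z - cinner y z"
  for x y z :: "'a::complex_hilbert"
  using cinner_add_left[of x "- y" z] by (simp add: cinner_minus_left)

lemma cinner_diff_right: "cinner x (y - z) = cinner x y - cinner x z"
  for x y z :: "'a::complex_hilbert"
  using cinner_add_right[of x y "- z"] by (simp add: cinner_minus_right)

lemma norm_square_cinner: "(norm x)\<^sup>2 = Re (cinner x x)" for x :: "'a::complex_hilbert"
  by (simp add: cinner_self)

lemma cmod_cinner_self: "cmod (cinner x x) = (norm x)\<^sup>2" for x :: "'a::complex_hilbert"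
  unfolding cinner_self norm_of_real by simp

lemma cinner_ext: "(\<And>z. cinner x z = cinner y z) \<Longrightarrow> x = y" for x y :: "'a::complex_hilbert"
  using norm_square_cinner[of "x - y"] by (simp add: cinner_diff_left)

lemma scaleC_one [simp]: "1 *\<^sub>C x = x" for x :: "'a::complex_hilbert"
  using scaleC_of_real[of 1 x] by simp

lemma scaleC_zero_left [simp]: "0 *\<^sub>C x = 0" for x :: "'a::complex_hilbert"
  using scaleC_of_real[of 0 x] by simp

lemma scaleC_zero_right [simp]: "c *\<^sub>C 0 = 0" for c :: complex
  using norm_scaleC[of c 0] by simp

lemma scaleC_minus_left: "(- c) *\<^sub>C x = - (c *\<^sub>C x)" for x :: "'a::complex_hilbert"
  using scaleC_add_left[of c "- c" x] by (simp add: eq_neg_iff_add_eq_0 add.commute)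

lemma scaleC_minus_right: "c *\<^sub>C (- x) = - (c *\<^sub>C x)" for x :: "'a::complex_hilbert"
  using scaleC_add_right[of c x "- x"] by (simp add: eq_neg_iff_add_eq_0 add.commute)

lemma scaleC_diff_right: "c *\<^sub>C (x - y) = c *\<^sub>C x - c *\<^sub>C y" for x y :: "'a::complex_hilbert"
  using scaleC_add_right[of c x "- y"] by (simp add: scaleC_minus_right)

text \<open>Polarization: \<open>a\<close> and \<open>b\<close> stand for the values of a
  sesquilinear form at \<open>(x, y)\<close> and \<open>(y, x)\<close>. The hypotheses express that
  a form real at \<open>x\<close> and \<open>y\<close> is also real at \<open>x + y\<close> and
  \<open>x + \<i> y\<close>.\<close>

lemma hermitian_from_real_values:
  assumes "Im (a + b) = 0" "Im (- \<i> * a + \<i> * b) = 0"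
  shows "b = cnj a"
  using assms by (simp add: complex_eq_iff)

lemma nonneg_Reals_iff: "z \<in> nonneg_Reals \<longleftrightarrow> Im z = 0 \<and> 0 \<le> Re z"
  by (auto simp: complex_nonneg_Reals_iff)

lemma hermitian_if_nonneg:
  fixes P :: "'a::complex_hilbert \<Rightarrow> 'a"
  assumes add: "\<And>x y. P (x + y) = P x + P y"
    and scale: "\<And>c x. P (c *\<^sub>C x) = c *\<^sub>C P x"
    and nonneg: "\<And>x. cinner (P x) x \<in> nonneg_Reals"
  shows "cinner (P x) y = cinner x (P y)"
proof -
  have "Im (cinner (P (x + y)) (x + y)) = 0" "Im (cinner (P (x + \<i> *\<^sub>C y)) (x + \<i> *\<^sub>C y)) = 0"
    "Im (cinner (P x) x) = 0" "Im (cinner (P y) y) = 0"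
    using nonneg by (auto simp: nonneg_Reals_iff)
  then have "cinner (P y) x = cnj (cinner (P x) y)"
    by (intro hermitian_from_real_values)
       (simp_all add: add scale cinner_add_left cinner_add_right cinner_scaleC_left
         cinner_scaleC_right algebra_simps)
  then show ?thesis
    by (metis cinner_commute complex_cnj_cnj)
qed

text \<open>Covers both the identity, which gives the usual Cauchy-Schwarz inequality, and the forms
  of positive operators.\<close>

lemma cauchy_schwarz_form:
  fixes P :: "'a::complex_hilbert \<Rightarrow> 'a"
  assumes add: "\<And>x y. P (x + y) = P x + P y"
    and scale: "\<And>c x. P (c *\<^sub>C x) = c *\<^sub>C P x"
    and nonneg: "\<And>x. cinner (P x) x \<in> nonneg_Reals"
  shows "(cmod (cinner (P x) y))\<^sup>2 \<le> Re (cinner (P x) x) * Re (cinner (P y) y)"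
proof -
  define a where "a = Re (cinner (P x) x)"
  define b where "b = cinner (P x) y"
  define c where "c = Re (cinner (P y) y)"
  have a: "cinner (P x) x = of_real a" and c: "cinner (P y) y = of_real c" and c0: "c \<ge> 0"
    using nonneg[of x] nonneg[of y] by (auto simp: nonneg_Reals_iff a_def c_def complex_eq_iff)
  have b': "cinner (P y) x = cnj b"
    using hermitian_if_nonneg[of P, OF assms, of y x] cinner_commute[of y "P x"] by (simp add: b_def)
  \<comment> \<open>The form is evaluated at \<open>x - t b y\<close>; the factor \<open>b\<close>
    aligns the phases, so that the cross terms become the real number \<open>cmod b\<close>
    squared.\<close>
  have *: "a - 2 * t * (cmod b)\<^sup>2 + t\<^sup>2 * (cmod b)\<^sup>2 * c \<ge> 0" for t :: real
  proof -
    have P: "P (x + (- (of_real t * b)) *\<^sub>C y) = P x + (- (of_real t * b)) *\<^sub>C P y"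
      by (simp only: add scale)
    have "0 \<le> Re (cinner (P (x + (- (of_real t * b)) *\<^sub>C y)) (x + (- (of_real t * b)) *\<^sub>C y))"
      using nonneg by (auto simp: nonneg_Reals_iff)
    also have "cinner (P (x + (- (of_real t * b)) *\<^sub>C y)) (x + (- (of_real t * b)) *\<^sub>C y)
        = of_real a - 2 * of_real t * (b * cnj b) + (of_real t)\<^sup>2 * (b * cnj b) * of_real c"
      unfolding P cinner_add_left cinner_add_right cinner_scaleC_left cinner_scaleC_right a c b'
        b_def[symmetric]
      by (simp add: algebra_simps power2_eq_square)
    also have "\<dots> = of_real (a - 2 * t * (cmod b)\<^sup>2 + t\<^sup>2 * (cmod b)\<^sup>2 * c)"
      unfolding complex_norm_square[symmetric] by simp
    finally show ?thesis by simp
  qed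
  show ?thesis
  proof (cases "c = 0")
    case True
    have "(cmod b)\<^sup>2 = 0"
    proof (rule ccontr)
      assume nz: "(cmod b)\<^sup>2 \<noteq> 0"
      \<comment> \<open>With \<open>c = 0\<close> the quadratic is linear in \<open>t\<close>; at
        this \<open>t\<close> it would equal \<open>- 1\<close>.\<close>
      have "a - 2 * ((a + 1) / (2 * (cmod b)\<^sup>2)) * (cmod b)\<^sup>2 \<ge> 0"
        using *[of "(a + 1) / (2 * (cmod b)\<^sup>2)"] True by simp
      moreover have "2 * ((a + 1) / (2 * (cmod b)\<^sup>2)) * (cmod b)\<^sup>2 = a + 1"
        using nz by (simp add: field_simps)
      ultimately show False by simp
    qed
    then show ?thesis using True by (simp add: b_def c_def)
  next
    case False
    with c0 have "c > 0" by simp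
    \<comment> \<open>For \<open>c > 0\<close> the quadratic in \<open>t\<close> is smallest at
      \<open>1 / c\<close> (or does not depend on \<open>t\<close>).\<close>
    with *[of "1 / c"] have "(cmod b)\<^sup>2 \<le> a * c"
      by (simp add: field_simps power2_eq_square)
    then show ?thesis by (simp add: a_def b_def c_def)
  qed
qed

lemma norm_cinner_le: "cmod (cinner x y) \<le> norm x * norm y" for x y :: "'a::complex_hilbert"
proof -
  have "(cmod (cinner x y))\<^sup>2 \<le> Re (cinner x x) * Re (cinner y y)"
    by (rule cauchy_schwarz_form[of "\<lambda>x. x"]) (auto simp: cinner_self nonneg_Reals_iff)
  then have "(cmod (cinner x y))\<^sup>2 \<le> (norm x * norm y)\<^sup>2"
    by (simp add: cinner_self power_mult_distrib)
  then show ?thesis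
    by (rule power2_le_imp_le) simp
qed

lemma bounded_bilinear_cinner: "bounded_bilinear (cinner :: 'a::complex_hilbert \<Rightarrow> 'a \<Rightarrow> complex)"
  by (rule bounded_bilinear.intro)
     (auto simp: cinner_add_left cinner_add_right cinner_scaleR_left cinner_scaleR_right
       intro!: exI[of _ 1] norm_cinner_le)

interpretation cinner: bounded_bilinear "cinner :: 'a::complex_hilbert \<Rightarrow> 'a \<Rightarrow> complex"
  by (rule bounded_bilinear_cinner)

lemma norm_le_if_cinner_le:
  fixes x :: "'a::complex_hilbert"
  assumes "\<And>y. cmod (cinner x y) \<le> K * norm y" "K \<ge> 0"
  shows "norm x \<le> K"
proof (cases "x = 0")
  case False
  have "(norm x)\<^sup>2 \<le> K * norm x"
    using assms(1)[of x] by (simp only: cmod_cinner_self)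
  then show ?thesis using False by (simp add: power2_eq_square)
qed (use assms in simp)

lemma blinfun_norm_scaleC_op: "norm (scaleC_op c T) = cmod c * norm T"
proof (cases "c = 0")
  case True
  then have "scaleC_op c T = 0" by (intro blinfun_eqI) (simp add: scaleC_op.rep_eq)
  then show ?thesis using True by simp
next
  case False
  have le: "norm (scaleC_op d X) \<le> cmod d * norm X" for d and X :: "'a::complex_hilbert \<Rightarrow>\<^sub>L 'a"
    by (rule norm_blinfun_bound)
       (auto simp: scaleC_op.rep_eq norm_scaleC norm_blinfun mult.assoc intro!: mult_left_mono)
  have "T = scaleC_op (inverse c) (scaleC_op c T)"
    using False by (intro blinfun_eqI) (simp add: scaleC_op.rep_eq scaleC_scaleC)
  then have "norm T \<le> cmod (inverse c) * norm (scaleC_op c T)" by (metis le)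
  then have "norm T \<le> norm (scaleC_op c T) / cmod c"
    by (simp add: norm_inverse divide_inverse mult.commute)
  then have "cmod c * norm T \<le> norm (scaleC_op c T)"
    using False by (simp add: pos_le_divide_eq mult.commute)
  then show ?thesis using le[of c T] by simp
qed

lemma bounded_bilinear_scaleC_op:
  "bounded_bilinear (scaleC_op :: complex \<Rightarrow> ('a::complex_hilbert \<Rightarrow>\<^sub>L 'a) \<Rightarrow> _)"
proof
  fix c d :: complex and r :: real and T U :: "'a \<Rightarrow>\<^sub>L 'a"
  show "scaleC_op (c + d) T = scaleC_op c T + scaleC_op d T"
    by (intro blinfun_eqI) (simp add: scaleC_op.rep_eq blinfun.add_left scaleC_add_left)
  show "scaleC_op c (T + U) = scaleC_op c T + scaleC_op c U"
    by (intro blinfun_eqI) (simp add: scaleC_op.rep_eq blinfun.add_left scaleC_add_right)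
  show "scaleC_op (r *\<^sub>R c) T = r *\<^sub>R scaleC_op c T"
    by (intro blinfun_eqI)
       (simp add: scaleC_op.rep_eq blinfun.scaleR_left scaleC_of_real[symmetric] scaleC_scaleC
         scaleR_conv_of_real)
  show "scaleC_op c (r *\<^sub>R T) = r *\<^sub>R scaleC_op c T"
    by (intro blinfun_eqI)
       (simp add: scaleC_op.rep_eq blinfun.scaleR_left scaleC_of_real[symmetric] scaleC_scaleC
         mult.commute)
  show "\<exists>K. \<forall>c T. norm (scaleC_op c (T :: 'a \<Rightarrow>\<^sub>L 'a)) \<le> norm c * norm T * K"
    by (intro exI[of _ 1]) (simp add: blinfun_norm_scaleC_op)
qed

interpretation scaleC_op: bounded_bilinear
  "scaleC_op :: complex \<Rightarrow> ('a::complex_hilbert \<Rightarrow>\<^sub>L 'a) \<Rightarrow> _"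
  by (rule bounded_bilinear_scaleC_op)

text \<open>Weaker than orthonormality and, unlike it, preserved by contractions
  (\<open>bessel_family_compose\<close>). This is why trace norms are measured on such
  families.\<close>

definition bessel_family :: "'i set \<Rightarrow> ('i \<Rightarrow> 'a::complex_hilbert) \<Rightarrow> bool" where
  "bessel_family I u \<longleftrightarrow> (\<forall>x. (\<Sum>i\<in>I. (cmod (cinner x (u i)))\<^sup>2) \<le> (norm x)\<^sup>2)"

definition orthonormal :: "'a::complex_hilbert set \<Rightarrow> bool" where
  "orthonormal B \<longleftrightarrow> (\<forall>e\<in>B. norm e = 1) \<and> (\<forall>e\<in>B. \<forall>f\<in>B. e \<noteq> f \<longrightarrow> cinner e f = 0)"

lemma orthonormal_subset: "orthonormal B \<Longrightarrow> F \<subseteq> B \<Longrightarrow> orthonormal F"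
  by (auto simp: orthonormal_def)

lemma onb_on_UNIV_iff:
  "onb_on UNIV B \<longleftrightarrow> orthonormal B \<and> (\<forall>x. (\<forall>e\<in>B. cinner x e = 0) \<longrightarrow> x = 0)"
  by (auto simp: onb_on_def orthonormal_def)

lemma cinner_orthonormal_sum_left:
  assumes "orthonormal F" "finite F" "e \<in> F"
  shows "cinner (\<Sum>f\<in>F. c f *\<^sub>C f) e = c e"
proof -
  have "cinner (\<Sum>f\<in>F. c f *\<^sub>C f) e = (\<Sum>f\<in>F. c f * cinner f e)"
    by (simp add: cinner.sum_left cinner_scaleC_left)
  also have "\<dots> = (\<Sum>f\<in>F. if f = e then c f else 0)"
    using assms by (intro sum.cong) (auto simp: orthonormal_def cinner_self)
  finally show ?thesis using assms by simp
qed

lemma norm_orthonormal_sum: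
  assumes "orthonormal F" "finite F"
  shows "(norm (\<Sum>f\<in>F. c f *\<^sub>C f))\<^sup>2 = (\<Sum>f\<in>F. (cmod (c f))\<^sup>2)"
proof -
  have "cinner (\<Sum>f\<in>F. c f *\<^sub>C f) (\<Sum>f\<in>F. c f *\<^sub>C f)
      = (\<Sum>e\<in>F. cnj (c e) * cinner (\<Sum>f\<in>F. c f *\<^sub>C f) e)"
    by (subst cinner.sum_right) (simp add: cinner_scaleC_right)
  also have "\<dots> = (\<Sum>e\<in>F. cnj (c e) * c e)"
    using assms by (intro sum.cong refl) (simp add: cinner_orthonormal_sum_left)
  also have "\<dots> = of_real (\<Sum>f\<in>F. (cmod (c f))\<^sup>2)"
    by (simp add: complex_norm_square mult.commute del: of_real_power)
  finally show ?thesis by (simp add: norm_square_cinner)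
qed

lemma orthogonal_projection_norm:
  fixes x :: "'a::complex_hilbert"
  assumes "orthonormal F" "finite F"
  shows "(norm (x - (\<Sum>f\<in>F. cinner x f *\<^sub>C f)))\<^sup>2
    = (norm x)\<^sup>2 - (\<Sum>f\<in>F. (cmod (cinner x f))\<^sup>2)"
proof -
  define p where "p = (\<Sum>f\<in>F. cinner x f *\<^sub>C f)"
  have "cinner x p = (\<Sum>f\<in>F. cnj (cinner x f) * cinner x f)"
    unfolding p_def by (simp add: cinner.sum_right cinner_scaleC_right)
  also have "\<dots> = of_real (\<Sum>f\<in>F. (cmod (cinner x f))\<^sup>2)"
    by (simp add: complex_norm_square mult.commute del: of_real_power)
  finally have xp: "cinner x p = of_real (\<Sum>f\<in>F. (cmod (cinner x f))\<^sup>2)" .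
  have pp: "(norm p)\<^sup>2 = (\<Sum>f\<in>F. (cmod (cinner x f))\<^sup>2)"
    unfolding p_def by (rule norm_orthonormal_sum[OF assms])
  have "(norm (x - p))\<^sup>2 = (norm x)\<^sup>2 - 2 * Re (cinner x p) + (norm p)\<^sup>2"
    unfolding norm_square_cinner
    using cinner_commute[of p x] by (simp add: cinner_diff_left cinner_diff_right)
  then show ?thesis using xp pp by (simp add: p_def)
qed

lemma bessel_orthonormal:
  assumes "orthonormal F" "finite F"
  shows "bessel_family F (\<lambda>e. e)"
  unfolding bessel_family_def
proof
  fix x
  show "(\<Sum>e\<in>F. (cmod (cinner x e))\<^sup>2) \<le> (norm x)\<^sup>2"
    using orthogonal_projection_norm[OF assms, of x]
      zero_le_power2[of "norm (x - (\<Sum>f\<in>F. cinner x f *\<^sub>C f))"] by linarith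
qed

text \<open>Testing the inequality with \<open>x = u i\<close> gives that the fourth power of
  \<open>norm (u i)\<close> is at most its square.\<close>

lemma bessel_family_norm_le_1:
  assumes "bessel_family I u" "finite I" "i \<in> I"
  shows "norm (u i) \<le> 1"
proof -
  have "(cmod (cinner (u i) (u i)))\<^sup>2 \<le> (\<Sum>j\<in>I. (cmod (cinner (u i) (u j)))\<^sup>2)"
    using assms by (intro member_le_sum) auto
  also have "\<dots> \<le> (norm (u i))\<^sup>2" using assms by (auto simp: bessel_family_def)
  finally have "(cmod (cinner (u i) (u i)))\<^sup>2 \<le> (norm (u i))\<^sup>2" .
  moreover have "cmod (cinner (u i) (u i)) = (norm (u i))\<^sup>2" by (rule cmod_cinner_self)
  ultimately have "(norm (u i))\<^sup>2 * (norm (u i))\<^sup>2 \<le> (norm (u i))\<^sup>2 * 1"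
    by (simp add: power2_eq_square)
  then have "(norm (u i))\<^sup>2 \<le> 1\<^sup>2"
    using mult_le_cancel_left_pos[of "(norm (u i))\<^sup>2" "(norm (u i))\<^sup>2" 1]
    by (cases "u i = 0") simp_all
  then show ?thesis by (rule power2_le_imp_le) simp
qed

section \<open>Completeness and existence of orthonormal bases\<close>

text \<open>The projections of \<open>x\<close> to finite sets whose Bessel sums approach the
  supremum \<open>M\<close> form a Cauchy sequence. Its limit differs from \<open>x\<close> by a
  vector orthogonal to the whole basis, hence by 0. The basis may have any cardinality.\<close>

lemma parseval_approx:
  fixes x :: "'a::complex_hilbert"
  assumes onb: "onb_on UNIV B" and \<eta>: "\<eta> > 0"
  shows "\<exists>F\<subseteq>B. finite F \<and> (norm x)\<^sup>2 \<le> (\<Sum>e\<in>F. (cmod (cinner x e))\<^sup>2) + \<eta>"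
proof -
  define g where "g F = (\<Sum>e\<in>F. (cmod (cinner x e))\<^sup>2)" for F
  define M where "M = (SUP F\<in>{F. F \<subseteq> B \<and> finite F}. g F)"
  have B: "orthonormal B" and comp: "\<And>y. (\<forall>e\<in>B. cinner y e = 0) \<Longrightarrow> y = 0"
    using onb by (auto simp: onb_on_UNIV_iff)
  have g_le: "g F \<le> (norm x)\<^sup>2" if "F \<subseteq> B" "finite F" for F
    using bessel_orthonormal[OF orthonormal_subset[OF B that(1)] that(2)]
    by (auto simp: bessel_family_def g_def)
  have bdd: "bdd_above (g ` {F. F \<subseteq> B \<and> finite F})"
    using g_le by (auto intro!: bdd_aboveI[of _ "(norm x)\<^sup>2"])
  have g_M: "g F \<le> M" if "F \<subseteq> B" "finite F" for F
    unfolding M_def using that bdd by (auto intro!: cSUP_upper)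
  have "\<exists>F. F \<subseteq> B \<and> finite F \<and> g F > M - 1 / Suc n" for n
  proof -
    have "M - 1 / Suc n < M" by simp
    then show ?thesis
      unfolding M_def using bdd by (subst (asm) less_cSUP_iff) (auto simp: M_def)
  qed
  then obtain F where F: "\<And>n. F n \<subseteq> B" "\<And>n. finite (F n)" "\<And>n. g (F n) > M - 1 / Suc n"
    by metis
  define p where "p n = (\<Sum>e\<in>F n. cinner x e *\<^sub>C e)" for n
  \<comment> \<open>The sets \<open>F n\<close> need not be nested. The part of \<open>F n\<close>
    outside \<open>F m\<close> contributes little because its union with \<open>F m\<close> still
    has a sum of at most \<open>M\<close>, which \<open>F m\<close> almost attains.\<close>
  have diff: "(norm (p n - p m))\<^sup>2 \<le> 1 / Suc m + 1 / Suc n" for m n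
  proof -
    have fin: "finite (F m \<union> F n)" and sub: "F m \<union> F n \<subseteq> B" using F by auto
    define c where "c e = (if e \<in> F n then cinner x e else 0) - (if e \<in> F m then cinner x e else 0)" for e
    have "(\<Sum>e\<in>F m \<union> F n. (if e \<in> F k then cinner x e else 0) *\<^sub>C e) = p k"
      if "k = m \<or> k = n" for k
      unfolding p_def using fin that F(2)
      by (intro sum.mono_neutral_cong_right) auto
    then have "p n - p m = (\<Sum>e\<in>F m \<union> F n. (if e \<in> F n then cinner x e else 0) *\<^sub>C e)
      - (\<Sum>e\<in>F m \<union> F n. (if e \<in> F m then cinner x e else 0) *\<^sub>C e)" by simp
    also have "\<dots> = (\<Sum>e\<in>F m \<union> F n. c e *\<^sub>C e)"
      unfolding sum_subtractf[symmetric] c_def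
      by (intro sum.cong refl) (auto simp: scaleC_minus_left)
    finally have "(norm (p n - p m))\<^sup>2 = (\<Sum>e\<in>F m \<union> F n. (cmod (c e))\<^sup>2)"
      using norm_orthonormal_sum[OF orthonormal_subset[OF B sub] fin] by simp
    also have "\<dots> = g (F n - F m) + g (F m - F n)"
    proof -
      have "(\<Sum>e\<in>F m \<union> F n. (cmod (c e))\<^sup>2)
        = (\<Sum>e\<in>F m \<union> F n. (if e \<in> F n - F m then (cmod (cinner x e))\<^sup>2 else 0)
          + (if e \<in> F m - F n then (cmod (cinner x e))\<^sup>2 else 0))"
        by (intro sum.cong refl) (auto simp: c_def)
      also have "\<dots> = g (F n - F m) + g (F m - F n)"
        unfolding sum.distrib g_def using fin
        by (intro arg_cong2[where f = "(+)"] sum.mono_neutral_cong_right) auto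
      finally show ?thesis .
    qed
    also have "g (F n - F m) \<le> 1 / Suc m"
    proof -
      have "g (F n - F m) + g (F m) = g (F n \<union> F m)"
        unfolding g_def using F(2) by (subst sum.union_disjoint[symmetric]) auto
      also have "\<dots> \<le> M" using F by (intro g_M) auto
      finally show ?thesis using F(3)[of m] by simp
    qed
    also have "g (F m - F n) \<le> 1 / Suc n"
    proof -
      have "g (F m - F n) + g (F n) = g (F m \<union> F n)"
        unfolding g_def using F(2) by (subst sum.union_disjoint[symmetric]) auto
      also have "\<dots> \<le> M" using F by (intro g_M) auto
      finally show ?thesis using F(3)[of n] by simp
    qed
    finally show ?thesis by simp
  qed
  have "Cauchy p"
  proof (rule metric_CauchyI)
    fix e :: real assume e: "e > 0"
    obtain K where K: "1 / real (Suc K) < e\<^sup>2 / 2"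
      using nat_approx_posE[of "e\<^sup>2 / 2"] e by auto
    have "dist (p m) (p n) < e" if "m \<ge> K" "n \<ge> K" for m n
    proof -
      have "1 / real (Suc m) \<le> 1 / real (Suc K)" "1 / real (Suc n) \<le> 1 / real (Suc K)"
        using that by (auto simp: frac_le)
      then have "(norm (p m - p n))\<^sup>2 < e\<^sup>2" using diff[of m n] K by simp
      then show ?thesis using e by (simp add: dist_norm power2_less_imp_less)
    qed
    then show "\<exists>K. \<forall>m\<ge>K. \<forall>n\<ge>K. dist (p m) (p n) < e" by blast
  qed
  then obtain q where q: "p \<longlonglongrightarrow> q" by (auto simp: Cauchy_convergent_iff convergent_def)
  have inv: "(\<lambda>n. 1 / real (Suc n)) \<longlonglongrightarrow> 0"
    using LIMSEQ_inverse_real_of_nat by (simp add: inverse_eq_divide)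
  have "x - q = 0"
  proof (rule comp, intro ballI)
    fix e assume e: "e \<in> B"
    have "(cmod (cinner (x - p n) e))\<^sup>2 \<le> 1 / Suc n" for n
    proof (cases "e \<in> F n")
      case True
      then have "cinner (p n) e = cinner x e"
        unfolding p_def using F orthonormal_subset[OF B] by (intro cinner_orthonormal_sum_left) auto
      then show ?thesis by (simp add: cinner_diff_left)
    next
      case False
      have orth: "cinner f e = 0" if "f \<in> F n" for f
      proof -
        have "f \<in> B" "f \<noteq> e" using that False F(1)[of n] by auto
        then show ?thesis using B e by (simp add: orthonormal_def)
      qed
      have "cinner (p n) e = 0"
        unfolding p_def cinner.sum_left cinner_scaleC_left by (simp add: orth)
      \<comment> \<open>Adjoining \<open>e\<close> cannot raise the sum above \<open>M\<close>, and
        \<open>F n\<close> misses \<open>M\<close> by less than \<open>1 / Suc n\<close>; so the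
        coefficient at \<open>e\<close> is small.\<close>
      moreover have "g (F n) + (cmod (cinner x e))\<^sup>2 = g (insert e (F n))"
        using False F(2)[of n] by (simp add: g_def)
      moreover have "g (insert e (F n)) \<le> M" using F(1)[of n] F(2)[of n] e by (intro g_M) auto
      ultimately show ?thesis using F(3)[of n] by (simp add: cinner_diff_left)
    qed
    then have lim0: "(\<lambda>n. (cmod (cinner (x - p n) e))\<^sup>2) \<longlonglongrightarrow> 0"
      by (rule tendsto_sandwich[OF always_eventually always_eventually tendsto_const inv, rotated, OF allI])
         simp_all
    have lim: "(\<lambda>n. (cmod (cinner (x - p n) e))\<^sup>2) \<longlonglongrightarrow> (cmod (cinner (x - q) e))\<^sup>2"
      by (rule tendsto_power[OF tendsto_norm[OF cinner.tendsto[OF tendsto_diff[OF tendsto_const q] tendsto_const]]])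
    from LIMSEQ_unique[OF lim lim0] show "cinner (x - q) e = 0" by simp
  qed
  then have "x = q" by simp
  with q have "p \<longlonglongrightarrow> x" by simp
  then have "(\<lambda>n. (norm (p n))\<^sup>2) \<longlonglongrightarrow> (norm x)\<^sup>2"
    by (intro tendsto_power tendsto_norm)
  moreover have "(norm (p n))\<^sup>2 = g (F n)" for n
    unfolding p_def g_def
    by (rule norm_orthonormal_sum[OF orthonormal_subset[OF B F(1)] F(2)])
  ultimately have "(\<lambda>n. g (F n)) \<longlonglongrightarrow> (norm x)\<^sup>2" by simp
  from order_tendstoD(1)[OF this, of "(norm x)\<^sup>2 - \<eta>"] \<eta>
  obtain n where "g (F n) > (norm x)\<^sup>2 - \<eta>"
    unfolding eventually_sequentially by auto
  then have "(norm x)\<^sup>2 \<le> (\<Sum>e\<in>F n. (cmod (cinner x e))\<^sup>2) + \<eta>" by (simp add: g_def)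
  with F(1)[of n] F(2)[of n] show ?thesis by blast
qed

text \<open>By Zorn's lemma there is a maximal orthonormal set; a nonzero vector orthogonal to all
  of it could be normalized and added. This gives \<open>some_onb\<close> its meaning.\<close>

lemma onb_exists: "\<exists>B. onb_on (UNIV :: 'a::complex_hilbert set) B"
proof -
  have "\<exists>B\<in>Collect (orthonormal :: 'a set \<Rightarrow> bool). \<forall>X\<in>Collect orthonormal. B \<subseteq> X \<longrightarrow> X = B"
  proof (rule subset_Zorn_nonempty)
    have "orthonormal ({} :: 'a set)" by (simp add: orthonormal_def)
    then show "Collect (orthonormal :: 'a set \<Rightarrow> bool) \<noteq> {}" by blast
    fix C :: "'a set set" assume ne: "C \<noteq> {}" and C: "subset.chain (Collect orthonormal) C"
    then have o: "orthonormal X" if "X \<in> C" for X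
      using that by (auto simp: subset_chain_def)
    have "norm e = 1" if "e \<in> X" "X \<in> C" for e X
      using o that by (auto simp: orthonormal_def)
    moreover have "cinner e f = 0" if "e \<in> X" "X \<in> C" "f \<in> Y" "Y \<in> C" "e \<noteq> f" for e f X Y
    proof -
      have "X \<subseteq> Y \<or> Y \<subseteq> X" using C that by (auto simp: subset_chain_def)
      then show ?thesis using o[OF that(2)] o[OF that(4)] that by (auto simp: orthonormal_def)
    qed
    ultimately show "\<Union>C \<in> Collect orthonormal"
      unfolding orthonormal_def mem_Collect_eq by (intro conjI ballI impI) (elim UnionE, simp)+
  qed
  then obtain B :: "'a set" where B: "orthonormal B"
    and max: "\<And>X. orthonormal X \<Longrightarrow> B \<subseteq> X \<Longrightarrow> X = B" by auto
  have "x = 0" if x: "\<forall>e\<in>B. cinner x e = 0" for x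
  proof (rule ccontr)
    assume "x \<noteq> 0"
    define y where "y = (1 / norm x) *\<^sub>R x"
    have y: "norm y = 1" using \<open>x \<noteq> 0\<close> by (simp add: y_def)
    have y0: "cinner y e = 0" "cinner e y = 0" if "e \<in> B" for e
    proof -
      show "cinner y e = 0" using x that by (simp add: y_def cinner_scaleR_left)
      then show "cinner e y = 0" by (metis cinner_commute complex_cnj_zero)
    qed
    have "orthonormal (insert y B)"
      unfolding orthonormal_def
    proof (intro conjI ballI impI)
      fix e assume "e \<in> insert y B"
      then show "norm e = 1" using y B unfolding orthonormal_def by (elim insertE) simp_all
    next
      fix e f assume e: "e \<in> insert y B" and f: "f \<in> insert y B" and "e \<noteq> f"
      show "cinner e f = 0"
      proof (cases "e = y \<or> f = y")
        case True
        then show ?thesis using e f \<open>e \<noteq> f\<close> y0 by (metis insertE)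
      next
        case False
        then have "e \<in> B" "f \<in> B" using e f by (metis insertE)+
        then show ?thesis using B \<open>e \<noteq> f\<close> by (simp add: orthonormal_def)
      qed
    qed
    from max[OF this subset_insertI] have "insert y B = B" .
    with insertI1[of y B] have "y \<in> B" by (simp only:)
    then have "cinner y y = 0" by (rule y0)
    then show False using y by (simp add: cinner_self)
  qed
  then have "onb_on UNIV B" using B unfolding onb_on_UNIV_iff by blast
  then show ?thesis ..
qed

lemma onb_on_some_onb: "onb_on UNIV (some_onb (UNIV :: 'a::complex_hilbert set))"
  unfolding some_onb_def using onb_exists by (rule someI_ex)

section \<open>Adjoints and positive operators\<close>

text \<open>A relation between two given operators, so that no Riesz representation is called for:
  every adjoint in the proof is exhibited explicitly.\<close>

definition is_adjoint :: "('a::complex_hilbert \<Rightarrow>\<^sub>L 'a) \<Rightarrow> ('a \<Rightarrow>\<^sub>L 'a) \<Rightarrow> bool" where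
  "is_adjoint X Y \<longleftrightarrow> (\<forall>u v. cinner (X u) v = cinner u (Y v))"

definition positive_blinfun :: "('a::complex_hilbert \<Rightarrow>\<^sub>L 'a) \<Rightarrow> bool" where
  "positive_blinfun P \<longleftrightarrow> is_adjoint P P \<and> (\<forall>x. cinner (P x) x \<in> nonneg_Reals)"

lemma is_adjointD: "is_adjoint X Y \<Longrightarrow> cinner (X u) v = cinner u (Y v)"
  by (simp add: is_adjoint_def)

lemma is_adjoint_sym: "is_adjoint X Y \<Longrightarrow> is_adjoint Y X"
  unfolding is_adjoint_def using cinner_commute by metis

lemma is_adjoint_add: "is_adjoint X Y \<Longrightarrow> is_adjoint X' Y' \<Longrightarrow> is_adjoint (X + X') (Y + Y')"
  by (simp add: is_adjoint_def blinfun.add_left cinner_add_left cinner_add_right)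

lemma is_adjoint_diff: "is_adjoint X Y \<Longrightarrow> is_adjoint X' Y' \<Longrightarrow> is_adjoint (X - X') (Y - Y')"
  by (simp add: is_adjoint_def blinfun.diff_left cinner_diff_left cinner_diff_right)

lemma is_adjoint_scaleR: "is_adjoint X Y \<Longrightarrow> is_adjoint (a *\<^sub>R X) (a *\<^sub>R Y)"
  by (simp add: is_adjoint_def blinfun.scaleR_left cinner_scaleR_left cinner_scaleR_right)

lemma is_adjoint_scaleC_op: "is_adjoint X Y \<Longrightarrow> is_adjoint (scaleC_op c X) (scaleC_op (cnj c) Y)"
  by (simp add: is_adjoint_def scaleC_op.rep_eq cinner_scaleC_left cinner_scaleC_right)

lemma is_adjoint_compose:
  "is_adjoint X Y \<Longrightarrow> is_adjoint X' Y' \<Longrightarrow> is_adjoint (X o\<^sub>L X') (Y' o\<^sub>L Y)"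
  by (simp add: is_adjoint_def)

lemma is_adjoint_id: "is_adjoint id_blinfun id_blinfun"
  by (simp add: is_adjoint_def)

lemma is_adjoint_zero: "is_adjoint 0 0"
  by (simp add: is_adjoint_def)

lemma is_adjoint_limit:
  assumes "X \<longlonglongrightarrow> X'" "Y \<longlonglongrightarrow> Y'" "\<And>n. is_adjoint (X n) (Y n)"
  shows "is_adjoint X' Y'"
  unfolding is_adjoint_def
proof (intro allI)
  fix u v
  have "(\<lambda>n. cinner (X n u) v) \<longlonglongrightarrow> cinner (X' u) v"
    by (rule cinner.tendsto[OF blinfun.tendsto[OF assms(1) tendsto_const] tendsto_const])
  moreover have "(\<lambda>n. cinner u (Y n v)) \<longlonglongrightarrow> cinner u (Y' v)"
    by (rule cinner.tendsto[OF tendsto_const blinfun.tendsto[OF assms(2) tendsto_const]])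
  moreover have "(\<lambda>n. cinner (X n u) v) = (\<lambda>n. cinner u (Y n v))"
    using assms(3) by (simp add: is_adjoint_def)
  ultimately show "cinner (X' u) v = cinner u (Y' v)" using LIMSEQ_unique by metis
qed

text \<open>Bounded linear operators are only real linear by their type; an adjoint forces complex
  linearity.\<close>

lemma is_adjoint_apply_scaleC:
  assumes "is_adjoint X Y"
  shows "X (c *\<^sub>C x) = c *\<^sub>C X x"
  by (rule cinner_ext) (simp add: cinner_scaleC_left is_adjointD[OF assms])

lemma norm_adjoint_le:
  assumes "is_adjoint X Y" "\<And>x. norm (X x) \<le> K * norm x" "K \<ge> 0"
  shows "norm (Y y) \<le> K * norm y"
proof (rule norm_le_if_cinner_le)
  fix x
  have "cmod (cinner (Y y) x) = cmod (cinner (X x) y)"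
    using is_adjointD[OF assms(1), of x y] cinner_commute[of "Y y" x] by simp
  also have "\<dots> \<le> norm (X x) * norm y" by (rule norm_cinner_le)
  also have "\<dots> \<le> (K * norm x) * norm y" using assms by (intro mult_right_mono) auto
  finally show "cmod (cinner (Y y) x) \<le> K * norm y * norm x" by (simp add: mult_ac)
qed (use assms in auto)

text \<open>\<open>G\<close> moves to the other side of the inner product, and its adjoint is a
  contraction as well.\<close>

lemma bessel_family_compose:
  assumes "is_adjoint G G'" "\<And>x. norm (G x) \<le> norm x" "bessel_family I u"
  shows "bessel_family I (\<lambda>i. G (u i))"
  unfolding bessel_family_def
proof
  fix x
  have "(\<Sum>i\<in>I. (cmod (cinner x (G (u i))))\<^sup>2) = (\<Sum>i\<in>I. (cmod (cinner (G' x) (u i)))\<^sup>2)"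
    using is_adjointD[OF is_adjoint_sym[OF assms(1)]] by simp
  also have "\<dots> \<le> (norm (G' x))\<^sup>2" using assms(3) by (auto simp: bessel_family_def)
  also have "\<dots> \<le> (norm x)\<^sup>2"
    using norm_adjoint_le[OF assms(1), of 1 x] assms(2) by (intro power_mono) auto
  finally show "(\<Sum>i\<in>I. (cmod (cinner x (G (u i))))\<^sup>2) \<le> (norm x)\<^sup>2" .
qed

lemma positive_blinfun_Re: "positive_blinfun P \<Longrightarrow> 0 \<le> Re (cinner (P x) x)"
  by (auto simp: positive_blinfun_def nonneg_Reals_iff)

lemma positive_blinfun_of_real:
  "positive_blinfun P \<Longrightarrow> cinner (P x) x = of_real (Re (cinner (P x) x))"
  by (auto simp: positive_blinfun_def nonneg_Reals_iff complex_eq_iff)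

lemma positive_blinfunI:
  assumes adj: "is_adjoint P P" and "\<And>x. 0 \<le> Re (cinner (P x) x)"
  shows "positive_blinfun P"
proof -
  have "cinner (P x) x = cnj (cinner (P x) x)" for x
    using is_adjointD[OF adj, of x x] cinner_commute[of x "P x"] by simp
  then have "Im (cinner (P x) x) = 0" for x
    by (metis complex_cnj_cancel_iff complex_is_Real_iff Reals_cnj_iff)
  then show ?thesis using assms by (auto simp: positive_blinfun_def nonneg_Reals_iff)
qed

lemma cauchy_schwarz_positive:
  assumes "positive_blinfun P"
  shows "(cmod (cinner (P x) y))\<^sup>2 \<le> Re (cinner (P x) x) * Re (cinner (P y) y)"
  using assms
  by (intro cauchy_schwarz_form)
     (auto simp: positive_blinfun_def blinfun.add_right is_adjoint_apply_scaleC)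

text \<open>Cauchy-Schwarz for the form of \<open>P\<close> at the pair \<open>x\<close>,
  \<open>P x\<close>; then \<open>norm (P x)\<close> squared is cancelled.\<close>

lemma norm_positive_le:
  assumes P: "positive_blinfun P" and le: "\<And>x. Re (cinner (P x) x) \<le> q * (norm x)\<^sup>2" and q: "q \<ge> 0"
  shows "norm (P x) \<le> q * norm x"
proof (cases "P x = 0")
  case False
  have "((norm (P x))\<^sup>2)\<^sup>2 = (cmod (cinner (P x) (P x)))\<^sup>2"
    by (simp only: cmod_cinner_self)
  also have "\<dots> \<le> Re (cinner (P x) x) * Re (cinner (P (P x)) (P x))"
    by (rule cauchy_schwarz_positive[OF P])
  also have "\<dots> \<le> (q * (norm x)\<^sup>2) * (q * (norm (P x))\<^sup>2)"
    using q by (intro mult_mono le positive_blinfun_Re[OF P]) simp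
  also have "\<dots> = (norm (P x))\<^sup>2 * (q * norm x)\<^sup>2"
    by (simp add: power2_eq_square mult_ac)
  finally have "(norm (P x))\<^sup>2 * (norm (P x))\<^sup>2 \<le> (norm (P x))\<^sup>2 * (q * norm x)\<^sup>2"
    by (simp only: power2_eq_square[of "(norm (P x))\<^sup>2"])
  moreover have "0 < (norm (P x))\<^sup>2" using False by simp
  ultimately have "(norm (P x))\<^sup>2 \<le> (q * norm x)\<^sup>2" by (rule mult_left_le_imp_le)
  then show ?thesis using q by (rule power2_le_imp_le[OF _ mult_nonneg_nonneg]) simp
qed (use q in auto)

text \<open>The fixed point \<open>Z = (Y + Z\<^sup>2) / 2\<close> satisfies \<open>(1 - Z)\<^sup>2 = 1 - Y\<close>.\<close>

primrec sqrt_iter :: "('a::complex_hilbert \<Rightarrow>\<^sub>L 'a) \<Rightarrow> nat \<Rightarrow> ('a \<Rightarrow>\<^sub>L 'a)" where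
  "sqrt_iter Y 0 = 0"
| "sqrt_iter Y (Suc n) = (1/2) *\<^sub>R (Y + (sqrt_iter Y n o\<^sub>L sqrt_iter Y n))"

text \<open>The same iteration with the number 1 in place of \<open>Y\<close>. It is increasing and
  bounded by 1 and majorizes the operator iteration term by term, which gives convergence even when
  \<open>norm Y = 1\<close>, where a geometric rate fails.\<close>

primrec sqrt_bound :: "nat \<Rightarrow> real" where
  "sqrt_bound 0 = 0"
| "sqrt_bound (Suc n) = (1 + (sqrt_bound n)\<^sup>2) / 2"

lemma sqrt_bound_bounds: "0 \<le> sqrt_bound n \<and> sqrt_bound n \<le> 1"
proof (induction n)
  case (Suc n)
  then have "(sqrt_bound n)\<^sup>2 \<le> 1" by (simp add: power_le_one)
  then show ?case by simp
qed simp

lemma sqrt_bound_mono: "sqrt_bound n \<le> sqrt_bound (Suc n)"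
proof -
  have "0 \<le> (1 - sqrt_bound n)\<^sup>2" by simp
  then show ?thesis by (simp add: power2_eq_square algebra_simps)
qed

lemma norm_sqrt_iter: "norm Y \<le> 1 \<Longrightarrow> norm (sqrt_iter Y n) \<le> sqrt_bound n"
proof (induction n)
  case (Suc n)
  have "norm (sqrt_iter Y (Suc n)) \<le> (norm Y + norm (sqrt_iter Y n o\<^sub>L sqrt_iter Y n)) / 2"
    using norm_triangle_ineq[of Y "sqrt_iter Y n o\<^sub>L sqrt_iter Y n"] by simp
  also have "\<dots> \<le> (1 + (sqrt_bound n)\<^sup>2) / 2"
  proof -
    have "norm (sqrt_iter Y n o\<^sub>L sqrt_iter Y n) \<le> norm (sqrt_iter Y n) * norm (sqrt_iter Y n)"
      by (rule norm_blinfun_compose)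
    also have "\<dots> \<le> sqrt_bound n * sqrt_bound n"
      using Suc sqrt_bound_bounds[of n] by (intro mult_mono) auto
    finally show ?thesis using Suc.prems by (simp add: power2_eq_square)
  qed
  finally show ?case by simp
qed simp

lemma norm_sqrt_iter_Suc_diff:
  assumes Y: "norm Y \<le> 1"
  shows "norm (sqrt_iter Y (Suc n) - sqrt_iter Y n) \<le> sqrt_bound (Suc n) - sqrt_bound n"
proof (induction n)
  case 0
  then show ?case using Y by simp
next
  case (Suc n)
  let ?A = "sqrt_iter Y (Suc n)" and ?B = "sqrt_iter Y n"
  let ?a = "sqrt_bound (Suc n)" and ?b = "sqrt_bound n"
  have A: "norm ?A \<le> ?a" and B: "norm ?B \<le> ?b" using norm_sqrt_iter[OF Y] by blast+
  \<comment> \<open>The difference of two squares is split as \<open>A (A - B) + (A - B) B\<close>,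
    which is valid without commutation; the scalar majorant satisfies the same identity.\<close>
  have "sqrt_iter Y (Suc (Suc n)) - ?A
      = (1/2) *\<^sub>R ((?A o\<^sub>L (?A - ?B)) + ((?A - ?B) o\<^sub>L ?B))"
    unfolding sqrt_iter.simps(2)[of Y "Suc n"] sqrt_iter.simps(2)[of Y n]
    by (intro blinfun_eqI) (simp add: blinfun.bilinear_simps algebra_simps)
  then have "norm (sqrt_iter Y (Suc (Suc n)) - ?A)
      \<le> (norm (?A o\<^sub>L (?A - ?B)) + norm ((?A - ?B) o\<^sub>L ?B)) / 2"
    using norm_triangle_ineq[of "?A o\<^sub>L (?A - ?B)" "(?A - ?B) o\<^sub>L ?B"]
    by (simp del: sqrt_iter.simps)
  also have "\<dots> \<le> (?a * (?a - ?b) + (?a - ?b) * ?b) / 2"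
  proof -
    have "norm (?A o\<^sub>L (?A - ?B)) \<le> norm ?A * norm (?A - ?B)"
      by (rule norm_blinfun_compose)
    also have "\<dots> \<le> ?a * (?a - ?b)"
      using A Suc sqrt_bound_bounds[of "Suc n"]
      by (intro mult_mono) (auto simp del: sqrt_iter.simps sqrt_bound.simps)
    finally have 1: "norm (?A o\<^sub>L (?A - ?B)) \<le> ?a * (?a - ?b)" .
    have "norm ((?A - ?B) o\<^sub>L ?B) \<le> norm (?A - ?B) * norm ?B"
      by (rule norm_blinfun_compose)
    also have "\<dots> \<le> (?a - ?b) * ?b"
      using B Suc sqrt_bound_mono[of n]
      by (intro mult_mono) (auto simp del: sqrt_iter.simps sqrt_bound.simps)
    finally show ?thesis using 1 by simp
  qed
  also have "\<dots> = sqrt_bound (Suc (Suc n)) - ?a"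
    unfolding sqrt_bound.simps(2)[of "Suc n"]
    by (subst (4) sqrt_bound.simps) (simp add: power2_eq_square algebra_simps diff_divide_distrib del: sqrt_bound.simps)
  finally show ?case .
qed

lemma norm_sqrt_iter_diff:
  assumes Y: "norm Y \<le> 1" and "n \<le> m"
  shows "norm (sqrt_iter Y m - sqrt_iter Y n) \<le> sqrt_bound m - sqrt_bound n"
  using \<open>n \<le> m\<close>
proof (induction m rule: dec_induct)
  case (step m)
  have "norm (sqrt_iter Y (Suc m) - sqrt_iter Y n)
      \<le> norm (sqrt_iter Y (Suc m) - sqrt_iter Y m) + norm (sqrt_iter Y m - sqrt_iter Y n)"
    by norm
  also have "\<dots> \<le> (sqrt_bound (Suc m) - sqrt_bound m) + (sqrt_bound m - sqrt_bound n)"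
    by (intro add_mono step.IH norm_sqrt_iter_Suc_diff[OF Y])
  finally show ?case by simp
qed simp

lemma sqrt_iter_limit:
  assumes Y: "norm Y \<le> 1" and adj: "is_adjoint Y Y"
  shows "\<exists>Z. is_adjoint Z Z \<and> norm Z \<le> 1 \<and> Z = (1/2) *\<^sub>R (Y + (Z o\<^sub>L Z))"
proof -
  have "incseq sqrt_bound" using sqrt_bound_mono by (rule incseq_SucI)
  then have "convergent sqrt_bound"
    using sqrt_bound_bounds by (intro Bseq_mono_convergent) (auto simp: incseq_def intro!: BseqI'[of _ 1])
  then have C: "Cauchy sqrt_bound" by (simp add: Cauchy_convergent_iff)
  have "Cauchy (sqrt_iter Y)"
  proof (rule metric_CauchyI)
    fix e :: real assume "e > 0"
    with C obtain N where N: "\<And>m n. m \<ge> N \<Longrightarrow> n \<ge> N \<Longrightarrow> dist (sqrt_bound m) (sqrt_bound n) < e"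
      by (meson Cauchy_def)
    have "dist (sqrt_iter Y m) (sqrt_iter Y n) < e" if "m \<ge> N" "n \<ge> N" for m n
    proof (cases "n \<le> m")
      case True
      have "dist (sqrt_iter Y m) (sqrt_iter Y n) \<le> dist (sqrt_bound m) (sqrt_bound n)"
        using norm_sqrt_iter_diff[OF Y True] by (simp add: dist_norm)
      then show ?thesis using N[OF that] by simp
    next
      case False
      then have "n \<ge> m" by simp
      have "dist (sqrt_iter Y m) (sqrt_iter Y n) \<le> dist (sqrt_bound n) (sqrt_bound m)"
        using norm_sqrt_iter_diff[OF Y \<open>n \<ge> m\<close>] by (simp add: dist_norm norm_minus_commute)
      then show ?thesis using N[OF that(2) that(1)] by simp
    qed
    then show "\<exists>N. \<forall>m\<ge>N. \<forall>n\<ge>N. dist (sqrt_iter Y m) (sqrt_iter Y n) < e" by blast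
  qed
  then obtain Z where Z: "sqrt_iter Y \<longlonglongrightarrow> Z" by (auto simp: Cauchy_convergent_iff convergent_def)
  have "is_adjoint (sqrt_iter Y n) (sqrt_iter Y n)" for n
    by (induction n) (auto intro!: is_adjoint_zero is_adjoint_scaleR is_adjoint_add adj is_adjoint_compose)
  then have "is_adjoint Z Z" by (rule is_adjoint_limit[OF Z Z])
  moreover have "norm Z \<le> 1"
  proof (rule Lim_norm_ubound[OF sequentially_bot Z])
    show "\<forall>\<^sub>F n in sequentially. norm (sqrt_iter Y n) \<le> 1"
      using norm_sqrt_iter[OF Y] sqrt_bound_bounds by (intro always_eventually allI) (meson order_trans)
  qed
  moreover have "Z = (1/2) *\<^sub>R (Y + (Z o\<^sub>L Z))"
  proof (rule LIMSEQ_unique)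
    show "(\<lambda>n. sqrt_iter Y (Suc n)) \<longlonglongrightarrow> Z" using Z by (rule LIMSEQ_Suc)
    show "(\<lambda>n. sqrt_iter Y (Suc n)) \<longlonglongrightarrow> (1/2) *\<^sub>R (Y + (Z o\<^sub>L Z))"
      unfolding sqrt_iter.simps(2)
      by (intro tendsto_scaleR tendsto_add tendsto_const
          bounded_bilinear.tendsto[OF bounded_bilinear_blinfun_compose Z Z])
  qed
  ultimately show ?thesis by blast
qed

lemma positive_sqrt_exists:
  assumes W: "positive_blinfun W"
  shows "\<exists>P. positive_blinfun P \<and> P o\<^sub>L P = W"
proof -
  \<comment> \<open>Scaling by \<open>c\<close> places \<open>Y = 1 - W / c\<close> between 0 and 1;
    the summand 1 keeps \<open>c\<close> positive when \<open>W = 0\<close>.\<close>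
  define c where "c = norm W + 1"
  have c: "c > 0" by (simp add: c_def add_nonneg_pos)
  define Y where "Y = id_blinfun - (1/c) *\<^sub>R W"
  have Wadj: "is_adjoint W W" using W by (simp add: positive_blinfun_def)
  have adj: "is_adjoint Y Y"
    unfolding Y_def by (intro is_adjoint_diff is_adjoint_id is_adjoint_scaleR Wadj)
  have form: "Re (cinner (Y x) x) = (norm x)\<^sup>2 - Re (cinner (W x) x) / c" for x
    by (simp add: Y_def blinfun.bilinear_simps cinner_diff_left cinner_scaleR_left norm_square_cinner)
  have "Re (cinner (W x) x) \<le> c * (norm x)\<^sup>2" for x
  proof -
    have "Re (cinner (W x) x) \<le> cmod (cinner (W x) x)" by (rule complex_Re_le_cmod)
    also have "\<dots> \<le> norm (W x) * norm x" by (rule norm_cinner_le)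
    also have "\<dots> \<le> (c * norm x) * norm x"
      using norm_blinfun[of W x] mult_right_mono[of "norm W" c "norm x"]
      by (intro mult_right_mono) (auto simp: c_def)
    finally show ?thesis by (simp add: power2_eq_square mult.assoc)
  qed
  then have Ypos: "positive_blinfun Y"
    using c by (intro positive_blinfunI adj) (simp add: form field_simps)
  have "norm (Y x) \<le> 1 * norm x" for x
    using positive_blinfun_Re[OF W] c
    by (intro norm_positive_le[OF Ypos]) (auto simp: form)
  then have "norm Y \<le> 1" by (intro norm_blinfun_bound) auto
  from sqrt_iter_limit[OF this adj] obtain Z
    where Z: "is_adjoint Z Z" "norm Z \<le> 1" "Z = (1/2) *\<^sub>R (Y + (Z o\<^sub>L Z))" by blast
  define P where "P = sqrt c *\<^sub>R (id_blinfun - Z)"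
  have "is_adjoint P P"
    unfolding P_def by (intro is_adjoint_scaleR is_adjoint_diff is_adjoint_id Z)
  \<comment> \<open>The bound \<open>norm Z \<le> 1\<close> makes \<open>1 - Z\<close> the
    nonnegative root.\<close>
  moreover have "0 \<le> Re (cinner (P x) x)" for x
  proof -
    have "Re (cinner (Z x) x) \<le> cmod (cinner (Z x) x)" by (rule complex_Re_le_cmod)
    also have "\<dots> \<le> norm (Z x) * norm x" by (rule norm_cinner_le)
    also have "\<dots> \<le> (1 * norm x) * norm x"
      using norm_blinfun[of Z x] mult_right_mono[OF Z(2), of "norm x"] by (intro mult_right_mono) auto
    finally have "0 \<le> (norm x)\<^sup>2 - Re (cinner (Z x) x)" by (simp add: power2_eq_square)
    then have "0 \<le> sqrt c * ((norm x)\<^sup>2 - Re (cinner (Z x) x))" using c by simp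
    then show ?thesis
      by (simp add: P_def blinfun.bilinear_simps cinner_diff_left cinner_scaleR_left
          norm_square_cinner)
  qed
  ultimately have "positive_blinfun P" by (rule positive_blinfunI)
  moreover have "P o\<^sub>L P = W"
  proof (rule blinfun_eqI)
    fix x
    have "2 *\<^sub>R Z x = 2 *\<^sub>R (((1/2) *\<^sub>R (Y + (Z o\<^sub>L Z))) x)" using Z(3) by simp
    then have "2 *\<^sub>R Z x = Y x + Z (Z x)" by (simp add: blinfun.bilinear_simps)
    then have ZZ: "Z (Z x) = 2 *\<^sub>R Z x - Y x" by simp
    have "(P o\<^sub>L P) x = c *\<^sub>R (x - 2 *\<^sub>R Z x + Z (Z x))"
      using c by (simp add: P_def blinfun.bilinear_simps algebra_simps scaleR_2)
    also have "\<dots> = c *\<^sub>R (x - Y x)" unfolding ZZ by simp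
    also have "\<dots> = W x" using c by (simp add: Y_def blinfun.bilinear_simps)
    finally show "(P o\<^sub>L P) x = W x" .
  qed
  ultimately show ?thesis by blast
qed

text \<open>With \<open>c = norm P + \<epsilon>\<close> the operator
  \<open>Y = 1 - (P + \<epsilon>) / c\<close> is positive and has norm at most
  \<open>q = 1 - \<epsilon> / c < 1\<close>, so \<open>P + \<epsilon> = c (1 - Y)\<close> is
  inverted by a Neumann series.\<close>

lemma positive_shift_inverse:
  assumes P: "positive_blinfun P" and \<epsilon>: "\<epsilon> > 0"
  shows "\<exists>K. is_adjoint K K \<and> (\<forall>x. P (K x) + \<epsilon> *\<^sub>R K x = x) \<and> (\<forall>x. K (P x) + \<epsilon> *\<^sub>R K x = x)"
proof -
  define c where "c = norm P + \<epsilon>"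
  have c: "c > 0" using \<epsilon> by (simp add: c_def add_nonneg_pos)
  define Y where "Y = id_blinfun - (1/c) *\<^sub>R (P + \<epsilon> *\<^sub>R id_blinfun)"
  define q where "q = 1 - \<epsilon> / c"
  have q: "0 \<le> q" "q < 1" using \<epsilon> c by (auto simp: q_def c_def field_simps)
  have Padj: "is_adjoint P P" using P by (simp add: positive_blinfun_def)
  have adj: "is_adjoint Y Y"
    unfolding Y_def by (intro is_adjoint_diff is_adjoint_id is_adjoint_scaleR is_adjoint_add Padj)
  have form: "Re (cinner (Y x) x) = q * (norm x)\<^sup>2 - Re (cinner (P x) x) / c" for x
    by (simp add: Y_def q_def blinfun.bilinear_simps cinner_diff_left cinner_scaleR_left
        cinner_add_left norm_square_cinner add_divide_distrib algebra_simps)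
  have "Re (cinner (P x) x) \<le> (c - \<epsilon>) * (norm x)\<^sup>2" for x
  proof -
    have "Re (cinner (P x) x) \<le> cmod (cinner (P x) x)" by (rule complex_Re_le_cmod)
    also have "\<dots> \<le> norm (P x) * norm x" by (rule norm_cinner_le)
    also have "\<dots> \<le> ((c - \<epsilon>) * norm x) * norm x"
      using norm_blinfun[of P x] by (intro mult_right_mono) (auto simp: c_def)
    finally show ?thesis by (simp add: power2_eq_square mult.assoc)
  qed
  moreover have "Re (cinner (Y x) x) = ((c - \<epsilon>) * (norm x)\<^sup>2 - Re (cinner (P x) x)) / c" for x
    using c unfolding form q_def by (simp add: field_simps)
  ultimately have "0 \<le> Re (cinner (Y x) x)" for x
    using c by simp
  then have Ypos: "positive_blinfun Y" by (intro positive_blinfunI adj)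
  have Yle: "norm (Y x) \<le> q * norm x" for x
    using positive_blinfun_Re[OF P] c q
    by (intro norm_positive_le[OF Ypos]) (auto simp: form)
  then have nY: "norm Y \<le> q" using q by (intro norm_blinfun_bound) auto
  \<comment> \<open>The Neumann series is summed by Banach's fixed point theorem in the space of
    bounded operators.\<close>
  have "\<exists>!K. (1/c) *\<^sub>R id_blinfun + (Y o\<^sub>L K) = K"
  proof (rule banach_fix_type[OF q])
    show "\<forall>K. \<forall>K'. dist ((1/c) *\<^sub>R id_blinfun + (Y o\<^sub>L K)) ((1/c) *\<^sub>R id_blinfun + (Y o\<^sub>L K')) \<le> q * dist K K'"
    proof (intro allI)
      fix K K' :: "'a \<Rightarrow>\<^sub>L 'a"
      have "(Y o\<^sub>L K) - (Y o\<^sub>L K') = Y o\<^sub>L (K - K')"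
        by (intro blinfun_eqI) (simp add: blinfun.bilinear_simps)
      then have "dist ((1/c) *\<^sub>R id_blinfun + (Y o\<^sub>L K)) ((1/c) *\<^sub>R id_blinfun + (Y o\<^sub>L K'))
          = norm (Y o\<^sub>L (K - K'))" by (simp add: dist_norm)
      also have "\<dots> \<le> norm Y * norm (K - K')" by (rule norm_blinfun_compose)
      also have "\<dots> \<le> q * dist K K'" using nY by (simp add: dist_norm mult_right_mono)
      finally show "dist ((1/c) *\<^sub>R id_blinfun + (Y o\<^sub>L K)) ((1/c) *\<^sub>R id_blinfun + (Y o\<^sub>L K')) \<le> q * dist K K'" .
    qed
  qed
  then obtain K where K: "(1/c) *\<^sub>R id_blinfun + (Y o\<^sub>L K) = K" by blast
  have inv: "P (K x) + \<epsilon> *\<^sub>R K x = x" for x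
  proof -
    have "K x = (1/c) *\<^sub>R x + Y (K x)" by (subst K[symmetric]) (simp add: blinfun.bilinear_simps)
    then have "(1/c) *\<^sub>R (P (K x) + \<epsilon> *\<^sub>R K x) = (1/c) *\<^sub>R x"
      by (simp add: Y_def blinfun.bilinear_simps algebra_simps)
    then show ?thesis using c by simp
  qed
  have Kadj: "is_adjoint K K"
    unfolding is_adjoint_def
  proof (intro allI)
    fix u v
    have "cinner (K u) v = cinner (K u) (P (K v) + \<epsilon> *\<^sub>R K v)" by (simp add: inv)
    also have "\<dots> = cinner (P (K u) + \<epsilon> *\<^sub>R K u) (K v)"
      by (simp add: cinner_add_left cinner_add_right cinner_scaleR_left cinner_scaleR_right
          is_adjointD[OF Padj])
    finally show "cinner (K u) v = cinner u (K v)" by (simp add: inv)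
  qed
  \<comment> \<open>The left inverse is the adjoint of the right inverse, \<open>P\<close> and
    \<open>K\<close> being self-adjoint.\<close>
  have "K (P x) + \<epsilon> *\<^sub>R K x = x" for x
  proof (rule cinner_ext)
    fix v
    have "cinner (K (P x) + \<epsilon> *\<^sub>R K x) v = cinner x (P (K v) + \<epsilon> *\<^sub>R K v)"
      by (simp add: cinner_add_left cinner_add_right cinner_scaleR_left cinner_scaleR_right
          is_adjointD[OF Padj] is_adjointD[OF Kadj])
    then show "cinner (K (P x) + \<epsilon> *\<^sub>R K x) v = cinner x v" by (simp add: inv)
  qed
  then show ?thesis using Kadj inv by blast
qed

section \<open>Trace class operators\<close>

text \<open>A polar decomposition \<open>T = K P\<close>, \<open>P = T\<^sup>* K\<close> up to \<open>\<epsilon>\<close>, with \<open>K = T (P + \<epsilon>)\<^sup>-\<^sup>1\<close>; it avoids partial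
  isometries.\<close>

lemma regularized_polar:
  assumes P: "positive_blinfun P" and adj: "is_adjoint T T'"
    and sq: "\<And>x. P (P x) = T' (T x)" and \<epsilon>: "\<epsilon> > 0"
  obtains K K' R where "is_adjoint K K'" "\<And>x. norm (blinfun_apply K x) \<le> norm x"
    "\<And>x. norm (blinfun_apply R x) \<le> norm x"
    "\<And>x. T x = K (P x) + \<epsilon> *\<^sub>R K x" "\<And>x. P x = T' (K x) + \<epsilon> *\<^sub>R R x"
proof -
  have Padj: "is_adjoint P P" using P by (simp add: positive_blinfun_def)
  obtain J where J: "is_adjoint J J" "\<And>x. P (J x) + \<epsilon> *\<^sub>R J x = x" "\<And>x. J (P x) + \<epsilon> *\<^sub>R J x = x"
    using positive_shift_inverse[OF P \<epsilon>] by blast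
  \<comment> \<open>Expanding the norm of \<open>x = P J x + \<epsilon> J x\<close>, all terms
    besides the first are nonnegative because \<open>P\<close> is positive.\<close>
  have PJ: "norm (P (J x)) \<le> norm x" for x
  proof -
    have "(norm x)\<^sup>2 = (norm (P (J x) + \<epsilon> *\<^sub>R J x))\<^sup>2" by (simp only: J(2))
    also have "\<dots> = (norm (P (J x)))\<^sup>2 + \<epsilon> * (Re (cinner (P (J x)) (J x)) + Re (cinner (J x) (P (J x))))
      + (norm (\<epsilon> *\<^sub>R J x))\<^sup>2"
      unfolding norm_square_cinner
      by (simp add: cinner_add_left cinner_add_right cinner_scaleR_left cinner_scaleR_right algebra_simps)
    also have "cinner (J x) (P (J x)) = cinner (P (J x)) (J x)"
      using is_adjointD[OF Padj, of "J x" "J x"] by simp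
    also have "(norm (P (J x)))\<^sup>2 + \<epsilon> * (Re (cinner (P (J x)) (J x)) + Re (cinner (P (J x)) (J x)))
      + (norm (\<epsilon> *\<^sub>R J x))\<^sup>2 \<ge> (norm (P (J x)))\<^sup>2"
      using positive_blinfun_Re[OF P, of "J x"] \<epsilon> by simp
    finally show ?thesis by (rule power2_le_imp_le) simp
  qed
  define K where "K = T o\<^sub>L J"
  have k1: "is_adjoint K (J o\<^sub>L T')" unfolding K_def by (rule is_adjoint_compose[OF adj J(1)])
  have k2: "norm (K x) \<le> norm x" for x
  proof -
    \<comment> \<open>Since \<open>T' T = P P\<close>, the vectors \<open>T (J x)\<close> and
      \<open>P (J x)\<close> have the same norm, and the latter is already estimated.\<close>
    have "cinner (T (J x)) (T (J x)) = cinner (J x) (P (P (J x)))"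
      by (simp add: sq is_adjointD[OF adj])
    also have "\<dots> = cinner (P (J x)) (P (J x))" by (simp add: is_adjointD[OF Padj])
    finally have "(norm (K x))\<^sup>2 = (norm (P (J x)))\<^sup>2" by (simp add: norm_square_cinner K_def)
    then have "norm (K x) = norm (P (J x))" by simp
    then show ?thesis using PJ by simp
  qed
  have k3: "norm ((P o\<^sub>L J) x) \<le> norm x" for x using PJ by simp
  have k4: "T x = K (P x) + \<epsilon> *\<^sub>R K x" for x
  proof -
    have "T x = T (J (P x) + \<epsilon> *\<^sub>R J x)" by (simp only: J(3))
    also have "\<dots> = K (P x) + \<epsilon> *\<^sub>R K x" by (simp add: K_def blinfun.add_right blinfun.scaleR_right)
    finally show ?thesis .
  qed
  have k5: "P x = T' (K x) + \<epsilon> *\<^sub>R (P o\<^sub>L J) x" for x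
  proof -
    have "P x = P (P (J x) + \<epsilon> *\<^sub>R J x)" by (simp only: J(2))
    also have "\<dots> = T' (K x) + \<epsilon> *\<^sub>R (P o\<^sub>L J) x"
      by (simp add: K_def blinfun.add_right blinfun.scaleR_right sq)
    finally show ?thesis .
  qed
  show thesis by (rule that[of K "J o\<^sub>L T'" "P o\<^sub>L J"]) (rule k1 k2 k3 k4 k5)+
qed

text \<open>Unlike the definition of trace class through the absolute value, this bound on the trace norm passes
  directly to sums, integrals and compositions.\<close>

definition trace_bounded :: "('a::complex_hilbert \<Rightarrow>\<^sub>L 'a) \<Rightarrow> real \<Rightarrow> bool" where
  "trace_bounded T C \<longleftrightarrow> (\<forall>(I::'a set) u v. finite I \<longrightarrow> bessel_family I u \<longrightarrow> bessel_family I v \<longrightarrow>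
     (\<Sum>i\<in>I. cmod (cinner (T (u i)) (v i))) \<le> C)"

lemma trace_boundedD:
  fixes T :: "'a::complex_hilbert \<Rightarrow>\<^sub>L 'a" and I :: "'a set"
  shows "trace_bounded T C \<Longrightarrow> finite I \<Longrightarrow> bessel_family I u \<Longrightarrow> bessel_family I v \<Longrightarrow>
    (\<Sum>i\<in>I. cmod (cinner (T (u i)) (v i))) \<le> C"
  by (simp add: trace_bounded_def)

lemma bessel_family_scaled:
  assumes "is_adjoint G G'" "norm G \<le> c" "c > 0" "bessel_family I u"
  shows "bessel_family I (\<lambda>i. (1 / c) *\<^sub>R G (u i))"
proof -
  have "norm (((1/c) *\<^sub>R G) x) \<le> norm x" for x
  proof -
    have "norm (G x) \<le> c * norm x"
      using norm_blinfun[of G x] mult_right_mono[OF assms(2), of "norm x"] by simp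
    then show ?thesis using assms(3) by (simp add: blinfun.scaleR_left field_simps)
  qed
  then show ?thesis
    using bessel_family_compose[OF is_adjoint_scaleR[OF assms(1)] _ assms(4), of "1/c"]
    by (simp add: blinfun.scaleR_left)
qed

text \<open>\<open>H\<close> is absorbed into the family \<open>u\<close> and the adjoint of
  \<open>G\<close> into \<open>v\<close>; division by \<open>d\<close> and \<open>c\<close> keeps
  both families Bessel.\<close>

lemma trace_bounded_compose:
  assumes T: "trace_bounded T C" and G: "is_adjoint G G'" "norm G \<le> c" "norm G' \<le> c" "c > 0"
    and H: "is_adjoint H H'" "norm H \<le> d" "d > 0"
  shows "trace_bounded (G o\<^sub>L T o\<^sub>L H) (c * d * C)"
  unfolding trace_bounded_def
proof (intro allI impI)
  fix I :: "'a set" and u v :: "'a \<Rightarrow> 'a"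
  assume fin: "finite I" and u: "bessel_family I u" and v: "bessel_family I v"
  define u' where "u' i = (1/d) *\<^sub>R H (u i)" for i
  define v' where "v' i = (1/c) *\<^sub>R G' (v i)" for i
  have "bessel_family I u'" unfolding u'_def by (rule bessel_family_scaled[OF H u])
  moreover have "bessel_family I v'"
    unfolding v'_def by (rule bessel_family_scaled[OF is_adjoint_sym[OF G(1)] G(3,4) v])
  ultimately have le: "(\<Sum>i\<in>I. cmod (cinner (T (u' i)) (v' i))) \<le> C"
    by (rule trace_boundedD[OF T fin])
  have "cinner ((G o\<^sub>L T o\<^sub>L H) (u i)) (v i) = (c * d) *\<^sub>R cinner (T (u' i)) (v' i)" for i
    using G(4) H(3)
    by (simp add: u'_def v'_def is_adjointD[OF G(1)] blinfun.scaleR_right cinner_scaleR_left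
        cinner_scaleR_right)
  then have "(\<Sum>i\<in>I. cmod (cinner ((G o\<^sub>L T o\<^sub>L H) (u i)) (v i)))
      = (c * d) * (\<Sum>i\<in>I. cmod (cinner (T (u' i)) (v' i)))"
    using G(4) H(3) by (simp add: sum_distrib_left norm_mult)
  also have "\<dots> \<le> (c * d) * C" using le G(4) H(3) by (intro mult_left_mono) auto
  finally show "(\<Sum>i\<in>I. cmod (cinner ((G o\<^sub>L T o\<^sub>L H) (u i)) (v i))) \<le> c * d * C" .
qed

text \<open>Factor \<open>P = Q Q\<close> and expand \<open>Q u\<close> in the basis; exchanging the two sums makes the Bessel
  inequality of the family applicable.\<close>

lemma positive_bessel_sum_le:
  assumes P: "positive_blinfun P" and onb: "onb_on UNIV B"
    and sum: "(\<lambda>e. Re (cinner (P e) e)) summable_on B"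
    and I: "finite I" "bessel_family I u"
  shows "(\<Sum>i\<in>I. Re (cinner (P (u i)) (u i))) \<le> (\<Sum>\<^sub>\<infinity>e\<in>B. Re (cinner (P e) e))"
proof (rule field_le_epsilon)
  fix \<eta> :: real assume \<eta>: "\<eta> > 0"
  obtain Q where Q: "positive_blinfun Q" "Q o\<^sub>L Q = P" using positive_sqrt_exists[OF P] by blast
  have Qadj: "is_adjoint Q Q" using Q by (simp add: positive_blinfun_def)
  have PQ: "Re (cinner (P x) x) = (norm (Q x))\<^sup>2" for x
    unfolding Q(2)[symmetric] by (simp add: norm_square_cinner is_adjointD[OF Qadj])
  \<comment> \<open>The error is shared among the members of \<open>I\<close>; the summand 1 allows
    for empty \<open>I\<close>.\<close>
  define \<mu> where "\<mu> = \<eta> / (real (card I) + 1)"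
  have \<mu>: "\<mu> > 0" using \<eta> by (simp add: \<mu>_def add_nonneg_pos)
  have "\<exists>F\<subseteq>B. finite F \<and> (norm (Q (u i)))\<^sup>2 \<le> (\<Sum>e\<in>F. (cmod (cinner (Q (u i)) e))\<^sup>2) + \<mu>" for i
    by (rule parseval_approx[OF onb \<mu>])
  then obtain F where F: "\<And>i. F i \<subseteq> B" "\<And>i. finite (F i)"
    "\<And>i. (norm (Q (u i)))\<^sup>2 \<le> (\<Sum>e\<in>F i. (cmod (cinner (Q (u i)) e))\<^sup>2) + \<mu>" by metis
  \<comment> \<open>One finite part of the basis serves all \<open>i\<close> at once, so the two
    finite sums can be exchanged.\<close>
  define E where "E = (\<Union>i\<in>I. F i)"
  have E: "finite E" "E \<subseteq> B" using F I by (auto simp: E_def)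
  have "(\<Sum>i\<in>I. Re (cinner (P (u i)) (u i))) \<le> (\<Sum>i\<in>I. (\<Sum>e\<in>E. (cmod (cinner (Q (u i)) e))\<^sup>2) + \<mu>)"
  proof (rule sum_mono)
    fix i assume i: "i \<in> I"
    have "(\<Sum>e\<in>F i. (cmod (cinner (Q (u i)) e))\<^sup>2) \<le> (\<Sum>e\<in>E. (cmod (cinner (Q (u i)) e))\<^sup>2)"
      using i E(1) by (intro sum_mono2) (auto simp: E_def)
    then show "Re (cinner (P (u i)) (u i)) \<le> (\<Sum>e\<in>E. (cmod (cinner (Q (u i)) e))\<^sup>2) + \<mu>"
      using F(3)[of i] PQ[of "u i"] by linarith
  qed
  also have "\<dots> = (\<Sum>e\<in>E. \<Sum>i\<in>I. (cmod (cinner (Q e) (u i)))\<^sup>2) + real (card I) * \<mu>"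
  proof -
    have "cmod (cinner (Q x) e) = cmod (cinner (Q e) x)" for x e
      using is_adjointD[OF Qadj, of e x] cinner_commute[of "Q x" e] by simp
    then show ?thesis by (simp add: sum.distrib sum.swap[of _ E I])
  qed
  also have "\<dots> \<le> (\<Sum>e\<in>E. Re (cinner (P e) e)) + \<eta>"
  proof (rule add_mono)
    show "(\<Sum>e\<in>E. \<Sum>i\<in>I. (cmod (cinner (Q e) (u i)))\<^sup>2) \<le> (\<Sum>e\<in>E. Re (cinner (P e) e))"
      unfolding PQ using I(2) by (intro sum_mono) (auto simp: bessel_family_def)
    show "real (card I) * \<mu> \<le> \<eta>" using \<eta> by (simp add: \<mu>_def field_simps)
  qed
  also have "(\<Sum>e\<in>E. Re (cinner (P e) e)) \<le> (\<Sum>\<^sub>\<infinity>e\<in>B. Re (cinner (P e) e))"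
    using E by (intro finite_sum_le_infsum sum positive_blinfun_Re[OF P])
  finally show "(\<Sum>i\<in>I. Re (cinner (P (u i)) (u i))) \<le> (\<Sum>\<^sub>\<infinity>e\<in>B. Re (cinner (P e) e)) + \<eta>" by simp
qed

text \<open>By the regularized polar decomposition an entry of \<open>T\<close> at \<open>u\<close>,
  \<open>v\<close> is, up to \<open>\<epsilon>\<close>, an entry of \<open>P\<close> at
  \<open>u\<close>, \<open>K' v\<close>. Cauchy-Schwarz for \<open>P\<close> reduces it to diagonal
  entries of \<open>P\<close> on two Bessel families, each with sum at most the trace
  \<open>\<tau>\<close> of \<open>P\<close>.\<close>

lemma trace_class_imp_trace_bounded:
  fixes T :: "'a::complex_hilbert \<Rightarrow>\<^sub>L 'a"
  assumes tc: "trace_class T" and adj: "is_adjoint T T'"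
  shows "\<exists>C. trace_bounded T C"
proof -
  obtain P0 B where P0: "is_abs_on UNIV (blinfun_apply T) P0" and onb: "onb_on UNIV B"
    and sum0: "(\<lambda>e. cinner (P0 e) e) summable_on B"
    using tc by (auto simp: trace_class_on_def)
  then obtain K where add: "\<And>x y. P0 (x + y) = P0 x + P0 y" and scale: "\<And>c x. P0 (c *\<^sub>C x) = c *\<^sub>C P0 x"
    and K: "\<And>x. norm (P0 x) \<le> K * norm x" and nonneg: "\<And>x. cinner (P0 x) x \<in> nonneg_Reals"
    and sq0: "\<And>x y. cinner (P0 (P0 x)) y = cinner (T x) (T y)"
    by (auto simp: is_abs_on_def bounded_op_on_def)
  \<comment> \<open>The definition provides the absolute value as a mere function; linearity, the
    bound and nonnegativity of its form turn it into a positive bounded operator.\<close>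
  have "bounded_linear P0"
    using add scale[of "of_real _"] K
    by (intro bounded_linear_intro[of _ K]) (auto simp: scaleC_of_real mult.commute)
  define P where "P = Blinfun P0"
  have P_apply: "blinfun_apply P = P0"
    unfolding P_def by (rule bounded_linear_Blinfun_apply[OF \<open>bounded_linear P0\<close>])
  have "is_adjoint P P"
    unfolding is_adjoint_def P_apply using hermitian_if_nonneg[of P0, OF add scale nonneg] by blast
  then have P: "positive_blinfun P"
    unfolding positive_blinfun_def P_apply using nonneg by blast
  have sq: "P (P x) = T' (T x)" for x
    unfolding P_apply
    by (rule cinner_ext) (simp add: sq0 is_adjointD[OF is_adjoint_sym[OF adj]])
  have sum: "(\<lambda>e. Re (cinner (P e) e)) summable_on B"
    unfolding P_apply using sum0 by (rule summable_on_Re)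
  define \<tau> where "\<tau> = (\<Sum>\<^sub>\<infinity>e\<in>B. Re (cinner (P e) e))"
  have "trace_bounded T \<tau>"
    unfolding trace_bounded_def
  proof (intro allI impI)
    fix I :: "'a set" and u v :: "'a \<Rightarrow> 'a"
    assume fin: "finite I" and u: "bessel_family I u" and v: "bessel_family I v"
    show "(\<Sum>i\<in>I. cmod (cinner (T (u i)) (v i))) \<le> \<tau>"
    proof (rule field_le_epsilon)
      fix \<eta> :: real assume \<eta>: "\<eta> > 0"
      define \<epsilon> where "\<epsilon> = \<eta> / (real (card I) + 1)"
      have \<epsilon>: "\<epsilon> > 0" using \<eta> by (simp add: \<epsilon>_def add_nonneg_pos)
      obtain K K' R where KK: "is_adjoint K K'" "\<And>x. norm (blinfun_apply K x) \<le> norm x"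
        "\<And>x. norm (blinfun_apply R x) \<le> norm x" "\<And>x. T x = K (P x) + \<epsilon> *\<^sub>R K x"
        "\<And>x. P x = T' (K x) + \<epsilon> *\<^sub>R R x"
        by (rule regularized_polar[OF P adj sq \<epsilon>]) (rule that)
      have K'le: "norm (K' x) \<le> norm x" for x
        using norm_adjoint_le[OF KK(1), of 1] KK(2) by simp
      have v': "bessel_family I (\<lambda>i. K' (v i))"
        by (rule bessel_family_compose[OF is_adjoint_sym[OF KK(1)] K'le v])
      have "cmod (cinner (T (u i)) (v i))
          \<le> (Re (cinner (P (u i)) (u i)) + Re (cinner (P (K' (v i))) (K' (v i)))) / 2 + \<epsilon>" if i: "i \<in> I" for i
      proof -
        have nu: "norm (u i) \<le> 1" and nv: "norm (v i) \<le> 1"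
          by (rule bessel_family_norm_le_1[OF u fin i] bessel_family_norm_le_1[OF v fin i])+
        have "cinner (T (u i)) (v i) = cinner (P (u i)) (K' (v i)) + \<epsilon> *\<^sub>R cinner (K (u i)) (v i)"
          unfolding KK(4)[of "u i"] cinner_add_left cinner_scaleR_left
          by (simp only: is_adjointD[OF KK(1), of "P (u i)"])
        then have "cmod (cinner (T (u i)) (v i))
            \<le> cmod (cinner (P (u i)) (K' (v i))) + \<epsilon> * cmod (cinner (K (u i)) (v i))"
          using norm_triangle_ineq[of "cinner (P (u i)) (K' (v i))" "\<epsilon> *\<^sub>R cinner (K (u i)) (v i)"] \<epsilon>
          by simp
        also have "cmod (cinner (K (u i)) (v i)) \<le> 1 * 1"
          using norm_cinner_le[of "K (u i)" "v i"] KK(2)[of "u i"] nu nv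
            mult_mono[of "norm (K (u i))" 1 "norm (v i)" 1] by simp
        \<comment> \<open>Cauchy-Schwarz for the form of \<open>P\<close>, then the inequality of
          geometric and arithmetic mean.\<close>
        also have "cmod (cinner (P (u i)) (K' (v i)))
            \<le> (Re (cinner (P (u i)) (u i)) + Re (cinner (P (K' (v i))) (K' (v i)))) / 2"
        proof (rule power2_le_imp_le)
          let ?a = "Re (cinner (P (u i)) (u i))" and ?b = "Re (cinner (P (K' (v i))) (K' (v i)))"
          have "(cmod (cinner (P (u i)) (K' (v i))))\<^sup>2 \<le> ?a * ?b"
            by (rule cauchy_schwarz_positive[OF P])
          also have "\<dots> \<le> ((?a + ?b) / 2)\<^sup>2"
            using zero_le_power2[of "?a - ?b"] by (simp add: power2_eq_square field_simps)
          finally show "(cmod (cinner (P (u i)) (K' (v i))))\<^sup>2 \<le> ((?a + ?b) / 2)\<^sup>2" .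
          show "0 \<le> (?a + ?b) / 2"
            using positive_blinfun_Re[OF P, of "u i"] positive_blinfun_Re[OF P, of "K' (v i)"] by simp
        qed
        finally show ?thesis using \<epsilon> by simp
      qed
      then have "(\<Sum>i\<in>I. cmod (cinner (T (u i)) (v i)))
          \<le> (\<Sum>i\<in>I. (Re (cinner (P (u i)) (u i)) + Re (cinner (P (K' (v i))) (K' (v i)))) / 2 + \<epsilon>)"
        by (rule sum_mono)
      also have "\<dots> = ((\<Sum>i\<in>I. Re (cinner (P (u i)) (u i)))
          + (\<Sum>i\<in>I. Re (cinner (P (K' (v i))) (K' (v i))))) / 2 + real (card I) * \<epsilon>"
        by (simp add: sum.distrib sum_divide_distrib[symmetric])
      also have "\<dots> \<le> (\<tau> + \<tau>) / 2 + \<eta>"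
      proof -
        have "real (card I) * \<epsilon> \<le> \<eta>" using \<eta> by (simp add: \<epsilon>_def field_simps)
        then show ?thesis
          using positive_bessel_sum_le[OF P onb sum fin u] positive_bessel_sum_le[OF P onb sum fin v']
          unfolding \<tau>_def[symmetric] by argo
      qed
      finally show "(\<Sum>i\<in>I. cmod (cinner (T (u i)) (v i))) \<le> \<tau> + \<eta>" by simp
    qed
  qed
  then show ?thesis ..
qed

text \<open>The diagonal entries of the absolute value are, up to \<open>\<epsilon>\<close>, the
  entries of \<open>T\<close> at the pairs \<open>e\<close>, \<open>K e\<close>, and the vectors
  \<open>K e\<close> again form a Bessel family because \<open>K\<close> is a contraction.\<close>

lemma trace_bounded_imp_trace_class:
  fixes T :: "'a::complex_hilbert \<Rightarrow>\<^sub>L 'a"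
  assumes T: "trace_bounded T C" and adj: "is_adjoint T T'"
  shows "trace_class T"
proof -
  have bounded: "bounded_op_on UNIV (blinfun_apply X)" if "is_adjoint X Y" for X Y :: "'a \<Rightarrow>\<^sub>L 'a"
    using norm_blinfun[of X]
    by (auto simp: bounded_op_on_def blinfun.add_right is_adjoint_apply_scaleC[OF that])
  have "positive_blinfun (T' o\<^sub>L T)"
  proof (rule positive_blinfunI)
    show "is_adjoint (T' o\<^sub>L T) (T' o\<^sub>L T)" by (rule is_adjoint_compose[OF is_adjoint_sym[OF adj] adj])
    show "0 \<le> Re (cinner ((T' o\<^sub>L T) x) x)" for x
      by (simp add: is_adjointD[OF is_adjoint_sym[OF adj]] cinner_self)
  qed
  then obtain P where P: "positive_blinfun P" "P o\<^sub>L P = T' o\<^sub>L T" using positive_sqrt_exists by blast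
  have sq: "P (P x) = T' (T x)" for x
    using arg_cong[OF P(2), of "\<lambda>X. blinfun_apply X x"] by simp
  have "is_abs_on UNIV (blinfun_apply T) (blinfun_apply P)"
    unfolding is_abs_on_def
    using P(1) bounded[of P P] by (auto simp: positive_blinfun_def sq is_adjointD[OF is_adjoint_sym[OF adj]])
  moreover define B where "B = some_onb (UNIV :: 'a set)"
  have onb: "onb_on UNIV B" unfolding B_def by (rule onb_on_some_onb)
  moreover have "(\<lambda>e. cinner (P e) e) summable_on B"
  proof -
    have bound: "(\<Sum>e\<in>F. Re (cinner (P e) e)) \<le> C" if F: "F \<subseteq> B" "finite F" for F
    proof (rule field_le_epsilon)
      fix \<eta> :: real assume \<eta>: "\<eta> > 0"
      define \<epsilon> where "\<epsilon> = \<eta> / (real (card F) + 1)"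
      have \<epsilon>: "\<epsilon> > 0" using \<eta> by (simp add: \<epsilon>_def add_nonneg_pos)
      obtain K K' R where KK: "is_adjoint K K'" "\<And>x. norm (blinfun_apply K x) \<le> norm x"
        "\<And>x. norm (blinfun_apply R x) \<le> norm x" "\<And>x. T x = K (P x) + \<epsilon> *\<^sub>R K x"
        "\<And>x. P x = T' (K x) + \<epsilon> *\<^sub>R R x"
        by (rule regularized_polar[OF P(1) adj sq \<epsilon>]) (rule that)
      have F': "bessel_family F (\<lambda>e. e)" "\<And>e. e \<in> F \<Longrightarrow> norm e = 1"
        using onb F bessel_orthonormal[of F] orthonormal_subset[of B F]
        by (auto simp: onb_on_UNIV_iff orthonormal_def)
      have "Re (cinner (P e) e) \<le> cmod (cinner (T e) (K e)) + \<epsilon>" if "e \<in> F" for e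
      proof -
        have "cinner (P e) e = cinner (K e) (T e) + \<epsilon> *\<^sub>R cinner (R e) e"
          unfolding KK(5)[of e] cinner_add_left cinner_scaleR_left
          by (simp only: is_adjointD[OF is_adjoint_sym[OF adj]])
        then have "Re (cinner (P e) e) \<le> cmod (cinner (K e) (T e)) + \<epsilon> * cmod (cinner (R e) e)"
          using complex_Re_le_cmod[of "cinner (K e) (T e)"] complex_Re_le_cmod[of "cinner (R e) e"] \<epsilon>
          by (simp add: add_mono)
        also have "cmod (cinner (K e) (T e)) = cmod (cinner (T e) (K e))"
          by (subst cinner_commute) simp
        also have "cmod (cinner (R e) e) \<le> 1"
          using norm_cinner_le[of "R e" e] KK(3)[of e] F'(2)[OF that] by simp
        finally show ?thesis using \<epsilon> by simp
      qed
      then have "(\<Sum>e\<in>F. Re (cinner (P e) e)) \<le> (\<Sum>e\<in>F. cmod (cinner (T e) (K e)) + \<epsilon>)"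
        by (rule sum_mono)
      also have "\<dots> = (\<Sum>e\<in>F. cmod (cinner (T e) (K e))) + real (card F) * \<epsilon>"
        by (simp add: sum.distrib)
      also have "\<dots> \<le> C + \<eta>"
      proof (rule add_mono)
        show "(\<Sum>e\<in>F. cmod (cinner (T e) (K e))) \<le> C"
          by (rule trace_boundedD[OF T F(2) F'(1) bessel_family_compose[OF KK(1,2) F'(1)]])
        show "real (card F) * \<epsilon> \<le> \<eta>" using \<eta> by (simp add: \<epsilon>_def field_simps)
      qed
      finally show "(\<Sum>e\<in>F. Re (cinner (P e) e)) \<le> C + \<eta>" .
    qed
    have "(\<lambda>e. Re (cinner (P e) e)) summable_on B"
      using bound positive_blinfun_Re[OF P(1)]
      by (intro nonneg_bounded_partial_sums_imp_summable_on[where C = C] eventually_finite_subsets_at_top_weakI) auto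
    then have "(\<lambda>e. of_real (Re (cinner (P e) e)) :: complex) summable_on B"
      by (rule summable_on_of_real)
    then show ?thesis using positive_blinfun_of_real[OF P(1)] by simp
  qed
  ultimately show ?thesis
    unfolding trace_class_on_def using bounded[OF adj] by blast
qed

section \<open>Resolvents and traces of contour integrals\<close>

lemma positive_operator_symmetric:
  assumes cl: "closed_operator A" and pos: "positive_operator A"
    and xy: "(x, y) \<in> A" and xy': "(x', y') \<in> A"
  shows "cinner y x' = cinner x y'"
proof -
  have add: "(x + x', y + y') \<in> A" using cl xy xy' by (auto simp: closed_operator_def)
  have "(\<i> *\<^sub>C x', \<i> *\<^sub>C y') \<in> A" using cl xy' by (auto simp: closed_operator_def)
  then have addi: "(x + \<i> *\<^sub>C x', y + \<i> *\<^sub>C y') \<in> A"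
    using cl xy by (auto simp: closed_operator_def)
  have real: "Im (cinner v u) = 0" if "(u, v) \<in> A" for u v
    using pos that by (auto simp: positive_operator_def nonneg_Reals_iff)
  have "cinner y' x = cnj (cinner y x')"
  proof (rule hermitian_from_real_values)
    show "Im (cinner y x' + cinner y' x) = 0"
      using real[OF add] real[OF xy] real[OF xy'] by (simp add: cinner_add_left cinner_add_right)
    show "Im (- \<i> * cinner y x' + \<i> * cinner y' x) = 0"
      using real[OF addi] real[OF xy] real[OF xy']
      by (simp add: cinner_add_left cinner_add_right cinner_scaleC_left cinner_scaleC_right)
  qed
  then show ?thesis using cinner_commute[of x y'] by simp
qed

lemma is_resolventE:
  assumes "is_resolvent A z R"
  obtains y where "(R u, y) \<in> A" "y - z *\<^sub>C R u = u"
proof -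
  have "\<exists>y. (R u, y) \<in> A \<and> y - z *\<^sub>C R u = u" using assms unfolding is_resolvent_def by (elim conjE allE)
  then show thesis using that by (elim exE conjE)
qed

lemma is_resolvent_unique:
  assumes "is_resolvent A z R" "is_resolvent A z R'"
  shows "R = R'"
proof (rule blinfun_eqI)
  fix u
  obtain y where y: "(R u, y) \<in> A" "y - z *\<^sub>C R u = u" using is_resolventE[OF assms(1)] .
  have "R' (y - z *\<^sub>C R u) = R u" using assms(2) y(1) unfolding is_resolvent_def by blast
  then show "R u = R' u" by (simp add: y(2))
qed

lemma is_resolvent_resolvent:
  assumes "\<exists>R. is_resolvent A z R"
  shows "is_resolvent A z (resolvent A z)"
proof -
  obtain R where R: "is_resolvent A z R" using assms by blast
  show ?thesis
    unfolding resolvent_def by (rule theI[of _ R]) (use R is_resolvent_unique in auto)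
qed

lemma is_resolvent_cancel: "is_resolvent A z R \<Longrightarrow> (x, y) \<in> A \<Longrightarrow> R (y - z *\<^sub>C x) = x"
  unfolding is_resolvent_def by meson

text \<open>Positivity enters the proof here: it makes \<open>A\<close> symmetric, and moving
  \<open>A\<close> across the inner product replaces \<open>z\<close> by its conjugate.\<close>

lemma is_adjoint_resolvent:
  assumes cl: "closed_operator A" and pos: "positive_operator A"
    and R: "is_resolvent A z R" and R': "is_resolvent A (cnj z) R'"
  shows "is_adjoint R R'"
  unfolding is_adjoint_def
proof (intro allI)
  fix u v
  obtain y where y: "(R u, y) \<in> A" "y - z *\<^sub>C R u = u" using is_resolventE[OF R] .
  obtain y' where y': "(R' v, y') \<in> A" "y' - cnj z *\<^sub>C R' v = v" using is_resolventE[OF R'] .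
  have "cinner (R u) v = cinner (R u) (y' - cnj z *\<^sub>C R' v)" by (simp only: y'(2))
  also have "\<dots> = cinner (y - z *\<^sub>C R u) (R' v)"
    using positive_operator_symmetric[OF cl pos y(1) y'(1)]
    by (simp add: cinner_diff_left cinner_diff_right cinner_scaleC_left cinner_scaleC_right)
  finally show "cinner (R u) v = cinner u (R' v)" by (simp only: y(2))
qed

lemma resolvent_identity_right:
  assumes "is_resolvent A 0 R0" "is_resolvent A z R"
  shows "R u = R0 (u + z *\<^sub>C R u)"
proof -
  obtain y where y: "(R u, y) \<in> A" "y - z *\<^sub>C R u = u" using is_resolventE[OF assms(2)] .
  have "R0 (y - 0 *\<^sub>C R u) = R u" by (rule is_resolvent_cancel[OF assms(1) y(1)])
  moreover have "y = u + z *\<^sub>C R u" using y(2) by (simp add: algebra_simps)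
  ultimately show ?thesis by simp
qed

text \<open>The adjoint provides the complex linearity that pulls the scalar \<open>z\<close> out of
  \<open>R\<close>.\<close>

lemma resolvent_identity_left:
  assumes "is_resolvent A 0 R0" "is_resolvent A z R" "is_adjoint R R'"
  shows "R u = R0 u + z *\<^sub>C R (R0 u)"
proof -
  obtain y where y: "(R0 u, y) \<in> A" "y - 0 *\<^sub>C R0 u = u" using is_resolventE[OF assms(1)] .
  have "R (y - z *\<^sub>C R0 u) = R0 u" by (rule is_resolvent_cancel[OF assms(2) y(1)])
  moreover have "y = u" using y(2) by simp
  ultimately have "R u - z *\<^sub>C R (R0 u) = R0 u"
    by (simp add: blinfun.diff_right is_adjoint_apply_scaleC[OF assms(3)])
  then show ?thesis by (simp add: algebra_simps)
qed

lemma resolvent_difference_factorization: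
  assumes A: "is_resolvent A 0 R0" "is_resolvent A z R" "is_adjoint R R'"
    and B: "is_resolvent B 0 S0" "is_resolvent B z S"
  shows "R - S = (id_blinfun + scaleC_op z R) o\<^sub>L (R0 - S0) o\<^sub>L (id_blinfun + scaleC_op z S)"
proof (rule blinfun_eqI)
  fix u
  define v where "v = u + z *\<^sub>C S u"
  have "R v = R0 v + z *\<^sub>C R (R0 v)" by (rule resolvent_identity_left[OF A])
  moreover have "S u = S0 v" unfolding v_def by (rule resolvent_identity_right[OF B])
  moreover have "R v = R u + z *\<^sub>C R (S u)"
    by (simp add: v_def blinfun.add_right is_adjoint_apply_scaleC[OF A(3)])
  ultimately have "(R0 v - S0 v) + z *\<^sub>C R (R0 v - S0 v) = R u - S u"
    by (simp add: blinfun.diff_right scaleC_diff_right algebra_simps)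
  then show "(R - S) u = ((id_blinfun + scaleC_op z R) o\<^sub>L (R0 - S0) o\<^sub>L (id_blinfun + scaleC_op z S)) u"
    by (simp add: blinfun.add_left blinfun.diff_left scaleC_op.rep_eq v_def[symmetric])
qed

section \<open>Traces of operator-valued integrals\<close>

lemma bounded_linear_matrix_element:
  "bounded_linear (\<lambda>X. cinner (blinfun_apply X u) v)"
  by (intro bounded_linear_compose[OF cinner.bounded_linear_left] blinfun.bounded_linear_left)

lemma matrix_element_integral:
  assumes "F integrable_on S"
  shows "(\<lambda>x. cinner (blinfun_apply (F x) u) v) integrable_on S"
    and "cinner (blinfun_apply (integral S F) u) v = integral S (\<lambda>x. cinner (blinfun_apply (F x) u) v)"
  using integrable_linear[OF assms bounded_linear_matrix_element[of u v]]
    integral_linear[OF assms bounded_linear_matrix_element[of u v]]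
  by (simp_all add: o_def)

lemma is_adjoint_integral:
  fixes F G :: "real \<Rightarrow> ('a::complex_hilbert \<Rightarrow>\<^sub>L 'a)"
  assumes F: "F integrable_on S" and G: "G integrable_on S"
    and adj: "\<And>x. x \<in> S \<Longrightarrow> is_adjoint (F x) (G x)"
  shows "is_adjoint (integral S F) (integral S G)"
  unfolding is_adjoint_def
proof (intro allI)
  fix u v
  have "cinner (integral S F u) v = integral S (\<lambda>x. cinner (F x u) v)"
    by (rule matrix_element_integral[OF F])
  also have "\<dots> = integral S (\<lambda>x. cnj (cinner (G x v) u))"
  proof (rule integral_cong)
    fix x assume "x \<in> S"
    then have "cinner (F x u) v = cinner u (G x v)" by (rule is_adjointD[OF adj])
    then show "cinner (F x u) v = cnj (cinner (G x v) u)" using cinner_commute[of u "G x v"] by simp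
  qed
  also have "\<dots> = cnj (integral S (\<lambda>x. cinner (G x v) u))" by (rule integral_cnj[symmetric])
  also have "\<dots> = cnj (cinner (integral S G v) u)" by (simp only: matrix_element_integral(2)[OF G])
  also have "\<dots> = cinner u (integral S G v)" by (rule cinner_commute[symmetric])
  finally show "cinner (integral S F u) v = cinner u (integral S G v)" .
qed

lemma trace_bounded_integral:
  fixes F :: "real \<Rightarrow> ('a::complex_hilbert \<Rightarrow>\<^sub>L 'a)"
  assumes F: "F integrable_on S" and tb: "\<And>x. x \<in> S \<Longrightarrow> trace_bounded (F x) (g x)"
    and g: "g integrable_on S"
  shows "trace_bounded (integral S F) (integral S g)"
  unfolding trace_bounded_def
proof (intro allI impI)
  fix I :: "'a set" and u v :: "'a \<Rightarrow> 'a"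
  assume fin: "finite I" and u: "bessel_family I u" and v: "bessel_family I v"
  \<comment> \<open>These phases turn the sum of moduli into a linear expression in the integral.
    The pointwise bound then applies to one integrand, without absolute integrability of the
    separate entries.\<close>
  define c where "c i = cnj (sgn (cinner (integral S F (u i)) (v i)))" for i
  have c: "c i * cinner (integral S F (u i)) (v i) = of_real (cmod (cinner (integral S F (u i)) (v i)))" for i
  proof (cases "cinner (integral S F (u i)) (v i) = 0")
    case False
    then show ?thesis
      using complex_norm_square[of "cinner (integral S F (u i)) (v i)"]
      by (simp add: c_def sgn_eq power2_eq_square field_simps)
  qed simp
  have c1: "cmod (c i) \<le> 1" for i by (simp add: c_def norm_sgn)
  have int: "(\<lambda>x. c i * cinner (F x (u i)) (v i)) integrable_on S" for i
    by (rule integrable_on_mult_right[OF matrix_element_integral(1)[OF F]])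
  have "of_real (\<Sum>i\<in>I. cmod (cinner (integral S F (u i)) (v i)))
      = (\<Sum>i\<in>I. c i * cinner (integral S F (u i)) (v i))" by (simp add: c)
  also have "\<dots> = (\<Sum>i\<in>I. integral S (\<lambda>x. c i * cinner (F x (u i)) (v i)))"
    by (simp add: matrix_element_integral(2)[OF F])
  also have "\<dots> = integral S (\<lambda>x. \<Sum>i\<in>I. c i * cinner (F x (u i)) (v i))"
    by (rule integral_sum[symmetric, OF fin int])
  finally have eq: "of_real (\<Sum>i\<in>I. cmod (cinner (integral S F (u i)) (v i)))
      = integral S (\<lambda>x. \<Sum>i\<in>I. c i * cinner (F x (u i)) (v i))" .
  have "norm (integral S (\<lambda>x. \<Sum>i\<in>I. c i * cinner (F x (u i)) (v i))) \<le> integral S g"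
  proof (rule integral_norm_bound_integral[OF integrable_sum[OF fin int] g])
    fix x assume x: "x \<in> S"
    have "cmod (\<Sum>i\<in>I. c i * cinner (F x (u i)) (v i)) \<le> (\<Sum>i\<in>I. cmod (c i * cinner (F x (u i)) (v i)))"
      by (rule norm_sum)
    also have "\<dots> \<le> (\<Sum>i\<in>I. cmod (cinner (F x (u i)) (v i)))"
      using c1 by (intro sum_mono) (simp add: norm_mult mult_left_le_one_le)
    also have "\<dots> \<le> g x" by (rule trace_boundedD[OF tb[OF x] fin u v])
    finally show "cmod (\<Sum>i\<in>I. c i * cinner (F x (u i)) (v i)) \<le> g x" .
  qed
  also have "norm (integral S (\<lambda>x. \<Sum>i\<in>I. c i * cinner (F x (u i)) (v i)))
      = \<bar>\<Sum>i\<in>I. cmod (cinner (integral S F (u i)) (v i))\<bar>"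
    unfolding eq[symmetric] by (rule norm_of_real)
  finally show "(\<Sum>i\<in>I. cmod (cinner (integral S F (u i)) (v i))) \<le> integral S g" by linarith
qed

lemma trace_bounded_add:
  "trace_bounded X C \<Longrightarrow> trace_bounded Y D \<Longrightarrow> trace_bounded (X + Y) (C + D)"
  unfolding trace_bounded_def
proof (intro allI impI)
  fix I :: "'a set" and u v :: "'a \<Rightarrow> 'a"
  assume X: "\<forall>(I::'a set) u v. finite I \<longrightarrow> bessel_family I u \<longrightarrow> bessel_family I v \<longrightarrow> (\<Sum>i\<in>I. cmod (cinner (X (u i)) (v i))) \<le> C"
    and Y: "\<forall>(I::'a set) u v. finite I \<longrightarrow> bessel_family I u \<longrightarrow> bessel_family I v \<longrightarrow> (\<Sum>i\<in>I. cmod (cinner (Y (u i)) (v i))) \<le> D"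
    and I: "finite I" "bessel_family I u" "bessel_family I v"
  have "(\<Sum>i\<in>I. cmod (cinner ((X + Y) (u i)) (v i)))
      \<le> (\<Sum>i\<in>I. cmod (cinner (X (u i)) (v i)) + cmod (cinner (Y (u i)) (v i)))"
    by (intro sum_mono) (simp add: blinfun.add_left cinner_add_left norm_triangle_ineq)
  also have "\<dots> \<le> C + D"
    unfolding sum.distrib by (rule add_mono) (rule X[rule_format, OF I] Y[rule_format, OF I])+
  finally show "(\<Sum>i\<in>I. cmod (cinner ((X + Y) (u i)) (v i))) \<le> C + D" .
qed

lemma trace_bounded_scaleC_op:
  assumes "trace_bounded X C"
  shows "trace_bounded (scaleC_op c X) (cmod c * C)"
  unfolding trace_bounded_def
proof (intro allI impI)
  fix I :: "'a set" and u v :: "'a \<Rightarrow> 'a"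
  assume I: "finite I" "bessel_family I u" "bessel_family I v"
  show "(\<Sum>i\<in>I. cmod (cinner (scaleC_op c X (u i)) (v i))) \<le> cmod c * C"
    using mult_left_mono[OF trace_boundedD[OF assms I], of "cmod c"]
    by (simp add: scaleC_op.rep_eq cinner_scaleC_left norm_mult sum_distrib_left)
qed

lemma trace_bounded_onb_sum:
  fixes X :: "'a::complex_hilbert \<Rightarrow>\<^sub>L 'a"
  assumes "trace_bounded X C" "F \<subseteq> some_onb UNIV" "finite F"
  shows "(\<Sum>e\<in>F. cmod (cinner (X e) e)) \<le> C"
proof -
  have "orthonormal (some_onb UNIV :: 'a set)" using onb_on_some_onb unfolding onb_on_UNIV_iff by (rule conjunct1)
  from orthonormal_subset[OF this assms(2)]  have "bessel_family F (\<lambda>e. e)"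
    using assms(3) by (rule bessel_orthonormal)
  then show ?thesis using trace_boundedD[OF assms(1,3)] by simp
qed

lemma trace_bounded_summable:
  assumes "trace_bounded X C"
  shows "(\<lambda>e. norm (cinner (X e) e)) summable_on some_onb UNIV"
  unfolding Infinite_Sum.abs_summable_iff_bdd_above
  using trace_bounded_onb_sum[OF assms] by (auto intro!: bdd_aboveI[of _ C])

lemma norm_Tr_le:
  assumes "trace_bounded X C"
  shows "cmod (Tr X) \<le> C"
proof -
  have "cmod (Tr X) \<le> (\<Sum>\<^sub>\<infinity>e\<in>some_onb UNIV. cmod (cinner (X e) e))"
    unfolding trace_on_def by (rule norm_infsum_bound[OF trace_bounded_summable[OF assms]])
  also have "\<dots> \<le> C"
    by (rule infsum_le_finite_sums[OF trace_bounded_summable[OF assms]])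
       (rule trace_bounded_onb_sum[OF assms])
  finally show ?thesis .
qed

lemma Tr_add:
  assumes "trace_bounded X C" "trace_bounded Y D"
  shows "Tr (X + Y) = Tr X + Tr Y"
  unfolding trace_on_def blinfun.add_left cinner_add_left
  by (rule infsum_add[OF abs_summable_summable[OF trace_bounded_summable[OF assms(1)]]
      abs_summable_summable[OF trace_bounded_summable[OF assms(2)]]])

lemma Tr_scaleC_op: "Tr (scaleC_op c X) = c * Tr X"
  unfolding trace_on_def scaleC_op.rep_eq cinner_scaleC_left by (rule infsum_cmult_right')

text \<open>The orthonormal basis may be uncountable. Since \<open>F\<close> is continuous, all diagonal entries
  vanish identically outside a countable part of it, for which dominated convergence is available.\<close>

lemma Tr_integral:
  fixes F :: "real \<Rightarrow> ('a::complex_hilbert \<Rightarrow>\<^sub>L 'a)"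
  assumes cont: "continuous_on S F" and F: "F integrable_on S"
    and tb: "\<And>x. x \<in> S \<Longrightarrow> trace_bounded (F x) (g x)" and g: "g integrable_on S"
  shows "(\<lambda>x. Tr (F x)) integrable_on S \<and> Tr (integral S F) = integral S (\<lambda>x. Tr (F x))"
proof -
  define B where "B = some_onb (UNIV :: 'a set)"
  \<comment> \<open>A countable dense set of parameters. At each of them only countably many
    diagonal entries are nonzero, and continuity extends the vanishing of the others to all of
    \<open>S\<close>.\<close>
  obtain T where T: "countable T" "T \<subseteq> S" "S \<subseteq> closure T" by (rule separable)
  define E where "E = (\<Union>x\<in>T. {e\<in>B. cinner (F x e) e \<noteq> 0})"
  have "countable E"
    unfolding E_def B_def using T
    by (intro countable_UN abs_summable_countable trace_bounded_summable[OF tb]) auto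
  have EB: "E \<subseteq> B" by (auto simp: E_def)
  have zero: "cinner (F x e) e = 0" if x: "x \<in> S" and e: "e \<in> B - E" for x e
  proof -
    have cont_e: "continuous_on S (\<lambda>x. cinner (F x e) e)"
      by (rule bounded_linear.continuous_on[OF bounded_linear_matrix_element cont])
    have 0: "cinner (F y e) e = 0" if "y \<in> T" for y
      using that e by (auto simp: E_def)
    from x T(3) have "x \<in> closure T" by auto
    then obtain t where t: "\<And>n. t n \<in> T" "t \<longlonglongrightarrow> x" unfolding closure_sequential by blast
    have "(\<lambda>n. cinner (F (t n) e) e) \<longlonglongrightarrow> cinner (F x e) e"
      using continuous_on_tendsto_compose[OF cont_e t(2) x] t(1) T(2) by (simp add: subset_iff)
    then show ?thesis using 0[OF t(1)] by (simp add: LIMSEQ_const_iff)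
  qed
  have zero': "cinner (integral S F e) e = 0" if "e \<in> B - E" for e
  proof -
    have "integral S (\<lambda>x. cinner (F x e) e) = integral S (\<lambda>x. 0)"
      using zero that by (intro integral_cong) auto
    then show ?thesis by (simp add: matrix_element_integral(2)[OF F])
  qed
  have TrE: "Tr (F x) = (\<Sum>\<^sub>\<infinity>e\<in>E. cinner (F x e) e)" if "x \<in> S" for x
    unfolding trace_on_def B_def[symmetric]
    using EB zero[OF that] by (intro infsum_cong_neutral) auto
  have TrE': "Tr (integral S F) = (\<Sum>\<^sub>\<infinity>e\<in>E. cinner (integral S F e) e)"
    unfolding trace_on_def B_def[symmetric]
    using EB zero' by (intro infsum_cong_neutral) auto
  \<comment> \<open>Dominated convergence works along sequences, so \<open>E\<close> is exhausted by
    initial segments of an enumeration, which exists only for nonempty \<open>E\<close>.\<close>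
  define Fn where "Fn n = (if E = {} then {} else from_nat_into E ` {..<n})" for n :: nat
  have fin: "finite (Fn n)" and FnE: "Fn n \<subseteq> E" for n
    using from_nat_into[of E] by (auto simp: Fn_def)
  have lim: "filterlim Fn (finite_subsets_at_top E) sequentially"
    unfolding filterlim_finite_subsets_at_top
  proof (intro allI impI)
    fix X assume X: "finite X \<and> X \<subseteq> E"
    show "\<forall>\<^sub>F n in sequentially. finite (Fn n) \<and> X \<subseteq> Fn n \<and> Fn n \<subseteq> E"
    proof (cases "E = {}")
      case True
      then show ?thesis using X by (auto simp: Fn_def)
    next
      case False
      define N where "N = Suc (Max (insert 0 (to_nat_on E ` X)))"
      have "X \<subseteq> Fn n" if "n \<ge> N" for n
      proof
        fix e assume e: "e \<in> X"
        have "to_nat_on E e \<le> Max (insert 0 (to_nat_on E ` X))" using X e by (intro Max_ge) auto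
        then have "to_nat_on E e < n" using that by (simp add: N_def)
        moreover have "from_nat_into E (to_nat_on E e) = e"
          using e X by (intro from_nat_into_to_nat_on[OF \<open>countable E\<close>]) auto
        ultimately show "e \<in> Fn n" using False unfolding Fn_def by (metis imageI lessThan_iff)
      qed
      then show ?thesis
        using fin FnE by (intro eventually_sequentiallyI[of N]) simp
    qed
  qed
  have conv: "(\<lambda>n. \<Sum>e\<in>Fn n. cinner (X e) e) \<longlonglongrightarrow> (\<Sum>\<^sub>\<infinity>e\<in>E. cinner (X e) e)"
    if "trace_bounded X C" for X C
  proof -
    have "(\<lambda>e. cinner (X e) e) summable_on E"
      using EB unfolding B_def
      by (rule summable_on_subset_banach[OF abs_summable_summable[OF trace_bounded_summable[OF that]]])
    then have "(sum (\<lambda>e. cinner (X e) e) \<longlongrightarrow> (\<Sum>\<^sub>\<infinity>e\<in>E. cinner (X e) e)) (finite_subsets_at_top E)"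
      by (rule has_sum_infsum[unfolded has_sum_def])
    then show ?thesis using lim by (rule filterlim_compose)
  qed
  have int: "(\<lambda>x. \<Sum>e\<in>Fn n. cinner (F x e) e) integrable_on S" for n
    by (intro integrable_sum fin matrix_element_integral(1)[OF F])
  have bound: "norm (\<Sum>e\<in>Fn n. cinner (F x e) e) \<le> g x" if "x \<in> S" for n x
  proof -
    have "norm (\<Sum>e\<in>Fn n. cinner (F x e) e) \<le> (\<Sum>e\<in>Fn n. cmod (cinner (F x e) e))" by (rule norm_sum)
    also have "\<dots> \<le> g x"
      using FnE EB by (intro trace_bounded_onb_sum[OF tb[OF that]] fin) (auto simp: B_def)
    finally show ?thesis .
  qed
  have limx: "(\<lambda>n. \<Sum>e\<in>Fn n. cinner (F x e) e) \<longlonglongrightarrow> Tr (F x)" if "x \<in> S" for x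
    unfolding TrE[OF that] by (rule conv[OF tb[OF that]])
  note dc = dominated_convergence[of "\<lambda>n x. \<Sum>e\<in>Fn n. cinner (F x e) e" S g "\<lambda>x. Tr (F x)",
      OF int g bound limx]
  have "integral S (\<lambda>x. \<Sum>e\<in>Fn n. cinner (F x e) e) = (\<Sum>e\<in>Fn n. cinner (integral S F e) e)" for n
    by (simp add: integral_sum fin matrix_element_integral[OF F])
  then have "(\<lambda>n. \<Sum>e\<in>Fn n. cinner (integral S F e) e) \<longlonglongrightarrow> integral S (\<lambda>x. Tr (F x))"
    using dc(2) by simp
  moreover have "(\<lambda>n. \<Sum>e\<in>Fn n. cinner (integral S F e) e) \<longlonglongrightarrow> Tr (integral S F)"
    unfolding TrE' by (rule conv[OF trace_bounded_integral[OF F tb g]])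
  ultimately have "Tr (integral S F) = integral S (\<lambda>x. Tr (F x))" by (rule LIMSEQ_unique[rotated])
  then show ?thesis using dc(1) by simp
qed

text \<open>Serves half-lines as well as compact intervals and operator-valued as well as scalar
  functions: on compact pieces continuity suffices, and \<open>g\<close> controls infinity.\<close>

lemma integrable_dominated_on_interval:
  fixes F :: "real \<Rightarrow> 'b::banach"
  assumes S: "is_interval S" "closed S" and cont: "continuous_on S F"
    and le: "\<And>x. x \<in> S \<Longrightarrow> norm (F x) \<le> g x" and g: "g integrable_on S"
  shows "F integrable_on S"
proof (rule integrable_on_all_intervals_integrable_bound[OF _ le g])
  fix c d :: real
  have "is_interval (S \<inter> cbox c d) \<and> compact (S \<inter> cbox c d)"
    using S by (auto intro!: is_interval_Int is_interval_cbox closed_Int_compact)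
  then obtain a b where ab: "S \<inter> cbox c d = cbox a b" using is_interval_compact by blast
  have "F integrable_on cbox a b"
    unfolding ab[symmetric] by (subst ab, rule integrable_continuous)
      (rule continuous_on_subset[OF cont], use ab in auto)
  then show "(\<lambda>x. if x \<in> S then F x else 0) integrable_on cbox c d"
    unfolding integrable_restrict_Int ab .
qed

text \<open>The scalar counterpart of \<open>contour_integral_op\<close>, with the weight absorbed
  in \<open>g\<close>. Modulus and argument remain separate arguments because the two sides of the
  cut carry different values.\<close>

definition ray_arc_integral :: "real \<Rightarrow> real \<Rightarrow> real \<Rightarrow> (real \<Rightarrow> real \<Rightarrow> complex) \<Rightarrow> complex" where
  "ray_arc_integral r a b g =
     - integral {r..} (\<lambda>x. cis a * g x a)
     + integral {0..1} (\<lambda>t. \<i> * of_real (b - a) * rcis r (a + t * (b - a)) * g r (a + t * (b - a)))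
     + integral {r..} (\<lambda>x. cis b * g x b)"

text \<open>What the contour integrals require of the resolvents, with \<open>C\<close> a uniform
  trace-norm bound. \<open>K\<close> is invariant under conjugation because the adjoint of an
  integral runs over the conjugate path.\<close>

locale resolvent_pair =
  fixes R1 R2 :: "complex \<Rightarrow> ('a::complex_hilbert \<Rightarrow>\<^sub>L 'a)" and K :: "complex set" and M C :: real
  assumes cont: "continuous_on K R1" "continuous_on K R2"
    and bound: "\<And>z. z \<in> K \<Longrightarrow> norm (R1 z) \<le> M" "\<And>z. z \<in> K \<Longrightarrow> norm (R2 z) \<le> M"
    and cnj: "\<And>z. z \<in> K \<Longrightarrow> cnj z \<in> K"
    and adj: "\<And>z. z \<in> K \<Longrightarrow> is_adjoint (R1 z) (R1 (cnj z))" "\<And>z. z \<in> K \<Longrightarrow> is_adjoint (R2 z) (R2 (cnj z))"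
    and trace: "\<And>z. z \<in> K \<Longrightarrow> trace_bounded (R1 z - R2 z) C"
begin

lemma piece_integrable:
  assumes S: "is_interval S" "closed S" and k: "continuous_on S k" "(\<lambda>x. cmod (k x)) integrable_on S"
    and p: "continuous_on S p" "p ` S \<subseteq> K" and R: "R = R1 \<or> R = R2"
  shows "(\<lambda>x::real. scaleC_op (k x) (R (p x))) integrable_on S"
proof (rule integrable_dominated_on_interval[OF S])
  have "continuous_on K R" using R cont by auto
  then show "continuous_on S (\<lambda>x. scaleC_op (k x) (R (p x)))"
    using p by (intro scaleC_op.continuous_on k(1) continuous_on_compose2[of K R S p]) auto
  show "(\<lambda>x. cmod (k x) * M) integrable_on S" using k(2) by (rule integrable_on_mult_left)
  show "norm (scaleC_op (k x) (R (p x))) \<le> cmod (k x) * M" if "x \<in> S" for x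
    using that p(2) R bound[of "p x"] by (auto simp: blinfun_norm_scaleC_op intro!: mult_left_mono)
qed

lemma piece_adjoint:
  assumes S: "is_interval S" "closed S" and k: "continuous_on S k" "(\<lambda>x. cmod (k x)) integrable_on S"
    and p: "continuous_on S p" "p ` S \<subseteq> K" and R: "R = R1 \<or> R = R2"
  shows "is_adjoint (integral S (\<lambda>x::real. scaleC_op (k x) (R (p x))))
    (integral S (\<lambda>x. scaleC_op (cnj (k x)) (R (cnj (p x)))))"
proof (rule is_adjoint_integral)
  show "(\<lambda>x. scaleC_op (k x) (R (p x))) integrable_on S" by (rule piece_integrable[OF assms])
  show "(\<lambda>x. scaleC_op (cnj (k x)) (R (cnj (p x)))) integrable_on S"
    using k p cnj
    by (intro piece_integrable[OF S _ _ _ _ R] continuous_on_cnj) auto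
  show "is_adjoint (scaleC_op (k x) (R (p x))) (scaleC_op (cnj (k x)) (R (cnj (p x))))" if "x \<in> S" for x
    using that p(2) R adj[of "p x"] by (auto intro!: is_adjoint_scaleC_op)
qed

lemma piece_trace:
  assumes S: "is_interval S" "closed S" and k: "continuous_on S k" "(\<lambda>x. cmod (k x)) integrable_on S"
    and p: "continuous_on S p" "p ` S \<subseteq> K"
  defines "X \<equiv> integral S (\<lambda>x::real. scaleC_op (k x) (R1 (p x))) - integral S (\<lambda>x. scaleC_op (k x) (R2 (p x)))"
  shows "trace_bounded X (integral S (\<lambda>x. cmod (k x) * C))"
    and "Tr X = integral S (\<lambda>x. k x * Tr (R1 (p x) - R2 (p x)))"
proof -
  define F where "F x = scaleC_op (k x) (R1 (p x) - R2 (p x))" for x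
  have F_eq: "F x = scaleC_op (k x) (R1 (p x)) - scaleC_op (k x) (R2 (p x))" for x
    unfolding F_def by (rule scaleC_op.diff_right)
  note i1 = piece_integrable[OF assms(1-6) disjI1[OF refl]]
  note i2 = piece_integrable[OF assms(1-6) disjI2[OF refl]]
  have F: "F integrable_on S" unfolding F_eq by (rule integrable_diff[OF i1 i2])
  have X: "X = integral S F" unfolding X_def F_eq by (rule integral_diff[OF i1 i2, symmetric])
  have tb: "trace_bounded (F x) (cmod (k x) * C)" if "x \<in> S" for x
    unfolding F_def using that p(2) by (intro trace_bounded_scaleC_op trace) auto
  have g: "(\<lambda>x. cmod (k x) * C) integrable_on S" using k(2) by (rule integrable_on_mult_left)
  have cF: "continuous_on S F"
    unfolding F_def using p
    by (intro scaleC_op.continuous_on k(1) continuous_on_diff continuous_on_compose2[OF cont(1)]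
        continuous_on_compose2[OF cont(2)]) auto
  show "trace_bounded X (integral S (\<lambda>x. cmod (k x) * C))"
    unfolding X by (rule trace_bounded_integral[OF F tb g])
  show "Tr X = integral S (\<lambda>x. k x * Tr (R1 (p x) - R2 (p x)))"
  proof -
    have "Tr X = integral S (\<lambda>x. Tr (F x))" unfolding X using Tr_integral[OF cF F tb g] by (rule conjunct2)
    then show ?thesis by (simp only: F_def Tr_scaleC_op)
  qed
qed

lemma contour_trace:
  fixes c :: complex
  assumes wa: "continuous_on {r..} (\<lambda>x. w x a)" "(\<lambda>x. cmod (w x a)) integrable_on {r..}"
    and wb: "continuous_on {r..} (\<lambda>x. w x b)" "(\<lambda>x. cmod (w x b)) integrable_on {r..}"
    and wr: "continuous_on {0..1} (\<lambda>t. w r (a + t * (b - a)))"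
    and Ka: "\<And>x. x \<ge> r \<Longrightarrow> rcis x a \<in> K" and Kb: "\<And>x. x \<ge> r \<Longrightarrow> rcis x b \<in> K"
    and Kr: "\<And>t. t \<in> {0..1} \<Longrightarrow> rcis r (a + t * (b - a)) \<in> K"
  defines "X \<equiv> scaleC_op c (contour_integral_op r a b w R1) - scaleC_op c (contour_integral_op r a b w R2)"
  shows "trace_class X"
    and "Tr X = c * ray_arc_integral r a b (\<lambda>x \<theta>. w x \<theta> * Tr (R1 (rcis x \<theta>) - R2 (rcis x \<theta>)))"
proof -
  define \<theta> where "\<theta> t = a + t * (b - a)" for t
  define kr where "kr t = \<i> * of_real (b - a) * rcis r (\<theta> t) * w r (\<theta> t)" for t
  define Ia where "Ia R = integral {r..} (\<lambda>x. scaleC_op (cis a * w x a) (R (rcis x a)))"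
    for R :: "complex \<Rightarrow> ('a \<Rightarrow>\<^sub>L 'a)"
  define Ib where "Ib R = integral {r..} (\<lambda>x. scaleC_op (cis b * w x b) (R (rcis x b)))"
    for R :: "complex \<Rightarrow> ('a \<Rightarrow>\<^sub>L 'a)"
  define Ir where "Ir R = integral {0..1} (\<lambda>t. scaleC_op (kr t) (R (rcis r (\<theta> t))))"
    for R :: "complex \<Rightarrow> ('a \<Rightarrow>\<^sub>L 'a)"
  have ray: "is_interval {r..}" "closed {r..}" and seg: "is_interval {0..1::real}" "closed {0..1::real}"
    by (auto simp: is_interval_def)
  have rc: "continuous_on T (\<lambda>x. rcis x d)" for T d by (auto simp: rcis_def intro!: continuous_intros)
  have rth: "continuous_on T (\<lambda>t. rcis r (\<theta> t))" for T
    unfolding rcis_def \<theta>_def cis_conv_exp by (intro continuous_intros)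
  have ckr: "continuous_on {0..1} kr"
    unfolding kr_def using wr by (intro continuous_intros rth) (auto simp: \<theta>_def)
  have ikr: "(\<lambda>t. cmod (kr t)) integrable_on {0..1}"
    by (intro integrable_continuous_interval continuous_on_norm ckr)
  have cka: "continuous_on {r..} (\<lambda>x. cis a * w x a)" and ckb: "continuous_on {r..} (\<lambda>x. cis b * w x b)"
    by (intro continuous_intros wa wb)+
  have ika: "(\<lambda>x. cmod (cis a * w x a)) integrable_on {r..}"
    and ikb: "(\<lambda>x. cmod (cis b * w x b)) integrable_on {r..}"
    using wa(2) wb(2) by (simp_all add: norm_mult)
  have pa: "(\<lambda>x. rcis x a) ` {r..} \<subseteq> K" and pb: "(\<lambda>x. rcis x b) ` {r..} \<subseteq> K"
    and pr: "(\<lambda>t. rcis r (\<theta> t)) ` {0..1} \<subseteq> K"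
    using Ka Kb Kr by (auto simp: \<theta>_def)
  note A = ray cka ika rc pa and B = ray ckb ikb rc pb and D = seg ckr ikr rth pr
  have op: "contour_integral_op r a b w R = - Ia R + Ir R + Ib R" for R :: "complex \<Rightarrow> ('a \<Rightarrow>\<^sub>L 'a)"
    by (simp add: contour_integral_op_def Let_def Ia_def Ib_def Ir_def kr_def \<theta>_def)
  have X: "X = scaleC_op (- c) (Ia R1 - Ia R2) + scaleC_op c (Ir R1 - Ir R2) + scaleC_op c (Ib R1 - Ib R2)"
    unfolding X_def op
    by (simp add: scaleC_op.add_right scaleC_op.diff_right scaleC_op.minus_right scaleC_op.minus_left)
  note ta = trace_bounded_scaleC_op[OF piece_trace(1)[OF A, folded Ia_def], of "- c"]
  note tr = trace_bounded_scaleC_op[OF piece_trace(1)[OF D, folded Ir_def], of c]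
  note tb = trace_bounded_scaleC_op[OF piece_trace(1)[OF B, folded Ib_def], of c]
  note tX = trace_bounded_add[OF trace_bounded_add[OF ta tr] tb, folded X]
  \<comment> \<open>To conclude that \<open>X\<close> is trace class an adjoint must be exhibited;
    it is assembled from the three conjugate pieces.\<close>
  note adjoint_diff = is_adjoint_diff[OF piece_adjoint[OF _ _ _ _ _ _ disjI1[OF refl]]
      piece_adjoint[OF _ _ _ _ _ _ disjI2[OF refl]]]
  note adjoint_X = is_adjoint_add[OF is_adjoint_add[OF
      is_adjoint_scaleC_op[OF adjoint_diff[OF A A], of "- c"]
      is_adjoint_scaleC_op[OF adjoint_diff[OF D D], of c]]
      is_adjoint_scaleC_op[OF adjoint_diff[OF B B], of c], folded Ia_def Ib_def Ir_def, folded X]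
  show "trace_class X" by (rule trace_bounded_imp_trace_class[OF tX adjoint_X])
  have "Tr X = Tr (scaleC_op (- c) (Ia R1 - Ia R2)) + Tr (scaleC_op c (Ir R1 - Ir R2))
      + Tr (scaleC_op c (Ib R1 - Ib R2))"
    unfolding X by (simp only: Tr_add[OF trace_bounded_add[OF ta tr] tb] Tr_add[OF ta tr])
  also have "\<dots> = c * (- Tr (Ia R1 - Ia R2) + Tr (Ir R1 - Ir R2) + Tr (Ib R1 - Ib R2))"
    by (simp add: Tr_scaleC_op algebra_simps)
  also have "- Tr (Ia R1 - Ia R2) + Tr (Ir R1 - Ir R2) + Tr (Ib R1 - Ib R2)
      = ray_arc_integral r a b (\<lambda>x \<theta>. w x \<theta> * Tr (R1 (rcis x \<theta>) - R2 (rcis x \<theta>)))"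
    unfolding ray_arc_integral_def Ia_def Ib_def Ir_def piece_trace(2)[OF A] piece_trace(2)[OF B]
      piece_trace(2)[OF D]
    by (simp add: kr_def \<theta>_def mult.assoc)
  finally show "Tr X = c * ray_arc_integral r a b (\<lambda>x \<theta>. w x \<theta> * Tr (R1 (rcis x \<theta>) - R2 (rcis x \<theta>)))" .
qed

end

section \<open>Sectors around the positive axis\<close>

text \<open>The complement of the open sector of half-angle \<open>m\<close> around the positive
  axis, together with a disc. The cosine replaces the argument, so closedness and invariance under
  conjugation can be read off.\<close>

definition sector_region :: "real \<Rightarrow> real \<Rightarrow> complex set" where
  "sector_region m \<sigma> = {z. Re z \<le> cmod z * cos m} \<union> cball 0 \<sigma>"

lemma closed_sector_region: "closed (sector_region m \<sigma>)"
  unfolding sector_region_def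
  by (intro closed_Un closed_cball closed_Collect_le continuous_intros)

lemma cnj_sector_region: "z \<in> sector_region m \<sigma> \<Longrightarrow> cnj z \<in> sector_region m \<sigma>"
  by (auto simp: sector_region_def)

lemma sector_region_scale:
  assumes "z \<in> sector_region m \<sigma>" "0 \<le> t" "t \<le> 1"
  shows "of_real t * z \<in> sector_region m \<sigma>"
proof (cases "Re z \<le> cmod z * cos m")
  case True
  then have "t * Re z \<le> t * (cmod z * cos m)" using assms(2) by (rule mult_left_mono)
  then show ?thesis using assms(2) by (simp add: sector_region_def norm_mult mult_ac)
next
  case False
  then have "cmod z \<le> \<sigma>" using assms(1) by (simp add: sector_region_def)
  moreover have "t * cmod z \<le> 1 * cmod z" using assms(3) by (intro mult_right_mono) auto
  ultimately show ?thesis using assms(2) by (simp add: sector_region_def norm_mult)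
qed

text \<open>The cosine is decreasing on the range of the absolute value of \<open>Arg\<close>, which
  removes the discontinuous \<open>Arg\<close> from the description and shows that the region is
  open.\<close>

lemma cut_region_eq:
  assumes "0 < \<delta>" "\<delta> \<le> pi"
  shows "cut_region \<delta> \<rho> = {z. Re (- z) > cmod z * cos \<delta>} \<union> ball 0 \<rho>"
proof -
  have "z \<noteq> 0 \<and> \<bar>Arg (- z)\<bar> < \<delta> \<longleftrightarrow> Re (- z) > cmod z * cos \<delta>" for z
  proof (cases "z = 0")
    case False
    have "\<bar>Arg (- z)\<bar> \<le> pi" using Arg_bounded[of "- z"] by auto
    then have "\<bar>Arg (- z)\<bar> < \<delta> \<longleftrightarrow> cos \<delta> < cos \<bar>Arg (- z)\<bar>"
      using assms by (intro cos_mono_less_eq[symmetric]) linarith+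
    also have "cos \<bar>Arg (- z)\<bar> = Re (- z) / cmod z" using cos_Arg[of "- z"] False by simp
    also have "cos \<delta> < Re (- z) / cmod z \<longleftrightarrow> Re (- z) > cmod z * cos \<delta>"
      using False by (simp add: field_simps)
    finally show ?thesis using False by simp
  qed simp
  then show ?thesis
    by (simp only: cut_region_def set_eq_iff Un_iff mem_Collect_eq mem_ball_0) simp
qed

text \<open>The absolute value of \<open>Arg\<close> never exceeds \<open>pi\<close>, so for such
  \<delta> the angular condition holds for every nonzero \<open>z\<close>.\<close>

lemma cut_region_eq_UNIV:
  assumes "\<delta> > pi" "\<rho> > 0"
  shows "cut_region \<delta> \<rho> = UNIV"
proof -
  have "z \<noteq> 0 \<and> \<bar>Arg (- z)\<bar> < \<delta> \<or> cmod z < \<rho>" for z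
    using assms Arg_bounded[of "- z"] by (cases "z = 0") auto
  then show ?thesis by (simp add: cut_region_def)
qed

lemma open_cut_region:
  assumes "\<delta> > 0" "\<rho> > 0"
  shows "open (cut_region \<delta> \<rho>)"
proof (cases "\<delta> \<le> pi")
  case True
  show ?thesis
    unfolding cut_region_eq[OF assms(1) True]
    by (intro open_Un open_ball open_Collect_less continuous_intros)
next
  case False
  then show ?thesis using cut_region_eq_UNIV assms by simp
qed

text \<open>Outside the sector \<open>\<bar>Arg (- z)\<bar>\<close> is at most
  \<open>pi - m\<close>, which is less than \<delta>.\<close>

lemma sector_region_subset:
  assumes "0 < m" "m < pi" "pi - \<delta> < m" "\<sigma> < \<rho>" "0 < \<delta>" "0 < \<rho>"
  shows "sector_region m \<sigma> \<subseteq> cut_region \<delta> \<rho>"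
proof (cases "\<delta> \<le> pi")
  case True
  have "cos m < cos (pi - \<delta>)" using assms True by (intro cos_monotone_0_pi) auto
  then have "cos m < - cos \<delta>" by simp
  then have less: "cmod z * cos \<delta> < - (cmod z * cos m)" if "z \<noteq> 0" for z
    using that mult_strict_left_mono[of "cos \<delta>" "- cos m" "cmod z"] by simp
  have "z \<in> cut_region \<delta> \<rho>" if z: "z \<in> sector_region m \<sigma>" for z
  proof (cases "z = 0 \<or> cmod z \<le> \<sigma>")
    case True
    then have "cmod z < \<rho>" using assms by auto
    then show ?thesis by (simp add: cut_region_def)
  next
    case False
    then have "Re z \<le> cmod z * cos m" "z \<noteq> 0" using z by (auto simp: sector_region_def)
    then show ?thesis unfolding cut_region_eq[OF assms(5) True] using less[of z] by simp
  qed
  then show ?thesis by blast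
next
  case False
  then show ?thesis using cut_region_eq_UNIV assms by simp
qed

lemma infinity_in_bigoE:
  fixes f :: "complex \<Rightarrow> real"
  assumes "f \<in> O[infinity_in S](g)"
  obtains c R where "c > 0" "R \<ge> 1" "\<And>z. z \<in> S \<Longrightarrow> cmod z \<ge> R \<Longrightarrow> \<bar>f z\<bar> \<le> c * \<bar>g z\<bar>"
proof -
  obtain c where c: "c > 0" "\<forall>\<^sub>F z in infinity_in S. norm (f z) \<le> c * norm (g z)"
    using landau_o.bigE[OF assms] .
  then obtain R where R: "\<And>z. R \<le> cmod z \<Longrightarrow> z \<in> S \<Longrightarrow> norm (f z) \<le> c * norm (g z)"
    unfolding eventually_inf_principal eventually_at_infinity by auto
  show thesis by (rule that[of c "max R 1"]) (use c R in auto)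
qed

text \<open>Compactness treats bounded \<open>z\<close> and the decay condition treats large ones.
  The bound on \<open>cmod z * norm (resolvent A z)\<close> is what controls the outer factors
  \<open>1 + z (A - z)^(-1)\<close> of the resolvent difference.\<close>

lemma spectral_cut_bounds:
  fixes A :: "('a::complex_hilbert \<times> 'a) set"
  assumes cut: "spectral_cut \<delta> \<rho> A" and K: "closed K" "K \<subseteq> cut_region \<delta> \<rho>"
  shows "continuous_on K (resolvent A)"
    and "\<exists>M>0. \<forall>z\<in>K. norm (resolvent A z) \<le> M \<and> cmod z * norm (resolvent A z) \<le> M"
proof -
  have "continuous_on (cut_region \<delta> \<rho>) (resolvent A)"
    using cut unfolding spectral_cut_def holomorphic_op_on_def continuous_on_eq_continuous_within
    using has_derivative_continuous by blast
  then show cont: "continuous_on K (resolvent A)" using K(2) by (rule continuous_on_subset)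
  have "(\<lambda>z. norm (resolvent A z)) \<in> O[infinity_in (cut_region \<delta> \<rho>)](\<lambda>z. 1 / cmod z)"
    using cut by (simp add: spectral_cut_def)
  then obtain c R where c: "c > 0" and R: "R \<ge> 1"
    and le: "\<And>z. z \<in> cut_region \<delta> \<rho> \<Longrightarrow> cmod z \<ge> R \<Longrightarrow> \<bar>norm (resolvent A z)\<bar> \<le> c * \<bar>1 / cmod z\<bar>"
    by (rule infinity_in_bigoE) blast
  have "compact ((\<lambda>z. norm (resolvent A z)) ` (K \<inter> cball 0 R))"
    using K(1) continuous_on_subset[OF cont]
    by (intro compact_continuous_image continuous_on_norm closed_Int_compact) auto
  from compact_imp_bounded[OF this] obtain N where
    "\<forall>y\<in>(\<lambda>z. norm (resolvent A z)) ` (K \<inter> cball 0 R). norm y \<le> N" unfolding bounded_iff by blast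
  then have N: "norm (resolvent A z) \<le> N" if "z \<in> K" "cmod z \<le> R" for z using that by auto
  \<comment> \<open>The first summand serves \<open>cmod z > R\<close>, where
    \<open>R \<ge> 1\<close> lets the weighted bound imply the plain one; the second serves the disc
    of radius \<open>R\<close>.\<close>
  define M where "M = c + R * \<bar>N\<bar>"
  have M0: "M > 0" using c R by (simp add: M_def add_pos_nonneg)
  have NM: "\<bar>N\<bar> \<le> M" using R c mult_right_mono[of 1 R "\<bar>N\<bar>"] by (simp add: M_def)
  have "norm (resolvent A z) \<le> M \<and> cmod z * norm (resolvent A z) \<le> M" if z: "z \<in> K" for z
  proof (cases "cmod z \<le> R")
    case True
    have n: "norm (resolvent A z) \<le> \<bar>N\<bar>" using N[OF z True] by simp
    have "cmod z * norm (resolvent A z) \<le> R * \<bar>N\<bar>" using n True R by (intro mult_mono) auto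
    also have "\<dots> \<le> M" using c by (simp add: M_def)
    finally show ?thesis using n NM by linarith
  next
    case False
    then have "norm (resolvent A z) \<le> c * (1 / cmod z)" using le[of z] z K(2) by auto
    moreover have "0 < cmod z" using False R by linarith
    ultimately have a: "cmod z * norm (resolvent A z) \<le> c"
      by (simp add: pos_le_divide_eq mult.commute)
    moreover have "1 * norm (resolvent A z) \<le> cmod z * norm (resolvent A z)"
      using False R by (intro mult_right_mono) auto
    moreover have "c \<le> M" using R by (simp add: M_def)
    ultimately show ?thesis by linarith
  qed
  then show "\<exists>M>0. \<forall>z\<in>K. norm (resolvent A z) \<le> M \<and> cmod z * norm (resolvent A z) \<le> M"
    using M0 by auto
qed

lemma resolvent_pair_exists:
  fixes A1 A2 :: "('a::complex_hilbert \<times> 'a) set"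
  assumes cl: "closed_operator A1" "closed_operator A2"
    and pos: "positive_operator A1" "positive_operator A2"
    and cut: "spectral_cut \<delta> \<rho> A1" "spectral_cut \<delta> \<rho> A2"
    and tc: "trace_class (resolvent A1 0 - resolvent A2 0)"
    and K: "closed K" "K \<subseteq> cut_region \<delta> \<rho>" "\<And>z. z \<in> K \<Longrightarrow> cnj z \<in> K"
  shows "\<exists>M C. resolvent_pair (resolvent A1) (resolvent A2) K M C"
proof -
  have \<rho>: "0 < \<rho>" using cut by (simp add: spectral_cut_def)
  then have zero: "0 \<in> cut_region \<delta> \<rho>" by (simp add: cut_region_def)
  have res: "is_resolvent A1 z (resolvent A1 z)" "is_resolvent A2 z (resolvent A2 z)"
    if "z \<in> cut_region \<delta> \<rho>" for z
    using cut that by (auto simp: spectral_cut_def intro!: is_resolvent_resolvent)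
  have adj: "is_adjoint (resolvent A1 z) (resolvent A1 (cnj z))"
    "is_adjoint (resolvent A2 z) (resolvent A2 (cnj z))"
    if "z \<in> cut_region \<delta> \<rho>" "cnj z \<in> cut_region \<delta> \<rho>" for z
    using is_adjoint_resolvent[OF cl(1) pos(1) res(1)[OF that(1)] res(1)[OF that(2)]]
      is_adjoint_resolvent[OF cl(2) pos(2) res(2)[OF that(1)] res(2)[OF that(2)]] .
  have "is_adjoint (resolvent A1 0 - resolvent A2 0) (resolvent A1 0 - resolvent A2 0)"
    using adj[of 0] zero by (simp add: is_adjoint_diff)
  then obtain C where C: "trace_bounded (resolvent A1 0 - resolvent A2 0) C"
    using trace_class_imp_trace_bounded[OF tc] by blast
  obtain M1 where M1: "M1 > 0"
    "\<And>z. z \<in> K \<Longrightarrow> norm (resolvent A1 z) \<le> M1 \<and> cmod z * norm (resolvent A1 z) \<le> M1"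
    using spectral_cut_bounds(2)[OF cut(1) K(1,2)] by blast
  obtain M2 where M2: "M2 > 0"
    "\<And>z. z \<in> K \<Longrightarrow> norm (resolvent A2 z) \<le> M2 \<and> cmod z * norm (resolvent A2 z) \<le> M2"
    using spectral_cut_bounds(2)[OF cut(2) K(1,2)] by blast
  define M where "M = max M1 M2"
  have M: "norm (resolvent A1 z) \<le> M" "cmod z * norm (resolvent A1 z) \<le> M"
    "norm (resolvent A2 z) \<le> M" "cmod z * norm (resolvent A2 z) \<le> M" if "z \<in> K" for z
    using M1(2)[OF that] M2(2)[OF that] by (auto simp: M_def)
  have M0: "M > 0" using M1(1) by (simp add: M_def)
  \<comment> \<open>Both outer factors of the factorization have norm at most \<open>1 + M\<close>,
    whence the constant \<open>(1 + M) * (1 + M) * C\<close> below.\<close>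
  have G: "norm (id_blinfun + scaleC_op z R) \<le> 1 + M"
    if "cmod z * norm R \<le> M" for z and R :: "'a \<Rightarrow>\<^sub>L 'a"
    using norm_triangle_ineq[of id_blinfun "scaleC_op z R"] that
      norm_blinfun_id_le[where 'a = 'a] by (simp add: blinfun_norm_scaleC_op)
  have "resolvent_pair (resolvent A1) (resolvent A2) K M ((1 + M) * (1 + M) * C)"
  proof
    show "continuous_on K (resolvent A1)" "continuous_on K (resolvent A2)"
      using spectral_cut_bounds(1)[OF cut(1) K(1,2)] spectral_cut_bounds(1)[OF cut(2) K(1,2)] .
    fix z assume z: "z \<in> K"
    then have zc: "z \<in> cut_region \<delta> \<rho>" "cnj z \<in> cut_region \<delta> \<rho>" using K by auto
    show "norm (resolvent A1 z) \<le> M" "norm (resolvent A2 z) \<le> M" "cnj z \<in> K"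
      using M[OF z] K(3)[OF z] by blast+
    show a: "is_adjoint (resolvent A1 z) (resolvent A1 (cnj z))"
      "is_adjoint (resolvent A2 z) (resolvent A2 (cnj z))"
      using adj[OF zc] .
    have eq: "resolvent A1 z - resolvent A2 z = (id_blinfun + scaleC_op z (resolvent A1 z))
        o\<^sub>L (resolvent A1 0 - resolvent A2 0) o\<^sub>L (id_blinfun + scaleC_op z (resolvent A2 z))"
      by (rule resolvent_difference_factorization[OF res(1)[OF zero] res(1)[OF zc(1)] a(1)
            res(2)[OF zero] res(2)[OF zc(1)]])
    have M': "cmod (cnj z) * norm (resolvent A1 (cnj z)) \<le> M" by (rule M(2)[OF K(3)[OF z]])
    show "trace_bounded (resolvent A1 z - resolvent A2 z) ((1 + M) * (1 + M) * C)"
      unfolding eq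
      by (rule trace_bounded_compose[OF C
            is_adjoint_add[OF is_adjoint_id is_adjoint_scaleC_op[OF a(1)]] G[OF M(2)[OF z]] G[OF M'] _
            is_adjoint_add[OF is_adjoint_id is_adjoint_scaleC_op[OF a(2)]] G[OF M(4)[OF z]]])
        (use M0 in auto)
  qed
  then show ?thesis by blast
qed

section \<open>Power-log expansions and the scattering phase\<close>

definition power_log :: "real \<Rightarrow> nat \<Rightarrow> real \<Rightarrow> complex" where
  "power_log \<beta> k x = of_real (x powr \<beta> * ln x ^ k)"

lemma complex_power_log:
  assumes "x > 0"
  shows "of_real x powr of_real \<beta> * Ln (of_real x) ^ k = power_log \<beta> k x"
  using assms by (simp add: power_log_def powr_of_real Ln_of_real)

lemma power_log_sum_of_real:
  assumes "x > 0"
  shows "power_log_sum \<beta> J c N (of_real x) = (\<Sum>j\<in>{..<N} - {J}. \<Sum>k\<le>1. c j k * power_log (\<beta> j) k x)"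
  unfolding power_log_sum_def complex_power_log[OF assms, symmetric] by (simp add: mult.assoc)

lemma power_log_tendsto_0:
  assumes "\<beta> < 0" "k \<le> 1"
  shows "(power_log \<beta> k \<longlongrightarrow> 0) at_top"
proof -
  have "((\<lambda>x. x powr \<beta>) \<longlongrightarrow> 0) at_top" using assms(1) by real_asymp
  moreover have "((\<lambda>x. x powr \<beta> * ln x) \<longlongrightarrow> 0) at_top" using assms(1) by real_asymp
  ultimately have "((\<lambda>x. x powr \<beta> * ln x ^ k) \<longlongrightarrow> 0) at_top"
    using assms(2) by (cases "k = 0") (auto simp: le_Suc_eq)
  then show ?thesis unfolding power_log_def using tendsto_of_real by fastforce
qed

text \<open>Division by \<open>ln x\<close> isolates \<open>d\<close>; what remains is a constant
  function.\<close>

lemma const_plus_ln_tendsto_0: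
  fixes c d :: complex
  assumes "((\<lambda>x. c + d * of_real (ln x)) \<longlongrightarrow> 0) at_top"
  shows "c = 0 \<and> d = 0"
proof -
  have inv: "((\<lambda>x::real. 1 / ln x) \<longlongrightarrow> 0) at_top" by real_asymp
  have "((\<lambda>x. (c + d * of_real (ln x)) * of_real (1 / ln x)) \<longlongrightarrow> 0 * of_real 0) at_top"
    by (intro tendsto_mult assms tendsto_of_real inv)
  moreover have "((\<lambda>x. c * of_real (1 / ln x)) \<longlongrightarrow> c * of_real 0) at_top"
    by (intro tendsto_mult tendsto_const tendsto_of_real inv)
  ultimately have "((\<lambda>x. (c + d * of_real (ln x)) * of_real (1 / ln x) - c * of_real (1 / ln x)) \<longlongrightarrow> 0) at_top"
    using tendsto_diff by fastforce
  moreover have "\<forall>\<^sub>F x in at_top. (c + d * of_real (ln x)) * of_real (1 / ln x) - c * of_real (1 / ln x) = d"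
    using eventually_gt_at_top[of "1::real"]
    by eventually_elim (simp add: field_simps)
  ultimately have "((\<lambda>x::real. d) \<longlongrightarrow> 0) at_top" by (rule Lim_transform_eventually)
  then have d: "d = 0" by (simp add: tendsto_const_iff)
  then show ?thesis using assms by (simp add: tendsto_const_iff)
qed

text \<open>By induction the earlier coefficients vanish. Division by the power with exponent
  \<open>\<gamma> j\<close> sends all later terms to 0 and leaves a constant plus a multiple of
  \<open>ln x\<close>; the condition \<open>\<gamma> j \<ge> 0\<close> ensures that the division
  preserves the limit 0.\<close>

lemma power_log_coeffs_zero:
  fixes C :: "nat \<Rightarrow> nat \<Rightarrow> complex" and \<gamma> :: "nat \<Rightarrow> real"
  assumes anti: "\<And>i j. i < j \<Longrightarrow> \<gamma> j < \<gamma> i"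
    and lim: "((\<lambda>x. \<Sum>j<N. \<Sum>k\<le>1. C j k * power_log (\<gamma> j) k x) \<longlongrightarrow> 0) at_top"
    and j: "j < N" "\<gamma> j \<ge> 0"
  shows "C j 0 = 0 \<and> C j 1 = 0"
  using j
proof (induction j rule: less_induct)
  case (less j)
  define F where "F x = (\<Sum>j<N. \<Sum>k\<le>1. C j k * power_log (\<gamma> j) k x)" for x
  define T where "T x = (\<Sum>i\<in>{j<..<N}. \<Sum>k\<le>1. C i k * power_log (\<gamma> i - \<gamma> j) k x)" for x
  have before: "C i k = 0" if "i < j" "k \<le> 1" for i k
  proof -
    have "\<gamma> i \<ge> 0" using anti[OF that(1)] less.prems(2) by simp
    then show ?thesis using less.IH[OF that(1)] that less.prems(1) by (cases k) auto
  qed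
  have T: "(T \<longlongrightarrow> 0) at_top"
    unfolding T_def using anti
    by (intro tendsto_null_sum tendsto_mult_right_zero power_log_tendsto_0) auto
  have eq: "F x * of_real (x powr - \<gamma> j) - T x = C j 0 + C j 1 * of_real (ln x)" if "x > 0" for x
  proof -
    have shift: "power_log (\<gamma> i) k x * of_real (x powr - \<gamma> j) = power_log (\<gamma> i - \<gamma> j) k x" for i k
      using that by (simp add: power_log_def powr_diff powr_minus field_simps)
    have "F x * of_real (x powr - \<gamma> j) = (\<Sum>i<N. \<Sum>k\<le>1. C i k * power_log (\<gamma> i - \<gamma> j) k x)"
      by (simp only: F_def sum_distrib_right mult.assoc shift)
    also have "\<dots> = (\<Sum>i\<in>{j<..<N} \<union> {j}. \<Sum>k\<le>1. C i k * power_log (\<gamma> i - \<gamma> j) k x)"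
      using less.prems(1) by (intro sum.mono_neutral_right) (auto simp: not_less le_less before)
    also have "\<dots> = T x + (\<Sum>k\<le>1. C j k * power_log 0 k x)"
      by (subst sum.union_disjoint) (auto simp: T_def)
    finally show ?thesis using that by (simp add: power_log_def)
  qed
  have "((\<lambda>x. F x * of_real (x powr - \<gamma> j)) \<longlongrightarrow> 0) at_top"
  proof (cases "\<gamma> j = 0")
    case True
    have "\<forall>\<^sub>F x in at_top. F x = F x * of_real (x powr - \<gamma> j)"
      using eventually_gt_at_top[of "0::real"] by eventually_elim (simp add: True)
    then show ?thesis using lim unfolding F_def[symmetric] by (rule Lim_transform_eventually[rotated])
  next
    case False
    then have "- \<gamma> j < 0" using less.prems(2) by simp
    then have "((\<lambda>x. x powr - \<gamma> j) \<longlongrightarrow> 0) at_top" by real_asymp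
    from tendsto_mult[OF lim[folded F_def] tendsto_of_real[OF this]] show ?thesis by simp
  qed
  from tendsto_diff[OF this T] have "((\<lambda>x. F x * of_real (x powr - \<gamma> j) - T x) \<longlongrightarrow> 0) at_top" by simp
  moreover have "\<forall>\<^sub>F x in at_top. F x * of_real (x powr - \<gamma> j) - T x = C j 0 + C j 1 * of_real (ln x)"
    using eventually_gt_at_top[of "0::real"] by eventually_elim (rule eq)
  ultimately have "((\<lambda>x. C j 0 + C j 1 * of_real (ln x)) \<longlongrightarrow> 0) at_top"
    by (rule Lim_transform_eventually)
  then show ?case by (rule const_plus_ln_tendsto_0)
qed

lemma bigo_negative_power_tendsto_0:
  fixes f :: "real \<Rightarrow> complex"
  assumes "(\<lambda>x. cmod (f x)) \<in> O[at_top](\<lambda>x. x powr p)" "p < 0"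
  shows "(f \<longlongrightarrow> 0) at_top"
proof -
  obtain c where c: "\<forall>\<^sub>F x in at_top. norm (cmod (f x)) \<le> c * norm (x powr p)"
    using landau_o.bigE[OF assms(1)] by metis
  have "((\<lambda>x. x powr p) \<longlongrightarrow> 0) at_top" using assms(2) by real_asymp
  then have "((\<lambda>x. c * norm (x powr p)) \<longlongrightarrow> c * norm (0::real)) at_top"
    by (intro tendsto_mult tendsto_const tendsto_norm)
  then have "((\<lambda>x. c * norm (x powr p)) \<longlongrightarrow> 0) at_top" by simp
  then show ?thesis by (rule Lim_null_comparison[rotated]) (use c in simp)
qed

lemma exponents_eventually_gt:
  assumes "exponents \<alpha> J"
  shows "\<forall>\<^sub>F N in sequentially. \<alpha> N > B"
  using assms unfolding exponents_def filterlim_at_top_dense by auto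

lemma exponents_less_iff:
  assumes "exponents \<alpha> J"
  shows "\<alpha> i < \<alpha> j \<longleftrightarrow> i < j"
  using assms unfolding exponents_def by (auto simp: strict_mono_less)

lemma exponents_neq_1:
  assumes "exponents \<alpha> J" "j \<noteq> J"
  shows "\<alpha> j \<noteq> 1"
  using assms strict_mono_eq[of \<alpha> j J] unfolding exponents_def by auto

lemma expansion_at_infinity_unique:
  assumes exps: "exponents \<alpha> J"
    and 1: "expansion_at_infinity \<alpha> J f c d a" and 2: "expansion_at_infinity \<alpha> J f c' d' a'"
  shows "c = c'"
proof -
  have "\<forall>\<^sub>F N in sequentially. \<alpha> N > 2 \<and> N > J
      \<and> (\<lambda>\<mu>. cmod (f \<mu> - (c + d * of_real (ln \<mu>) + power_log_sum (\<lambda>j. 1 - \<alpha> j) J a N (of_real \<mu>))))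
          \<in> O[at_top](\<lambda>\<mu>. \<mu> powr (1 - \<alpha> N + 1))
      \<and> (\<lambda>\<mu>. cmod (f \<mu> - (c' + d' * of_real (ln \<mu>) + power_log_sum (\<lambda>j. 1 - \<alpha> j) J a' N (of_real \<mu>))))
          \<in> O[at_top](\<lambda>\<mu>. \<mu> powr (1 - \<alpha> N + 1))"
    using 1[unfolded expansion_at_infinity_def] 2[unfolded expansion_at_infinity_def]
      exponents_eventually_gt[OF exps, of 2] eventually_gt_at_top[of J]
  proof eventually_elim
    case (elim N)
    show ?case using elim(1)[rule_format, of 1] elim(2)[rule_format, of 1] elim(3,4) by simp
  qed
  then obtain N where N: "\<alpha> N > 2" "N > J" and
    O1: "(\<lambda>\<mu>. cmod (f \<mu> - (c + d * of_real (ln \<mu>) + power_log_sum (\<lambda>j. 1 - \<alpha> j) J a N (of_real \<mu>))))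
          \<in> O[at_top](\<lambda>\<mu>. \<mu> powr (1 - \<alpha> N + 1))" and
    O2: "(\<lambda>\<mu>. cmod (f \<mu> - (c' + d' * of_real (ln \<mu>) + power_log_sum (\<lambda>j. 1 - \<alpha> j) J a' N (of_real \<mu>))))
          \<in> O[at_top](\<lambda>\<mu>. \<mu> powr (1 - \<alpha> N + 1))"
    unfolding eventually_sequentially by blast
  \<comment> \<open>As \<open>1 - \<alpha> J = 0\<close>, the omitted index \<open>J\<close> is free
    to carry the constant and the logarithm, so that all terms fit one scale of powers.\<close>
  define C where "C j k = (if j = J then (if k = 0 then c - c' else d - d') else a j k - a' j k)" for j k :: nat
  define G where "G x = (\<Sum>j<N. \<Sum>k\<le>1. C j k * power_log (1 - \<alpha> j) k x)" for x
  \<comment> \<open>With \<open>\<alpha> N > 2\<close> and \<open>\<eta> = 1\<close> both remainders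
    tend to 0.\<close>
  have neg: "1 - \<alpha> N + 1 < 0" using N(1) by simp
  have "((\<lambda>\<mu>. (f \<mu> - (c' + d' * of_real (ln \<mu>) + power_log_sum (\<lambda>j. 1 - \<alpha> j) J a' N (of_real \<mu>)))
      - (f \<mu> - (c + d * of_real (ln \<mu>) + power_log_sum (\<lambda>j. 1 - \<alpha> j) J a N (of_real \<mu>)))) \<longlongrightarrow> 0 - 0) at_top"
    by (intro tendsto_diff bigo_negative_power_tendsto_0[OF O1 neg] bigo_negative_power_tendsto_0[OF O2 neg])
  moreover have "\<forall>\<^sub>F \<mu> in at_top.
      (f \<mu> - (c' + d' * of_real (ln \<mu>) + power_log_sum (\<lambda>j. 1 - \<alpha> j) J a' N (of_real \<mu>)))
      - (f \<mu> - (c + d * of_real (ln \<mu>) + power_log_sum (\<lambda>j. 1 - \<alpha> j) J a N (of_real \<mu>))) = G \<mu>"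
    using eventually_gt_at_top[of "0::real"]
  proof eventually_elim
    case (elim x)
    have "G x = (\<Sum>j\<in>({..<N} - {J}) \<union> {J}. \<Sum>k\<le>1. C j k * power_log (1 - \<alpha> j) k x)"
      unfolding G_def using N(2) by (intro sum.cong) auto
    also have "\<dots> = (\<Sum>j\<in>{..<N} - {J}. \<Sum>k\<le>1. C j k * power_log (1 - \<alpha> j) k x)
        + (\<Sum>k\<le>1. C J k * power_log 0 k x)"
      using exps by (subst sum.union_disjoint) (auto simp: exponents_def)
    also have "(\<Sum>k\<le>1. C J k * power_log 0 k x) = (c - c') + (d - d') * of_real (ln x)"
      using elim by (simp add: C_def power_log_def)
    also have "(\<Sum>j\<in>{..<N} - {J}. \<Sum>k\<le>1. C j k * power_log (1 - \<alpha> j) k x)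
        = power_log_sum (\<lambda>j. 1 - \<alpha> j) J a N (of_real x) - power_log_sum (\<lambda>j. 1 - \<alpha> j) J a' N (of_real x)"
      unfolding power_log_sum_of_real[OF elim] sum_subtractf[symmetric]
      by (intro sum.cong) (auto simp: C_def left_diff_distrib)
    finally show ?case by (simp add: algebra_simps)
  qed
  ultimately have "(G \<longlongrightarrow> 0 - 0) at_top" by (rule Lim_transform_eventually)
  then have "C J 0 = 0 \<and> C J 1 = 0"
    unfolding G_def using N(2) exps exponents_less_iff[OF exps]
    by (intro power_log_coeffs_zero[of "\<lambda>j. 1 - \<alpha> j"]) (auto simp: exponents_def)
  then show ?thesis by (simp add: C_def)
qed

lemma LIM_at_infinity_eq:
  assumes "exponents \<alpha> J" "expansion_at_infinity \<alpha> J f c d a"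
  shows "LIM_at_infinity \<alpha> J f = c"
  unfolding LIM_at_infinity_def
  by (rule the_equality) (use assms expansion_at_infinity_unique in blast)+

text \<open>Inversion of the variable reduces uniqueness at 0 to uniqueness at infinity; each
  logarithm changes sign.\<close>

lemma expansion_at_zero_imp_infinity:
  assumes "expansion_at_zero \<alpha> J f c d a"
  shows "expansion_at_infinity \<alpha> J (\<lambda>\<mu>. f (inverse \<mu>)) c (- d) (\<lambda>j k. (- 1) ^ k * a j k)"
  unfolding expansion_at_infinity_def
  using assms[unfolded expansion_at_zero_def]
proof eventually_elim
  case (elim N)
  show ?case
  proof (intro allI impI)
    fix \<eta> :: real assume "\<eta> > 0"
    with elim obtain C where C: "C > 0" "\<forall>\<^sub>F \<epsilon> in at_right 0. norm (cmod (f \<epsilon> - (c + d * of_real (ln \<epsilon>)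
        + power_log_sum (\<lambda>j. \<alpha> j - 1) J a N (of_real \<epsilon>)))) \<le> C * norm (\<epsilon> powr (\<alpha> N - 1 - \<eta>))"
      using landau_o.bigE by blast
    have ev: "\<forall>\<^sub>F \<mu> in at_top. norm (cmod (f (inverse \<mu>) - (c + d * of_real (ln (inverse \<mu>))
        + power_log_sum (\<lambda>j. \<alpha> j - 1) J a N (of_real (inverse \<mu>)))))
          \<le> C * norm ((inverse \<mu> :: real) powr (\<alpha> N - 1 - \<eta>))"
      using eventually_compose_filterlim[OF C(2) filterlim_inverse_at_right_top] .
    show "(\<lambda>\<mu>. cmod (f (inverse \<mu>) - (c + - d * of_real (ln \<mu>)
        + power_log_sum (\<lambda>j. 1 - \<alpha> j) J (\<lambda>j k. (- 1) ^ k * a j k) N (of_real \<mu>))))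
          \<in> O[at_top](\<lambda>\<mu>. \<mu> powr (1 - \<alpha> N + \<eta>))"
    proof (intro bigoI[of _ C], use ev eventually_gt_at_top[of 0] in eventually_elim)
      case (elim \<mu>)
      have "power_log_sum (\<lambda>j. \<alpha> j - 1) J a N (of_real (inverse \<mu>))
          = power_log_sum (\<lambda>j. 1 - \<alpha> j) J (\<lambda>j k. (- 1) ^ k * a j k) N (of_real \<mu>)"
        using elim
        by (subst (1 2) power_log_sum_of_real)
           (auto simp: power_log_def powr_minus[symmetric] inverse_powr ln_inverse intro!: sum.cong)
      moreover have "(inverse \<mu>) powr (\<alpha> N - 1 - \<eta>) = \<mu> powr (1 - \<alpha> N + \<eta>)"
        using elim by (simp add: inverse_powr powr_minus[symmetric] algebra_simps)
      ultimately show ?case using elim by (simp add: ln_inverse)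
    qed
  qed
qed

lemma LIM_at_zero_eq:
  assumes "exponents \<alpha> J" "expansion_at_zero \<alpha> J f c d a"
  shows "LIM_at_zero \<alpha> J f = c"
  unfolding LIM_at_zero_def
  by (rule the_equality)
     (use assms expansion_at_infinity_unique expansion_at_zero_imp_infinity in blast)+

text \<open>The constant is the limit of \<open>F\<close> along the negative axis, reached with
  error \<open>c / (p - 1)\<close> times the power of \<open>cmod z\<close>. From there an arc of
  length at most \<open>pi * cmod z\<close> leads to \<open>z\<close> and adds \<open>c * pi\<close>
  times the same power.\<close>

lemma asymptotic_constant_in_sector:
  fixes F F' :: "complex \<Rightarrow> complex"
  assumes R: "R > 0" and p: "p > 1" and c: "c \<ge> 0"
    and m: "0 < m" "m < pi / 2"
    and der: "\<And>z. cmod z \<ge> R \<Longrightarrow> Re z \<le> cmod z * cos m \<Longrightarrow> (F has_field_derivative F' z) (at z)"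
    and bd: "\<And>z. cmod z \<ge> R \<Longrightarrow> Re z \<le> cmod z * cos m \<Longrightarrow> cmod (F' z) \<le> c * cmod z powr (- p)"
  shows "\<exists>l. \<forall>z. cmod z \<ge> R \<longrightarrow> Re z \<le> cmod z * cos m \<longrightarrow>
    cmod (F z - l) \<le> c * (pi + 1 / (p - 1)) * cmod z powr (1 - p)"
proof -
  have cosm: "0 < cos m" using m by (intro cos_gt_zero) auto
  define g where "g x = F (- of_real x)" for x :: real
  have neg: "Re (- of_real x) \<le> cmod (- of_real x) * cos m" if "x > 0" for x :: real
    using cosm that by (simp add: order_trans[of "- x" 0])
  have g_diff: "cmod (g y - g x) \<le> c / (p - 1) * x powr (1 - p)" if xy: "R \<le> x" "x < y" for x y
  proof -
    \<comment> \<open>An antiderivative of the majorant \<open>c * t powr (- p)\<close> of the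
      derivative.\<close>
    define \<phi> where "\<phi> t = - (c / (p - 1)) * t powr (1 - p)" for t :: real
    have vd: "(g has_vector_derivative - F' (- of_real t)) (at t)" if "t \<ge> R" for t
    proof -
      have "(F has_field_derivative F' (- of_real t)) (at (- of_real t))"
        using that R neg[of t] by (intro der) auto
      then have "((\<lambda>x. F (- of_real x)) has_vector_derivative (- 1) * F' (- of_real t)) (at t)"
        by (intro field_vector_diff_chain_at[of "\<lambda>x. - of_real x", unfolded o_def])
           (auto intro!: derivative_eq_intros)
      then show ?thesis by (simp add: g_def[abs_def])
    qed
    have vd\<phi>: "(\<phi> has_vector_derivative c * t powr (- p)) (at t)" if "t > 0" for t
    proof -
      have "(\<phi> has_real_derivative - (c / (p - 1)) * ((1 - p) * t powr (1 - p - 1))) (at t)"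
        unfolding \<phi>_def using that p by (auto intro!: derivative_eq_intros)
      moreover have "- (c / (p - 1)) * ((1 - p) * t powr (1 - p - 1)) = c * t powr (- p)"
        using p by (simp add: field_simps)
      ultimately show ?thesis by (simp add: has_real_derivative_iff_has_vector_derivative)
    qed
    have "norm (g y - g x) \<le> \<phi> y - \<phi> x"
    proof (rule differentiable_bound_general[OF xy(2), where f' = "\<lambda>t. - F' (- of_real t)" and \<phi>' = "\<lambda>t. c * t powr (- p)"])
      show "continuous_on {x..y} g"
        using xy vd by (intro continuous_at_imp_continuous_on ballI) (meson atLeastAtMost_iff has_vector_derivative_continuous order_trans)
      show "continuous_on {x..y} \<phi>"
        unfolding \<phi>_def using xy R by (intro continuous_intros) auto
      fix t assume t: "x < t" "t < y"
      show "(g has_vector_derivative - F' (- of_real t)) (at t)" using t xy by (intro vd) auto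
      show "(\<phi> has_vector_derivative c * t powr (- p)) (at t)" using t xy R by (intro vd\<phi>) auto
      have "cmod (F' (- of_real t)) \<le> c * cmod (- of_real t) powr (- p)"
        using t xy R neg[of t] by (intro bd) auto
      then show "norm (- F' (- of_real t)) \<le> c * t powr (- p)" using t xy R by simp
    qed
    also have "\<dots> \<le> c / (p - 1) * x powr (1 - p)" using c p by (simp add: \<phi>_def)
    finally show ?thesis .
  qed
  define B where "B = c / (p - 1)"
  have B: "B \<ge> 0" using c p by (simp add: B_def)
  have lim0: "((\<lambda>n. B * (R + real n) powr (1 - p)) \<longlonglongrightarrow> 0)"
  proof -
    have "((\<lambda>n. (R + real n) powr (1 - p)) \<longlonglongrightarrow> 0)" using p by real_asymp
    from tendsto_mult_right_zero[OF this] show ?thesis .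
  qed
  have "Cauchy (\<lambda>n. g (R + real n))"
  proof (rule metric_CauchyI)
    fix e :: real assume "e > 0"
    then obtain N where N: "\<And>n. n \<ge> N \<Longrightarrow> B * (R + real n) powr (1 - p) < e"
      using order_tendstoD(2)[OF lim0, of e] by (auto simp: eventually_sequentially)
    have "dist (g (R + real i)) (g (R + real j)) < e" if "i \<ge> N" "j \<ge> N" for i j
    proof (cases i j rule: linorder_cases)
      case less
      then show ?thesis
        using g_diff[of "R + real i" "R + real j"] N[OF that(1)] by (simp add: dist_norm norm_minus_commute B_def)
    next
      case greater
      then show ?thesis
        using g_diff[of "R + real j" "R + real i"] N[OF that(2)] by (simp add: dist_norm B_def)
    qed (use \<open>e > 0\<close> in simp)
    then show "\<exists>N. \<forall>i\<ge>N. \<forall>j\<ge>N. dist (g (R + real i)) (g (R + real j)) < e" by blast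
  qed
  then obtain l where l: "(\<lambda>n. g (R + real n)) \<longlonglongrightarrow> l" by (auto simp: Cauchy_convergent_iff convergent_def)
  have g_l: "cmod (g x - l) \<le> B * x powr (1 - p)" if "x \<ge> R" for x
  proof -
    obtain N where N: "x - R < real N" using reals_Archimedean2 by blast
    have "(\<lambda>n. cmod (g x - g (R + real n))) \<longlonglongrightarrow> cmod (g x - l)"
      by (intro tendsto_norm tendsto_diff tendsto_const l)
    then show ?thesis
    proof (rule Lim_bounded)
    show "\<forall>n\<ge>N. cmod (g x - g (R + real n)) \<le> B * x powr (1 - p)"
    proof (intro allI impI)
      fix n assume "n \<ge> N"
      then have "x < R + real n" using N by linarith
      then show "cmod (g x - g (R + real n)) \<le> B * x powr (1 - p)"
        using g_diff[OF that, of "R + real n"] by (simp add: B_def norm_minus_commute)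
    qed
    qed
  qed
  have "cmod (F z - l) \<le> c * (pi + 1 / (p - 1)) * cmod z powr (1 - p)"
    if z: "cmod z \<ge> R" "Re z \<le> cmod z * cos m" for z
  proof -
    define r where "r = cmod z"
    define \<phi> where "\<phi> = Arg (- z)"
    \<comment> \<open>The arc from \<open>- r\<close> to \<open>z\<close>, along which the argument
      of \<open>- h s\<close> runs linearly from 0 to \<open>Arg (- z)\<close>.\<close>
    define h where "h s = - (of_real r * exp (\<i> * of_real (s * \<phi>)))" for s :: real
    have r: "r > 0" "r \<ge> R" using z R by (auto simp: r_def)
    have \<phi>: "\<bar>\<phi>\<bar> \<le> pi" using Arg_bounded[of "- z"] by (auto simp: \<phi>_def)
    have hz: "h 1 = z" using Arg_eq[of "- z"] r by (auto simp: h_def r_def \<phi>_def)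
    have h0: "h 0 = - of_real r" by (simp add: h_def)
    have hn: "cmod (h s) = r" for s using r by (simp add: h_def norm_mult)
    have hin: "Re (h s) \<le> cmod (h s) * cos m" if s: "0 \<le> s" "s \<le> 1" for s
    proof -
      \<comment> \<open>On this arc the real part is largest at the end point \<open>z\<close>, so
        the arc does not enter the sector.\<close>
      have "\<bar>s * \<phi>\<bar> \<le> \<bar>\<phi>\<bar>" using s by (simp add: abs_mult mult_left_le_one_le)
      then have "cos \<bar>\<phi>\<bar> \<le> cos \<bar>s * \<phi>\<bar>" using \<phi> by (intro cos_monotone_0_pi_le) auto
      moreover have "Re (h t) = - r * cos (t * \<phi>)" for t by (simp add: h_def Re_exp)
      ultimately have "Re (h s) \<le> Re (h 1)" using r by simp
      then show ?thesis using z(2) unfolding hn hz r_def[symmetric] by simp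
    qed
    have hd: "((\<lambda>s. F (h s)) has_vector_derivative (\<i> * of_real \<phi> * h s) * F' (h s)) (at s)"
      if s: "0 \<le> s" "s \<le> 1" for s
    proof -
      have "((\<lambda>w. - (of_real r * exp (\<i> * (w * of_real \<phi>)))) has_field_derivative \<i> * of_real \<phi> * h s)
          (at (of_real s))"
        by (auto intro!: derivative_eq_intros simp: h_def)
      from has_vector_derivative_real_field[OF this, of UNIV]
      have "(h has_vector_derivative \<i> * of_real \<phi> * h s) (at s)"
        by (simp add: h_def[abs_def])
      moreover have "(F has_field_derivative F' (h s)) (at (h s))"
        using s hin[of s] r by (intro der) (auto simp: hn)
      ultimately show ?thesis
        by (rule field_vector_diff_chain_at[unfolded o_def])
    qed
    have "norm (F (h 1) - F (h 0)) \<le> (c * pi * r powr (1 - p)) * 1 - (c * pi * r powr (1 - p)) * 0"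
    proof (rule differentiable_bound_general[where \<phi> = "\<lambda>s. (c * pi * r powr (1 - p)) * s"
          and f = "\<lambda>s. F (h s)" and \<phi>' = "\<lambda>s. c * pi * r powr (1 - p)"
          and f' = "\<lambda>s. (\<i> * of_real \<phi> * h s) * F' (h s)"])
      show "continuous_on {0..1} (\<lambda>s. F (h s))"
        using has_vector_derivative_continuous[OF hd]
        by (intro continuous_at_imp_continuous_on ballI) auto
      show "continuous_on {0..1} (\<lambda>s. (c * pi * r powr (1 - p)) * s)" by (intro continuous_intros)
      fix s :: real assume s: "0 < s" "s < 1"
      show "((\<lambda>s. F (h s)) has_vector_derivative (\<i> * of_real \<phi> * h s) * F' (h s)) (at s)"
        using s by (intro hd) auto
      show "((\<lambda>s. (c * pi * r powr (1 - p)) * s) has_vector_derivative c * pi * r powr (1 - p)) (at s)"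
        unfolding has_real_derivative_iff_has_vector_derivative[symmetric]
        by (auto intro!: derivative_eq_intros)
      have "cmod (F' (h s)) \<le> c * r powr (- p)" using s hin[of s] bd[of "h s"] r by (simp add: hn)
      then have "cmod (\<i> * of_real \<phi> * h s * F' (h s)) \<le> pi * r * (c * r powr (- p))"
        using \<phi> r unfolding norm_mult hn by (intro mult_mono) auto
      also have "\<dots> = c * pi * r powr (1 - p)" using r by (simp add: powr_diff powr_minus field_simps)
      finally show "norm (\<i> * of_real \<phi> * h s * F' (h s)) \<le> c * pi * r powr (1 - p)" .
    qed simp
    then have "cmod (F z - g r) \<le> c * pi * r powr (1 - p)" by (simp add: hz h0 g_def)
    moreover have "cmod (g r - l) \<le> B * r powr (1 - p)" by (rule g_l[OF r(2)])
    ultimately have "cmod (F z - l) \<le> c * pi * r powr (1 - p) + B * r powr (1 - p)"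
      using norm_triangle_ineq[of "F z - g r" "g r - l"] by simp
    then show ?thesis by (simp add: B_def r_def algebra_simps)
  qed
  then show ?thesis by blast
qed

text \<open>\<open>A0\<close> and \<open>A1\<close> solve \<open>\<beta> A1 = B1\<close> and
  \<open>\<beta> A0 + A1 = B0\<close>, which result from comparing the coefficients of the
  derivative; they are the origin of \<open>phase_coeff\<close>.\<close>

lemma power_log_has_field_derivative:
  fixes B0 B1 :: complex
  assumes w: "w \<notin> \<real>\<^sub>\<le>\<^sub>0" and \<beta>: "\<beta> \<noteq> (0 :: real)"
  defines "A1 \<equiv> B1 / of_real \<beta>"
  defines "A0 \<equiv> (B0 - A1) / of_real \<beta>"
  shows "((\<lambda>w. A0 * w powr of_real \<beta> + A1 * w powr of_real \<beta> * Ln w) has_field_derivative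
    B0 * w powr of_real (\<beta> - 1) + B1 * w powr of_real (\<beta> - 1) * Ln w) (at w)"
proof -
  have w0: "w \<noteq> 0" using w by auto
  have "w powr of_real \<beta> = w powr of_real (\<beta> - 1) * w"
    using w0 by (simp add: powr_diff)
  then show ?thesis
    using w w0 \<beta>
    by (auto intro!: derivative_eq_intros simp: A0_def A1_def field_simps)
qed

text \<open>Off the sector \<open>z\<close> is never positive, so the principal logarithm of
  \<open>- z\<close> is holomorphic on the whole domain of the expansions.\<close>

lemma neg_not_nonpos_Reals:
  assumes m: "0 < m" "m < pi / 2" and z: "Re z \<le> cmod z * cos m" "z \<noteq> 0"
  shows "- z \<notin> \<real>\<^sub>\<le>\<^sub>0"
proof
  assume "- z \<in> \<real>\<^sub>\<le>\<^sub>0"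
  then have "Im z = 0" "Re z \<ge> 0" by (auto simp: complex_nonpos_Reals_iff)
  then have w: "cmod z = Re z" "Re z > 0" using z(2) by (auto simp: cmod_eq_Re complex_eq_iff)
  have "cos m < cos 0" using m by (intro cos_monotone_0_pi) auto
  then have "Re z * cos m < Re z * 1" using w by (intro mult_strict_left_mono) auto
  then show False using z(1) w by simp
qed

section \<open>Asymptotics of the scattering phase\<close>

text \<open>Operators have disappeared: \<open>U\<close> stands for the cut region, \<open>f\<close>
  for the trace of the resolvent difference and \<open>C0\<close> for a bound on its trace
  norm.\<close>

locale scattering_phase =
  fixes U :: "complex set" and L f :: "complex \<Rightarrow> complex" and C0 m \<sigma> :: real
    and \<alpha> :: "nat \<Rightarrow> real" and J :: nat and b :: "nat \<Rightarrow> nat \<Rightarrow> complex"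
  assumes open_U: "open U"
    and sector_sub: "sector_region m \<sigma> \<subseteq> U"
    and m: "0 < m" "m < pi / 2" and \<sigma>: "0 < \<sigma>"
    and deriv_L: "\<And>z. z \<in> U \<Longrightarrow> (L has_field_derivative - f z) (at z)"
    and bound_f: "\<And>z. z \<in> sector_region m \<sigma> \<Longrightarrow> cmod (f z) \<le> C0"
    and exps: "exponents \<alpha> J"
    and expansion_f: "resolvent_trace_expansion U \<alpha> J b f"
begin

text \<open>Chosen so that \<open>phase_sum\<close> is an antiderivative of \<open>trace_sum\<close>
  in \<open>w = - z\<close>. The divisors are nonzero because \<open>\<alpha> j\<close> equals 1 for
  \<open>j = J\<close> alone.\<close>

definition phase_coeff :: "nat \<Rightarrow> nat \<Rightarrow> complex" where
  "phase_coeff j k = (if k = 0 then (b j 0 - b j 1 / of_real (1 - \<alpha> j)) / of_real (1 - \<alpha> j)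
     else b j 1 / of_real (1 - \<alpha> j))"

definition phase_sum :: "nat \<Rightarrow> complex \<Rightarrow> complex" where
  "phase_sum N w = b J 0 * Ln w + power_log_sum (\<lambda>j. 1 - \<alpha> j) J phase_coeff N w"

definition trace_sum :: "nat \<Rightarrow> complex \<Rightarrow> complex" where
  "trace_sum N w = power_log_sum (\<lambda>j. - \<alpha> j) J b N w + b J 0 * inverse w"

text \<open>The condition \<open>\<alpha> N > 1\<close> makes the remainder of \<open>f\<close>
  integrable at infinity, which gives the phase a constant term.\<close>

definition good :: "nat \<Rightarrow> bool" where
  "good N \<longleftrightarrow> \<alpha> N > 1 \<and> (\<forall>\<eta>>0. (\<lambda>z. cmod (f z - trace_sum N (- z)))
     \<in> O[infinity_in U](\<lambda>z. cmod z powr (- \<alpha> N + \<eta>)))"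

lemma eventually_good: "\<forall>\<^sub>F N in sequentially. good N"
  using expansion_f[unfolded resolvent_trace_expansion_def] exponents_eventually_gt[OF exps, of 1]
  by eventually_elim (simp add: good_def trace_sum_def)

lemma cos_m: "0 < cos m"
  using m by (intro cos_gt_zero) auto

lemma L_holomorphic: "L holomorphic_on U"
  using deriv_L open_U by (auto simp: holomorphic_on_open)

lemma f_holomorphic: "f holomorphic_on U"
proof -
  have "(\<lambda>z. - deriv L z) holomorphic_on U"
    by (intro holomorphic_on_minus holomorphic_deriv[OF L_holomorphic open_U])
  moreover have "- deriv L z = f z" if "z \<in> U" for z
    using DERIV_imp_deriv[OF deriv_L[OF that]] by simp
  ultimately show ?thesis by (rule holomorphic_transform)
qed

lemma sector_in_region: "Re z \<le> cmod z * cos m \<Longrightarrow> z \<in> sector_region m \<sigma>"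
  by (simp add: sector_region_def)

lemma L_bound:
  assumes "z \<in> sector_region m \<sigma>"
  shows "cmod (L z - L 0) \<le> C0 * cmod z"
proof -
  have seg: "w \<in> sector_region m \<sigma>" if "w \<in> closed_segment 0 z" for w
    using that sector_region_scale[OF assms] by (auto simp: in_segment scaleR_conv_of_real)
  have "norm (L z - L 0) \<le> C0 * norm (z - 0)"
  proof (rule field_differentiable_bound[where S = "closed_segment 0 z" and f' = "\<lambda>z. - f z"])
    fix w assume w: "w \<in> closed_segment 0 z"
    show "(L has_field_derivative - f w) (at w within closed_segment 0 z)"
      using deriv_L[of w] seg[OF w] sector_sub by (auto intro: DERIV_subset)
    show "norm (- f w) \<le> C0" using bound_f[OF seg[OF w]] by simp
  qed auto
  then show ?thesis by simp
qed

lemma phase_sum_deriv: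
  assumes w: "w \<notin> \<real>\<^sub>\<le>\<^sub>0"
  shows "(phase_sum N has_field_derivative trace_sum N w) (at w)"
proof -
  have 1: "((\<lambda>w. \<Sum>k\<le>1. phase_coeff j k * w powr of_real (1 - \<alpha> j) * Ln w ^ k) has_field_derivative
      (\<Sum>k\<le>1. b j k * w powr of_real (- \<alpha> j) * Ln w ^ k)) (at w)" if "j \<noteq> J" for j
    using power_log_has_field_derivative[OF w, of "1 - \<alpha> j" "b j 0" "b j 1"] exponents_neq_1[OF exps that]
    by (simp add: phase_coeff_def)
  have "((\<lambda>w. power_log_sum (\<lambda>j. 1 - \<alpha> j) J phase_coeff N w) has_field_derivative
      power_log_sum (\<lambda>j. - \<alpha> j) J b N w) (at w)"
    unfolding power_log_sum_def by (intro DERIV_sum 1) auto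
  moreover have "((\<lambda>w. b J 0 * Ln w) has_field_derivative b J 0 * inverse w) (at w)"
    using w by (auto intro!: derivative_eq_intros)
  ultimately have "((\<lambda>w. b J 0 * Ln w + power_log_sum (\<lambda>j. 1 - \<alpha> j) J phase_coeff N w)
      has_field_derivative b J 0 * inverse w + power_log_sum (\<lambda>j. - \<alpha> j) J b N w) (at w)"
    by (intro DERIV_add)
  then show ?thesis unfolding phase_sum_def[abs_def] trace_sum_def by (simp add: add.commute)
qed

text \<open>\<open>L z - phase_sum N (- z)\<close> has a derivative decaying faster than the
  reciprocal of \<open>cmod z\<close>. At this stage the constant may still depend on
  \<open>N\<close> and \<open>\<eta>\<close>.\<close>

lemma phase_constant_for:
  assumes "good N" "\<eta> > 0" "1 - \<alpha> N + \<eta> < 0"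
  shows "\<exists>l B R. R \<ge> 1 \<and> B \<ge> 0 \<and> (\<forall>z. cmod z \<ge> R \<longrightarrow> Re z \<le> cmod z * cos m \<longrightarrow>
    cmod (L z - phase_sum N (- z) - l) \<le> B * cmod z powr (1 - \<alpha> N + \<eta>))"
proof -
  have "(\<lambda>z. cmod (f z - trace_sum N (- z))) \<in> O[infinity_in U](\<lambda>z. cmod z powr (- \<alpha> N + \<eta>))"
    using assms by (simp add: good_def)
  then obtain c R where c: "c > 0" and R: "R \<ge> 1"
    and le: "\<And>z. z \<in> U \<Longrightarrow> cmod z \<ge> R \<Longrightarrow> \<bar>cmod (f z - trace_sum N (- z))\<bar> \<le> c * \<bar>cmod z powr (- \<alpha> N + \<eta>)\<bar>"
    by (rule infinity_in_bigoE) blast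
  define p where "p = \<alpha> N - \<eta>"
  have p: "p > 1" using assms(3) by (simp add: p_def)
  have "\<exists>l. \<forall>z. cmod z \<ge> R \<longrightarrow> Re z \<le> cmod z * cos m \<longrightarrow>
    cmod ((L z - phase_sum N (- z)) - l) \<le> c * (pi + 1 / (p - 1)) * cmod z powr (1 - p)"
  proof (rule asymptotic_constant_in_sector[where F' = "\<lambda>z. - f z - (- trace_sum N (- z))", OF _ p _ m])
    show "0 < R" "0 \<le> c" using R c by auto
    fix z assume z: "cmod z \<ge> R" "Re z \<le> cmod z * cos m"
    have zU: "z \<in> U" using sector_in_region[OF z(2)] sector_sub by auto
    have z0: "z \<noteq> 0" using z R by auto
    have "((\<lambda>z. phase_sum N (- z)) has_field_derivative trace_sum N (- z) * (- 1)) (at z)"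
      by (rule DERIV_chain2[where g = uminus, OF phase_sum_deriv[OF neg_not_nonpos_Reals[OF m z(2) z0]]])
         (auto intro!: derivative_eq_intros)
    then show "((\<lambda>z. L z - phase_sum N (- z)) has_field_derivative - f z - (- trace_sum N (- z))) (at z)"
      by (intro DERIV_diff deriv_L[OF zU]) simp
    have "cmod (- f z - (- trace_sum N (- z))) = cmod (f z - trace_sum N (- z))"
      by (metis minus_diff_minus norm_minus_cancel)
    then show "cmod (- f z - (- trace_sum N (- z))) \<le> c * cmod z powr (- p)"
      using le[OF zU z(1)] by (simp add: p_def)
  qed
  then obtain l where l: "\<And>z. cmod z \<ge> R \<Longrightarrow> Re z \<le> cmod z * cos m \<Longrightarrow>
    cmod ((L z - phase_sum N (- z)) - l) \<le> c * (pi + 1 / (p - 1)) * cmod z powr (1 - p)" by blast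
  show ?thesis
  proof (intro exI conjI allI impI)
    show "R \<ge> 1" "c * (pi + 1 / (p - 1)) \<ge> 0" using R c p by auto
    fix z assume "cmod z \<ge> R" "Re z \<le> cmod z * cos m"
    from l[OF this] show "cmod (L z - phase_sum N (- z) - l) \<le> c * (pi + 1 / (p - 1)) * cmod z powr (1 - \<alpha> N + \<eta>)"
      by (simp add: p_def algebra_simps)
  qed
qed

lemma phase_sum_diff_tendsto:
  assumes "\<alpha> N > 1" "N \<le> N'"
  shows "((\<lambda>x::real. phase_sum N' (of_real x) - phase_sum N (of_real x)) \<longlongrightarrow> 0) at_top"
proof -
  have neg: "1 - \<alpha> j < 0" if "j \<ge> N" for j
    using assms(1) exponents_less_iff[OF exps, of N j] that by (cases "j = N") auto
  have J: "J < N" using assms(1) exps exponents_less_iff[OF exps, of J N] by (simp add: exponents_def)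
  have "((\<lambda>x. \<Sum>j\<in>{N..<N'}. \<Sum>k\<le>1. phase_coeff j k * power_log (1 - \<alpha> j) k x) \<longlongrightarrow> 0) at_top"
    using neg by (intro tendsto_null_sum tendsto_mult_right_zero power_log_tendsto_0) auto
  moreover have "\<forall>\<^sub>F x in at_top. (\<Sum>j\<in>{N..<N'}. \<Sum>k\<le>1. phase_coeff j k * power_log (1 - \<alpha> j) k x)
      = phase_sum N' (of_real x) - phase_sum N (of_real x)"
    using eventually_gt_at_top[of "0::real"]
  proof eventually_elim
    case (elim x)
    let ?g = "\<lambda>j. \<Sum>k\<le>1. phase_coeff j k * power_log (1 - \<alpha> j) k x"
    have eq: "{..<N'} - {J} = ({..<N} - {J}) \<union> {N..<N'}" using assms(2) J by auto
    have "sum ?g ({..<N'} - {J}) = sum ?g ({..<N} - {J}) + sum ?g {N..<N'}"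
      unfolding eq by (rule sum.union_disjoint) auto
    then show ?case
      unfolding phase_sum_def power_log_sum_of_real[OF elim] by (simp only: add.assoc[symmetric] add_diff_cancel_left')
  qed
  ultimately show ?thesis by (rule Lim_transform_eventually)
qed

lemma phase_limit_on_axis:
  assumes "\<forall>z. cmod z \<ge> R \<longrightarrow> Re z \<le> cmod z * cos m \<longrightarrow>
    cmod (L z - phase_sum N (- z) - l) \<le> B * cmod z powr p" "p < 0"
  shows "((\<lambda>x::real. L (- of_real x) - phase_sum N (of_real x)) \<longlongrightarrow> l) at_top"
proof -
  have "((\<lambda>x::real. x powr p) \<longlongrightarrow> 0) at_top" using assms(2) by real_asymp
  from tendsto_mult_right_zero[OF this] have "((\<lambda>x::real. B * x powr p) \<longlongrightarrow> 0) at_top" .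
  moreover have "\<forall>\<^sub>F x in at_top. norm (L (- of_real x) - phase_sum N (of_real x) - l) \<le> B * x powr p"
    using eventually_ge_at_top[of "max R 0"]
  proof eventually_elim
    case (elim x)
    have "- x \<le> x * cos m" using elim cos_m by (simp add: order_trans[of "- x" 0])
    then show ?case using assms(1)[rule_format, of "- of_real x"] elim by simp
  qed
  ultimately have "((\<lambda>x::real. L (- of_real x) - phase_sum N (of_real x) - l) \<longlongrightarrow> 0) at_top"
    by (rule Lim_null_comparison[rotated])
  then show ?thesis by (rule LIM_zero_cancel)
qed

text \<open>One constant serves all \<open>N\<close>: on the negative axis it is a limit, and two
  phase sums with \<open>\<alpha> N > 1\<close> differ by terms with negative exponents
  only.\<close>

lemma phase_expansion:
  "\<exists>l. \<forall>N \<eta>. good N \<longrightarrow> \<eta> > 0 \<longrightarrow> 1 - \<alpha> N + \<eta> < 0 \<longrightarrow>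
    (\<exists>B R. R \<ge> 1 \<and> B \<ge> 0 \<and> (\<forall>z. cmod z \<ge> R \<longrightarrow> Re z \<le> cmod z * cos m \<longrightarrow>
      cmod (L z - phase_sum N (- z) - l) \<le> B * cmod z powr (1 - \<alpha> N + \<eta>)))"
proof -
  obtain N0 where N0: "good N0" using eventually_good by (auto simp: eventually_sequentially)
  define \<eta>0 where "\<eta>0 = (\<alpha> N0 - 1) / 2"
  have \<eta>0: "\<eta>0 > 0" "1 - \<alpha> N0 + \<eta>0 < 0" using N0 by (auto simp: \<eta>0_def good_def field_simps)
  obtain l B0 R0 where l: "R0 \<ge> 1" "B0 \<ge> 0" "\<forall>z. cmod z \<ge> R0 \<longrightarrow> Re z \<le> cmod z * cos m \<longrightarrow>
    cmod (L z - phase_sum N0 (- z) - l) \<le> B0 * cmod z powr (1 - \<alpha> N0 + \<eta>0)"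
    using phase_constant_for[OF N0 \<eta>0] by blast
  note lim0 = phase_limit_on_axis[OF l(3) \<eta>0(2)]
  show ?thesis
  proof (intro exI[of _ l] allI impI)
    fix N \<eta> assume N: "good N" and \<eta>: "\<eta> > 0" "1 - \<alpha> N + \<eta> < 0"
    obtain l' B R where l': "R \<ge> 1" "B \<ge> 0" "\<forall>z. cmod z \<ge> R \<longrightarrow> Re z \<le> cmod z * cos m \<longrightarrow>
      cmod (L z - phase_sum N (- z) - l') \<le> B * cmod z powr (1 - \<alpha> N + \<eta>)"
      using phase_constant_for[OF N \<eta>] by blast
    note lim = phase_limit_on_axis[OF l'(3) \<eta>(2)]
    have "((\<lambda>x::real. phase_sum N (of_real x) - phase_sum N0 (of_real x)) \<longlongrightarrow> 0) at_top"
    proof (cases "N0 \<le> N")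
      case True
      then show ?thesis using N0 by (intro phase_sum_diff_tendsto) (auto simp: good_def)
    next
      case False
      then have "((\<lambda>x::real. phase_sum N0 (of_real x) - phase_sum N (of_real x)) \<longlongrightarrow> 0) at_top"
        using N by (intro phase_sum_diff_tendsto) (auto simp: good_def)
      from tendsto_minus[OF this] show ?thesis by simp
    qed
    from tendsto_add[OF lim this] have "((\<lambda>x::real. L (- of_real x) - phase_sum N0 (of_real x)) \<longlongrightarrow> l') at_top"
      by simp
    then have "l' = l" using lim0 by (rule tendsto_unique[OF trivial_limit_at_top_linorder])
    then show "\<exists>B R. R \<ge> 1 \<and> B \<ge> 0 \<and> (\<forall>z. cmod z \<ge> R \<longrightarrow> Re z \<le> cmod z * cos m \<longrightarrow>
      cmod (L z - phase_sum N (- z) - l) \<le> B * cmod z powr (1 - \<alpha> N + \<eta>))"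
      using l' by blast
  qed
qed

text \<open>By \<open>expansion_at_infinity_L\<close> this is the constant that
  \<open>LIM_at_infinity\<close> extracts from the phase on the negative axis.\<close>

definition phase_const :: complex where
  "phase_const = (SOME l. \<forall>N \<eta>. good N \<longrightarrow> \<eta> > 0 \<longrightarrow> 1 - \<alpha> N + \<eta> < 0 \<longrightarrow>
    (\<exists>B R. R \<ge> 1 \<and> B \<ge> 0 \<and> (\<forall>z. cmod z \<ge> R \<longrightarrow> Re z \<le> cmod z * cos m \<longrightarrow>
      cmod (L z - phase_sum N (- z) - l) \<le> B * cmod z powr (1 - \<alpha> N + \<eta>))))"

lemma phase_const_bound:
  assumes "good N" "\<eta> > 0" "1 - \<alpha> N + \<eta> < 0"
  shows "\<exists>B R. R \<ge> 1 \<and> B \<ge> 0 \<and> (\<forall>z. cmod z \<ge> R \<longrightarrow> Re z \<le> cmod z * cos m \<longrightarrow>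
      cmod (L z - phase_sum N (- z) - phase_const) \<le> B * cmod z powr (1 - \<alpha> N + \<eta>))"
  by (rule someI_ex[OF phase_expansion, folded phase_const_def, rule_format, OF assms])

lemma expansion_at_infinity_L:
  "expansion_at_infinity \<alpha> J (\<lambda>\<mu>. L (- of_real \<mu>)) phase_const (b J 0) phase_coeff"
  unfolding expansion_at_infinity_def
  using eventually_good
proof eventually_elim
  case (elim N)
  show ?case
  proof (intro allI impI)
    fix \<eta> :: real assume \<eta>: "\<eta> > 0"
    \<comment> \<open>The bound on the phase requires a negative exponent, so \<open>\<eta>\<close>
      is capped; for large arguments a smaller \<open>\<eta>\<close> gives the stronger
      estimate.\<close>
    define \<eta>' where "\<eta>' = min \<eta> ((\<alpha> N - 1) / 2)"
    have "\<alpha> N > 1" using elim by (simp add: good_def)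
    then have \<eta>': "\<eta>' > 0" "1 - \<alpha> N + \<eta>' < 0" "\<eta>' \<le> \<eta>"
      using \<eta> by (auto simp: \<eta>'_def min_def field_simps)
    obtain B R where B: "R \<ge> 1" "B \<ge> 0" "\<And>z. cmod z \<ge> R \<Longrightarrow> Re z \<le> cmod z * cos m \<Longrightarrow>
      cmod (L z - phase_sum N (- z) - phase_const) \<le> B * cmod z powr (1 - \<alpha> N + \<eta>')"
      using phase_const_bound[OF elim \<eta>'(1,2)] by blast
    show "(\<lambda>\<mu>. cmod (L (- of_real \<mu>) - (phase_const + b J 0 * of_real (ln \<mu>)
        + power_log_sum (\<lambda>j. 1 - \<alpha> j) J phase_coeff N (of_real \<mu>))))
      \<in> O[at_top](\<lambda>\<mu>. \<mu> powr (1 - \<alpha> N + \<eta>))"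
    proof (intro bigoI[of _ B], use eventually_ge_at_top[of R] in eventually_elim)
      case (elim x)
      have x: "x \<ge> 1" using elim B(1) by simp
      have "- x \<le> x * cos m" using x cos_m by (simp add: order_trans[of "- x" 0])
      then have "cmod (L (- of_real x) - phase_sum N (of_real x) - phase_const) \<le> B * x powr (1 - \<alpha> N + \<eta>')"
        using B(3)[of "- of_real x"] elim x by simp
      also have "\<dots> \<le> B * x powr (1 - \<alpha> N + \<eta>)"
        using B(2) x \<eta>'(3) by (intro mult_left_mono powr_mono) auto
      finally show ?case using x by (simp add: phase_sum_def Ln_of_real algebra_simps)
    qed
  qed
qed

end

section \<open>Hankel contours\<close>

text \<open>The mean value inequality on the disc bounds the difference quotients by
  \<open>M\<close>, so dominated convergence applies along every sequence of increments.\<close>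

lemma dominated_field_derivative:
  fixes g g' :: "complex \<Rightarrow> real \<Rightarrow> complex"
  assumes d: "d > 0"
    and int: "\<And>s. s \<in> ball s0 d \<Longrightarrow> g s integrable_on S"
    and der: "\<And>s x. s \<in> ball s0 d \<Longrightarrow> x \<in> S \<Longrightarrow> ((\<lambda>s. g s x) has_field_derivative g' s x) (at s)"
    and bd: "\<And>s x. s \<in> ball s0 d \<Longrightarrow> x \<in> S \<Longrightarrow> cmod (g' s x) \<le> M x"
    and M: "M integrable_on S"
  shows "((\<lambda>s. integral S (g s)) has_field_derivative integral S (g' s0)) (at s0)"
proof -
  have s0: "s0 \<in> ball s0 d" using d by simp
  have lip: "cmod (g s x - g s0 x) \<le> M x * cmod (s - s0)" if "s \<in> ball s0 d" "x \<in> S" for s x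
    using that s0 der bd
    by (intro field_differentiable_bound[where S = "ball s0 d" and f' = "\<lambda>s. g' s x"])
       (auto intro: DERIV_subset)
  have "((\<lambda>h. (integral S (g (s0 + h)) - integral S (g s0)) / h) \<longlongrightarrow> integral S (g' s0)) (at 0)"
    unfolding tendsto_at_iff_sequentially
  proof (intro allI impI)
    fix h :: "nat \<Rightarrow> complex" assume h0: "\<forall>i. h i \<in> UNIV - {0}" and h: "h \<longlonglongrightarrow> 0"
    \<comment> \<open>The value 0 for increments that leave the disc makes the domination hold for
      every \<open>k\<close>.\<close>
    define f where "f k x = (if cmod (h k) < d then (g (s0 + h k) x - g s0 x) / h k else 0)" for k x
    have ev: "\<forall>\<^sub>F k in sequentially. cmod (h k) < d"
      using tendsto_norm[OF h] d by (intro order_tendstoD(2)[where y = "cmod 0"]) auto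
    have f_int: "f k integrable_on S" for k
    proof (cases "cmod (h k) < d")
      case True
      then show ?thesis unfolding f_def if_P[OF True] using s0
        by (intro integrable_on_divide integrable_diff int) (auto simp: dist_norm)
    next
      case False
      then show ?thesis by (simp add: f_def[abs_def] integrable_0)
    qed
    have f_le: "norm (f k x) \<le> M x" if x: "x \<in> S" for k x
    proof (cases "cmod (h k) < d")
      case True
      then have "s0 + h k \<in> ball s0 d" by (simp add: dist_norm)
      from lip[OF this x] show ?thesis using True h0 by (simp add: f_def norm_divide divide_le_eq)
    next
      case False
      then show ?thesis using order_trans[OF norm_ge_zero bd[OF s0 x]] by (simp add: f_def)
    qed
    have f_lim: "(\<lambda>k. f k x) \<longlonglongrightarrow> g' s0 x" if x: "x \<in> S" for x
    proof -
      have "((\<lambda>h. (g (s0 + h) x - g s0 x) / h) \<longlongrightarrow> g' s0 x) (at 0)"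
        using der[OF s0 x] by (simp add: DERIV_def)
      then have "(\<lambda>k. (g (s0 + h k) x - g s0 x) / h k) \<longlonglongrightarrow> g' s0 x"
        unfolding tendsto_at_iff_sequentially using h0 h by (auto simp: o_def)
      moreover have "\<forall>\<^sub>F k in sequentially. (g (s0 + h k) x - g s0 x) / h k = f k x"
        using ev by eventually_elim (simp add: f_def)
      ultimately show ?thesis by (rule Lim_transform_eventually)
    qed
    have "(\<lambda>k. integral S (f k)) \<longlonglongrightarrow> integral S (g' s0)"
      by (rule dominated_convergence(2)[OF f_int M f_le f_lim])
    moreover have "\<forall>\<^sub>F k in sequentially. integral S (f k)
        = (integral S (g (s0 + h k)) - integral S (g s0)) / h k"
      using ev
    proof eventually_elim
      case (elim k)
      then have "s0 + h k \<in> ball s0 d" by (simp add: dist_norm)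
      then show ?case
        using elim int s0 by (simp add: f_def[abs_def] integral_diff)
    qed
    ultimately show "((\<lambda>h. (integral S (g (s0 + h)) - integral S (g s0)) / h) \<circ> h) \<longlonglongrightarrow> integral S (g' s0)"
      unfolding o_def by (rule Lim_transform_eventually)
  qed
  then show ?thesis by (simp add: DERIV_def)
qed

lemma integral_halfline_tendsto:
  fixes g :: "real \<Rightarrow> complex"
  assumes g: "continuous_on {r..} g" and le: "\<And>x. x \<ge> r \<Longrightarrow> cmod (g x) \<le> M x" and M: "M integrable_on {r..}"
  shows "((\<lambda>X. integral {r..X} g) \<longlongrightarrow> integral {r..} g) at_top"
proof (rule tendsto_at_topI_sequentially)
  fix X :: "nat \<Rightarrow> real" assume X: "filterlim X at_top sequentially"
  define f where "f n x = (if x \<in> {r..X n} then g x else 0)" for n x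
  have restrict: "f n integrable_on {r..} \<and> integral {r..} (f n) = integral {r..X n} g" for n
  proof -
    have "{r..} \<inter> {r..X n} = {r..X n}" by auto
    moreover have "g integrable_on {r..X n}"
      by (rule integrable_continuous_interval, rule continuous_on_subset[OF g]) auto
    ultimately show ?thesis
      unfolding f_def[abs_def] using integrable_restrict_Int[of "{r..X n}" g "{r..}"]
        integral_restrict_Int[of "{r..}" "{r..X n}" g] by (simp add: Int_commute)
  qed
  have "(\<lambda>n. integral {r..} (f n)) \<longlonglongrightarrow> integral {r..} g"
  proof (rule dominated_convergence(2)[OF _ M])
    show "f n integrable_on {r..}" for n using restrict by blast
    show "norm (f n x) \<le> M x" if "x \<in> {r..}" for n x
      using le[of x] that order_trans[OF norm_ge_zero le[of x]] by (auto simp: f_def)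
    show "(\<lambda>n. f n x) \<longlonglongrightarrow> g x" if "x \<in> {r..}" for x
    proof (rule tendsto_eventually)
      have "\<forall>\<^sub>F n in sequentially. X n \<ge> x" using X by (simp add: filterlim_at_top)
      then show "\<forall>\<^sub>F n in sequentially. f n x = g x"
        by eventually_elim (use that in \<open>simp add: f_def\<close>)
    qed
  qed
  then show "(\<lambda>n. integral {r..X n} g) \<longlonglongrightarrow> integral {r..} g" using restrict by simp
qed

text \<open>Lets part of an exponential decay absorb any power; it is needed on half-lines bounded
  away from 0 only.\<close>

lemma powr_le_exp:
  fixes r c p :: real
  assumes "r > 0" "c > 0"
  shows "\<exists>B>0. \<forall>x\<ge>r. x powr p \<le> B * exp (c * x)"
proof -
  have "((\<lambda>x. x powr p * exp (- c * x)) \<longlongrightarrow> 0) at_top" using assms(2) by real_asymp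
  then have "\<forall>\<^sub>F x in at_top. x powr p * exp (- c * x) < 1" by (rule order_tendstoD) simp
  then obtain T where T: "\<And>x. x \<ge> T \<Longrightarrow> x powr p * exp (- c * x) < 1"
    by (auto simp: eventually_at_top_linorder)
  have "compact ((\<lambda>x. x powr p * exp (- c * x)) ` {r..max r T})"
    using assms(1) by (intro compact_continuous_image continuous_intros) auto
  from compact_imp_bounded[OF this] obtain N where
    N: "\<And>x. r \<le> x \<Longrightarrow> x \<le> max r T \<Longrightarrow> x powr p * exp (- c * x) \<le> N"
    unfolding bounded_iff by fastforce
  have "x powr p \<le> max N 1 * exp (c * x)" if "x \<ge> r" for x
  proof -
    have "x powr p * exp (- c * x) \<le> max N 1"
    proof (cases "x \<le> max r T")
      case True
      then show ?thesis using N[of x] that by simp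
    next
      case False
      then have "x powr p * exp (- c * x) < 1" by (intro T) simp
      then show ?thesis by simp
    qed
    then have "x powr p * exp (- c * x) * exp (c * x) \<le> max N 1 * exp (c * x)"
      by (rule mult_right_mono) simp
    then show ?thesis by (simp add: mult.assoc mult_exp_exp)
  qed
  then show ?thesis by (intro exI[of _ "max N 1"]) auto
qed

text \<open>Incoming argument \<open>a\<close>, outgoing argument \<open>b\<close>. Both rays lie in
  the open right half-plane, where \<open>exp (- z)\<close> decays, and every argument in between
  keeps the distance \<open>m\<close> from the positive axis.\<close>

locale hankel_contour =
  fixes m a b :: real
  assumes m_bounds: "0 < m" "m < pi / 2" and a_bounds: "m \<le> a" "a < pi / 2"
    and b_bounds: "3 * pi / 2 < b" "b \<le> 2 * pi - m"
begin

text \<open>The coordinate \<open>w\<close> with \<open>z = - exp w\<close>; \<open>Im w\<close> is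
  the argument of \<open>- z\<close>, so the ray of argument \<theta> becomes the horizontal line at
  height \<open>\<theta> - pi\<close>.\<close>

definition strip :: "complex set" where
  "strip = {w. \<bar>Im w\<bar> \<le> pi - m}"

definition exterior :: "real \<Rightarrow> complex set" where
  "exterior r = {z. r \<le> cmod z \<and> Re z \<le> cmod z * cos m}"

definition hankel :: "real \<Rightarrow> (complex \<Rightarrow> complex) \<Rightarrow> complex" where
  "hankel r F = ray_arc_integral r a b (\<lambda>x \<theta>. F (rcis x \<theta>))"

text \<open>Decay is demanded on the two rays only, since the weight \<open>exp (- z)\<close> grows
  in the left half-plane.\<close>

definition admissible :: "real \<Rightarrow> (complex \<Rightarrow> complex) \<Rightarrow> bool" where
  "admissible r F \<longleftrightarrow> continuous_on (exterior r) F \<and>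
    (\<exists>B c. B \<ge> 0 \<and> c > 0 \<and> (\<forall>x\<ge>r. \<forall>\<theta>\<in>{a, b}. cmod (F (rcis x \<theta>)) \<le> B * exp (- c * x)))"

definition \<kappa> :: real where "\<kappa> = min (cos a) (cos b)"

lemma cos_ab: "0 < cos a" "0 < cos b"
proof -
  show "0 < cos a" using m_bounds a_bounds by (intro cos_gt_zero_pi) auto
  have "0 < cos (2 * pi - b)" using b_bounds m_bounds by (intro cos_gt_zero_pi) auto
  then show "0 < cos b" by simp
qed

lemma \<kappa>: "0 < \<kappa>" "\<theta> \<in> {a, b} \<Longrightarrow> \<kappa> \<le> cos \<theta>"
  using cos_ab by (auto simp: \<kappa>_def)

lemma cos_le_cos_m:
  assumes "m \<le> \<theta>" "\<theta> \<le> 2 * pi - m"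
  shows "cos \<theta> \<le> cos m"
proof (cases "\<theta> \<le> pi")
  case True
  then show ?thesis using assms m_bounds by (intro cos_monotone_0_pi_le) auto
next
  case False
  then have "cos (2 * pi - \<theta>) \<le> cos m" using assms m_bounds by (intro cos_monotone_0_pi_le) auto
  then show ?thesis by simp
qed

lemma rcis_exterior:
  assumes "0 \<le> r" "r \<le> x" "m \<le> \<theta>" "\<theta> \<le> 2 * pi - m"
  shows "rcis x \<theta> \<in> exterior r"
  using assms cos_le_cos_m[OF assms(3,4)] by (auto simp: exterior_def mult_left_mono)

lemma angles: "m \<le> a" "a \<le> 2 * pi - m" "m \<le> b" "b \<le> 2 * pi - m" "a < b" "b - a \<le> 2 * pi"
  using m_bounds a_bounds b_bounds by auto

lemma ray_exterior: "0 \<le> r \<Longrightarrow> r \<le> x \<Longrightarrow> \<theta> \<in> {a, b} \<Longrightarrow> rcis x \<theta> \<in> exterior r"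
  using angles by (auto intro!: rcis_exterior)

lemma arc_angle:
  assumes "t \<in> {0..1}"
  shows "m \<le> a + t * (b - a)" "a + t * (b - a) \<le> 2 * pi - m"
proof -
  define u where "u = t * (b - a)"
  have "0 \<le> u" unfolding u_def using assms angles by (intro mult_nonneg_nonneg) auto
  then show "m \<le> a + t * (b - a)" using angles unfolding u_def by linarith
  have "u \<le> 1 * (b - a)" unfolding u_def using assms angles by (intro mult_right_mono) auto
  then have "u \<le> b - a" by simp
  then show "a + t * (b - a) \<le> 2 * pi - m" using angles unfolding u_def by linarith
qed

lemma arc_exterior:
  assumes "0 \<le> r" "t \<in> {0..1}"
  shows "rcis r (a + t * (b - a)) \<in> exterior r"
  using assms by (intro rcis_exterior arc_angle) auto

lemma convex_strip: "convex strip"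
proof -
  have "strip = {w. Im w \<le> pi - m} \<inter> {w. Im w \<ge> - (pi - m)}" by (auto simp: strip_def)
  then show ?thesis by (simp add: convex_Int convex_halfspace_Im_le convex_halfspace_Im_ge)
qed

lemma neg_exp_exterior:
  assumes "w \<in> strip" "r \<le> exp (Re w)"
  shows "- exp w \<in> exterior r"
proof -
  have "cos (pi - m) \<le> cos \<bar>Im w\<bar>"
    using assms m_bounds by (intro cos_monotone_0_pi_le) (auto simp: strip_def)
  then have "- cos m \<le> cos (Im w)" by simp
  then have "exp (Re w) * - cos m \<le> exp (Re w) * cos (Im w)" by (rule mult_left_mono) simp
  then show ?thesis using assms by (simp add: exterior_def Re_exp)
qed

lemma rcis_eq_neg_exp: "x > 0 \<Longrightarrow> rcis x \<theta> = - exp (Complex (ln x) (\<theta> - pi))"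
  by (simp add: complex_eq_iff Re_exp Im_exp)

lemma strip_Complex: "m \<le> \<theta> \<Longrightarrow> \<theta> \<le> 2 * pi - m \<Longrightarrow> Complex u (\<theta> - pi) \<in> strip"
  by (auto simp: strip_def)

lemma ray_continuous:
  assumes "0 \<le> r" "continuous_on (exterior r) F" "\<theta> \<in> {a, b}"
  shows "continuous_on {r..} (\<lambda>x. cis \<theta> * F (rcis x \<theta>))"
  by (intro continuous_intros continuous_on_compose2[OF assms(2)])
     (use assms ray_exterior in \<open>auto simp: rcis_def intro!: continuous_intros\<close>)

lemma arc_continuous:
  assumes "0 \<le> r" "continuous_on (exterior r) F"
  shows "continuous_on {0..1} (\<lambda>t. \<i> * of_real (b - a) * rcis r (a + t * (b - a)) * F (rcis r (a + t * (b - a))))"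
proof -
  have "continuous_on {0..1} (\<lambda>t. rcis r (a + t * (b - a)))"
    unfolding rcis_def cis_conv_exp by (intro continuous_intros)
  then show ?thesis
    by (intro continuous_intros continuous_on_compose2[OF assms(2)])
       (use arc_exterior[OF assms(1)] in auto)
qed

lemma admissible_integrable:
  assumes "0 \<le> r" "admissible r F" "\<theta> \<in> {a, b}"
  shows "(\<lambda>x. cis \<theta> * F (rcis x \<theta>)) integrable_on {r..}"
proof -
  obtain B c where B: "c > 0" "\<And>x. x \<ge> r \<Longrightarrow> cmod (F (rcis x \<theta>)) \<le> B * exp (- c * x)"
    using assms(2,3) unfolding admissible_def by blast
  have "(\<lambda>x. B * exp (- c * x)) integrable_on {r..}"
    using has_integral_exp_minus_to_infinity[OF B(1), of r] by (intro integrable_on_mult_right) blast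
  then show ?thesis
    using B(2) assms
    by (intro integrable_dominated_on_interval[OF _ _ ray_continuous])
       (auto simp: admissible_def norm_mult is_interval_def)
qed

lemma admissible_continuous: "admissible r F \<Longrightarrow> continuous_on (exterior r) F"
  by (simp add: admissible_def)

text \<open>The fundamental theorem of calculus is applied to each of the three pieces; the values
  of \<open>P\<close> at radius \<open>r\<close> cancel, leaving the two far ends.\<close>

lemma hankel_limit:
  assumes r: "r > 0" and F: "admissible r F"
    and P: "\<And>w. w \<in> strip \<Longrightarrow> r \<le> exp (Re w) \<Longrightarrow>
      (P has_field_derivative F (- exp w) * (- exp w)) (at w within strip)"
  shows "((\<lambda>X. P (Complex (ln X) (b - pi)) - P (Complex (ln X) (a - pi))) \<longlongrightarrow> hankel r F) at_top"
proof -
  have r0: "0 \<le> r" using r by simp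
  note cont = admissible_continuous[OF F]
  obtain B c where B: "c > 0" "\<And>x \<theta>. x \<ge> r \<Longrightarrow> \<theta> \<in> {a, b} \<Longrightarrow> cmod (F (rcis x \<theta>)) \<le> B * exp (- c * x)"
    using F unfolding admissible_def by blast
  have Bint: "(\<lambda>x. B * exp (- c * x)) integrable_on {r..}"
    using has_integral_exp_minus_to_infinity[OF B(1), of r] by (intro integrable_on_mult_right) blast
  have ray_lim: "((\<lambda>X. integral {r..X} (\<lambda>x. cis \<theta> * F (rcis x \<theta>)))
      \<longlongrightarrow> integral {r..} (\<lambda>x. cis \<theta> * F (rcis x \<theta>))) at_top" if "\<theta> \<in> {a, b}" for \<theta>
    using B(2)[OF _ that]
    by (intro integral_halfline_tendsto[OF ray_continuous[OF r0 cont that] _ Bint]) (simp add: norm_mult)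
  have ray_ftc: "integral {r..X} (\<lambda>x. cis \<theta> * F (rcis x \<theta>))
      = P (Complex (ln X) (\<theta> - pi)) - P (Complex (ln r) (\<theta> - pi))" if \<theta>: "\<theta> \<in> {a, b}" and X: "r \<le> X" for X \<theta>
  proof (rule integral_unique, rule fundamental_theorem_of_calculus[OF X])
    fix x assume x: "x \<in> {r..X}"
    define p where "p x = Complex (ln x) (\<theta> - pi)" for x
    have x0: "x > 0" using x r by auto
    have in_strip: "p y \<in> strip" for y
      using \<theta> angles by (auto simp: p_def intro!: strip_Complex)
    have "((\<lambda>x. of_real (ln x) + \<i> * of_real (\<theta> - pi)) has_vector_derivative of_real (1 / x)) (at x within {r..X})"
      using x0 by (auto intro!: derivative_eq_intros simp: has_real_derivative_iff_has_vector_derivative[symmetric])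
    then have "(p has_vector_derivative of_real (1 / x)) (at x within {r..X})"
      by (simp add: p_def[abs_def] Complex_eq)
    moreover have "(P has_field_derivative F (- exp (p x)) * (- exp (p x))) (at (p x) within p ` {r..X})"
      by (rule DERIV_subset[OF P[OF in_strip]]) (use x in_strip r in \<open>auto simp: p_def\<close>)
    ultimately have "(P \<circ> p has_vector_derivative of_real (1 / x) * (F (- exp (p x)) * (- exp (p x)))) (at x within {r..X})"
      by (rule field_vector_diff_chain_within)
    also have "- exp (p x) = rcis x \<theta>" using rcis_eq_neg_exp[OF x0] by (simp add: p_def)
    also have "of_real (1 / x) * (F (rcis x \<theta>) * rcis x \<theta>) = cis \<theta> * F (rcis x \<theta>)"
      using x0 by (simp add: rcis_def)
    finally show "((\<lambda>x. P (Complex (ln x) (\<theta> - pi))) has_vector_derivative cis \<theta> * F (rcis x \<theta>)) (at x within {r..X})"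
      by (simp add: o_def p_def)
  qed
  have arc_ftc: "integral {0..1} (\<lambda>t. \<i> * of_real (b - a) * rcis r (a + t * (b - a)) * F (rcis r (a + t * (b - a))))
      = P (Complex (ln r) (b - pi)) - P (Complex (ln r) (a - pi))"
  proof -
    define p where "p t = Complex (ln r) (a + t * (b - a) - pi)" for t
    have "((\<lambda>t. \<i> * of_real (b - a) * rcis r (a + t * (b - a)) * F (rcis r (a + t * (b - a))))
        has_integral (P \<circ> p) 1 - (P \<circ> p) 0) {0..1}"
    proof (rule fundamental_theorem_of_calculus)
      fix t :: real assume t: "t \<in> {0..1}"
      have in_strip: "p t \<in> strip" if "t \<in> {0..1}" for t
        unfolding p_def using that by (intro strip_Complex arc_angle)
      have "((\<lambda>t. of_real (ln r) + \<i> * of_real (a + t * (b - a) - pi)) has_vector_derivative \<i> * of_real (b - a)) (at t within {0..1})"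
        by (auto intro!: derivative_eq_intros simp: algebra_simps)
      then have "(p has_vector_derivative \<i> * of_real (b - a)) (at t within {0..1})"
        by (simp add: p_def[abs_def] Complex_eq)
      moreover have "(P has_field_derivative F (- exp (p t)) * (- exp (p t))) (at (p t) within p ` {0..1})"
        by (rule DERIV_subset[OF P[OF in_strip[OF t]]]) (use in_strip r in \<open>auto simp: p_def\<close>)
      ultimately have "(P \<circ> p has_vector_derivative \<i> * of_real (b - a) * (F (- exp (p t)) * (- exp (p t)))) (at t within {0..1})"
        by (rule field_vector_diff_chain_within)
      moreover have "- exp (p t) = rcis r (a + t * (b - a))" using rcis_eq_neg_exp[OF r] by (simp add: p_def)
      ultimately show "(P \<circ> p has_vector_derivative
          \<i> * of_real (b - a) * rcis r (a + t * (b - a)) * F (rcis r (a + t * (b - a)))) (at t within {0..1})"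
        by (simp add: mult_ac)
    qed simp
    from integral_unique[OF this] show ?thesis by (simp add: p_def)
  qed
  have lim: "((\<lambda>X. - integral {r..X} (\<lambda>x. cis a * F (rcis x a))
      + integral {0..1} (\<lambda>t. \<i> * of_real (b - a) * rcis r (a + t * (b - a)) * F (rcis r (a + t * (b - a))))
      + integral {r..X} (\<lambda>x. cis b * F (rcis x b))) \<longlongrightarrow> hankel r F) at_top"
    unfolding hankel_def ray_arc_integral_def
    by (intro tendsto_add tendsto_minus tendsto_const ray_lim) auto
  show ?thesis
  proof (rule Lim_transform_eventually[OF lim])
    show "\<forall>\<^sub>F X in at_top. - integral {r..X} (\<lambda>x. cis a * F (rcis x a))
      + integral {0..1} (\<lambda>t. \<i> * of_real (b - a) * rcis r (a + t * (b - a)) * F (rcis r (a + t * (b - a))))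
      + integral {r..X} (\<lambda>x. cis b * F (rcis x b)) = P (Complex (ln X) (b - pi)) - P (Complex (ln X) (a - pi))"
      using eventually_ge_at_top[of r]
      by eventually_elim (simp only: ray_ftc[OF insertI1] ray_ftc[OF insertI2[OF singletonI]] arc_ftc, simp)
  qed
qed

text \<open>\<open>- exp w\<close> is never 0, so \<open>F\<close> may be singular at 0; a primitive
  that would be multivalued in \<open>z\<close> is single valued on the convex strip.\<close>

lemma strip_primitive:
  assumes V: "open V" "F holomorphic_on V" and sub: "\<And>z. z \<noteq> 0 \<Longrightarrow> Re z \<le> cmod z * cos m \<Longrightarrow> z \<in> V"
  shows "\<exists>P. \<forall>w\<in>strip. (P has_field_derivative F (- exp w) * (- exp w)) (at w within strip)"
proof -
  have in_V: "- exp w \<in> V" if "w \<in> strip" for w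
    using neg_exp_exterior[OF that, of 0] by (intro sub) (auto simp: exterior_def)
  have diff: "(\<lambda>w. F (- exp w) * (- exp w)) field_differentiable at w" if "w \<in> strip" for w
  proof -
    have "F field_differentiable at (- exp w)"
      using V in_V[OF that] by (auto simp: holomorphic_on_open field_differentiable_def)
    moreover have "(\<lambda>w. - exp w) field_differentiable at w"
      by (intro field_differentiable_minus field_differentiable_within_exp)
    ultimately have "(F \<circ> (\<lambda>w. - exp w)) field_differentiable at w"
      by (intro field_differentiable_compose)
    then show ?thesis
      using \<open>(\<lambda>w. - exp w) field_differentiable at w\<close> unfolding o_def
      by (rule field_differentiable_mult)
  qed
  have "continuous_on strip (\<lambda>w. F (- exp w) * (- exp w))"
    using diff by (intro continuous_at_imp_continuous_on ballI field_differentiable_imp_continuous_at)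
  from holomorphic_convex_primitive[OF convex_strip finite.emptyI this] diff obtain P where
    "\<And>w. w \<in> strip \<Longrightarrow> (P has_field_derivative F (- exp w) * (- exp w)) (at w within strip)"
    using interior_subset by (metis Diff_empty subsetD)
  then show ?thesis by blast
qed

text \<open>Both integrals are limits of the same difference of one primitive, in which the radius
  no longer occurs.\<close>

lemma hankel_radius_independent:
  assumes r: "r > 0" "r' > 0" and F: "admissible r F" "admissible r' F"
    and V: "open V" "F holomorphic_on V" "\<And>z. z \<noteq> 0 \<Longrightarrow> Re z \<le> cmod z * cos m \<Longrightarrow> z \<in> V"
  shows "hankel r F = hankel r' F"
proof -
  obtain P where P: "\<And>w. w \<in> strip \<Longrightarrow> (P has_field_derivative F (- exp w) * (- exp w)) (at w within strip)"
    using strip_primitive[OF V] by blast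
  show ?thesis
    using hankel_limit[OF r(1) F(1) P] hankel_limit[OF r(2) F(2) P]
    by (rule tendsto_unique[OF trivial_limit_at_top_linorder])
qed

text \<open>A dilation of \<open>z\<close> is the translation of \<open>w\<close> by
  \<open>ln \<epsilon>\<close>, so the limit is taken along \<open>\<epsilon> * X\<close> instead of
  \<open>X\<close>.\<close>

lemma hankel_scale:
  assumes r: "r > 0" "r' > 0" "\<epsilon> > 0" and F: "admissible r F" "admissible r' (\<lambda>z. of_real \<epsilon> * F (of_real \<epsilon> * z))"
    and V: "open V" "F holomorphic_on V" "\<And>z. z \<noteq> 0 \<Longrightarrow> Re z \<le> cmod z * cos m \<Longrightarrow> z \<in> V"
  shows "hankel r' (\<lambda>z. of_real \<epsilon> * F (of_real \<epsilon> * z)) = hankel r F"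
proof -
  obtain P where P: "\<And>w. w \<in> strip \<Longrightarrow> (P has_field_derivative F (- exp w) * (- exp w)) (at w within strip)"
    using strip_primitive[OF V] by blast
  define Q where "Q w = P (w + of_real (ln \<epsilon>))" for w
  have exp_eq: "exp (w + of_real (ln \<epsilon>)) = of_real \<epsilon> * exp w" for w :: complex
    using r(3) by (simp add: exp_add exp_of_real mult.commute)
  have Q: "(Q has_field_derivative (of_real \<epsilon> * F (of_real \<epsilon> * - exp w)) * (- exp w)) (at w within strip)"
    if w: "w \<in> strip" for w
  proof -
    have img: "(\<lambda>w. w + of_real (ln \<epsilon>)) ` strip \<subseteq> strip" by (auto simp: strip_def)
    have ws: "w + of_real (ln \<epsilon>) \<in> strip" using w by (auto simp: strip_def)
    have "((\<lambda>w. w + of_real (ln \<epsilon>)) has_field_derivative 1) (at w within strip)"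
      by (auto intro!: derivative_eq_intros)
    from DERIV_image_chain[OF DERIV_subset[OF P[OF ws] img] this]
    show ?thesis by (simp add: Q_def[abs_def] o_def exp_eq mult_ac)
  qed
  have "filterlim (\<lambda>X. \<epsilon> * X) at_top at_top" using r(3) by real_asymp
  from filterlim_compose[OF hankel_limit[OF r(1) F(1) P] this]
  have "((\<lambda>X. P (Complex (ln (\<epsilon> * X)) (b - pi)) - P (Complex (ln (\<epsilon> * X)) (a - pi))) \<longlongrightarrow> hankel r F) at_top" by simp
  moreover have "\<forall>\<^sub>F X in at_top. P (Complex (ln (\<epsilon> * X)) (b - pi)) - P (Complex (ln (\<epsilon> * X)) (a - pi))
      = Q (Complex (ln X) (b - pi)) - Q (Complex (ln X) (a - pi))"
    using eventually_gt_at_top[of 0]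
  proof eventually_elim
    case (elim X)
    have "Complex (ln (\<epsilon> * X)) y = Complex (ln X) y + of_real (ln \<epsilon>)" for y
      using elim r(3) by (simp add: complex_eq_iff ln_mult)
    then show ?case by (simp add: Q_def)
  qed
  ultimately have "((\<lambda>X. Q (Complex (ln X) (b - pi)) - Q (Complex (ln X) (a - pi))) \<longlongrightarrow> hankel r F) at_top"
    by (rule Lim_transform_eventually)
  with hankel_limit[OF r(2) F(2) Q] show ?thesis
    by (rule tendsto_unique[OF trivial_limit_at_top_linorder])
qed

text \<open>The form in which integration by parts is used: \<open>E\<close> composed with
  \<open>- exp\<close> is the required primitive, and it vanishes at both ends.\<close>

lemma hankel_derivative_zero:
  assumes r: "r > 0" and F: "admissible r F"
    and E: "\<And>z. z \<in> exterior r \<Longrightarrow> (E has_field_derivative F z) (at z)"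
    and lim: "\<And>\<theta>. \<theta> \<in> {a, b} \<Longrightarrow> ((\<lambda>X. E (rcis X \<theta>)) \<longlongrightarrow> 0) at_top"
  shows "hankel r F = 0"
proof -
  have P: "((\<lambda>w. E (- exp w)) has_field_derivative F (- exp w) * (- exp w)) (at w within strip)"
    if "w \<in> strip" "r \<le> exp (Re w)" for w
  proof -
    have "((\<lambda>w. - exp w) has_field_derivative - exp w) (at w)" by (auto intro!: derivative_eq_intros)
    from DERIV_chain2[where g = "\<lambda>w. - exp w", OF E[OF neg_exp_exterior[OF that]] this]
    show ?thesis by (rule DERIV_subset) simp
  qed
  have "((\<lambda>X. E (rcis X b) - E (rcis X a)) \<longlongrightarrow> 0 - 0) at_top" by (intro tendsto_diff lim) auto
  moreover have "\<forall>\<^sub>F X in at_top. E (rcis X b) - E (rcis X a)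
      = E (- exp (Complex (ln X) (b - pi))) - E (- exp (Complex (ln X) (a - pi)))"
    using eventually_gt_at_top[of 0] by eventually_elim (simp add: rcis_eq_neg_exp)
  ultimately have "((\<lambda>X. E (- exp (Complex (ln X) (b - pi))) - E (- exp (Complex (ln X) (a - pi)))) \<longlongrightarrow> 0 - 0) at_top"
    by (rule Lim_transform_eventually)
  from tendsto_unique[OF trivial_limit_at_top_linorder hankel_limit[OF r F P] this] show ?thesis by simp
qed

lemma admissible_add:
  assumes "0 \<le> r" "admissible r F" "admissible r G"
  shows "admissible r (\<lambda>z. F z + G z)"
proof -
  obtain B c where B: "B \<ge> 0" "c > 0" "\<And>x \<theta>. x \<ge> r \<Longrightarrow> \<theta> \<in> {a, b} \<Longrightarrow> cmod (F (rcis x \<theta>)) \<le> B * exp (- c * x)"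
    using assms(2) unfolding admissible_def by blast
  obtain B' c' where B': "B' \<ge> 0" "c' > 0" "\<And>x \<theta>. x \<ge> r \<Longrightarrow> \<theta> \<in> {a, b} \<Longrightarrow> cmod (G (rcis x \<theta>)) \<le> B' * exp (- c' * x)"
    using assms(3) unfolding admissible_def by blast
  have "cmod (F (rcis x \<theta>) + G (rcis x \<theta>)) \<le> (B + B') * exp (- min c c' * x)"
    if x: "x \<ge> r" "\<theta> \<in> {a, b}" for x \<theta>
  proof -
    have "x \<ge> 0" using x assms(1) by simp
    then have "min c c' * x \<le> c * x" "min c c' * x \<le> c' * x" by (auto intro: mult_right_mono)
    then have "B * exp (- c * x) \<le> B * exp (- min c c' * x)" "B' * exp (- c' * x) \<le> B' * exp (- min c c' * x)"
      using B(1) B'(1) by (auto intro!: mult_left_mono)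
    then show ?thesis
      using norm_triangle_ineq[of "F (rcis x \<theta>)" "G (rcis x \<theta>)"] B(3)[OF x] B'(3)[OF x]
      unfolding distrib_right by linarith
  qed
  then show ?thesis
    unfolding admissible_def using assms B B'
    by (intro conjI continuous_on_add admissible_continuous exI[of _ "B + B'"] exI[of _ "min c c'"]) auto
qed

lemma admissible_cmult:
  assumes "admissible r F"
  shows "admissible r (\<lambda>z. k * F z)"
proof -
  obtain B c where B: "B \<ge> 0" "c > 0" "\<And>x \<theta>. x \<ge> r \<Longrightarrow> \<theta> \<in> {a, b} \<Longrightarrow> cmod (F (rcis x \<theta>)) \<le> B * exp (- c * x)"
    using assms unfolding admissible_def by blast
  have "cmod (k * F (rcis x \<theta>)) \<le> (cmod k * B) * exp (- c * x)" if x: "x \<ge> r" "\<theta> \<in> {a, b}" for x \<theta>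
    unfolding norm_mult mult.assoc using B(3)[OF x] by (intro mult_left_mono) auto
  then show ?thesis
    unfolding admissible_def using assms B
    by (intro conjI continuous_on_mult continuous_on_const admissible_continuous
        exI[of _ "cmod k * B"] exI[of _ c]) auto
qed

lemma admissible_cong:
  assumes "0 \<le> r" "admissible r F" "\<And>z. z \<in> exterior r \<Longrightarrow> F z = G z"
  shows "admissible r G"
proof -
  have "continuous_on (exterior r) F = continuous_on (exterior r) G"
    by (rule continuous_on_cong) (use assms(3) in auto)
  then have "continuous_on (exterior r) G" using assms(2) by (simp add: admissible_def)
  moreover have "G (rcis x \<theta>) = F (rcis x \<theta>)" if "x \<ge> r" "\<theta> \<in> {a, b}" for x \<theta>
    using assms(3)[OF ray_exterior[OF assms(1) that]] by simp
  ultimately show ?thesis using assms(2) unfolding admissible_def by (simp cong: conj_cong)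
qed

lemma hankel_cong:
  assumes "0 \<le> r" "\<And>z. z \<in> exterior r \<Longrightarrow> F z = G z"
  shows "hankel r F = hankel r G"
proof -
  have "integral {r..} (\<lambda>x. cis \<theta> * F (rcis x \<theta>)) = integral {r..} (\<lambda>x. cis \<theta> * G (rcis x \<theta>))"
    if "\<theta> \<in> {a, b}" for \<theta>
    using assms(2)[OF ray_exterior[OF assms(1) _ that]] by (intro integral_cong) auto
  moreover have "integral {0..1} (\<lambda>t. \<i> * of_real (b - a) * rcis r (a + t * (b - a)) * F (rcis r (a + t * (b - a))))
      = integral {0..1} (\<lambda>t. \<i> * of_real (b - a) * rcis r (a + t * (b - a)) * G (rcis r (a + t * (b - a))))"
    using assms(2)[OF arc_exterior[OF assms(1)]] by (intro integral_cong) auto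
  ultimately show ?thesis unfolding hankel_def ray_arc_integral_def by simp
qed

lemma hankel_add:
  assumes r: "0 \<le> r" and F: "admissible r F" and G: "admissible r G"
  shows "hankel r (\<lambda>z. F z + G z) = hankel r F + hankel r G"
proof -
  have ray: "integral {r..} (\<lambda>x. cis \<theta> * (F (rcis x \<theta>) + G (rcis x \<theta>)))
      = integral {r..} (\<lambda>x. cis \<theta> * F (rcis x \<theta>)) + integral {r..} (\<lambda>x. cis \<theta> * G (rcis x \<theta>))"
    if "\<theta> \<in> {a, b}" for \<theta>
    unfolding distrib_left
    by (rule integral_add[OF admissible_integrable[OF r F that] admissible_integrable[OF r G that]])
  have arc: "integral {0..1} (\<lambda>t. \<i> * of_real (b - a) * rcis r (a + t * (b - a)) * (F (rcis r (a + t * (b - a))) + G (rcis r (a + t * (b - a)))))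
      = integral {0..1} (\<lambda>t. \<i> * of_real (b - a) * rcis r (a + t * (b - a)) * F (rcis r (a + t * (b - a))))
      + integral {0..1} (\<lambda>t. \<i> * of_real (b - a) * rcis r (a + t * (b - a)) * G (rcis r (a + t * (b - a))))"
    unfolding distrib_left
    by (intro integral_add integrable_continuous_interval arc_continuous[OF r] admissible_continuous F G)
  show ?thesis
    unfolding hankel_def ray_arc_integral_def ray[OF insertI1] ray[OF insertI2[OF singletonI]] arc by simp
qed

lemma hankel_cmult: "hankel r (\<lambda>z. k * F z) = k * hankel r F"
proof -
  have "integral S (\<lambda>x. c x * (k * g x)) = k * integral S (\<lambda>x. c x * g x)" for S and c g :: "real \<Rightarrow> complex"
    unfolding mult.left_commute[of _ k] by (rule integral_mult_right)
  then show ?thesis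
    unfolding hankel_def ray_arc_integral_def by (simp only: distrib_left mult_minus_right)
qed

lemma hankel_sum:
  assumes r: "0 \<le> r" and "finite I" "\<And>i. i \<in> I \<Longrightarrow> admissible r (F i)"
  shows "admissible r (\<lambda>z. \<Sum>i\<in>I. F i z) \<and> hankel r (\<lambda>z. \<Sum>i\<in>I. F i z) = (\<Sum>i\<in>I. hankel r (F i))"
  using assms(2,3)
proof (induction I rule: finite_induct)
  case empty
  have "admissible r (\<lambda>z. 0)" unfolding admissible_def by (auto intro!: exI[of _ 0] exI[of _ 1])
  moreover have "hankel r (\<lambda>z. 0) = 0" using hankel_cmult[of r 0 "\<lambda>z. 0"] by simp
  ultimately show ?case by simp
next
  case (insert i I)
  then show ?case using admissible_add[OF r] hankel_add[OF r] by auto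
qed

lemma norm_exp_ray:
  assumes "0 \<le> s" "0 \<le> x" "\<theta> \<in> {a, b}"
  shows "cmod (exp (- of_real s * rcis x \<theta>)) \<le> exp (- (s * \<kappa>) * x)"
proof -
  have "s * x * \<kappa> \<le> s * x * cos \<theta>" using assms \<kappa>(2)[OF assms(3)] by (intro mult_left_mono) auto
  then show ?thesis by (simp add: mult_ac)
qed

text \<open>Half of the decay rate \<open>2 * c\<close> absorbs the power growth of
  \<open>k\<close>. The parameter \<open>s\<close> may be complex, as differentiation in
  \<open>s\<close> requires.\<close>

lemma exp_admissible_general:
  assumes r: "r > 0" and c: "c > 0"
    and s: "\<And>x \<theta>. x \<ge> r \<Longrightarrow> \<theta> \<in> {a, b} \<Longrightarrow> cmod (exp (- s * rcis x \<theta>)) \<le> exp (- (2 * c) * x)"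
    and k: "continuous_on (exterior r) k"
    and le: "\<And>z. z \<in> exterior r \<Longrightarrow> cmod (k z) \<le> B * cmod z powr p" and B: "B \<ge> 0"
  shows "admissible r (\<lambda>z. exp (- s * z) * k z)"
proof -
  obtain B' where B': "B' > 0" "\<And>x. x \<ge> r \<Longrightarrow> x powr p \<le> B' * exp (c * x)"
    using powr_le_exp[OF r c] by blast
  have "cmod (exp (- s * rcis x \<theta>) * k (rcis x \<theta>)) \<le> (B * B') * exp (- c * x)"
    if x: "x \<ge> r" "\<theta> \<in> {a, b}" for x \<theta>
  proof -
    have x0: "x \<ge> 0" using x r by simp
    have "cmod (k (rcis x \<theta>)) \<le> B * (B' * exp (c * x))"
      using le[OF ray_exterior[OF _ x]] r x0 B'(2)[OF x(1)] B
      by (simp add: order_trans[OF _ mult_left_mono])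
    then have "cmod (exp (- s * rcis x \<theta>) * k (rcis x \<theta>)) \<le> exp (- (2 * c) * x) * (B * (B' * exp (c * x)))"
      unfolding norm_mult using s[OF x] by (intro mult_mono) auto
    also have "\<dots> = (B * B') * (exp (- (2 * c) * x) * exp (c * x))" by simp
    also have "exp (- (2 * c) * x) * exp (c * x) = exp (- c * x)"
      unfolding exp_add[symmetric] by (simp add: field_simps)
    finally show ?thesis .
  qed
  then show ?thesis
    unfolding admissible_def using B B'(1) c k
    by (intro conjI exI[of _ "B * B'"] exI[of _ c]) (auto intro!: continuous_intros)
qed

lemma exp_admissible:
  assumes r: "r > 0" and s: "s > 0" and k: "continuous_on (exterior r) k"
    and le: "\<And>z. z \<in> exterior r \<Longrightarrow> cmod (k z) \<le> B * cmod z powr p" and B: "B \<ge> 0"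
  shows "admissible r (\<lambda>z. exp (- of_real s * z) * k z)"
proof (rule exp_admissible_general[OF r _ _ k le B])
  show "0 < s * \<kappa> / 2" using s \<kappa>(1) by simp
  show "cmod (exp (- of_real s * rcis x \<theta>)) \<le> exp (- (2 * (s * \<kappa> / 2)) * x)" if "x \<ge> r" "\<theta> \<in> {a, b}" for x \<theta>
    using norm_exp_ray[of s x \<theta>] that r s by simp
qed

text \<open>Each ray contributes at most the integral of \<open>M\<close>, and the arc has length at
  most \<open>2 * pi * r\<close>.\<close>

lemma hankel_bound:
  assumes r: "r > 0" and F: "admissible r F"
    and M: "\<And>x \<theta>. x \<ge> r \<Longrightarrow> \<theta> \<in> {a, b} \<Longrightarrow> cmod (F (rcis x \<theta>)) \<le> M x" "M integrable_on {r..}"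
    and Marc: "\<And>z. z \<in> exterior r \<Longrightarrow> cmod z = r \<Longrightarrow> cmod (F z) \<le> Marc"
  shows "cmod (hankel r F) \<le> 2 * integral {r..} M + 2 * pi * r * Marc"
proof -
  have r0: "0 \<le> r" using r by simp
  have ray: "cmod (integral {r..} (\<lambda>x. cis \<theta> * F (rcis x \<theta>))) \<le> integral {r..} M" if "\<theta> \<in> {a, b}" for \<theta>
    using M(1)[OF _ that]
    by (intro integral_norm_bound_integral admissible_integrable[OF r0 F that] M(2)) (simp add: norm_mult)
  have "cmod (integral {0..1} (\<lambda>t. \<i> * of_real (b - a) * rcis r (a + t * (b - a)) * F (rcis r (a + t * (b - a)))))
      \<le> integral {0..1::real} (\<lambda>t. 2 * pi * r * Marc)"
  proof (rule integral_norm_bound_integral)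
    fix t :: real assume t: "t \<in> {0..1}"
    have le: "cmod (F (rcis r (a + t * (b - a)))) \<le> Marc"
      using arc_exterior[OF r0 t] r by (intro Marc) auto
    have "cmod (\<i> * of_real (b - a)) * cmod (rcis r (a + t * (b - a))) * cmod (F (rcis r (a + t * (b - a))))
        \<le> (2 * pi) * r * Marc"
      using le r angles by (intro mult_mono) (auto simp: norm_mult simp flip: of_real_diff)
    then show "cmod (\<i> * of_real (b - a) * rcis r (a + t * (b - a)) * F (rcis r (a + t * (b - a)))) \<le> 2 * pi * r * Marc"
      by (simp only: norm_mult)
  qed (intro integrable_continuous_interval arc_continuous[OF r0] admissible_continuous F,
      rule integrable_const_ivl)
  then have arc: "cmod (integral {0..1} (\<lambda>t. \<i> * of_real (b - a) * rcis r (a + t * (b - a)) * F (rcis r (a + t * (b - a)))))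
      \<le> 2 * pi * r * Marc" by (simp only: integral_const_real) simp
  have tri: "cmod (- A + B + C) \<le> cmod A + cmod B + cmod C" for A B C
    using norm_triangle_ineq[of "- A + B" C] norm_triangle_ineq[of "- A" B] by simp
  show ?thesis
    unfolding hankel_def ray_arc_integral_def
    using order_trans[OF tri add_mono[OF add_mono[OF ray[OF insertI1] arc] ray[OF insertI2[OF singletonI]]]]
    by simp
qed

lemma hankel_has_field_derivative:
  assumes r: "r > 0" and d: "d > 0"
    and F: "\<And>s. s \<in> ball s0 d \<Longrightarrow> admissible r (F s)"
    and der: "\<And>s z. s \<in> ball s0 d \<Longrightarrow> z \<in> exterior r \<Longrightarrow> ((\<lambda>s. F s z) has_field_derivative F' s z) (at s)"
    and M: "\<And>s x \<theta>. s \<in> ball s0 d \<Longrightarrow> x \<ge> r \<Longrightarrow> \<theta> \<in> {a, b} \<Longrightarrow> cmod (F' s (rcis x \<theta>)) \<le> M x"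
      "M integrable_on {r..}"
    and Marc: "\<And>s z. s \<in> ball s0 d \<Longrightarrow> z \<in> exterior r \<Longrightarrow> cmod z = r \<Longrightarrow> cmod (F' s z) \<le> Marc"
  shows "((\<lambda>s. hankel r (F s)) has_field_derivative hankel r (F' s0)) (at s0)"
proof -
  have r0: "0 \<le> r" using r by simp
  have ray: "((\<lambda>s. integral {r..} (\<lambda>x. cis \<theta> * F s (rcis x \<theta>))) has_field_derivative
      integral {r..} (\<lambda>x. cis \<theta> * F' s0 (rcis x \<theta>))) (at s0)" if \<theta>: "\<theta> \<in> {a, b}" for \<theta>
  proof (rule dominated_field_derivative[OF d, where M = M])
    show "(\<lambda>x. cis \<theta> * F s (rcis x \<theta>)) integrable_on {r..}" if "s \<in> ball s0 d" for s
      by (rule admissible_integrable[OF r0 F[OF that] \<theta>])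
    show "((\<lambda>s. cis \<theta> * F s (rcis x \<theta>)) has_field_derivative cis \<theta> * F' s (rcis x \<theta>)) (at s)"
      if "s \<in> ball s0 d" "x \<in> {r..}" for s x
      using that ray_exterior[OF r0 _ \<theta>] by (intro DERIV_cmult der) auto
    show "cmod (cis \<theta> * F' s (rcis x \<theta>)) \<le> M x" if "s \<in> ball s0 d" "x \<in> {r..}" for s x
      using M(1)[OF that(1) _ \<theta>] that(2) by (simp add: norm_mult)
  qed (rule M(2))
  have arc: "((\<lambda>s. integral {0..1} (\<lambda>t. \<i> * of_real (b - a) * rcis r (a + t * (b - a)) * F s (rcis r (a + t * (b - a)))))
      has_field_derivative integral {0..1} (\<lambda>t. \<i> * of_real (b - a) * rcis r (a + t * (b - a)) * F' s0 (rcis r (a + t * (b - a))))) (at s0)"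
  proof (rule dominated_field_derivative[OF d, where M = "\<lambda>t. (2 * pi) * r * Marc"])
    fix s assume s: "s \<in> ball s0 d"
    show "(\<lambda>t. \<i> * of_real (b - a) * rcis r (a + t * (b - a)) * F s (rcis r (a + t * (b - a)))) integrable_on {0..1}"
      by (intro integrable_continuous_interval arc_continuous[OF r0] admissible_continuous F s)
    fix t :: real assume t: "t \<in> {0..1}"
    show "((\<lambda>s. \<i> * of_real (b - a) * rcis r (a + t * (b - a)) * F s (rcis r (a + t * (b - a))))
        has_field_derivative \<i> * of_real (b - a) * rcis r (a + t * (b - a)) * F' s (rcis r (a + t * (b - a)))) (at s)"
      by (intro DERIV_cmult der s arc_exterior[OF r0 t])
    have le: "cmod (F' s (rcis r (a + t * (b - a)))) \<le> Marc"
      using arc_exterior[OF r0 t] r by (intro Marc s) auto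
    have "cmod (\<i> * of_real (b - a)) * cmod (rcis r (a + t * (b - a))) * cmod (F' s (rcis r (a + t * (b - a))))
        \<le> (2 * pi) * r * Marc"
      using le r angles by (intro mult_mono) (auto simp: norm_mult simp flip: of_real_diff)
    then show "cmod (\<i> * of_real (b - a) * rcis r (a + t * (b - a)) * F' s (rcis r (a + t * (b - a)))) \<le> (2 * pi) * r * Marc"
      by (simp only: norm_mult)
  qed (rule integrable_const_ivl)
  show ?thesis
    unfolding hankel_def ray_arc_integral_def by (intro DERIV_add DERIV_minus ray arc) auto
qed

end

section \<open>Hankel's integral for the reciprocal Gamma function\<close>

lemma continuous_on_gamma_kernel:
  assumes \<beta>: "1 < \<beta>"
  shows "continuous_on {0..} (\<lambda>t::real. t powr (\<beta> - 1) / exp t)"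
proof -
  have "continuous_on {0..} (\<lambda>t::real. t powr (\<beta> - 1))"
    by (rule continuous_on_powr'[OF continuous_on_id continuous_on_const]) (use \<beta> in auto)
  moreover have "continuous_on {0..} (\<lambda>t::real. exp t)" by (rule continuous_on_exp[OF continuous_on_id])
  ultimately show ?thesis by (rule continuous_on_divide) simp
qed

context hankel_contour
begin

text \<open>The integrand of Hankel's formula for \<open>rGamma (1 - \<beta>)\<close>; at
  \<open>\<beta> = 0\<close> its derivative in \<beta> brings down \<open>Ln (- z)\<close>.\<close>

definition gamma_integrand :: "complex \<Rightarrow> complex \<Rightarrow> complex" where
  "gamma_integrand \<beta> z = exp (- z) * ((- z) powr \<beta> / z)"

lemma exterior_1D:
  assumes "z \<in> exterior 1"
  shows "1 \<le> cmod z" "z \<noteq> 0" "- z \<notin> \<real>\<^sub>\<le>\<^sub>0"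
proof -
  show "1 \<le> cmod z" using assms by (simp add: exterior_def)
  then show "z \<noteq> 0" by auto
  then show "- z \<notin> \<real>\<^sub>\<le>\<^sub>0"
    using assms by (intro neg_not_nonpos_Reals[OF m_bounds]) (simp_all add: exterior_def)
qed

lemma norm_Ln_le: "w \<noteq> 0 \<Longrightarrow> cmod (Ln w) \<le> \<bar>ln (cmod w)\<bar> + pi"
  using cmod_le[of "Ln w"] Im_Ln_le_pi[of w] mpi_less_Im_Ln[of w] by auto

text \<open>The disc of radius 3 contains 0, where the formula is needed, and the real interval from
  1 to 2, where it is computed. The factor \<open>exp (3 * pi)\<close> bounds the effect of the
  argument of \<open>- z\<close>.\<close>

lemma gamma_integrand_bound:
  assumes \<beta>: "cmod \<beta> < 3" and z: "z \<in> exterior 1"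
  shows "cmod ((- z) powr \<beta> / z) \<le> exp (3 * pi) * cmod z powr 3"
    and "cmod ((- z) powr \<beta> / z * Ln (- z)) \<le> exp (3 * pi) * (1 + pi) * cmod z powr 3"
proof -
  have z1: "1 \<le> cmod z" "z \<noteq> 0" using exterior_1D[OF z] by auto
  have ln: "0 \<le> ln (cmod z)" "ln (cmod z) \<le> cmod z" using z1 ln_bound[of "cmod z"] by auto
  have Ln: "cmod (Ln (- z)) \<le> ln (cmod z) + pi" using norm_Ln_le[of "- z"] z1 ln by simp
  have "Re (\<beta> * Ln (- z)) \<le> cmod \<beta> * cmod (Ln (- z))"
    using complex_Re_le_cmod[of "\<beta> * Ln (- z)"] by (simp add: norm_mult)
  also have "\<dots> \<le> 3 * (ln (cmod z) + pi)" using \<beta> Ln ln by (intro mult_mono) auto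
  finally have "cmod ((- z) powr \<beta>) \<le> exp (3 * pi + 3 * ln (cmod z))"
    using z1 by (simp add: powr_def)
  also have "\<dots> = exp (3 * pi) * cmod z powr 3" using z1 by (simp add: exp_add powr_def)
  finally have p: "cmod ((- z) powr \<beta>) \<le> exp (3 * pi) * cmod z powr 3" .
  have "cmod ((- z) powr \<beta> / z) \<le> cmod ((- z) powr \<beta>)"
    using z1 mult_right_mono[OF z1(1), of "cmod ((- z) powr \<beta>)"] by (simp add: norm_divide divide_le_eq mult.commute)
  then show "cmod ((- z) powr \<beta> / z) \<le> exp (3 * pi) * cmod z powr 3" using p by simp
  have "pi * 1 \<le> pi * cmod z" using z1 by (intro mult_left_mono) auto
  then have "cmod (Ln (- z)) \<le> (1 + pi) * cmod z"
    using Ln ln unfolding distrib_right by linarith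
  then have "cmod ((- z) powr \<beta>) * cmod (Ln (- z)) \<le> (exp (3 * pi) * cmod z powr 3) * ((1 + pi) * cmod z)"
    using p by (intro mult_mono) auto
  then show "cmod ((- z) powr \<beta> / z * Ln (- z)) \<le> exp (3 * pi) * (1 + pi) * cmod z powr 3"
    using z1 by (simp add: norm_mult norm_divide divide_le_eq mult_ac)
qed

lemma gamma_integrand_continuous:
  "continuous_on (exterior 1) (\<lambda>z. (- z) powr \<beta> / z)"
  "continuous_on (exterior 1) (\<lambda>z. (- z) powr \<beta> / z * Ln (- z))"
proof -
  have Ln: "continuous_on (exterior 1) (\<lambda>z. Ln (- z))"
    by (intro continuous_on_Ln' continuous_intros) (rule exterior_1D(3))
  have powr: "exp (\<beta> * Ln (- z)) = (- z) powr \<beta>" if "z \<in> exterior 1" for z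
    using exterior_1D(2)[OF that] by (simp add: powr_def)
  have "continuous_on (exterior 1) (\<lambda>z. exp (\<beta> * Ln (- z)) / z)"
    using exterior_1D(2) by (intro continuous_intros Ln) auto
  then show 1: "continuous_on (exterior 1) (\<lambda>z. (- z) powr \<beta> / z)"
    by (rule continuous_on_eq) (simp add: powr)
  show "continuous_on (exterior 1) (\<lambda>z. (- z) powr \<beta> / z * Ln (- z))"
    by (rule continuous_on_mult[OF 1 Ln])
qed

lemma gamma_integrand_admissible: "cmod \<beta> < 3 \<Longrightarrow> admissible 1 (gamma_integrand \<beta>)"
  using exp_admissible[OF zero_less_one zero_less_one gamma_integrand_continuous(1)[of \<beta>] gamma_integrand_bound(1)]
  by (simp add: gamma_integrand_def[abs_def])

lemma gamma_hankel_deriv: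
  assumes s0: "cmod s0 < 3"
  shows "((\<lambda>\<beta>. hankel 1 (gamma_integrand \<beta>)) has_field_derivative
    hankel 1 (\<lambda>z. gamma_integrand s0 z * Ln (- z))) (at s0)"
proof -
  obtain B where B: "B > 0" "\<And>x. x \<ge> 1 \<Longrightarrow> x powr 3 \<le> B * exp (\<kappa> / 2 * x)"
    using powr_le_exp[of 1 "\<kappa> / 2" 3] \<kappa>(1) by auto
  define A where "A = exp (3 * pi) * (1 + pi)"
  have A: "A \<ge> 0" using pi_gt_zero by (simp add: A_def)
  have split: "gamma_integrand s z * Ln (- z) = exp (- of_real 1 * z) * ((- z) powr s / z * Ln (- z))" for s z
    by (simp add: gamma_integrand_def)
  define d where "d = 3 - cmod s0"
  have sd: "cmod s < 3" if "s \<in> ball s0 d" for s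
    using that norm_triangle_ineq[of s0 "s - s0"] by (simp add: d_def dist_norm norm_minus_commute)
  show ?thesis
  proof (rule hankel_has_field_derivative[where d = d and M = "\<lambda>x. A * B * exp (- (\<kappa> / 2) * x)" and Marc = "exp 1 * A"])
    show "d > 0" using s0 by (simp add: d_def)
    show "(\<lambda>x. A * B * exp (- (\<kappa> / 2) * x)) integrable_on {1..}"
      using has_integral_exp_minus_to_infinity[of "\<kappa> / 2" 1] \<kappa>(1) by (intro integrable_on_mult_right) auto
    fix s assume s: "s \<in> ball s0 d"
    show "admissible 1 (gamma_integrand s)" by (rule gamma_integrand_admissible[OF sd[OF s]])
    show "((\<lambda>s. gamma_integrand s z) has_field_derivative gamma_integrand s z * Ln (- z)) (at s)"
      if z: "z \<in> exterior 1" for z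
      unfolding gamma_integrand_def using exterior_1D[OF z]
      by (auto intro!: derivative_eq_intros)
    show "cmod (gamma_integrand s (rcis x \<theta>) * Ln (- rcis x \<theta>)) \<le> A * B * exp (- (\<kappa> / 2) * x)"
      if x: "1 \<le> x" "\<theta> \<in> {a, b}" for x \<theta>
    proof -
      have "cmod ((- rcis x \<theta>) powr s / rcis x \<theta> * Ln (- rcis x \<theta>)) \<le> A * x powr 3"
        using gamma_integrand_bound(2)[OF sd[OF s] ray_exterior[OF zero_le_one x]] x by (simp add: A_def)
      also have "\<dots> \<le> A * (B * exp (\<kappa> / 2 * x))" using B(2)[OF x(1)] A by (rule mult_left_mono)
      finally have "cmod (exp (- of_real 1 * rcis x \<theta>)) * cmod ((- rcis x \<theta>) powr s / rcis x \<theta> * Ln (- rcis x \<theta>))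
          \<le> exp (- (1 * \<kappa>) * x) * (A * (B * exp (\<kappa> / 2 * x)))"
        using x by (intro mult_mono norm_exp_ray) auto
      also have "\<dots> = A * B * (exp (- (1 * \<kappa>) * x) * exp (\<kappa> / 2 * x))" by simp
      also have "exp (- (1 * \<kappa>) * x) * exp (\<kappa> / 2 * x) = exp (- (\<kappa> / 2) * x)"
        unfolding exp_add[symmetric] by (simp add: field_simps)
      finally show ?thesis by (simp only: split norm_mult[of "exp (- of_real 1 * rcis x \<theta>)"])
    qed
    show "cmod (gamma_integrand s z * Ln (- z)) \<le> exp 1 * A" if z: "z \<in> exterior 1" "cmod z = 1" for z
    proof -
      have "cmod (exp (- of_real 1 * z)) \<le> exp 1" using z(2) complex_Re_le_cmod[of "- z"] by simp
      then have "cmod (exp (- of_real 1 * z)) * cmod ((- z) powr s / z * Ln (- z)) \<le> exp 1 * A"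
        using gamma_integrand_bound(2)[OF sd[OF s] z(1)] z(2) by (intro mult_mono) (auto simp: A_def)
      then show ?thesis by (simp only: split norm_mult[of "exp (- of_real 1 * z)"])
    qed
  qed simp
qed

text \<open>In the coordinate \<open>z = - exp w\<close> the integrand is entire, so the ends of the contour can be
  moved to the lines \<open>Im w = \<plusminus> pi\<close>, where it becomes the integrand of the Gamma function.\<close>

lemma hankel_gamma_real:
  assumes \<beta>: "1 < \<beta>" "\<beta> < (2::real)"
  shows "hankel 1 (gamma_integrand (of_real \<beta>)) = 2 * \<i> * sin (of_real (pi * \<beta>)) * of_real (Gamma \<beta>)"
proof -
  define q where "q w = exp (exp w + of_real \<beta> * w)" for w :: complex
  have "q holomorphic_on UNIV" unfolding q_def by (intro holomorphic_intros)
  from holomorphic_convex_primitive'[OF convex_UNIV open_UNIV this] obtain P where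
    P: "\<And>w. (P has_field_derivative q w) (at w)" by auto
  have norm_q: "cmod (q (Complex u y)) = exp (exp u * cos y + \<beta> * u)" for u y
    by (simp add: q_def Re_exp)
  have lim_H: "((\<lambda>X. P (Complex (ln X) (b - pi)) - P (Complex (ln X) (a - pi)))
      \<longlongrightarrow> hankel 1 (gamma_integrand (of_real \<beta>))) at_top"
  proof (rule hankel_limit)
    show "admissible 1 (gamma_integrand (of_real \<beta>))" using \<beta> by (intro gamma_integrand_admissible) auto
    fix w assume w: "w \<in> strip"
    have "Ln (exp w) = w" using w m_bounds by (intro Ln_exp) (auto simp: strip_def)
    then have "gamma_integrand (of_real \<beta>) (- exp w) * - exp w = q w"
      by (simp add: gamma_integrand_def q_def powr_def exp_add)
    then show "(P has_field_derivative gamma_integrand (of_real \<beta>) (- exp w) * - exp w) (at w within strip)"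
      using P[of w] by (simp add: has_field_derivative_at_within)
  qed simp
  \<comment> \<open>The mean value inequality on a vertical segment, on which the modulus of
    \<open>q\<close> is given by \<open>norm_q\<close>.\<close>
  have vertical: "cmod (P (Complex u y2) - P (Complex u y1)) \<le> D * (y2 - y1)"
    if "y1 \<le> y2" "\<And>y. y1 \<le> y \<Longrightarrow> y \<le> y2 \<Longrightarrow> exp (exp u * cos y + \<beta> * u) \<le> D" for u y1 y2 D
  proof -
    have "norm (P (Complex u y2) - P (Complex u y1)) \<le> D * norm (Complex u y2 - Complex u y1)"
    proof (rule field_differentiable_bound[where S = "closed_segment (Complex u y1) (Complex u y2)" and f' = q])
      fix w assume w: "w \<in> closed_segment (Complex u y1) (Complex u y2)"
      then obtain t where t: "0 \<le> t" "t \<le> 1" "w = Complex u (y1 + t * (y2 - y1))"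
        by (auto simp: in_segment complex_eq_iff algebra_simps)
      have "0 \<le> t * (y2 - y1)" "t * (y2 - y1) \<le> 1 * (y2 - y1)"
        using t that(1) mult_left_le_one_le[of "y2 - y1" t] by simp_all
      then have "exp (exp u * cos (y1 + t * (y2 - y1)) + \<beta> * u) \<le> D" by (intro that(2)) auto
      then show "norm (q w) \<le> D" unfolding t(3) norm_q .
      show "(P has_field_derivative q w) (at w within closed_segment (Complex u y1) (Complex u y2))"
        using P by (rule has_field_derivative_at_within)
    qed auto
    also have "norm (Complex u y2 - Complex u y1) = y2 - y1" using that(1) by (simp add: cmod_def)
    finally show ?thesis .
  qed
  \<comment> \<open>Between the outgoing ray and the line at height \<open>pi\<close> the cosine is
    at most \<open>- cos b < 0\<close>, so \<open>q\<close> is exponentially small in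
    \<open>X\<close> there.\<close>
  have upper: "((\<lambda>X. P (Complex (ln X) pi) - P (Complex (ln X) (b - pi))) \<longlongrightarrow> 0) at_top"
  proof (rule Lim_null_comparison)
    show "\<forall>\<^sub>F X in at_top. norm (P (Complex (ln X) pi) - P (Complex (ln X) (b - pi)))
        \<le> exp (- cos b * X + \<beta> * ln X) * (pi - (b - pi))"
      using eventually_gt_at_top[of 0]
    proof eventually_elim
      case (elim X)
      show ?case
      proof (rule vertical)
        show "b - pi \<le> pi" using b_bounds m_bounds by simp
        fix y assume y: "b - pi \<le> y" "y \<le> pi"
        have "cos y \<le> cos (b - pi)" using y b_bounds m_bounds by (intro cos_monotone_0_pi_le) auto
        then have "X * cos y \<le> X * - cos b" using elim by (intro mult_left_mono) auto
        then show "exp (exp (ln X) * cos y + \<beta> * ln X) \<le> exp (- cos b * X + \<beta> * ln X)"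
          using elim by (simp add: mult.commute)
      qed
    qed
    have "((\<lambda>X. exp (- cos b * X + \<beta> * ln X)) \<longlongrightarrow> 0) at_top" using cos_ab(2) by real_asymp
    then show "((\<lambda>X. exp (- cos b * X + \<beta> * ln X) * (pi - (b - pi))) \<longlongrightarrow> 0) at_top"
      by (rule tendsto_mult_left_zero)
  qed
  have lower: "((\<lambda>X. P (Complex (ln X) (a - pi)) - P (Complex (ln X) (- pi))) \<longlongrightarrow> 0) at_top"
  proof (rule Lim_null_comparison)
    show "\<forall>\<^sub>F X in at_top. norm (P (Complex (ln X) (a - pi)) - P (Complex (ln X) (- pi)))
        \<le> exp (- cos a * X + \<beta> * ln X) * (a - pi - - pi)"
      using eventually_gt_at_top[of 0]
    proof eventually_elim
      case (elim X)
      show ?case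
      proof (rule vertical)
        show "- pi \<le> a - pi" using a_bounds m_bounds by simp
        fix y assume y: "- pi \<le> y" "y \<le> a - pi"
        have "cos (- y) \<le> cos (pi - a)" using y a_bounds m_bounds by (intro cos_monotone_0_pi_le) auto
        then have "X * cos y \<le> X * - cos a" using elim by (intro mult_left_mono) auto
        then show "exp (exp (ln X) * cos y + \<beta> * ln X) \<le> exp (- cos a * X + \<beta> * ln X)"
          using elim by (simp add: mult.commute)
      qed
    qed
    have "((\<lambda>X. exp (- cos a * X + \<beta> * ln X)) \<longlongrightarrow> 0) at_top" using cos_ab(1) by real_asymp
    then show "((\<lambda>X. exp (- cos a * X + \<beta> * ln X) * (a - pi - - pi)) \<longlongrightarrow> 0) at_top"
      by (rule tendsto_mult_left_zero)
  qed
  \<comment> \<open>The difference of the primitive between the lines at heights \<open>pi\<close>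
    and \<open>- pi\<close>, as a function of the radius. The value 0 at the origin is its limit, so
    the whole half-line can be used.\<close>
  define \<Phi> where "\<Phi> x = (if x \<le> 0 then 0 else P (Complex (ln x) pi) - P (Complex (ln x) (- pi)))" for x
  define S where "S = 2 * \<i> * sin (of_real (pi * \<beta>))"
  define g where "g t = (of_real (t powr (\<beta> - 1) / exp t) :: complex)" for t :: real
  have "((\<lambda>X. (P (Complex (ln X) (b - pi)) - P (Complex (ln X) (a - pi)))
      + (P (Complex (ln X) pi) - P (Complex (ln X) (b - pi)))
      + (P (Complex (ln X) (a - pi)) - P (Complex (ln X) (- pi))))
      \<longlongrightarrow> hankel 1 (gamma_integrand (of_real \<beta>)) + 0 + 0) at_top"
    by (intro tendsto_add lim_H upper lower)
  moreover have "\<forall>\<^sub>F X in at_top. (P (Complex (ln X) (b - pi)) - P (Complex (ln X) (a - pi)))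
      + (P (Complex (ln X) pi) - P (Complex (ln X) (b - pi)))
      + (P (Complex (ln X) (a - pi)) - P (Complex (ln X) (- pi))) = \<Phi> X"
    using eventually_gt_at_top[of 0] by eventually_elim (simp add: \<Phi>_def)
  ultimately have "(\<Phi> \<longlongrightarrow> hankel 1 (gamma_integrand (of_real \<beta>)) + 0 + 0) at_top"
    by (rule Lim_transform_eventually)
  then have \<Phi>_lim: "(\<Phi> \<longlongrightarrow> hankel 1 (gamma_integrand (of_real \<beta>))) at_top" by simp
  have \<Phi>_deriv: "(\<Phi> has_vector_derivative S * g x) (at x)" if x: "x > 0" for x
  proof -
    have side: "((\<lambda>x. P (Complex (ln x) y)) has_vector_derivative of_real (1 / x) * q (Complex (ln x) y)) (at x)" for y
    proof -
      have "((\<lambda>x. of_real (ln x) + \<i> * of_real y) has_vector_derivative of_real (1 / x)) (at x)"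
        using x by (auto intro!: derivative_eq_intros simp: has_real_derivative_iff_has_vector_derivative[symmetric])
      then have "((\<lambda>x. Complex (ln x) y) has_vector_derivative of_real (1 / x)) (at x)"
        by (simp add: Complex_eq)
      from field_vector_diff_chain_at[OF this P] show ?thesis by (simp add: o_def)
    qed
    have q_pm: "q (Complex (ln x) y) = of_real (x * (x powr (\<beta> - 1) / exp x)) * exp (\<i> * of_real (\<beta> * y))"
      if "y = pi \<or> y = - pi" for y
    proof -
      have e: "exp (Complex (ln x) y) = - of_real x"
        using x that by (auto simp: complex_eq_iff Re_exp Im_exp)
      have "of_real \<beta> * Complex (ln x) y = of_real (\<beta> * ln x) + \<i> * of_real (\<beta> * y)"
        by (simp add: complex_eq_iff)
      then have "q (Complex (ln x) y) = exp (of_real (- x + \<beta> * ln x)) * exp (\<i> * of_real (\<beta> * y))"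
        unfolding q_def e by (simp add: exp_add[symmetric] algebra_simps)
      also have "exp (of_real (- x + \<beta> * ln x)) = (of_real (exp (- x + \<beta> * ln x)) :: complex)"
        by (rule exp_of_real)
      also have "exp (- x + \<beta> * ln x) = x * (x powr (\<beta> - 1) / exp x)"
      proof -
        have "x powr (\<beta> - 1) = exp (\<beta> * ln x) / x" using x by (simp add: powr_diff powr_def[of x \<beta>])
        then show ?thesis using x by (simp add: exp_add exp_diff exp_minus field_simps)
      qed
      finally show ?thesis .
    qed
    have "((\<lambda>x. P (Complex (ln x) pi) - P (Complex (ln x) (- pi))) has_vector_derivative
        of_real (1 / x) * q (Complex (ln x) pi) - of_real (1 / x) * q (Complex (ln x) (- pi))) (at x)"
      by (intro has_vector_derivative_diff side)
    moreover have "of_real (1 / x) * q (Complex (ln x) pi) - of_real (1 / x) * q (Complex (ln x) (- pi)) = S * g x"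
    proof -
      have "of_real (1 / x) * q (Complex (ln x) pi) - of_real (1 / x) * q (Complex (ln x) (- pi))
          = g x * (exp (\<i> * of_real (pi * \<beta>)) - exp (- (\<i> * of_real (pi * \<beta>))))"
        using x by (simp add: q_pm g_def algebra_simps)
      also have "exp (\<i> * of_real (pi * \<beta>)) - exp (- (\<i> * of_real (pi * \<beta>))) = S"
        unfolding S_def sin_exp_eq by simp
      finally show ?thesis by simp
    qed
    ultimately have "((\<lambda>x. P (Complex (ln x) pi) - P (Complex (ln x) (- pi))) has_vector_derivative S * g x) (at x)"
      by simp
    then show ?thesis
      by (rule has_vector_derivative_transform_within_open[of _ _ _ "{0<..}"]) (use x in \<open>auto simp: \<Phi>_def\<close>)
  qed
  \<comment> \<open>This bound tends to 0 at the origin and so gives the continuity needed on closed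
    intervals starting at 0.\<close>
  have \<Phi>_le: "cmod (\<Phi> x) \<le> exp x * x powr \<beta> * (2 * pi)" if "x \<ge> 0" for x
  proof (cases "x = 0")
    case False
    then have x: "x > 0" using that by simp
    have "cmod (P (Complex (ln x) pi) - P (Complex (ln x) (- pi))) \<le> (exp x * x powr \<beta>) * (pi - - pi)"
    proof (rule vertical)
      fix y
      have "x * cos y \<le> x * 1" using x by (intro mult_left_mono) auto
      then show "exp (exp (ln x) * cos y + \<beta> * ln x) \<le> exp x * x powr \<beta>"
        using x by (simp add: powr_def exp_add[symmetric])
    qed simp
    then show ?thesis using x by (simp add: \<Phi>_def)
  qed (simp add: \<Phi>_def)
  have \<Phi>_cont: "continuous_on {0..X} \<Phi>" for X
    unfolding continuous_on_eq_continuous_within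
  proof
    fix x assume x: "x \<in> {0..X}"
    show "continuous (at x within {0..X}) \<Phi>"
    proof (cases "x = 0")
      case True
      have "continuous_on {0..} (\<lambda>x. exp x * x powr \<beta> * (2 * pi))"
        using \<beta> by (intro continuous_intros continuous_on_powr') auto
      then have "((\<lambda>x. exp x * x powr \<beta> * (2 * pi)) \<longlongrightarrow> exp 0 * 0 powr \<beta> * (2 * pi)) (at 0 within {0..})"
        unfolding continuous_on_def by (elim ballE[of _ _ 0]) auto
      then have "((\<lambda>x. exp x * x powr \<beta> * (2 * pi)) \<longlongrightarrow> 0) (at 0 within {0..X})"
        by (auto intro: tendsto_within_subset)
      moreover have "\<forall>\<^sub>F x in at 0 within {0..X}. norm (\<Phi> x) \<le> exp x * x powr \<beta> * (2 * pi)"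
        unfolding eventually_at_filter using \<Phi>_le by auto
      ultimately have "(\<Phi> \<longlongrightarrow> 0) (at 0 within {0..X})" by (rule Lim_null_comparison[rotated])
      then show ?thesis by (simp add: True continuous_within \<Phi>_def)
    next
      case False
      then show ?thesis
        using x has_vector_derivative_continuous[OF \<Phi>_deriv] by (auto intro: continuous_at_imp_continuous_within)
    qed
  qed
  have ftc: "S * integral {0..X} g = \<Phi> X" if "X \<ge> 0" for X
  proof -
    have "((\<lambda>t. S * g t) has_integral (\<Phi> X - \<Phi> 0)) {0..X}"
      by (rule fundamental_theorem_of_calculus_interior[OF that \<Phi>_cont]) (use \<Phi>_deriv in auto)
    then have "integral {0..X} (\<lambda>t. S * g t) = \<Phi> X - \<Phi> 0" by (rule integral_unique)
    moreover have "\<Phi> 0 = 0" by (simp add: \<Phi>_def)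
    ultimately show ?thesis by (simp only: integral_mult_right diff_0_right)
  qed
  have ev: "\<forall>\<^sub>F X in at_top. \<Phi> X = S * integral {0..X} g"
    using eventually_ge_at_top[of 0] by eventually_elim (simp only: ftc)
  have "((\<lambda>t. t powr (\<beta> - 1) / exp t) has_integral Gamma \<beta>) {0..}"
    using \<beta> by (intro Gamma_integral_real) auto
  note gamma = this
  have gi: "(g has_integral of_real (Gamma \<beta>)) {0..}"
    using has_integral_linear[OF gamma bounded_linear_of_real] by (simp only: g_def[abs_def] o_def)
  have M: "(\<lambda>t. t powr (\<beta> - 1) / exp t) integrable_on {0..}"
    by (rule has_integral_integrable[OF gamma])
  have g_cont: "continuous_on {0..} g"
    unfolding g_def by (rule continuous_on_of_real[OF continuous_on_gamma_kernel[OF \<beta>(1)]])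
  have g_le: "cmod (g x) \<le> x powr (\<beta> - 1) / exp x" if "x \<ge> 0" for x
  proof -
    have "0 \<le> x powr (\<beta> - 1) / exp x" by simp
    then show ?thesis unfolding g_def norm_of_real by (simp only: abs_of_nonneg order_refl)
  qed
  have "((\<lambda>X. integral {0..X} g) \<longlongrightarrow> integral {0..} g) at_top"
    by (rule integral_halfline_tendsto[OF g_cont g_le M])
  then have "((\<lambda>X. S * integral {0..X} g) \<longlongrightarrow> S * integral {0..} g) at_top" by (intro tendsto_mult tendsto_const)
  then have l1: "((\<lambda>X. S * integral {0..X} g) \<longlongrightarrow> S * of_real (Gamma \<beta>)) at_top"
    by (simp only: integral_unique[OF gi])
  have l2: "((\<lambda>X. S * integral {0..X} g) \<longlongrightarrow> hankel 1 (gamma_integrand (of_real \<beta>))) at_top"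
    using \<Phi>_lim ev by (rule Lim_transform_eventually)
  from tendsto_unique[OF trivial_limit_at_top_linorder l2 l1] show ?thesis
    by (simp only: S_def)
qed

text \<open>Identity theorem on the disc of radius 3: both sides are holomorphic there, and for real
  \<beta> between 1 and 2 they agree by the reflection formula.\<close>

lemma hankel_gamma:
  assumes \<beta>: "cmod \<beta> < 3"
  shows "hankel 1 (gamma_integrand \<beta>) = 2 * of_real pi * \<i> * rGamma (1 - \<beta>)"
proof -
  define D where "D \<beta> = hankel 1 (gamma_integrand \<beta>) - 2 * of_real pi * \<i> * rGamma (1 - \<beta>)" for \<beta>
  define T where "T = complex_of_real ` {1<..<2}"
  have D0: "D z = 0" if zT: "z \<in> T" for z
  proof -
    obtain t where t: "1 < t" "t < 2" and z: "z = of_real t" using zT by (auto simp: T_def)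
    have "rGamma (of_real t) * rGamma (1 - of_real t) = sin (of_real (pi * t)) / (of_real pi :: complex)"
      using rGamma_reflection_complex[of "of_real t"] by simp
    then have "sin (of_real (pi * t)) = of_real pi * (rGamma (of_real t) * rGamma (1 - of_real t :: complex))"
      by (simp add: field_simps)
    moreover have "rGamma (of_real t) * of_real (Gamma t) = (1 :: complex)"
    proof -
      have "Gamma t \<noteq> 0" using t Gamma_real_pos[of t] by linarith
      then show ?thesis by (simp add: rGamma_inverse_Gamma Gamma_complex_of_real)
    qed
    ultimately have "2 * \<i> * sin (of_real (pi * t)) * of_real (Gamma t)
        = 2 * of_real pi * \<i> * rGamma (1 - of_real t)"
      by (simp add: mult_ac)
    then show ?thesis using hankel_gamma_real[OF t] by (simp add: D_def z)
  qed
  have "(\<lambda>\<beta>. hankel 1 (gamma_integrand \<beta>)) holomorphic_on ball 0 3"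
    unfolding holomorphic_on_open[OF open_ball] by (intro ballI exI, rule gamma_hankel_deriv) simp
  moreover have "(\<lambda>\<beta>. 2 * of_real pi * \<i> * rGamma (1 - \<beta>)) holomorphic_on ball 0 3"
    by (intro holomorphic_intros)
  ultimately have D_hol: "D holomorphic_on ball 0 3"
    unfolding D_def[abs_def] by (rule holomorphic_on_diff)
  \<comment> \<open>An interior point of the interval where the identity is known.\<close>
  have lim: "of_real (3 / 2) islimpt T"
  proof -
    show ?thesis
      unfolding islimpt_approachable
    proof (intro allI impI)
      fix e :: real assume e: "e > 0"
      define h where "h = min (e / 2) (1 / 4)"
      have h: "0 < h" "h < e" "h < 1 / 2" using e by (auto simp: h_def min_def)
      have "complex_of_real (3 / 2 + h) - of_real (3 / 2) = of_real h" by (simp only: of_real_add) simp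
      then have "dist (complex_of_real (3 / 2 + h)) (of_real (3 / 2)) = h"
        unfolding dist_norm using h(1) by (simp only: norm_of_real abs_of_pos)
      moreover have "complex_of_real (3 / 2 + h) \<noteq> of_real (3 / 2)"
        unfolding of_real_eq_iff using h(1) by simp
      moreover have "complex_of_real (3 / 2 + h) \<in> T"
        unfolding T_def using h by (intro imageI) simp
      ultimately show "\<exists>x'\<in>T. x' \<noteq> of_real (3 / 2) \<and> dist x' (of_real (3 / 2)) < e"
        using h(2) by (intro bexI[of _ "complex_of_real (3 / 2 + h)"] conjI) simp_all
    qed
  qed
  have sub: "T \<subseteq> ball 0 3"
  proof
    fix z assume "z \<in> T"
    then obtain t where t: "1 < t" "t < 2" "z = of_real t" by (auto simp: T_def)
    then show "z \<in> ball 0 3" by simp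
  qed
  have "of_real (3 / 2) \<in> ball (0 :: complex) 3" "\<beta> \<in> ball 0 3"
    using \<beta> by (simp_all only: mem_ball_0 norm_of_real)
  from analytic_continuation[OF D_hol open_ball connected_ball sub this(1) lim D0 this(2)]
  have "D \<beta> = 0" .
  then show ?thesis by (simp add: D_def)
qed

lemma hankel_one: "hankel 1 (\<lambda>z. exp (- z) * (1 / z)) = 2 * of_real pi * \<i>"
proof -
  have "hankel 1 (gamma_integrand 0) = hankel 1 (\<lambda>z. exp (- z) * (1 / z))"
    by (rule hankel_cong) (auto simp: gamma_integrand_def powr_0 dest: exterior_1D)
  then show ?thesis using hankel_gamma[of 0] by (simp add: rGamma_inverse_Gamma)
qed

text \<open>The formula is differentiated at \<open>\<beta> = 0\<close>; as
  \<open>Gamma 1 = 1\<close>, the derivative of \<open>rGamma (1 - \<beta>)\<close> there is the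
  derivative of Gamma at 1.\<close>

lemma hankel_Ln: "hankel 1 (\<lambda>z. exp (- z) * (1 / z) * Ln (- z)) = 2 * of_real pi * \<i> * deriv Gamma 1"
proof -
  have one: "(1 :: complex) \<notin> \<int>\<^sub>\<le>\<^sub>0" by (simp add: one_notin_nonpos_Ints)
  have "((\<lambda>\<beta>. hankel 1 (gamma_integrand \<beta>)) has_field_derivative
      hankel 1 (\<lambda>z. gamma_integrand 0 z * Ln (- z))) (at 0)"
    by (rule gamma_hankel_deriv) simp
  from has_field_derivative_transform_within_open[OF this open_ball _ hankel_gamma, of 0 3]
  have 1: "((\<lambda>\<beta>. 2 * of_real pi * \<i> * rGamma (1 - \<beta>)) has_field_derivative
      hankel 1 (\<lambda>z. gamma_integrand 0 z * Ln (- z))) (at 0)" by simp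
  have "((\<lambda>\<beta>. rGamma (1 - \<beta>)) has_field_derivative (- rGamma (1 - 0) * Digamma (1 - 0)) * (- 1)) (at (0 :: complex))"
  proof (rule DERIV_chain2[where f = rGamma and g = "\<lambda>\<beta>. 1 - \<beta>"])
    show "(rGamma has_field_derivative - rGamma (1 - 0) * Digamma (1 - 0)) (at (1 - (0 :: complex)))"
      using one by (intro has_field_derivative_rGamma_no_nonpos_int) simp
    show "((\<lambda>\<beta>. 1 - \<beta>) has_field_derivative - 1) (at (0 :: complex))"
      by (auto intro!: derivative_eq_intros)
  qed
  then have 2: "((\<lambda>\<beta>. 2 * of_real pi * \<i> * rGamma (1 - \<beta>)) has_field_derivative
      2 * of_real pi * \<i> * ((- rGamma (1 - 0) * Digamma (1 - 0)) * (- 1))) (at (0 :: complex))"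
    by (rule DERIV_cmult)
  have "deriv Gamma 1 = (Digamma 1 :: complex)"
    using DERIV_imp_deriv[OF has_field_derivative_Gamma[OF one, of UNIV]] by simp
  moreover have "hankel 1 (\<lambda>z. gamma_integrand 0 z * Ln (- z)) = hankel 1 (\<lambda>z. exp (- z) * (1 / z) * Ln (- z))"
    by (rule hankel_cong) (auto simp: gamma_integrand_def powr_0 dest: exterior_1D)
  ultimately show ?thesis using DERIV_unique[OF 1 2] by (simp add: rGamma_inverse_Gamma)
qed

section \<open>Uniform bounds and scaling of power-log terms\<close>

text \<open>Perturbing the real parameter \<epsilon> by a complex number of modulus below
  \<open>\<epsilon> * \<kappa> / 2\<close> costs at most half of the decay along the rays.\<close>

lemma norm_exp_ray_ball:
  assumes \<epsilon>: "\<epsilon> > 0" and s: "s \<in> ball (of_real \<epsilon>) (\<epsilon> * \<kappa> / 2)" and x: "x \<ge> 0" "\<theta> \<in> {a, b}"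
  shows "cmod (exp (- s * rcis x \<theta>)) \<le> exp (- (2 * (\<epsilon> * \<kappa> / 4)) * x)"
proof -
  have "0 \<le> \<epsilon> * \<kappa>" using \<epsilon> \<kappa>(1) by simp
  then have "cmod ((of_real \<epsilon> - s) * rcis x \<theta>) \<le> (\<epsilon> * \<kappa> / 2) * x"
    unfolding norm_mult using s x by (intro mult_mono) (auto simp: dist_norm)
  then have "Re ((of_real \<epsilon> - s) * rcis x \<theta>) \<le> (\<epsilon> * \<kappa> / 2) * x"
    using complex_Re_le_cmod[of "(of_real \<epsilon> - s) * rcis x \<theta>"] by linarith
  moreover have "\<epsilon> * x * \<kappa> \<le> \<epsilon> * x * cos \<theta>" using \<epsilon> x \<kappa>(2)[OF x(2)] by (intro mult_left_mono) auto
  moreover have "- s * rcis x \<theta> = (of_real \<epsilon> - s) * rcis x \<theta> - of_real \<epsilon> * rcis x \<theta>" by (simp add: algebra_simps)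
  moreover have "Re (of_real \<epsilon> * rcis x \<theta>) = \<epsilon> * x * cos \<theta>" by simp
  ultimately have "Re (- s * rcis x \<theta>) \<le> (\<epsilon> * \<kappa> / 2) * x - \<epsilon> * x * \<kappa>"
    by (simp only: minus_complex.simps)
  also have "\<dots> = - (2 * (\<epsilon> * \<kappa> / 4)) * x" by (simp add: field_simps)
  finally show ?thesis by simp
qed

text \<open>On the contour of radius \<open>1 / t\<close> each ray integral of
  \<open>exp (- t \<kappa> x)\<close> is \<open>exp (- \<kappa>) / (\<kappa> t)\<close>. The arc has
  length at most \<open>2 * pi / t\<close>, and the weight there has modulus at most
  \<open>exp 1\<close>.\<close>

definition exp_const :: real where
  "exp_const = 2 * (exp (- \<kappa>) / \<kappa>) + 2 * pi * exp 1"

lemma hankel_exp_bound: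
  assumes t: "t > 0" and adm: "admissible (1 / t) (\<lambda>z. exp (- of_real t * z) * k z)"
    and k: "\<And>z. z \<in> exterior (1 / t) \<Longrightarrow> cmod (k z) \<le> A" and A: "A \<ge> 0"
  shows "cmod (hankel (1 / t) (\<lambda>z. exp (- of_real t * z) * k z)) \<le> A * exp_const / t"
proof -
  have r: "1 / t > 0" using t by simp
  have t\<kappa>: "t * \<kappa> > 0" using t \<kappa>(1) by simp
  have I: "((\<lambda>x. A * exp (- (t * \<kappa>) * x)) has_integral A * (exp (- (t * \<kappa>) * (1 / t)) / (t * \<kappa>))) {1 / t..}"
    by (rule has_integral_mult_right[OF has_integral_exp_minus_to_infinity[OF t\<kappa>]])
  have "cmod (hankel (1 / t) (\<lambda>z. exp (- of_real t * z) * k z))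
      \<le> 2 * integral {1 / t..} (\<lambda>x. A * exp (- (t * \<kappa>) * x)) + 2 * pi * (1 / t) * (exp 1 * A)"
  proof (rule hankel_bound[OF r adm])
    fix x \<theta> assume x: "1 / t \<le> x" "\<theta> \<in> {a, b}"
    have x0: "0 \<le> x" using x r by linarith
    have "cmod (exp (- of_real t * rcis x \<theta>)) * cmod (k (rcis x \<theta>)) \<le> exp (- (t * \<kappa>) * x) * A"
      by (rule mult_mono[OF norm_exp_ray[OF less_imp_le[OF t] x0 x(2)] k[OF ray_exterior[OF less_imp_le[OF r] x]]])
         simp_all
    then show "cmod (exp (- of_real t * rcis x \<theta>) * k (rcis x \<theta>)) \<le> A * exp (- (t * \<kappa>) * x)"
      by (simp only: norm_mult mult.commute)
  next
    show "(\<lambda>x. A * exp (- (t * \<kappa>) * x)) integrable_on {1 / t..}" using I by (rule has_integral_integrable)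
  next
    fix z assume z: "z \<in> exterior (1 / t)" "cmod z = 1 / t"
    have "cmod (- of_real t * z) = 1" unfolding norm_mult norm_minus_cancel norm_of_real z(2) using t by simp
    then have "cmod (exp (- of_real t * z)) \<le> exp 1"
      using complex_Re_le_cmod[of "- of_real t * z"] by simp
    then show "cmod (exp (- of_real t * z) * k z) \<le> exp 1 * A"
      unfolding norm_mult using k[OF z(1)] by (intro mult_mono) auto
  qed
  also have "integral {1 / t..} (\<lambda>x. A * exp (- (t * \<kappa>) * x)) = A * (exp (- (t * \<kappa>) * (1 / t)) / (t * \<kappa>))"
    using I by (rule integral_unique)
  also have "2 * (A * (exp (- (t * \<kappa>) * (1 / t)) / (t * \<kappa>))) + 2 * pi * (1 / t) * (exp 1 * A) = A * exp_const / t"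
    using t \<kappa>(1) by (simp add: exp_const_def field_simps)
  finally show ?thesis .
qed

text \<open>The values at \<open>\<beta> = 0\<close> are computed in \<open>hankel_coeff_0\<close>;
  the other values enter the unnamed constants of the heat expansion.\<close>

definition hankel_coeff :: "real \<Rightarrow> nat \<Rightarrow> complex" where
  "hankel_coeff \<beta> k = hankel 1 (\<lambda>z. exp (- of_real 1 * z) * ((- z) powr of_real \<beta> * Ln (- z) ^ k / z))"

lemma exterior_posD:
  assumes "r > 0" "z \<in> exterior r"
  shows "z \<noteq> 0" "- z \<notin> \<real>\<^sub>\<le>\<^sub>0"
proof -
  show "z \<noteq> 0" using assms by (auto simp: exterior_def)
  then show "- z \<notin> \<real>\<^sub>\<le>\<^sub>0"
    using assms by (intro neg_not_nonpos_Reals[OF m_bounds]) (simp_all add: exterior_def)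
qed

lemma power_log_term_admissible:
  assumes r: "r > 0" and s: "s > 0" and k: "k \<le> 1"
  shows "admissible r (\<lambda>z. exp (- of_real s * z) * ((- z) powr of_real \<beta> * Ln (- z) ^ k / z))"
proof -
  have Ln: "continuous_on (exterior r) (\<lambda>z. Ln (- z))"
    by (intro continuous_on_Ln' continuous_intros) (rule exterior_posD(2)[OF r])
  have powr: "exp (of_real \<beta> * Ln (- z)) = (- z) powr of_real \<beta>" if "z \<in> exterior r" for z
    using exterior_posD(1)[OF r that] by (simp add: powr_def)
  have "continuous_on (exterior r) (\<lambda>z. exp (of_real \<beta> * Ln (- z)) * Ln (- z) ^ k / z)"
    using exterior_posD(1)[OF r] by (intro continuous_intros Ln) auto
  then have cont: "continuous_on (exterior r) (\<lambda>z. (- z) powr of_real \<beta> * Ln (- z) ^ k / z)"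
    by (rule continuous_on_eq) (simp add: powr)
  \<comment> \<open>Since \<open>cmod z / r \<ge> 1\<close>, the constants
    \<open>\<bar>ln r\<bar>\<close> and \<open>pi\<close> in the bound for the logarithm become
    multiples of \<open>cmod z\<close>.\<close>
  define A where "A = \<bar>ln r\<bar> / r + 1 + pi / r"
  have A: "A \<ge> 0" using r by (simp add: A_def)
  have Ln_le: "cmod (Ln (- z)) \<le> A * cmod z" if z: "z \<in> exterior r" for z
  proof -
    have z0: "cmod z \<ge> r" "cmod z > 0" using z r by (auto simp: exterior_def)
    have "\<bar>ln (cmod z)\<bar> \<le> \<bar>ln r\<bar> + cmod z"
    proof (cases "cmod z \<ge> 1")
      case True
      then show ?thesis using ln_bound[OF z0(2)] ln_ge_zero[OF True] by linarith
    next
      case False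
      then have "ln r \<le> ln (cmod z)" "ln (cmod z) \<le> 0" using z0 r by auto
      then show ?thesis using z0(2) by linarith
    qed
    then have "cmod (Ln (- z)) \<le> \<bar>ln r\<bar> * 1 + cmod z + pi * 1"
      using norm_Ln_le[of "- z"] z0 by fastforce
    also have "\<dots> \<le> \<bar>ln r\<bar> * (cmod z / r) + cmod z + pi * (cmod z / r)"
      using z0 r by (intro add_mono mult_left_mono) auto
    also have "\<dots> = A * cmod z" by (simp add: A_def algebra_simps)
    finally show ?thesis .
  qed
  have B: "cmod ((- z) powr of_real \<beta> * Ln (- z) ^ k / z) \<le> (A + 1 / r) * cmod z powr \<beta>" if z: "z \<in> exterior r" for z
  proof -
    have z0: "cmod z \<ge> r" "cmod z > 0" using z r by (auto simp: exterior_def)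
    have "cmod (Ln (- z) ^ k) \<le> (A + 1 / r) * cmod z"
    proof (cases "k = 0")
      case True
      have "1 \<le> (1 / r) * cmod z" using z0 r by simp
      also have "\<dots> \<le> (A + 1 / r) * cmod z" using A by (intro mult_right_mono) auto
      finally show ?thesis using True by simp
    next
      case False
      then have "k = 1" using k by simp
      have "A * cmod z \<le> (A + 1 / r) * cmod z" using r by (intro mult_right_mono) auto
      then show ?thesis using Ln_le[OF z] \<open>k = 1\<close> by simp
    qed
    then have "cmod (Ln (- z) ^ k) / cmod z \<le> A + 1 / r" using z0 by (simp add: pos_divide_le_eq)
    moreover have "cmod ((- z) powr of_real \<beta>) = cmod z powr \<beta>"
      using z0 by (simp add: powr_def)
    ultimately show ?thesis
      using mult_left_mono[of "cmod (Ln (- z) ^ k) / cmod z" "A + 1 / r" "cmod z powr \<beta>"]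
      by (simp add: norm_mult norm_divide mult.commute)
  qed
  have "A + 1 / r \<ge> 0" using A r by simp
  from exp_admissible[OF r s cont B this] show ?thesis .
qed

text \<open>The substitution of \<open>\<epsilon> z\<close> for \<open>z\<close> carries the contour
  of radius \<open>1 / \<epsilon>\<close> to the unit contour. The logarithm splits off
  \<open>ln \<epsilon>\<close>, which is the source of all logarithms in the heat expansion.\<close>

lemma power_log_term_scaled:
  assumes \<epsilon>: "\<epsilon> > 0"
  shows "hankel (1 / \<epsilon>) (\<lambda>z. exp (- of_real \<epsilon> * z) * ((- z) powr of_real \<beta> * Ln (- z) ^ 0 / z))
      = of_real (\<epsilon> powr (- \<beta>)) * hankel_coeff \<beta> 0" (is "?T0 = _")
    and "hankel (1 / \<epsilon>) (\<lambda>z. exp (- of_real \<epsilon> * z) * ((- z) powr of_real \<beta> * Ln (- z) ^ 1 / z))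
      = of_real (\<epsilon> powr (- \<beta>)) * (hankel_coeff \<beta> 1 - of_real (ln \<epsilon>) * hankel_coeff \<beta> 0)" (is "?T1 = _")
proof -
  have r: "1 / \<epsilon> > 0" "0 \<le> 1 / \<epsilon>" using \<epsilon> by auto
  define K where "K k z = exp (- of_real 1 * z) * ((- z) powr of_real \<beta> * Ln (- z) ^ k / z)" for k and z :: complex
  define T where "T k z = exp (- of_real \<epsilon> * z) * ((- z) powr of_real \<beta> * Ln (- z) ^ k / z)" for k and z :: complex
  have adm_T: "admissible (1 / \<epsilon>) (T k)" if "k \<le> 1" for k
    unfolding T_def by (rule power_log_term_admissible[OF r(1) \<epsilon> that])
  have adm_K: "admissible 1 (K k)" if "k \<le> 1" for k
    unfolding K_def by (rule power_log_term_admissible[OF zero_less_one zero_less_one that])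
  have hol: "K k holomorphic_on {z. - z \<notin> \<real>\<^sub>\<le>\<^sub>0}" for k
  proof -
    have "(\<lambda>z. exp (- of_real 1 * z) * (exp (of_real \<beta> * Ln (- z)) * Ln (- z) ^ k / z)) holomorphic_on {z. - z \<notin> \<real>\<^sub>\<le>\<^sub>0}"
      by (intro holomorphic_intros) auto
    then show ?thesis by (rule holomorphic_transform) (auto simp: K_def powr_def)
  qed
  have op: "open {z :: complex. - z \<notin> \<real>\<^sub>\<le>\<^sub>0}"
  proof -
    have "open (uminus -` (- \<real>\<^sub>\<le>\<^sub>0 :: complex set))"
      by (intro continuous_open_vimage) (auto intro!: continuous_intros)
    moreover have "uminus -` (- \<real>\<^sub>\<le>\<^sub>0) = {z :: complex. - z \<notin> \<real>\<^sub>\<le>\<^sub>0}" by auto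
    ultimately show ?thesis by (simp only:)
  qed
  have sub: "z \<in> {z. - z \<notin> \<real>\<^sub>\<le>\<^sub>0}" if "z \<noteq> 0" "Re z \<le> cmod z * cos m" for z
    using neg_not_nonpos_Reals[OF m_bounds that(2,1)] by simp
  have Ln_scale: "Ln (- (of_real \<epsilon> * z)) = of_real (ln \<epsilon>) + Ln (- z)" if "z \<noteq> 0" for z
    using Ln_times_of_real[OF \<epsilon>, of "- z"] that \<epsilon> by (simp add: Ln_of_real)
  have powr_scale: "(- (of_real \<epsilon> * z)) powr of_real \<beta> = of_real (\<epsilon> powr \<beta>) * (- z) powr of_real \<beta>"
    if "z \<noteq> 0" for z :: complex
  proof -
    have "(- (of_real \<epsilon> * z)) powr of_real \<beta> = exp (of_real (\<beta> * ln \<epsilon>)) * exp (of_real \<beta> * Ln (- z))"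
      using that \<epsilon> by (simp add: powr_def Ln_scale distrib_left exp_add)
    also have "exp (of_real (\<beta> * ln \<epsilon>)) = (of_real (\<epsilon> powr \<beta>) :: complex)"
      using \<epsilon> by (simp add: powr_def exp_of_real del: of_real_mult)
    finally show ?thesis using that by (simp add: powr_def)
  qed
  have e0: "of_real \<epsilon> * K 0 (of_real \<epsilon> * z) = of_real (\<epsilon> powr \<beta>) * T 0 z" if "z \<in> exterior (1 / \<epsilon>)" for z
    using exterior_posD(1)[OF r(1) that] \<epsilon> by (simp add: K_def T_def powr_scale)
  have e1: "of_real \<epsilon> * K 1 (of_real \<epsilon> * z) = of_real (\<epsilon> powr \<beta>) * (of_real (ln \<epsilon>) * T 0 z + T 1 z)" if "z \<in> exterior (1 / \<epsilon>)" for z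
  proof -
    have z0: "z \<noteq> 0" by (rule exterior_posD(1)[OF r(1) that])
    have "of_real \<epsilon> * K 1 (of_real \<epsilon> * z)
        = exp (- of_real \<epsilon> * z) * ((- (of_real \<epsilon> * z)) powr of_real \<beta> * Ln (- (of_real \<epsilon> * z)) / z)"
      using z0 \<epsilon> by (simp add: K_def)
    also have "\<dots> = of_real (\<epsilon> powr \<beta>) * (of_real (ln \<epsilon>) * T 0 z + T 1 z)"
      unfolding powr_scale[OF z0] Ln_scale[OF z0] T_def
      by (simp add: distrib_left distrib_right add_divide_distrib mult_ac)
    finally show ?thesis .
  qed
  have adm0: "admissible (1 / \<epsilon>) (\<lambda>z. of_real (\<epsilon> powr \<beta>) * T 0 z)"
    and adm1: "admissible (1 / \<epsilon>) (\<lambda>z. of_real (\<epsilon> powr \<beta>) * (of_real (ln \<epsilon>) * T 0 z + T 1 z))"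
    by (intro admissible_cmult admissible_add r adm_T order_refl zero_le_one)+
  have s: "hankel (1 / \<epsilon>) (\<lambda>z. of_real \<epsilon> * K k (of_real \<epsilon> * z)) = hankel_coeff \<beta> k"
    if "k \<le> 1" "admissible (1 / \<epsilon>) (\<lambda>z. of_real \<epsilon> * K k (of_real \<epsilon> * z))" for k
  proof -
    have "hankel (1 / \<epsilon>) (\<lambda>z. of_real \<epsilon> * K k (of_real \<epsilon> * z)) = hankel 1 (K k)"
      by (rule hankel_scale[OF zero_less_one r(1) \<epsilon> adm_K[OF that(1)] that(2) op hol sub])
    then show ?thesis by (simp only: hankel_coeff_def K_def[abs_def])
  qed
  have "hankel_coeff \<beta> 0 = hankel (1 / \<epsilon>) (\<lambda>z. of_real (\<epsilon> powr \<beta>) * T 0 z)"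
    using s[OF zero_le_one admissible_cong[OF r(2) adm0 e0[symmetric]]] hankel_cong[OF r(2) e0] by simp
  then have c0: "hankel_coeff \<beta> 0 = of_real (\<epsilon> powr \<beta>) * hankel (1 / \<epsilon>) (T 0)"
    by (simp only: hankel_cmult)
  have "hankel_coeff \<beta> 1 = hankel (1 / \<epsilon>) (\<lambda>z. of_real (\<epsilon> powr \<beta>) * (of_real (ln \<epsilon>) * T 0 z + T 1 z))"
    using s[OF order_refl admissible_cong[OF r(2) adm1 e1[symmetric]]] hankel_cong[OF r(2) e1] by simp
  also have "\<dots> = of_real (\<epsilon> powr \<beta>) * (of_real (ln \<epsilon>) * hankel (1 / \<epsilon>) (T 0) + hankel (1 / \<epsilon>) (T 1))"
    by (simp only: hankel_cmult hankel_add[OF r(2) admissible_cmult[OF adm_T[OF zero_le_one]] adm_T[OF order_refl]])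
  finally have c1: "hankel_coeff \<beta> 1 = of_real (\<epsilon> powr \<beta>) * (of_real (ln \<epsilon>) * hankel (1 / \<epsilon>) (T 0) + hankel (1 / \<epsilon>) (T 1))" .
  have p: "of_real (\<epsilon> powr (- \<beta>)) * of_real (\<epsilon> powr \<beta>) = (1 :: complex)"
    using \<epsilon> by (simp add: powr_minus flip: of_real_mult)
  then have p': "of_real (\<epsilon> powr (- \<beta>)) * (of_real (\<epsilon> powr \<beta>) * w) = w" for w :: complex
    by (simp only: mult.assoc[symmetric] mult_1_left)
  have 0: "hankel (1 / \<epsilon>) (T 0) = of_real (\<epsilon> powr (- \<beta>)) * hankel_coeff \<beta> 0"
    by (simp only: c0 p')
  have 1: "hankel (1 / \<epsilon>) (T 1) = of_real (\<epsilon> powr (- \<beta>)) * (hankel_coeff \<beta> 1 - of_real (ln \<epsilon>) * hankel_coeff \<beta> 0)"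
    unfolding right_diff_distrib mult.left_commute[of "of_real (\<epsilon> powr (- \<beta>))" "of_real (ln \<epsilon>)"] 0[symmetric]
    by (simp only: c1 p') simp
  show "?T0 = of_real (\<epsilon> powr (- \<beta>)) * hankel_coeff \<beta> 0" using 0 by (simp only: T_def[abs_def])
  show "?T1 = of_real (\<epsilon> powr (- \<beta>)) * (hankel_coeff \<beta> 1 - of_real (ln \<epsilon>) * hankel_coeff \<beta> 0)"
    using 1 by (simp only: T_def[abs_def])
qed

lemma hankel_coeff_0: "hankel_coeff 0 0 = 2 * of_real pi * \<i>" "hankel_coeff 0 1 = 2 * of_real pi * \<i> * deriv Gamma 1"
proof -
  have "hankel_coeff 0 0 = hankel 1 (\<lambda>z. exp (- z) * (1 / z))"
    unfolding hankel_coeff_def by (rule hankel_cong) (use exterior_1D(2) in \<open>auto simp: powr_0\<close>)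
  then show "hankel_coeff 0 0 = 2 * of_real pi * \<i>" using hankel_one by simp
  have "hankel_coeff 0 1 = hankel 1 (\<lambda>z. exp (- z) * (1 / z) * Ln (- z))"
    unfolding hankel_coeff_def by (rule hankel_cong) (use exterior_1D(2) in \<open>auto simp: powr_0\<close>)
  then show "hankel_coeff 0 1 = 2 * of_real pi * \<i> * deriv Gamma 1" using hankel_Ln by simp
qed

end

section \<open>The heat trace\<close>

locale heat_phase = scattering_phase U L f C0 m \<sigma> \<alpha> J b + hankel_contour m p q
  for U :: "complex set" and L f :: "complex \<Rightarrow> complex" and C0 m \<sigma> :: real
    and \<alpha> :: "nat \<Rightarrow> real" and J :: nat and b :: "nat \<Rightarrow> nat \<Rightarrow> complex" and p q :: real
begin

text \<open>The radius 1 is a normalization; by \<open>heat_radius\<close> every positive radius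
  gives the same value.\<close>

definition heat :: "real \<Rightarrow> complex" where
  "heat t = \<i> / (2 * of_real pi) * hankel 1 (\<lambda>z. exp (- of_real t * z) * f z)"

text \<open>The integral of \<open>exp (- t z) / z\<close> is \<open>2 * pi * \<i>\<close>, so
  adding \<open>L 0\<close> amounts to replacing \<open>L z\<close> by \<open>L z - L 0\<close>
  under the integral. That difference divided by \<open>z\<close> is bounded, which makes the
  primitive vanish at infinity.\<close>

definition heat_primitive :: "real \<Rightarrow> complex" where
  "heat_primitive t = L 0 + \<i> / (2 * of_real pi) * hankel 1 (\<lambda>z. exp (- of_real t * z) * (L z / z))"

lemma exterior_sub: "exterior r \<subseteq> sector_region m \<sigma>"
  by (auto simp: exterior_def sector_region_def)

lemma exterior_U: "exterior r \<subseteq> U"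
  using exterior_sub sector_sub by blast

lemma C0_nonneg: "0 \<le> C0"
proof -
  have "0 \<in> sector_region m \<sigma>" using \<sigma> by (simp add: sector_region_def)
  from order_trans[OF norm_ge_zero bound_f[OF this]] show ?thesis .
qed

lemma f_continuous: "continuous_on (exterior r) f"
  using holomorphic_on_imp_continuous_on[OF f_holomorphic] exterior_U by (rule continuous_on_subset)

lemma L_continuous: "continuous_on (exterior r) L"
  using holomorphic_on_imp_continuous_on[OF L_holomorphic] exterior_U by (rule continuous_on_subset)

lemma L_over_z_continuous: "r > 0 \<Longrightarrow> continuous_on (exterior r) (\<lambda>z. L z / z)"
  using exterior_posD(1) by (intro continuous_on_divide L_continuous continuous_on_id) auto

lemma L_growth:
  assumes r: "r > 0" and z: "z \<in> exterior r"
  shows "cmod (L z) \<le> (cmod (L 0) / r + C0) * cmod z"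
proof -
  have "cmod (L z) \<le> cmod (L 0) + cmod (L z - L 0)" using norm_triangle_ineq[of "L 0" "L z - L 0"] by simp
  also have "cmod (L z - L 0) \<le> C0 * cmod z" using z exterior_sub by (intro L_bound) blast
  also have "cmod (L 0) = cmod (L 0) / r * r" using r by simp
  also have "cmod (L 0) / r * r \<le> cmod (L 0) / r * cmod z"
    using r z by (intro mult_left_mono) (auto simp: exterior_def)
  finally show ?thesis by (simp add: algebra_simps)
qed

lemma growth_nonneg: "r > 0 \<Longrightarrow> 0 \<le> cmod (L 0) / r + C0"
  using C0_nonneg by simp

lemma admissible_f: "r > 0 \<Longrightarrow> t > 0 \<Longrightarrow> admissible r (\<lambda>z. exp (- of_real t * z) * f z)"
proof (rule exp_admissible[where p = 0, OF _ _ f_continuous _ C0_nonneg])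
  assume r: "r > 0"
  fix z assume z: "z \<in> exterior r"
  then have "cmod (f z) \<le> C0" using exterior_sub by (intro bound_f) blast
  then show "cmod (f z) \<le> C0 * cmod z powr 0" using exterior_posD(1)[OF r z] by simp
qed

lemma admissible_L: "r > 0 \<Longrightarrow> t > 0 \<Longrightarrow> admissible r (\<lambda>z. exp (- of_real t * z) * L z)"
proof (rule exp_admissible[where p = 1, OF _ _ L_continuous])
  assume r: "r > 0"
  show "0 \<le> cmod (L 0) / r + C0" by (rule growth_nonneg[OF r])
  fix z assume "z \<in> exterior r"
  from L_growth[OF r this] show "cmod (L z) \<le> (cmod (L 0) / r + C0) * cmod z powr 1" by simp
qed

lemma L_over_z_bound:
  assumes r: "r > 0" and z: "z \<in> exterior r"
  shows "cmod (L z / z) \<le> (cmod (L 0) / r + C0) * cmod z powr 0"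
  using L_growth[OF assms] exterior_posD(1)[OF assms] by (simp add: norm_divide pos_divide_le_eq)

lemma admissible_L_over_z: "r > 0 \<Longrightarrow> t > 0 \<Longrightarrow> admissible r (\<lambda>z. exp (- of_real t * z) * (L z / z))"
  using L_over_z_continuous L_over_z_bound growth_nonneg by (intro exp_admissible) blast+

lemma U_contains: "z \<noteq> 0 \<Longrightarrow> Re z \<le> cmod z * cos m \<Longrightarrow> z \<in> U"
  using sector_in_region sector_sub by blast

lemma heat_radius:
  assumes "r > 0" "t > 0"
  shows "heat t = \<i> / (2 * of_real pi) * hankel r (\<lambda>z. exp (- of_real t * z) * f z)"
proof -
  have "hankel 1 (\<lambda>z. exp (- of_real t * z) * f z) = hankel r (\<lambda>z. exp (- of_real t * z) * f z)"
    using assms f_holomorphic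
    by (intro hankel_radius_independent[OF _ _ _ _ open_U _ U_contains] admissible_f holomorphic_intros) auto
  then show ?thesis by (simp add: heat_def)
qed

lemma heat_primitive_radius:
  assumes "r > 0" "t > 0"
  shows "heat_primitive t = L 0 + \<i> / (2 * of_real pi) * hankel r (\<lambda>z. exp (- of_real t * z) * (L z / z))"
proof -
  have "(\<lambda>z. exp (- of_real t * z) * (L z / z)) holomorphic_on U - {0}"
    using holomorphic_on_subset[OF L_holomorphic, of "U - {0}"] by (intro holomorphic_intros) auto
  moreover have "z \<in> U - {0}" if "z \<noteq> 0" "Re z \<le> cmod z * cos m" for z
    using U_contains that by simp
  ultimately have "hankel 1 (\<lambda>z. exp (- of_real t * z) * (L z / z)) = hankel r (\<lambda>z. exp (- of_real t * z) * (L z / z))"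
    using assms open_U
    by (intro hankel_radius_independent[where V = "U - {0}"] admissible_L_over_z open_delete) auto
  then show ?thesis by (simp add: heat_primitive_def)
qed

lemma norm_prefactor: "cmod (\<i> / (2 * of_real pi) * w) \<le> cmod w"
proof -
  have "1 * cmod w \<le> 2 * pi * cmod w" using pi_ge_two by (intro mult_right_mono) auto
  then show ?thesis by (simp add: norm_mult norm_divide divide_le_eq mult.commute)
qed

lemma heat_bound: "t > 0 \<Longrightarrow> cmod (heat t) \<le> C0 * exp_const / t"
proof -
  assume t: "t > 0"
  then have "cmod (hankel (1 / t) (\<lambda>z. exp (- of_real t * z) * f z)) \<le> C0 * exp_const / t"
    using exterior_sub by (intro hankel_exp_bound admissible_f bound_f C0_nonneg) auto
  then show ?thesis
    using norm_prefactor[of "hankel (1 / t) (\<lambda>z. exp (- of_real t * z) * f z)"] heat_radius[of "1 / t" t] t by simp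
qed

lemma heat_primitive_bound:
  assumes t: "t > 0"
  shows "cmod (heat_primitive t) \<le> C0 * exp_const / t"
proof -
  have r: "1 / t > 0" "0 \<le> 1 / t" using t by auto
  have adm0: "admissible (1 / t) (\<lambda>z. exp (- of_real t * z) * ((- z) powr of_real 0 * Ln (- z) ^ 0 / z))"
    by (rule power_log_term_admissible[OF r(1) t zero_le_one])
  have k: "cmod ((L z - L 0) / z) \<le> C0" if z: "z \<in> exterior (1 / t)" for z
  proof -
    have "cmod (L z - L 0) \<le> C0 * cmod z" using z exterior_sub by (intro L_bound) blast
    then show ?thesis using exterior_posD(1)[OF r(1) z] by (simp add: norm_divide pos_divide_le_eq)
  qed
  have adm1: "admissible (1 / t) (\<lambda>z. exp (- of_real t * z) * ((L z - L 0) / z))"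
  proof (rule exp_admissible[OF r(1) t _ _ C0_nonneg, where p = 0])
    show "continuous_on (exterior (1 / t)) (\<lambda>z. (L z - L 0) / z)"
      using exterior_posD(1)[OF r(1)]
      by (intro continuous_on_divide continuous_on_diff L_continuous continuous_on_id continuous_on_const) auto
    show "cmod ((L z - L 0) / z) \<le> C0 * cmod z powr 0" if "z \<in> exterior (1 / t)" for z
      using k[OF that] exterior_posD(1)[OF r(1) that] by simp
  qed
  have "hankel (1 / t) (\<lambda>z. exp (- of_real t * z) * (L z / z))
      = hankel (1 / t) (\<lambda>z. L 0 * (exp (- of_real t * z) * ((- z) powr of_real 0 * Ln (- z) ^ 0 / z))
          + exp (- of_real t * z) * ((L z - L 0) / z))"
    using exterior_posD(1)[OF r(1)]
    by (intro hankel_cong[OF r(2)]) (simp add: powr_0 field_simps)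
  also have "\<dots> = L 0 * hankel (1 / t) (\<lambda>z. exp (- of_real t * z) * ((- z) powr of_real 0 * Ln (- z) ^ 0 / z))
      + hankel (1 / t) (\<lambda>z. exp (- of_real t * z) * ((L z - L 0) / z))"
    by (simp only: hankel_add[OF r(2) admissible_cmult[OF adm0] adm1] hankel_cmult)
  also have "hankel (1 / t) (\<lambda>z. exp (- of_real t * z) * ((- z) powr of_real 0 * Ln (- z) ^ 0 / z)) = 2 * of_real pi * \<i>"
    unfolding power_log_term_scaled(1)[OF t] hankel_coeff_0 using t by simp
  finally have "heat_primitive t = \<i> / (2 * of_real pi) * hankel (1 / t) (\<lambda>z. exp (- of_real t * z) * ((L z - L 0) / z))"
    unfolding heat_primitive_radius[OF r(1) t] by (simp add: field_simps)
  moreover have "cmod (hankel (1 / t) (\<lambda>z. exp (- of_real t * z) * ((L z - L 0) / z))) \<le> C0 * exp_const / t"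
    by (rule hankel_exp_bound[OF t adm1 k C0_nonneg])
  ultimately show ?thesis using norm_prefactor[of "hankel (1 / t) (\<lambda>z. exp (- of_real t * z) * ((L z - L 0) / z))"] by simp
qed

lemma heat_primitive_deriv:
  assumes \<epsilon>: "\<epsilon> > 0"
  shows "(heat_primitive has_vector_derivative heat \<epsilon> / of_real \<epsilon>) (at \<epsilon>)"
proof -
  \<comment> \<open>On the disc of radius \<open>d\<close> the decay rate is still
    \<open>2 * c\<close>; one half of it absorbs the linear growth of \<open>L\<close>, the other
    remains as the majorant.\<close>
  define c where "c = \<epsilon> * \<kappa> / 4"
  have c: "c > 0" using \<epsilon> \<kappa>(1) by (simp add: c_def)
  define d where "d = \<epsilon> * \<kappa> / 2"
  have d: "d > 0" using \<epsilon> \<kappa>(1) by (simp add: d_def)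
  define A where "A = cmod (L 0) / 1 + C0"
  have A: "A \<ge> 0" using growth_nonneg[of 1] by (simp add: A_def)
  obtain B where B: "B > 0" "\<And>x. x \<ge> 1 \<Longrightarrow> x powr 1 \<le> B * exp (c * x)"
    using powr_le_exp[OF zero_less_one c] by blast
  have e: "cmod (exp (- s * rcis x \<theta>)) \<le> exp (- (2 * c) * x)"
    if "s \<in> ball (of_real \<epsilon>) d" "x \<ge> 1" "\<theta> \<in> {p, q}" for s x \<theta>
    using norm_exp_ray_ball[OF \<epsilon> that(1)[unfolded d_def] _ that(3), of x] that(2) by (simp add: c_def)
  have der: "((\<lambda>s. hankel 1 (\<lambda>z. exp (- s * z) * (L z / z))) has_field_derivative
      hankel 1 (\<lambda>z. exp (- of_real \<epsilon> * z) * (- L z))) (at (of_real \<epsilon>))"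
  proof (rule hankel_has_field_derivative[OF zero_less_one d, where M = "\<lambda>x. A * B * exp (- c * x)"
        and Marc = "exp (\<epsilon> + d) * A"])
    show "(\<lambda>x. A * B * exp (- c * x)) integrable_on {1..}"
      using has_integral_exp_minus_to_infinity[OF c, of 1] by (intro integrable_on_mult_right) blast
    fix s assume s: "s \<in> ball (complex_of_real \<epsilon>) d"
    show "admissible 1 (\<lambda>z. exp (- s * z) * (L z / z))"
      by (rule exp_admissible_general[OF zero_less_one c e[OF s] L_over_z_continuous[OF zero_less_one]
            L_over_z_bound[OF zero_less_one] growth_nonneg[OF zero_less_one]])
    show "((\<lambda>s. exp (- s * z) * (L z / z)) has_field_derivative exp (- s * z) * (- L z)) (at s)"
      if z: "z \<in> exterior 1" for z
      using exterior_posD(1)[OF zero_less_one z] by (auto intro!: derivative_eq_intros)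
    show "cmod (exp (- s * rcis x \<theta>) * (- L (rcis x \<theta>))) \<le> A * B * exp (- c * x)"
      if x: "1 \<le> x" "\<theta> \<in> {p, q}" for x \<theta>
    proof -
      have "cmod (- L (rcis x \<theta>)) \<le> A * x powr 1"
        using L_growth[OF zero_less_one ray_exterior[OF zero_le_one x]] x by (simp add: A_def)
      also have "\<dots> \<le> A * (B * exp (c * x))" using B(2)[OF x(1)] A by (rule mult_left_mono)
      finally have "cmod (exp (- s * rcis x \<theta>)) * cmod (- L (rcis x \<theta>)) \<le> exp (- (2 * c) * x) * (A * (B * exp (c * x)))"
        using e[OF s x] by (intro mult_mono) auto
      also have "\<dots> = A * B * (exp (- (2 * c) * x) * exp (c * x))" by simp
      also have "exp (- (2 * c) * x) * exp (c * x) = exp (- c * x)"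
        unfolding exp_add[symmetric] by (simp add: field_simps)
      finally show ?thesis by (simp only: norm_mult)
    qed
    show "cmod (exp (- s * z) * (- L z)) \<le> exp (\<epsilon> + d) * A" if z: "z \<in> exterior 1" "cmod z = 1" for z
    proof -
      have "cmod s \<le> \<epsilon> + d"
        using s norm_triangle_ineq[of "of_real \<epsilon>" "s - of_real \<epsilon>"] \<epsilon> by (simp add: dist_norm norm_minus_commute)
      then have "cmod (- s * z) \<le> \<epsilon> + d" using z(2) by (simp add: norm_mult)
      then have "cmod (exp (- s * z)) \<le> exp (\<epsilon> + d)" using complex_Re_le_cmod[of "- s * z"] by simp
      moreover have "cmod (- L z) \<le> A" using L_growth[OF zero_less_one z(1)] z(2) by (simp add: A_def)
      ultimately show ?thesis unfolding norm_mult by (intro mult_mono) auto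
    qed
  qed
  have adm_L: "admissible 1 (\<lambda>z. exp (- of_real \<epsilon> * z) * (- L z))"
    using admissible_cmult[OF admissible_L[OF zero_less_one \<epsilon>], of "- 1"] by simp
  note adm_f = admissible_f[OF zero_less_one \<epsilon>]
  \<comment> \<open>Integration by parts: the integrand is the derivative of
    \<open>exp (- \<epsilon> z) L z\<close>, which vanishes at both ends of the contour.\<close>
  have "hankel 1 (\<lambda>z. of_real \<epsilon> * (exp (- of_real \<epsilon> * z) * (- L z)) + (- 1) * (exp (- of_real \<epsilon> * z) * f z)) = 0"
  proof (rule hankel_derivative_zero[where E = "\<lambda>z. exp (- of_real \<epsilon> * z) * L z", OF zero_less_one])
    show "admissible 1 (\<lambda>z. of_real \<epsilon> * (exp (- of_real \<epsilon> * z) * (- L z)) + (- 1) * (exp (- of_real \<epsilon> * z) * f z))"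
      by (intro admissible_add admissible_cmult adm_L adm_f zero_le_one)
    fix z assume "z \<in> exterior 1"
    then have "z \<in> U" using exterior_U by blast
    from deriv_L[OF this]
    show "((\<lambda>z. exp (- of_real \<epsilon> * z) * L z) has_field_derivative
        of_real \<epsilon> * (exp (- of_real \<epsilon> * z) * (- L z)) + (- 1) * (exp (- of_real \<epsilon> * z) * f z)) (at z)"
      by (auto intro!: derivative_eq_intros simp: algebra_simps)
  next
    fix \<theta> assume \<theta>: "\<theta> \<in> {p, q}"
    have eps: "of_real \<epsilon> \<in> ball (complex_of_real \<epsilon>) d" using d by simp
    show "((\<lambda>X. exp (- of_real \<epsilon> * rcis X \<theta>) * L (rcis X \<theta>)) \<longlongrightarrow> 0) at_top"
    proof (rule Lim_null_comparison)
      show "\<forall>\<^sub>F X in at_top. norm (exp (- of_real \<epsilon> * rcis X \<theta>) * L (rcis X \<theta>)) \<le> A * (X * exp (- (2 * c) * X))"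
        using eventually_ge_at_top[of 1]
      proof eventually_elim
        case (elim X)
        have "cmod (L (rcis X \<theta>)) \<le> A * X"
          using L_growth[OF zero_less_one ray_exterior[OF zero_le_one elim \<theta>]] elim by (simp add: A_def)
        then have "cmod (exp (- of_real \<epsilon> * rcis X \<theta>)) * cmod (L (rcis X \<theta>)) \<le> exp (- (2 * c) * X) * (A * X)"
          using e[OF eps elim \<theta>] by (intro mult_mono) auto
        then show ?case by (simp only: norm_mult) (simp add: mult_ac)
      qed
      have "((\<lambda>X. X * exp (- (2 * c) * X)) \<longlongrightarrow> 0) at_top" using c by real_asymp
      from tendsto_mult_right_zero[OF this] show "((\<lambda>X. A * (X * exp (- (2 * c) * X))) \<longlongrightarrow> 0) at_top" .
    qed
  qed
  then have "of_real \<epsilon> * hankel 1 (\<lambda>z. exp (- of_real \<epsilon> * z) * (- L z)) + (- 1) * hankel 1 (\<lambda>z. exp (- of_real \<epsilon> * z) * f z) = 0"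
    by (simp only: hankel_add[OF zero_le_one admissible_cmult[OF adm_L] admissible_cmult[OF adm_f]] hankel_cmult)
  then have eq: "hankel 1 (\<lambda>z. exp (- of_real \<epsilon> * z) * (- L z)) = hankel 1 (\<lambda>z. exp (- of_real \<epsilon> * z) * f z) / of_real \<epsilon>"
    using \<epsilon> by (simp add: eq_divide_eq mult.commute)
  have "((\<lambda>s. L 0 + \<i> / (2 * of_real pi) * hankel 1 (\<lambda>z. exp (- s * z) * (L z / z))) has_field_derivative
      0 + \<i> / (2 * of_real pi) * hankel 1 (\<lambda>z. exp (- of_real \<epsilon> * z) * (- L z))) (at (of_real \<epsilon>))"
    by (intro DERIV_add DERIV_cmult der DERIV_const)
  from has_vector_derivative_real_field[OF this[unfolded eq], of UNIV] show ?thesis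
    by (simp add: heat_primitive_def[abs_def] heat_def)
qed

lemma heat_over_t_bound: "t > 0 \<Longrightarrow> cmod (heat t / of_real t) \<le> C0 * exp_const * t powr - 2"
  using divide_right_mono[OF heat_bound[of t], of t]
  by (simp add: norm_divide powr_minus powr_numeral power2_eq_square field_simps)

text \<open>Continuity comes from differentiating under the contour integral; it is used to
  integrate the heat trace over half-lines.\<close>

lemma heat_continuous: "continuous_on {0<..} heat"
proof (intro continuous_at_imp_continuous_on ballI)
  fix \<epsilon> :: real assume "\<epsilon> \<in> {0<..}"
  then have \<epsilon>: "\<epsilon> > 0" by simp
  define c where "c = \<epsilon> * \<kappa> / 4"
  have c: "c > 0" using \<epsilon> \<kappa>(1) by (simp add: c_def)
  define d where "d = \<epsilon> * \<kappa> / 2"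
  have d: "d > 0" using \<epsilon> \<kappa>(1) by (simp add: d_def)
  obtain B where B: "B > 0" "\<And>x. x \<ge> 1 \<Longrightarrow> x powr 1 \<le> B * exp (c * x)"
    using powr_le_exp[OF zero_less_one c] by blast
  have e: "cmod (exp (- s * rcis x \<theta>)) \<le> exp (- (2 * c) * x)"
    if "s \<in> ball (of_real \<epsilon>) d" "x \<ge> 1" "\<theta> \<in> {p, q}" for s x \<theta>
    using norm_exp_ray_ball[OF \<epsilon> that(1)[unfolded d_def] _ that(3), of x] that(2) by (simp add: c_def)
  have f_le: "cmod (f z) \<le> C0" if "z \<in> exterior 1" for z
    using that exterior_sub by (intro bound_f) blast
  have f_le': "cmod (f z) \<le> C0 * cmod z powr 0" if "z \<in> exterior 1" for z
    using f_le[OF that] exterior_posD(1)[OF zero_less_one that] by simp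
  have der: "((\<lambda>s. hankel 1 (\<lambda>z. exp (- s * z) * f z)) has_field_derivative
      hankel 1 (\<lambda>z. exp (- of_real \<epsilon> * z) * (- (z * f z)))) (at (of_real \<epsilon>))"
  proof (rule hankel_has_field_derivative[OF zero_less_one d, where M = "\<lambda>x. C0 * B * exp (- c * x)"
        and Marc = "exp (\<epsilon> + d) * C0"])
    show "(\<lambda>x. C0 * B * exp (- c * x)) integrable_on {1..}"
      using has_integral_exp_minus_to_infinity[OF c, of 1] by (intro integrable_on_mult_right) blast
    fix s assume s: "s \<in> ball (complex_of_real \<epsilon>) d"
    show "admissible 1 (\<lambda>z. exp (- s * z) * f z)"
      by (rule exp_admissible_general[OF zero_less_one c e[OF s] f_continuous f_le' C0_nonneg])
    show "((\<lambda>s. exp (- s * z) * f z) has_field_derivative exp (- s * z) * (- (z * f z))) (at s)" for z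
      by (auto intro!: derivative_eq_intros)
    show "cmod (exp (- s * rcis x \<theta>) * (- (rcis x \<theta> * f (rcis x \<theta>)))) \<le> C0 * B * exp (- c * x)"
      if x: "1 \<le> x" "\<theta> \<in> {p, q}" for x \<theta>
    proof -
      have "cmod (- (rcis x \<theta> * f (rcis x \<theta>))) = cmod (f (rcis x \<theta>)) * x powr 1"
        using x by (simp add: norm_mult)
      also have "\<dots> \<le> C0 * (B * exp (c * x))"
        using B(2)[OF x(1)] f_le[OF ray_exterior[OF zero_le_one x]] C0_nonneg by (intro mult_mono) auto
      finally have "cmod (exp (- s * rcis x \<theta>)) * cmod (- (rcis x \<theta> * f (rcis x \<theta>))) \<le> exp (- (2 * c) * x) * (C0 * (B * exp (c * x)))"
        using e[OF s x] by (intro mult_mono) auto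
      also have "\<dots> = C0 * B * (exp (- (2 * c) * x) * exp (c * x))" by simp
      also have "exp (- (2 * c) * x) * exp (c * x) = exp (- c * x)"
        unfolding exp_add[symmetric] by (simp add: field_simps)
      finally show ?thesis by (simp only: norm_mult)
    qed
    show "cmod (exp (- s * z) * (- (z * f z))) \<le> exp (\<epsilon> + d) * C0" if z: "z \<in> exterior 1" "cmod z = 1" for z
    proof -
      have "cmod s \<le> \<epsilon> + d"
        using s norm_triangle_ineq[of "of_real \<epsilon>" "s - of_real \<epsilon>"] \<epsilon> by (simp add: dist_norm norm_minus_commute)
      then have "cmod (- s * z) \<le> \<epsilon> + d" using z(2) by (simp add: norm_mult)
      then have "cmod (exp (- s * z)) \<le> exp (\<epsilon> + d)" using complex_Re_le_cmod[of "- s * z"] by simp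
      moreover have "cmod (- (z * f z)) \<le> C0" using f_le[OF z(1)] z(2) by (simp add: norm_mult)
      ultimately show ?thesis unfolding norm_mult[of "exp (- s * z)"] by (intro mult_mono) auto
    qed
  qed
  from has_vector_derivative_real_field[OF DERIV_cmult[OF der, of "\<i> / (2 * of_real pi)"], of UNIV]
  have "(heat has_vector_derivative \<i> / (2 * of_real pi) *
      hankel 1 (\<lambda>z. exp (- of_real \<epsilon> * z) * (- (z * f z)))) (at \<epsilon>)"
    by (simp add: heat_def[abs_def])
  then show "isCont heat \<epsilon>" by (rule has_vector_derivative_continuous)
qed

lemma heat_over_t:
  assumes \<epsilon>: "\<epsilon> > 0"
  shows "(\<lambda>t. - (1 / of_real t) * heat t) absolutely_integrable_on {\<epsilon>..}"
    and "integral {\<epsilon>..} (\<lambda>t. - (1 / of_real t) * heat t) = heat_primitive \<epsilon>"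
proof -
  let ?g = "\<lambda>t. - (1 / of_real t) * heat t"
  have cont: "continuous_on {\<epsilon>..} ?g"
    using \<epsilon> by (intro continuous_intros continuous_on_subset[OF heat_continuous]) auto
  have le: "cmod (?g t) \<le> C0 * exp_const * t powr - 2" if "t \<ge> \<epsilon>" for t
    using heat_over_t_bound[of t] that \<epsilon> by simp
  have M: "(\<lambda>t. C0 * exp_const * t powr - 2) integrable_on {\<epsilon>..}"
    using has_integral_powr_to_inf[of "- 2" \<epsilon>] \<epsilon> by (intro integrable_on_mult_right) auto
  have int: "?g integrable_on {\<epsilon>..}"
    using le by (intro integrable_dominated_on_interval[OF _ _ cont _ M]) (auto simp: is_interval_def)
  show "?g absolutely_integrable_on {\<epsilon>..}"
    by (rule absolutely_integrable_integrable_bound[OF _ int M]) (use le in simp)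
  have ftc: "integral {\<epsilon>..X} ?g = heat_primitive \<epsilon> - heat_primitive X" if "X \<ge> \<epsilon>" for X
  proof -
    have "(?g has_integral (- heat_primitive X) - (- heat_primitive \<epsilon>)) {\<epsilon>..X}"
    proof (rule fundamental_theorem_of_calculus[OF that])
      fix t assume "t \<in> {\<epsilon>..X}"
      then have "t > 0" using \<epsilon> by auto
      from has_vector_derivative_minus[OF heat_primitive_deriv[OF this]]
      have "((\<lambda>t. - heat_primitive t) has_vector_derivative ?g t) (at t)" by simp
      then show "((\<lambda>t. - heat_primitive t) has_vector_derivative ?g t) (at t within {\<epsilon>..X})"
        by (rule has_vector_derivative_at_within)
    qed
    from integral_unique[OF this] show ?thesis by simp
  qed
  have "(heat_primitive \<longlongrightarrow> 0) at_top"
  proof (rule Lim_null_comparison)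
    show "\<forall>\<^sub>F t in at_top. norm (heat_primitive t) \<le> C0 * exp_const * (1 / t)"
      using eventually_gt_at_top[of 0] by eventually_elim (use heat_primitive_bound in simp)
    have "((\<lambda>t::real. 1 / t) \<longlongrightarrow> 0) at_top" by real_asymp
    from tendsto_mult_right_zero[OF this] show "((\<lambda>t. C0 * exp_const * (1 / t)) \<longlongrightarrow> 0) at_top" .
  qed
  then have "((\<lambda>X. heat_primitive \<epsilon> - heat_primitive X) \<longlongrightarrow> heat_primitive \<epsilon> - 0) at_top"
    by (intro tendsto_diff tendsto_const)
  moreover have "\<forall>\<^sub>F X in at_top. heat_primitive \<epsilon> - heat_primitive X = integral {\<epsilon>..X} ?g"
    using eventually_ge_at_top[of \<epsilon>] by eventually_elim (simp only: ftc)
  ultimately have "((\<lambda>X. integral {\<epsilon>..X} ?g) \<longlongrightarrow> heat_primitive \<epsilon> - 0) at_top"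
    by (rule Lim_transform_eventually)
  from tendsto_unique[OF trivial_limit_at_top_linorder integral_halfline_tendsto[OF cont le M] this]
  show "integral {\<epsilon>..} ?g = heat_primitive \<epsilon>" by simp
qed

text \<open>The constants \<open>c'\<close> of the expansion. By
  \<open>power_log_term_scaled\<close> a logarithmic term of the phase feeds both the pure power and
  the logarithmic term in \<epsilon>.\<close>

definition heat_coeff :: "nat \<Rightarrow> nat \<Rightarrow> complex" where
  "heat_coeff j k = \<i> / (2 * of_real pi) *
    (if k = 0 then phase_coeff j 0 * hankel_coeff (1 - \<alpha> j) 0 + phase_coeff j 1 * hankel_coeff (1 - \<alpha> j) 1
     else - phase_coeff j 1 * hankel_coeff (1 - \<alpha> j) 0)"

text \<open>On the contour of radius \<open>1 / \<epsilon>\<close> every term scales by a power of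
  \<epsilon>, while the remainder of the phase, divided by \<open>z\<close>, is estimated by
  \<open>hankel_exp_bound\<close>.\<close>

lemma heat_primitive_expansion:
  assumes N: "good N" and \<eta>: "\<eta> > 0" "1 - \<alpha> N + \<eta> < 0"
  shows "\<exists>B T. T > 0 \<and> (\<forall>\<epsilon>. 0 < \<epsilon> \<longrightarrow> \<epsilon> \<le> T \<longrightarrow>
    cmod (heat_primitive \<epsilon> - (L 0 - phase_const - b J 0 * deriv Gamma 1 + b J 0 * of_real (ln \<epsilon>)
      + power_log_sum (\<lambda>j. \<alpha> j - 1) J heat_coeff N (of_real \<epsilon>))) \<le> B * \<epsilon> powr (\<alpha> N - 1 - \<eta>))"
proof -
  define p where "p = 1 - \<alpha> N + \<eta>"
  obtain B R where R: "R \<ge> 1" and B: "B \<ge> 0" and rem: "\<And>z. cmod z \<ge> R \<Longrightarrow> Re z \<le> cmod z * cos m \<Longrightarrow>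
      cmod (L z - phase_sum N (- z) - phase_const) \<le> B * cmod z powr p"
    using phase_const_bound[OF N \<eta>] unfolding p_def by blast
  have main: "cmod (heat_primitive \<epsilon> - (L 0 - phase_const - b J 0 * deriv Gamma 1 + b J 0 * of_real (ln \<epsilon>)
      + power_log_sum (\<lambda>j. \<alpha> j - 1) J heat_coeff N (of_real \<epsilon>))) \<le> (B * exp_const) * \<epsilon> powr (\<alpha> N - 1 - \<eta>)"
    if \<epsilon>: "0 < \<epsilon>" "\<epsilon> \<le> 1 / R" for \<epsilon>
  proof -
    \<comment> \<open>As \<open>\<epsilon> \<le> 1 / R\<close>, the entire contour lies where the
      expansion of the phase is valid.\<close>
    define r where "r = 1 / \<epsilon>"
    have r: "r > 0" "0 \<le> r" "r \<ge> R" using \<epsilon> R by (auto simp: r_def field_simps)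
    define W where "W \<beta> k z = exp (- of_real \<epsilon> * z) * ((- z) powr of_real \<beta> * Ln (- z) ^ k / z)" for \<beta> k z
    define E where "E z = exp (- of_real \<epsilon> * z) * ((L z - phase_sum N (- z) - phase_const) / z)" for z
    have adm_W: "admissible r (W \<beta> k)" if "k \<le> 1" for \<beta> k
      unfolding W_def by (rule power_log_term_admissible[OF r(1) \<epsilon>(1) that])
    have hW0: "hankel r (W \<beta> 0) = of_real (\<epsilon> powr (- \<beta>)) * hankel_coeff \<beta> 0" for \<beta>
      unfolding W_def r_def by (rule power_log_term_scaled(1)[OF \<epsilon>(1)])
    have hW1: "hankel r (W \<beta> 1) = of_real (\<epsilon> powr (- \<beta>)) * (hankel_coeff \<beta> 1 - of_real (ln \<epsilon>) * hankel_coeff \<beta> 0)" for \<beta>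
      unfolding W_def r_def by (rule power_log_term_scaled(2)[OF \<epsilon>(1)])
    define S where "S z = (\<Sum>j\<in>{..<N} - {J}. \<Sum>k\<le>1. phase_coeff j k * W (1 - \<alpha> j) k z)" for z
    have inner: "admissible r (\<lambda>z. \<Sum>k\<le>1. phase_coeff j k * W (1 - \<alpha> j) k z)
        \<and> hankel r (\<lambda>z. \<Sum>k\<le>1. phase_coeff j k * W (1 - \<alpha> j) k z)
          = (\<Sum>k\<le>1. hankel r (\<lambda>z. phase_coeff j k * W (1 - \<alpha> j) k z))" for j
      by (intro hankel_sum[OF r(2)] admissible_cmult adm_W) auto
    have S: "admissible r S \<and> hankel r S
        = (\<Sum>j\<in>{..<N} - {J}. hankel r (\<lambda>z. \<Sum>k\<le>1. phase_coeff j k * W (1 - \<alpha> j) k z))"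
      unfolding S_def[abs_def] by (intro hankel_sum[OF r(2)] conjunct1[OF inner]) auto
    define Q where "Q z = phase_const * W 0 0 z + b J 0 * W 0 1 z + S z" for z
    have adm_PB: "admissible r (\<lambda>z. phase_const * W 0 0 z + b J 0 * W 0 1 z)"
      by (intro admissible_add admissible_cmult adm_W r) auto
    have adm_Q: "admissible r Q"
      unfolding Q_def[abs_def] by (intro admissible_add[OF r(2) adm_PB] conjunct1[OF S])
    have split: "exp (- of_real \<epsilon> * z) * (L z / z) = Q z + E z" if z: "z \<in> exterior r" for z
    proof -
      have z0: "z \<noteq> 0" by (rule exterior_posD(1)[OF r(1) z])
      have "S z = exp (- of_real \<epsilon> * z) * (power_log_sum (\<lambda>j. 1 - \<alpha> j) J phase_coeff N (- z) / z)"
        unfolding S_def W_def power_log_sum_def sum_divide_distrib sum_distrib_left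
        by (intro sum.cong refl) (simp add: mult_ac)
      then show ?thesis
        using z0 unfolding Q_def E_def W_def phase_sum_def by (simp add: powr_0 field_simps)
    qed
    have adm_L: "admissible r (\<lambda>z. exp (- of_real \<epsilon> * z) * (L z / z))"
      by (rule admissible_L_over_z[OF r(1) \<epsilon>(1)])
    \<comment> \<open>The remainder \<open>E\<close> is admissible as a difference of admissible
      functions.\<close>
    have adm_diff: "admissible r (\<lambda>z. exp (- of_real \<epsilon> * z) * (L z / z) + (- 1) * Q z)"
      by (rule admissible_add[OF r(2) adm_L admissible_cmult[OF adm_Q]])
    have adm_E: "admissible r E"
      by (rule admissible_cong[OF r(2) adm_diff]) (simp only: split, simp)
    have "hankel r (\<lambda>z. exp (- of_real \<epsilon> * z) * (L z / z)) = hankel r (\<lambda>z. Q z + E z)"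
      by (rule hankel_cong[OF r(2) split])
    also have "\<dots> = hankel r Q + hankel r E" by (rule hankel_add[OF r(2) adm_Q adm_E])
    also have "hankel r Q = phase_const * hankel r (W 0 0) + b J 0 * hankel r (W 0 1) + hankel r S"
    proof -
      have adm1: "admissible r (\<lambda>z. phase_const * W 0 0 z)" and adm2: "admissible r (\<lambda>z. b J 0 * W 0 1 z)"
        by (intro admissible_cmult adm_W; simp)+
      have "hankel r Q = hankel r (\<lambda>z. phase_const * W 0 0 z + b J 0 * W 0 1 z) + hankel r S"
        unfolding Q_def[abs_def] by (rule hankel_add[OF r(2) adm_PB conjunct1[OF S]])
      then show ?thesis unfolding hankel_add[OF r(2) adm1 adm2] hankel_cmult .
    qed
    finally have hL: "hankel r (\<lambda>z. exp (- of_real \<epsilon> * z) * (L z / z))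
      = phase_const * hankel r (W 0 0) + b J 0 * hankel r (W 0 1) + hankel r S + hankel r E" .
    define u where "u = \<i> / (2 * of_real pi)"
    \<comment> \<open>This sign turns the constant and logarithmic terms of the phase into
      \<open>- phase_const\<close>, \<open>- b J 0\<close> times the derivative of Gamma at 1, and
      \<open>+ b J 0 * ln \<epsilon>\<close>.\<close>
    have u: "u * (2 * of_real pi * \<i>) = - 1" by (simp add: u_def)
    have W00: "hankel r (W 0 0) = 2 * of_real pi * \<i>" unfolding hW0 hankel_coeff_0 using \<epsilon>(1) by simp
    have W01: "hankel r (W 0 1) = 2 * of_real pi * \<i> * (deriv Gamma 1 - of_real (ln \<epsilon>))"
      unfolding hW1 hankel_coeff_0 using \<epsilon>(1) by (simp add: algebra_simps)
    have hS: "u * hankel r S = power_log_sum (\<lambda>j. \<alpha> j - 1) J heat_coeff N (of_real \<epsilon>)"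
    proof -
      have "u * hankel r S = (\<Sum>j\<in>{..<N} - {J}. u * hankel r (\<lambda>z. \<Sum>k\<le>1. phase_coeff j k * W (1 - \<alpha> j) k z))"
        unfolding conjunct2[OF S] sum_distrib_left ..
      also have "\<dots> = (\<Sum>j\<in>{..<N} - {J}. \<Sum>k\<le>1. heat_coeff j k * power_log (\<alpha> j - 1) k \<epsilon>)"
      proof (rule sum.cong[OF refl])
        fix j
        have "hankel r (\<lambda>z. \<Sum>k\<le>1. phase_coeff j k * W (1 - \<alpha> j) k z)
          = phase_coeff j 0 * hankel r (W (1 - \<alpha> j) 0) + phase_coeff j 1 * hankel r (W (1 - \<alpha> j) 1)"
          unfolding conjunct2[OF inner] hankel_cmult by simp
        also have "\<dots> = of_real (\<epsilon> powr (\<alpha> j - 1)) * (phase_coeff j 0 * hankel_coeff (1 - \<alpha> j) 0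
            + phase_coeff j 1 * (hankel_coeff (1 - \<alpha> j) 1 - of_real (ln \<epsilon>) * hankel_coeff (1 - \<alpha> j) 0))"
          unfolding hW0 hW1 by (simp add: algebra_simps)
        finally have h: "hankel r (\<lambda>z. \<Sum>k\<le>1. phase_coeff j k * W (1 - \<alpha> j) k z)
          = of_real (\<epsilon> powr (\<alpha> j - 1)) * (phase_coeff j 0 * hankel_coeff (1 - \<alpha> j) 0
            + phase_coeff j 1 * (hankel_coeff (1 - \<alpha> j) 1 - of_real (ln \<epsilon>) * hankel_coeff (1 - \<alpha> j) 0))" .
        have k0: "heat_coeff j 0 = u * (phase_coeff j 0 * hankel_coeff (1 - \<alpha> j) 0
            + phase_coeff j 1 * hankel_coeff (1 - \<alpha> j) 1)"
          and k1: "heat_coeff j 1 = u * (- phase_coeff j 1 * hankel_coeff (1 - \<alpha> j) 0)"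
          by (simp_all add: heat_coeff_def u_def)
        have two: "(\<Sum>k\<le>1. heat_coeff j k * power_log (\<alpha> j - 1) k \<epsilon>)
          = heat_coeff j 0 * power_log (\<alpha> j - 1) 0 \<epsilon> + heat_coeff j 1 * power_log (\<alpha> j - 1) 1 \<epsilon>"
          by (simp add: atMost_Suc add.commute)
        show "u * hankel r (\<lambda>z. \<Sum>k\<le>1. phase_coeff j k * W (1 - \<alpha> j) k z)
          = (\<Sum>k\<le>1. heat_coeff j k * power_log (\<alpha> j - 1) k \<epsilon>)"
          unfolding h two by (simp only: k0 k1) (simp add: power_log_def algebra_simps)
      qed
      also have "\<dots> = power_log_sum (\<lambda>j. \<alpha> j - 1) J heat_coeff N (of_real \<epsilon>)"
        by (rule power_log_sum_of_real[OF \<epsilon>(1), symmetric])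
      finally show ?thesis .
    qed
    have "heat_primitive \<epsilon> = L 0 + u * (phase_const * hankel r (W 0 0) + b J 0 * hankel r (W 0 1) + hankel r S + hankel r E)"
      unfolding heat_primitive_radius[OF r(1) \<epsilon>(1)] hL u_def ..
    also have "\<dots> = L 0 + phase_const * (u * (2 * of_real pi * \<i>))
        + b J 0 * (deriv Gamma 1 - of_real (ln \<epsilon>)) * (u * (2 * of_real pi * \<i>)) + u * hankel r S + u * hankel r E"
      unfolding W00 W01 by (simp add: algebra_simps)
    also have "\<dots> = L 0 - phase_const - b J 0 * deriv Gamma 1 + b J 0 * of_real (ln \<epsilon>)
      + power_log_sum (\<lambda>j. \<alpha> j - 1) J heat_coeff N (of_real \<epsilon>) + u * hankel r E"
      unfolding u hS by (simp add: algebra_simps)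
    finally have eq: "heat_primitive \<epsilon> - (L 0 - phase_const - b J 0 * deriv Gamma 1 + b J 0 * of_real (ln \<epsilon>)
      + power_log_sum (\<lambda>j. \<alpha> j - 1) J heat_coeff N (of_real \<epsilon>)) = u * hankel r E" by simp
    have "cmod (hankel (1 / \<epsilon>) (\<lambda>z. exp (- of_real \<epsilon> * z) * ((L z - phase_sum N (- z) - phase_const) / z)))
      \<le> (B * r powr (p - 1)) * exp_const / \<epsilon>"
    proof (rule hankel_exp_bound[OF \<epsilon>(1)])
      show "admissible (1 / \<epsilon>) (\<lambda>z. exp (- of_real \<epsilon> * z) * ((L z - phase_sum N (- z) - phase_const) / z))"
        using adm_E by (simp only: E_def[abs_def] r_def)
      show "0 \<le> B * r powr (p - 1)" using B by simp
      fix z assume z: "z \<in> exterior (1 / \<epsilon>)"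
      then have zr: "cmod z \<ge> r" "Re z \<le> cmod z * cos m" by (auto simp: exterior_def r_def)
      have z0: "cmod z > 0" using zr r by linarith
      have "cmod (L z - phase_sum N (- z) - phase_const) \<le> B * cmod z powr p"
        using zr r by (intro rem) auto
      then have "cmod (L z - phase_sum N (- z) - phase_const) / cmod z \<le> B * cmod z powr p / cmod z"
        using z0 by (intro divide_right_mono) auto
      also have "\<dots> = B * cmod z powr (p - 1)" using z0 by (simp add: powr_diff)
      also have "\<dots> \<le> B * r powr (p - 1)"
        using zr r B \<eta>(2) by (intro mult_left_mono powr_mono2') (auto simp: p_def)
      finally show "cmod ((L z - phase_sum N (- z) - phase_const) / z) \<le> B * r powr (p - 1)"
        by (simp only: norm_divide)
    qed
    also have "(B * r powr (p - 1)) * exp_const / \<epsilon> = (B * exp_const) * \<epsilon> powr (\<alpha> N - 1 - \<eta>)"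
    proof -
      have "r powr (p - 1) / \<epsilon> = r powr p" using r \<epsilon>(1) by (simp add: powr_diff r_def)
      also have "r powr p = \<epsilon> powr (- p)" using \<epsilon>(1) by (simp add: r_def inverse_eq_divide[symmetric] inverse_powr powr_minus)
      also have "- p = \<alpha> N - 1 - \<eta>" by (simp add: p_def)
      finally show ?thesis by (metis mult.assoc mult.commute times_divide_eq_right)
    qed
    finally show ?thesis
      unfolding eq u_def E_def[abs_def] r_def using norm_prefactor by (rule order_trans[rotated])
  qed
  have "0 < 1 / R" using R by simp
  then show ?thesis using main by blast
qed

lemma heat_cutoff_expansion:
  assumes eq: "\<And>\<epsilon>. \<epsilon> > 0 \<Longrightarrow> g \<epsilon> = heat_primitive \<epsilon>"
  shows "expansion_at_zero \<alpha> J g (L 0 - phase_const - b J 0 * deriv Gamma 1) (b J 0) heat_coeff"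
  unfolding expansion_at_zero_def
  using eventually_good
proof eventually_elim
  case (elim N)
  show ?case
  proof (intro allI impI)
    fix \<eta> :: real assume \<eta>: "\<eta> > 0"
    define \<eta>' where "\<eta>' = min \<eta> ((\<alpha> N - 1) / 2)"
    have "\<alpha> N > 1" using elim by (simp add: good_def)
    then have \<eta>': "\<eta>' > 0" "1 - \<alpha> N + \<eta>' < 0" "\<eta>' \<le> \<eta>"
      using \<eta> by (auto simp: \<eta>'_def min_def field_simps)
    obtain B T where T: "T > 0" and B: "\<And>\<epsilon>. 0 < \<epsilon> \<Longrightarrow> \<epsilon> \<le> T \<Longrightarrow>
      cmod (heat_primitive \<epsilon> - (L 0 - phase_const - b J 0 * deriv Gamma 1 + b J 0 * of_real (ln \<epsilon>)
      + power_log_sum (\<lambda>j. \<alpha> j - 1) J heat_coeff N (of_real \<epsilon>))) \<le> B * \<epsilon> powr (\<alpha> N - 1 - \<eta>')"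
      using heat_primitive_expansion[OF elim \<eta>'(1,2)] by blast
    have "\<forall>\<^sub>F \<epsilon> in at_right 0. 0 < \<epsilon> \<and> \<epsilon> < min T 1"
      using eventually_at_right_real[of 0 "min T 1"] T by (auto elim!: eventually_mono)
    then show "(\<lambda>\<epsilon>. cmod (g \<epsilon> - (L 0 - phase_const - b J 0 * deriv Gamma 1 + b J 0 * of_real (ln \<epsilon>)
        + power_log_sum (\<lambda>j. \<alpha> j - 1) J heat_coeff N (of_real \<epsilon>))))
      \<in> O[at_right 0](\<lambda>\<epsilon>. \<epsilon> powr (\<alpha> N - 1 - \<eta>))"
    proof (intro bigoI[of _ "\<bar>B\<bar>"], eventually_elim)
      case (elim \<epsilon>)
      have "B * \<epsilon> powr (\<alpha> N - 1 - \<eta>') \<le> \<bar>B\<bar> * \<epsilon> powr (\<alpha> N - 1 - \<eta>)"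
        using elim \<eta>'(3) by (intro mult_mono powr_mono') auto
      then show ?case using B[of \<epsilon>] elim eq[of \<epsilon>] by simp
    qed
  qed
qed

end

section \<open>The relative zeta function\<close>

text \<open>A truncated Mellin transform at the argument \<open>1 - s\<close>; the exponential form
  makes the dependence on \<open>s\<close> entire for each \<open>x\<close>.\<close>

definition mellin :: "real \<Rightarrow> (real \<Rightarrow> complex) \<Rightarrow> complex \<Rightarrow> complex" where
  "mellin r h s = integral {r..} (\<lambda>x. exp (- s * of_real (ln x)) * h x)"

lemma norm_exp_ln: "x > 0 \<Longrightarrow> cmod (exp (- s * of_real (ln x))) = x powr (- Re s)"
  by (simp add: powr_def)

lemma continuous_on_exp_ln: "r > 0 \<Longrightarrow> continuous_on {r..} (\<lambda>x. exp (- s * complex_of_real (ln x)))"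
  by (intro continuous_intros) auto

lemma norm_mellin_integrand:
  assumes "r > 0" "x \<ge> r" "cmod (h x) \<le> B * x powr p"
  shows "cmod (exp (- s * of_real (ln x)) * h x) \<le> B * x powr (p - Re s)"
proof -
  have x: "x > 0" using assms by linarith
  have "x powr (- Re s) * cmod (h x) \<le> x powr (- Re s) * (B * x powr p)"
    using assms(3) by (rule mult_left_mono) simp
  also have "\<dots> = B * x powr (p - Re s)"
    by (simp add: powr_add[symmetric])
  finally show ?thesis by (simp only: norm_mult norm_exp_ln[OF x])
qed

lemma powr_integrable_halfline:
  fixes r p :: real
  assumes "r > 0" "p < - 1"
  shows "(\<lambda>x. B * x powr p) integrable_on {r..}"
  using has_integral_powr_to_inf[of p r] assms by (intro integrable_on_mult_right) auto

lemma mellin_integrable: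
  assumes r: "r > 0" and h: "continuous_on {r..} h" and le: "\<And>x. x \<ge> r \<Longrightarrow> cmod (h x) \<le> B * x powr p"
    and s: "Re s > p + 1"
  shows "(\<lambda>x. exp (- s * of_real (ln x)) * h x) integrable_on {r..}"
proof (rule integrable_dominated_on_interval)
  show "continuous_on {r..} (\<lambda>x. exp (- s * of_real (ln x)) * h x)"
    by (intro continuous_on_mult h continuous_on_exp_ln r)
  show "norm (exp (- s * of_real (ln x)) * h x) \<le> B * x powr (p - Re s)" if "x \<in> {r..}" for x
    by (rule norm_mellin_integrand[of r, OF r _ le]) (use that in auto)
  show "(\<lambda>x. B * x powr (p - Re s)) integrable_on {r..}"
    using s by (intro powr_integrable_halfline r) auto
qed (auto simp: is_interval_def)

lemma powr_quotient:
  fixes x r p :: real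
  assumes "x > 0" "r > 0"
  shows "(x / r) powr p = x powr p * r powr (- p)"
  using assms by (simp add: powr_divide powr_minus_divide)

text \<open>Written in \<open>x / r \<ge> 1\<close>, where powers are monotone in the exponent; the
  logarithm costs an arbitrarily small power.\<close>

lemma abs_ln_le_powr:
  fixes r x d :: real
  assumes "0 < r" "r \<le> x" "d > 0"
  shows "\<bar>ln x\<bar> \<le> (\<bar>ln r\<bar> + 1 / d) * (x / r) powr d"
proof -
  have y: "x / r \<ge> 1" using assms by simp
  have "ln x = ln r + ln (x / r)" using assms by (simp add: ln_div)
  then have "\<bar>ln x\<bar> \<le> \<bar>ln r\<bar> + ln (x / r)" using ln_ge_zero[OF y] by linarith
  also have "ln (x / r) \<le> (x / r) powr d / d" by (rule ln_powr_bound[OF y assms(3)])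
  also have "\<bar>ln r\<bar> \<le> \<bar>ln r\<bar> * (x / r) powr d"
    using ge_one_powr_ge_zero[OF y, of d] assms(3) by (intro mult_right_mono[of 1, simplified] mult_le_cancel_left1[THEN iffD2]) auto
  finally show ?thesis by (simp add: algebra_simps)
qed

lemma mellin_has_field_derivative:
  assumes r: "r > 0" and h: "continuous_on {r..} h" and le: "\<And>x. x \<ge> r \<Longrightarrow> cmod (h x) \<le> B * x powr p"
    and s0: "Re s0 > p + 1"
  shows "(mellin r h has_field_derivative mellin r (\<lambda>x. - (of_real (ln x) * h x)) s0) (at s0)"
  unfolding mellin_def[abs_def]
proof (rule dominated_field_derivative)
  \<comment> \<open>Of the margin \<open>4 * d\<close> one \<open>d\<close> is lost by moving
    \<open>s\<close> within the disc and one to the logarithm; the exponent \<open>p - q + d\<close>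
    equals \<open>- 1 - 2 * d\<close> and is still integrable.\<close>
  define d where "d = (Re s0 - p - 1) / 4"
  show d: "0 < d" using s0 by (simp add: d_def)
  define q where "q = Re s0 - d"
  \<comment> \<open>A bound for \<open>r powr (- Re s)\<close> on the whole disc, left over when
    \<open>x\<close> is replaced by \<open>x / r\<close>.\<close>
  define K where "K = exp ((\<bar>Re s0\<bar> + d) * \<bar>ln r\<bar>)"
  define A where "A = K * (\<bar>ln r\<bar> + 1 / d) * (B * r powr p)"
  have Re_s: "\<bar>Re s - Re s0\<bar> < d" if "s \<in> ball s0 d" for s
    using that abs_Re_le_cmod[of "s - s0"] by (simp add: dist_norm norm_minus_commute)
  have q: "p - q + d < - 1" using d by (simp add: q_def d_def field_simps)
  show "(\<lambda>x. exp (- s * of_real (ln x)) * h x) integrable_on {r..}" if "s \<in> ball s0 d" for s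
    using Re_s[OF that] d by (intro mellin_integrable[OF r h le]) (auto simp: d_def abs_if split: if_splits)
  show "((\<lambda>s. exp (- s * of_real (ln x)) * h x) has_field_derivative
      exp (- s * of_real (ln x)) * - (of_real (ln x) * h x)) (at s)" for s x
    by (auto intro!: derivative_eq_intros)
  show "(\<lambda>x. A * (x / r) powr (p - q + d)) integrable_on {r..}"
  proof (rule integrable_cong[THEN iffD1])
    show "(\<lambda>x. (A * r powr (- (p - q + d))) * x powr (p - q + d)) integrable_on {r..}"
      by (rule powr_integrable_halfline[OF r q])
    show "A * r powr (- (p - q + d)) * x powr (p - q + d) = A * (x / r) powr (p - q + d)" if "x \<in> {r..}" for x
      using that r by (simp only: powr_quotient[of x r] atLeast_iff) simp
  qed
  fix s x assume s: "s \<in> ball s0 d" and "x \<in> {r..}"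
  then have x: "x \<ge> r" "x > 0" using r by auto
  have y: "x / r \<ge> 1" using x r by simp
  have B: "0 \<le> B * x powr p" using order_trans[OF norm_ge_zero le[OF x(1)]] .
  have "x powr (- Re s) = (x / r) powr (- Re s) * r powr (- Re s)"
    using x r by (simp add: powr_divide)
  also have "\<dots> \<le> (x / r) powr (- q) * K"
  proof (rule mult_mono)
    show "(x / r) powr (- Re s) \<le> (x / r) powr (- q)"
      using Re_s[OF s] y by (intro powr_mono) (auto simp: q_def abs_if split: if_splits)
    have "- Re s * ln r \<le> \<bar>Re s\<bar> * \<bar>ln r\<bar>" by (simp add: abs_mult[symmetric])
    also have "\<dots> \<le> (\<bar>Re s0\<bar> + d) * \<bar>ln r\<bar>" using Re_s[OF s] by (intro mult_right_mono) auto
    finally show "r powr (- Re s) \<le> K" using r by (simp add: powr_def K_def)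
  qed (auto simp: K_def)
  finally have e1: "cmod (exp (- s * of_real (ln x))) \<le> (x / r) powr (- q) * K"
    by (simp only: norm_exp_ln[OF x(2)])
  have "x powr p = r powr p * (x / r) powr p" using x r by (simp add: powr_divide)
  then have e2: "cmod (h x) \<le> (B * r powr p) * (x / r) powr p" using le[OF x(1)] by (simp add: mult.assoc)
  have e3: "\<bar>ln x\<bar> \<le> (\<bar>ln r\<bar> + 1 / d) * (x / r) powr d" by (rule abs_ln_le_powr[OF r x(1) d])
  have "cmod (exp (- s * of_real (ln x))) * (\<bar>ln x\<bar> * cmod (h x))
      \<le> ((x / r) powr (- q) * K) * (((\<bar>ln r\<bar> + 1 / d) * (x / r) powr d) * ((B * r powr p) * (x / r) powr p))"
    using e1 e2 e3 d by (intro mult_mono) (auto simp: K_def)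
  also have "\<dots> = A * ((x / r) powr (- q) * (x / r) powr d * (x / r) powr p)" by (simp add: A_def)
  also have "(x / r) powr (- q) * (x / r) powr d * (x / r) powr p = (x / r) powr (p - q + d)"
    unfolding powr_add[symmetric] by (simp add: algebra_simps)
  finally show "cmod (exp (- s * of_real (ln x)) * - (of_real (ln x) * h x)) \<le> A * (x / r) powr (p - q + d)"
    by (simp only: norm_mult norm_minus_cancel norm_of_real)
qed

lemma mellin_halfline_tendsto:
  assumes r: "r > 0" and h: "continuous_on {r..} h" and le: "\<And>x. x \<ge> r \<Longrightarrow> cmod (h x) \<le> B * x powr p"
    and s: "Re s > p + 1"
  shows "((\<lambda>X. integral {r..X} (\<lambda>x. exp (- s * of_real (ln x)) * h x)) \<longlongrightarrow> mellin r h s) at_top"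
  unfolding mellin_def
proof (rule integral_halfline_tendsto)
  show "continuous_on {r..} (\<lambda>x. exp (- s * of_real (ln x)) * h x)"
    by (intro continuous_on_mult h continuous_on_exp_ln r)
  show "cmod (exp (- s * of_real (ln x)) * h x) \<le> B * x powr (p - Re s)" if "x \<ge> r" for x
    by (rule norm_mellin_integrand[where h = h and p = p, OF r that le[OF that]])
  show "(\<lambda>x. B * x powr (p - Re s)) integrable_on {r..}"
    using s by (intro powr_integrable_halfline r) auto
qed

text \<open>The closed form of the integral of \<open>x powr (- s - a) * ln x ^ k\<close> from
  \<open>r\<close> to infinity for \<open>k\<close> at most 1; outside the half-plane of convergence
  it is the meromorphic continuation, with the pole at \<open>1 - a\<close>.\<close>

definition mellin_tail :: "real \<Rightarrow> real \<Rightarrow> nat \<Rightarrow> complex \<Rightarrow> complex" where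
  "mellin_tail r a k s = exp ((1 - s - of_real a) * of_real (ln r)) *
     (if k = 0 then 1 / (s + of_real a - 1)
      else of_real (ln r) / (s + of_real a - 1) + 1 / (s + of_real a - 1)\<^sup>2)"

lemma mellin_tail_analytic: "s + of_real a \<noteq> 1 \<Longrightarrow> mellin_tail r a k analytic_on {s}"
  unfolding mellin_tail_def[abs_def] by (cases "k = 0") (auto intro!: analytic_intros simp: algebra_simps)

lemma mellin_tail_meromorphic: "mellin_tail r a k meromorphic_on A"
proof -
  have e: "(\<lambda>s. exp ((1 - s - of_real a) * of_real (ln r))) meromorphic_on A"
    by (intro analytic_on_imp_meromorphic_on analytic_intros)
  have "(\<lambda>s. s + of_real a - 1) meromorphic_on A"
    by (intro meromorphic_intros)
  with e show ?thesis
    unfolding mellin_tail_def[abs_def] by (cases "k = 0") (auto intro!: meromorphic_intros)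
qed

lemma mellin_power_log:
  assumes r: "r > 0" and k: "k \<le> 1" and s: "Re s + a > 1"
  shows "(\<lambda>x. exp (- s * of_real (ln x)) * power_log (- a) k x) integrable_on {r..}"
    and "mellin r (power_log (- a) k) s = mellin_tail r a k s"
proof -
  have cont: "continuous_on {r..} (power_log (- a) k)" for k
    unfolding power_log_def[abs_def] using r by (intro continuous_intros) auto
  have le0: "cmod (power_log (- a) 0 x) \<le> 1 * x powr (- a)" for x
    by (simp add: power_log_def)
  have mellin0: "mellin r (power_log (- a) 0) s = mellin_tail r a 0 s" if s: "Re s + a > 1" for s
  proof -
    define w where "w = 1 - s - of_real a"
    have w: "w \<noteq> 0" "Re w < 0" using s by (auto simp: w_def complex_eq_iff)
    define G where "G x = exp (w * of_real (ln x)) / w" for x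
    have ftc: "integral {r..X} (\<lambda>x. exp (- s * of_real (ln x)) * power_log (- a) 0 x) = G X - G r" if "X \<ge> r" for X
    proof (rule integral_unique, rule fundamental_theorem_of_calculus[OF that])
      fix x assume "x \<in> {r..X}"
      then have x: "x > 0" using r by auto
      have "((\<lambda>y. exp (w * y) / w) has_field_derivative exp (w * of_real (ln x))) (at (of_real (ln x)))"
        using w by (auto intro!: derivative_eq_intros)
      moreover have "((\<lambda>x. complex_of_real (ln x)) has_vector_derivative of_real (1 / x)) (at x within {r..X})"
        using x by (intro has_vector_derivative_of_real)
          (auto intro!: derivative_eq_intros simp: has_real_derivative_iff_has_vector_derivative[symmetric] divide_inverse)
      ultimately have "(G has_vector_derivative of_real (1 / x) * exp (w * of_real (ln x))) (at x within {r..X})"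
        using field_vector_diff_chain_within[OF _ has_field_derivative_at_within]
        by (fastforce simp: o_def G_def[abs_def])
      moreover have "of_real (1 / x) * exp (w * of_real (ln x)) = exp (- s * of_real (ln x)) * power_log (- a) 0 x"
      proof -
        have "of_real (1 / x) = exp (- complex_of_real (ln x))"
          using x by (simp add: exp_minus exp_of_real inverse_eq_divide)
        moreover have "power_log (- a) 0 x = exp (- of_real a * complex_of_real (ln x))"
          using x by (simp add: power_log_def powr_def exp_of_real[symmetric])
        ultimately show ?thesis
          by (simp only: exp_add[symmetric]) (simp add: w_def algebra_simps)
      qed
      ultimately show "(G has_vector_derivative exp (- s * of_real (ln x)) * power_log (- a) 0 x) (at x within {r..X})"
        by simp
    qed
    have "(G \<longlongrightarrow> 0) at_top"
    proof (rule Lim_null_comparison)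
      show "\<forall>\<^sub>F x in at_top. norm (G x) \<le> (1 / cmod w) * x powr Re w"
        using eventually_gt_at_top[of 0] by eventually_elim (simp add: G_def norm_divide powr_def)
      have "((\<lambda>x::real. x powr Re w) \<longlongrightarrow> 0) at_top" using w by real_asymp
      from tendsto_mult_right_zero[OF this] show "((\<lambda>x. (1 / cmod w) * x powr Re w) \<longlongrightarrow> 0) at_top" .
    qed
    then have "((\<lambda>X. G X - G r) \<longlongrightarrow> 0 - G r) at_top" by (intro tendsto_diff tendsto_const)
    moreover have "\<forall>\<^sub>F X in at_top. G X - G r = integral {r..X} (\<lambda>x. exp (- s * of_real (ln x)) * power_log (- a) 0 x)"
      using eventually_ge_at_top[of r] by eventually_elim (simp only: ftc)
    ultimately have lim: "((\<lambda>X. integral {r..X} (\<lambda>x. exp (- s * of_real (ln x)) * power_log (- a) 0 x)) \<longlongrightarrow> 0 - G r) at_top"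
      by (rule Lim_transform_eventually)
    have "mellin r (power_log (- a) 0) s = 0 - G r"
      using s by (intro tendsto_unique[OF trivial_limit_at_top_linorder mellin_halfline_tendsto[OF r cont le0] lim]) auto
    also have "\<dots> = mellin_tail r a 0 s"
    proof -
      have "s + of_real a - 1 = - w" by (simp add: w_def)
      then show ?thesis by (simp add: mellin_tail_def G_def w_def[symmetric])
    qed
    finally show ?thesis .
  qed
  \<comment> \<open>The logarithmic case follows from the pure power by differentiation in
    \<open>s\<close>.\<close>
  have der: "(mellin_tail r a 0 has_field_derivative - mellin_tail r a 1 s) (at s)"
  proof -
    have "s + of_real a - 1 \<noteq> 0" using s by (auto simp: complex_eq_iff)
    then have "((\<lambda>s. 1 / (s + of_real a - 1)) has_field_derivative - (1 / (s + of_real a - 1)\<^sup>2)) (at s)"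
      by (auto intro!: derivative_eq_intros simp: power2_eq_square)
    moreover have "((\<lambda>s. exp ((1 - s - of_real a) * of_real (ln r))) has_field_derivative
        - of_real (ln r) * exp ((1 - s - of_real a) * of_real (ln r))) (at s)"
      by (auto intro!: derivative_eq_intros)
    ultimately have "(mellin_tail r a 0 has_field_derivative
        - of_real (ln r) * exp ((1 - s - of_real a) * of_real (ln r)) * (1 / (s + of_real a - 1))
        + - (1 / (s + of_real a - 1)\<^sup>2) * exp ((1 - s - of_real a) * of_real (ln r))) (at s)"
      unfolding mellin_tail_def[abs_def] if_P[OF refl] by (rule DERIV_mult[rotated])
    then show ?thesis by (simp add: mellin_tail_def algebra_simps)
  qed
  have mellin1: "mellin r (power_log (- a) 1) s = mellin_tail r a 1 s"
  proof -
    have "(mellin r (power_log (- a) 0) has_field_derivative mellin r (\<lambda>x. - (of_real (ln x) * power_log (- a) 0 x)) s) (at s)"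
      using s by (intro mellin_has_field_derivative[OF r cont le0]) auto
    moreover have "(mellin r (power_log (- a) 0) has_field_derivative - mellin_tail r a 1 s) (at s)"
    proof (rule has_field_derivative_transform_within_open[OF der, of "{s. Re s > 1 - a}"])
      show "open {s. 1 - a < Re s}" by (rule open_halfspace_Re_gt)
    qed (use s mellin0 in \<open>auto simp: algebra_simps\<close>)
    ultimately have eq: "mellin r (\<lambda>x. - (of_real (ln x) * power_log (- a) 0 x)) s = - mellin_tail r a 1 s"
      by (rule DERIV_unique)
    have "mellin r (\<lambda>x. - (of_real (ln x) * power_log (- a) 0 x)) s = - mellin r (power_log (- a) 1) s"
      unfolding mellin_def by (subst integral_neg[symmetric]) (simp add: power_log_def mult_ac)
    then show ?thesis using eq by simp
  qed
  have k: "k = 0 \<or> k = 1" using k by auto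
  show "mellin r (power_log (- a) k) s = mellin_tail r a k s"
    using k mellin0[OF s] mellin1 by auto
  show "(\<lambda>x. exp (- s * of_real (ln x)) * power_log (- a) k x) integrable_on {r..}"
  proof -
    define d where "d = (Re s + a - 1) / 2"
    have d: "d > 0" using s by (simp add: d_def)
    \<comment> \<open>A common constant for both \<open>k\<close>; for \<open>k = 1\<close> the
      logarithm is traded for the power \<open>d\<close>, half of the available margin.\<close>
    define B where "B = max 1 ((\<bar>ln r\<bar> + 1 / d) * r powr (- d))"
    show ?thesis
    proof (rule mellin_integrable[OF r cont])
      show "Re s > (if k = 0 then - a else d - a) + 1" using s d by (auto simp: d_def field_simps)
      show "cmod (power_log (- a) k x) \<le> B * x powr (if k = 0 then - a else d - a)" if x: "x \<ge> r" for x
      proof (cases "k = 0")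
        case True
        have "1 * x powr (- a) \<le> B * x powr (- a)" by (intro mult_right_mono) (auto simp: B_def)
        then show ?thesis using True le0[of x] by simp
      next
        case False
        then have k1: "k = 1" using k by auto
        have "x > 0" using x r by linarith
        have "\<bar>ln x\<bar> * x powr (- a) \<le> ((\<bar>ln r\<bar> + 1 / d) * (x / r) powr d) * x powr (- a)"
          by (intro mult_right_mono abs_ln_le_powr r x d) simp
        also have "\<dots> = ((\<bar>ln r\<bar> + 1 / d) * r powr (- d)) * x powr (d - a)"
          unfolding powr_quotient[OF \<open>x > 0\<close> r] diff_conv_add_uminus powr_add by (simp only: mult_ac)
        also have "\<dots> \<le> B * x powr (d - a)" by (intro mult_right_mono) (auto simp: B_def)
        finally show ?thesis using k1 by (simp add: power_log_def norm_mult mult.commute)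
      qed
    qed
  qed
qed

text \<open>The factor \<open>sin (pi s) / pi\<close> of the ray integrals divided by
  \<open>s\<close>: it absorbs the simple pole that the term \<open>b J 0\<close> produces at
  0.\<close>

definition sin_quotient :: "complex \<Rightarrow> complex" where
  "sin_quotient s = (if s = 0 then 1 else sin (of_real pi * s) / (of_real pi * s))"

lemma sin_quotient_holomorphic: "sin_quotient holomorphic_on A"
proof -
  have d: "((\<lambda>s. sin (of_real pi * s) / of_real pi) has_field_derivative 1) (at 0)"
    by (auto intro!: derivative_eq_intros)
  have "(\<lambda>s. sin (of_real pi * s) / of_real pi) holomorphic_on UNIV"
    by (intro holomorphic_intros) auto
  from pole_lemma[OF this, of 0] have "(\<lambda>z. if z = 0 then deriv (\<lambda>s. sin (of_real pi * s) / of_real pi) 0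
      else (sin (of_real pi * z) / of_real pi - sin (of_real pi * 0) / of_real pi) / (z - 0)) holomorphic_on UNIV"
    by simp
  also have "(\<lambda>z. if z = 0 then deriv (\<lambda>s. sin (of_real pi * s) / of_real pi) 0
      else (sin (of_real pi * z) / of_real pi - sin (of_real pi * 0) / of_real pi) / (z - 0)) = sin_quotient"
    by (auto simp: sin_quotient_def fun_eq_iff DERIV_imp_deriv[OF d])
  finally show ?thesis by (rule holomorphic_on_subset) simp
qed

text \<open>The function is even.\<close>

lemma sin_quotient_deriv_0: "(sin_quotient has_field_derivative 0) (at 0)"
proof -
  obtain D where D: "(sin_quotient has_field_derivative D) (at 0)"
    using sin_quotient_holomorphic[of UNIV] by (auto simp: holomorphic_on_open)
  have "((\<lambda>s. sin_quotient (- s)) has_field_derivative D * (- 1)) (at 0)"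
    by (rule DERIV_chain2[where g = uminus]) (use D in \<open>auto intro!: derivative_eq_intros\<close>)
  moreover have "(\<lambda>s. sin_quotient (- s)) = sin_quotient"
    by (auto simp: sin_quotient_def fun_eq_iff)
  ultimately have "D * (- 1) = D" using D DERIV_unique by metis
  then have "D = 0" by (simp add: complex_eq_iff)
  with D show ?thesis by simp
qed

lemma integral_reverse_unit_interval:
  fixes g :: "real \<Rightarrow> complex"
  assumes "(g has_integral I) {0..1}"
  shows "((\<lambda>t. g (1 - t)) has_integral I) {0..1}"
proof -
  have "(\<lambda>x::real. - x + 1) ` {0..1} = {0..1}"
  proof (intro equalityI subsetI)
    fix x :: real assume "x \<in> {0..1}"
    then have "x = - (1 - x) + 1" "1 - x \<in> {0..1}" by auto
    then show "x \<in> (\<lambda>x. - x + 1) ` {0..1}" by blast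
  qed auto
  then show ?thesis
    using has_integral_affinity[of g I 0 1 "- 1" 1] assms by (simp add: add.commute)
qed

section \<open>Continuation of the zeta function\<close>

locale zeta_phase = scattering_phase U L f C0 m \<sigma> \<alpha> J b
  for U L f C0 m \<sigma> \<alpha> J b +
  fixes r :: real
  assumes r: "0 < r" "r \<le> \<sigma>"
begin

text \<open>The expansion has no logarithm at the index \<open>J\<close>; a zero coefficient there
  lets \<open>J\<close> be summed together with the other indices.\<close>

definition trace_coeff :: "nat \<Rightarrow> nat \<Rightarrow> complex" where
  "trace_coeff j k = (if j = J \<and> k \<noteq> 0 then 0 else b j k)"

definition remainder :: "nat \<Rightarrow> real \<Rightarrow> complex" where
  "remainder N x = f (- of_real x) - trace_sum N (of_real x)"

lemma J_less: "good N \<Longrightarrow> J < N"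
  using exps exponents_less_iff[OF exps, of J N] by (auto simp: good_def exponents_def)

lemma sum_trace_coeff:
  assumes "J < N"
  shows "(\<Sum>j<N. \<Sum>k\<le>1. trace_coeff j k * g j k)
    = b J 0 * g J 0 + (\<Sum>j\<in>{..<N} - {J}. \<Sum>k\<le>1. b j k * g j k)"
proof -
  have "(\<Sum>j<N. \<Sum>k\<le>1. trace_coeff j k * g j k)
    = (\<Sum>k\<le>1. trace_coeff J k * g J k) + (\<Sum>j\<in>{..<N} - {J}. \<Sum>k\<le>1. trace_coeff j k * g j k)"
    using assms by (intro sum.remove) auto
  also have "(\<Sum>k\<le>1. trace_coeff J k * g J k) = b J 0 * g J 0"
    by (simp add: trace_coeff_def)
  also have "(\<Sum>j\<in>{..<N} - {J}. \<Sum>k\<le>1. trace_coeff j k * g j k) = (\<Sum>j\<in>{..<N} - {J}. \<Sum>k\<le>1. b j k * g j k)"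
    by (intro sum.cong refl) (auto simp: trace_coeff_def)
  finally show ?thesis .
qed

lemma trace_sum_of_real:
  assumes "J < N" "x > 0"
  shows "trace_sum N (of_real x) = (\<Sum>j<N. \<Sum>k\<le>1. trace_coeff j k * power_log (- \<alpha> j) k x)"
proof -
  have "power_log (- \<alpha> J) 0 x = inverse (of_real x)"
    using exps assms(2) by (simp add: exponents_def power_log_def powr_minus)
  then show ?thesis
    unfolding sum_trace_coeff[OF assms(1)] trace_sum_def power_log_sum_of_real[OF assms(2)]
    by (simp add: add.commute)
qed

lemma neg_real_in_region: "x \<ge> r \<Longrightarrow> - of_real x \<in> U" "x \<ge> r \<Longrightarrow> - of_real x \<in> sector_region m \<sigma>"
proof -
  show 1: "- of_real x \<in> sector_region m \<sigma>" if "x \<ge> r"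
  proof (rule sector_in_region)
    have "0 \<le> x * cos m" using that r cos_m by (intro mult_nonneg_nonneg) auto
    then show "Re (- of_real x) \<le> cmod (- of_real x) * cos m" using that r by simp
  qed
  show "- of_real x \<in> U" if "x \<ge> r" using 1[OF that] sector_sub by blast
qed

lemma f_neg_continuous: "continuous_on {r..} (\<lambda>x. f (- of_real x))"
  by (rule continuous_on_compose2[OF holomorphic_on_imp_continuous_on[OF f_holomorphic]])
     (auto intro!: continuous_intros neg_real_in_region)

lemma remainder_continuous:
  assumes "good N"
  shows "continuous_on {r..} (remainder N)"
proof (rule continuous_on_eq)
  show "continuous_on {r..} (\<lambda>x. f (- of_real x) - (\<Sum>j<N. \<Sum>k\<le>1. trace_coeff j k * power_log (- \<alpha> j) k x))"
    unfolding power_log_def using r by (intro continuous_intros f_neg_continuous) auto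
  show "f (- of_real x) - (\<Sum>j<N. \<Sum>k\<le>1. trace_coeff j k * power_log (- \<alpha> j) k x) = remainder N x" if "x \<in> {r..}" for x
    using that r trace_sum_of_real[OF J_less[OF assms]] by (simp add: remainder_def)
qed

text \<open>The asymptotic bound holds for large \<open>x\<close> only; on the compact rest the
  quotient by the power is continuous, hence bounded.\<close>

lemma remainder_bound:
  assumes N: "good N" and \<eta>: "\<eta> > 0"
  obtains B where "\<And>x. x \<ge> r \<Longrightarrow> cmod (remainder N x) \<le> B * x powr (- \<alpha> N + \<eta>)"
proof -
  let ?p = "- \<alpha> N + \<eta>"
  have "(\<lambda>z. cmod (f z - trace_sum N (- z))) \<in> O[infinity_in U](\<lambda>z. cmod z powr ?p)"
    using N \<eta> by (simp add: good_def)
  then obtain c R where c: "c > 0" and R: "R \<ge> 1"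
    and le: "\<And>z. z \<in> U \<Longrightarrow> cmod z \<ge> R \<Longrightarrow> \<bar>cmod (f z - trace_sum N (- z))\<bar> \<le> c * \<bar>cmod z powr ?p\<bar>"
    by (rule infinity_in_bigoE) blast
  have "continuous_on {r..max r R} (\<lambda>x. x powr ?p)"
    using r by (intro continuous_on_powr continuous_on_id continuous_on_const) auto
  then have "continuous_on {r..max r R} (\<lambda>x. cmod (remainder N x) / x powr ?p)"
    using r by (intro continuous_on_divide continuous_on_norm continuous_on_subset[OF remainder_continuous[OF N]]) auto
  then have bdd: "bdd_above ((\<lambda>x. cmod (remainder N x) / x powr ?p) ` {r..max r R})"
    by (intro bounded_imp_bdd_above compact_imp_bounded compact_continuous_image compact_Icc)
  define D where "D = (SUP x\<in>{r..max r R}. cmod (remainder N x) / x powr ?p)"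
  have D: "cmod (remainder N x) / x powr ?p \<le> D" if "x \<in> {r..max r R}" for x
    unfolding D_def using that bdd by (rule cSUP_upper)
  have "cmod (remainder N x) \<le> max c D * x powr ?p" if x: "x \<ge> r" for x
  proof (cases "x \<ge> R")
    case True
    have x0: "x > 0" using x r by linarith
    have "cmod (remainder N x) \<le> c * x powr ?p"
      using le[OF neg_real_in_region(1)[OF x]] True x0 by (simp add: remainder_def)
    also have "\<dots> \<le> max c D * x powr ?p" by (intro mult_right_mono) auto
    finally show ?thesis .
  next
    case False
    have x0: "x powr ?p > 0" using x r by simp
    have "cmod (remainder N x) / x powr ?p \<le> max c D" using D[of x] False x by (simp add: le_max_iff_disj)
    then show ?thesis using x0 by (simp add: pos_divide_le_eq)
  qed
  then show ?thesis using that by blast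
qed

lemma remainder_mellin:
  assumes N: "good N" and s: "1 - \<alpha> N < Re s"
  shows "(\<lambda>x. exp (- s * of_real (ln x)) * remainder N x) integrable_on {r..}"
    and "\<exists>D. (mellin r (remainder N) has_field_derivative D) (at s)"
    and "((\<lambda>X. integral {r..X} (\<lambda>x. exp (- s * of_real (ln x)) * remainder N x)) \<longlongrightarrow> mellin r (remainder N) s) at_top"
proof -
  define \<eta> where "\<eta> = (Re s - (1 - \<alpha> N)) / 2"
  have \<eta>: "\<eta> > 0" "Re s > (- \<alpha> N + \<eta>) + 1" using s by (auto simp: \<eta>_def field_simps)
  obtain B where B: "\<And>x. x \<ge> r \<Longrightarrow> cmod (remainder N x) \<le> B * x powr (- \<alpha> N + \<eta>)"
    using remainder_bound[OF N \<eta>(1)] by blast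
  note c = remainder_continuous[OF N]
  show "(\<lambda>x. exp (- s * of_real (ln x)) * remainder N x) integrable_on {r..}"
    by (rule mellin_integrable[OF r(1) c B \<eta>(2)])
  show "\<exists>D. (mellin r (remainder N) has_field_derivative D) (at s)"
    by (rule exI, rule mellin_has_field_derivative[OF r(1) c B \<eta>(2)])
  show "((\<lambda>X. integral {r..X} (\<lambda>x. exp (- s * of_real (ln x)) * remainder N x)) \<longlongrightarrow> mellin r (remainder N) s) at_top"
    by (rule mellin_halfline_tendsto[OF r(1) c B \<eta>(2)])
qed

lemma mellin_add_power_logs:
  assumes A: "finite A" "\<And>j. j \<in> A \<Longrightarrow> Re s + \<alpha> j > 1"
    and h: "(\<lambda>x. exp (- s * of_real (ln x)) * h x) integrable_on {r..}"
    and g: "\<And>x. x \<ge> r \<Longrightarrow> g x = h x + (\<Sum>j\<in>A. \<Sum>k\<le>1. c j k * power_log (- \<alpha> j) k x)"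
  shows "mellin r g s = mellin r h s + (\<Sum>j\<in>A. \<Sum>k\<le>1. c j k * mellin_tail r (\<alpha> j) k s)"
proof -
  have p: "((\<lambda>x. c j k * (exp (- s * of_real (ln x)) * power_log (- \<alpha> j) k x)) has_integral
      c j k * mellin_tail r (\<alpha> j) k s) {r..}" if "j \<in> A" "k \<in> {..1}" for j k
  proof (rule has_integral_mult_right)
    have "k \<le> 1" using that by simp
    from mellin_power_log[OF r(1) this A(2)[OF that(1)]]
    show "((\<lambda>x. exp (- s * of_real (ln x)) * power_log (- \<alpha> j) k x) has_integral mellin_tail r (\<alpha> j) k s) {r..}"
      unfolding mellin_def by (simp add: has_integral_integrable_integral)
  qed
  have "((\<lambda>x. exp (- s * of_real (ln x)) * h x
      + (\<Sum>j\<in>A. \<Sum>k\<le>1. c j k * (exp (- s * of_real (ln x)) * power_log (- \<alpha> j) k x))) has_integral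
      mellin r h s + (\<Sum>j\<in>A. \<Sum>k\<le>1. c j k * mellin_tail r (\<alpha> j) k s)) {r..}"
    unfolding mellin_def using h
    by (intro has_integral_add has_integral_sum p A(1) integrable_integral) auto
  then have "((\<lambda>x. exp (- s * of_real (ln x)) * g x) has_integral
      mellin r h s + (\<Sum>j\<in>A. \<Sum>k\<le>1. c j k * mellin_tail r (\<alpha> j) k s)) {r..}"
    by (rule has_integral_eq[rotated]) (simp add: g distrib_left sum_distrib_left mult_ac)
  then show ?thesis unfolding mellin_def by (rule integral_unique)
qed

text \<open>For \<open>Re s > 1\<close> this is the Mellin transform of \<open>f\<close> on the
  negative axis; in this form it is meromorphic for \<open>Re s > 1 - \<alpha> N\<close>.\<close>

definition ray_part :: "nat \<Rightarrow> complex \<Rightarrow> complex" where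
  "ray_part N s = mellin r (remainder N) s + (\<Sum>j<N. \<Sum>k\<le>1. trace_coeff j k * mellin_tail r (\<alpha> j) k s)"

text \<open>The terms with index from \<open>N\<close> to \<open>M - 1\<close> have convergent
  integrals for \<open>Re s > 1 - \<alpha> N\<close>, so they may be moved between the remainder and
  the explicit sum.\<close>

lemma ray_part_eq:
  assumes N: "good N" and M: "good M" and "N \<le> M" and s: "1 - \<alpha> N < Re s"
  shows "ray_part N s = ray_part M s"
proof -
  have mono: "\<alpha> N \<le> \<alpha> j" if "j \<ge> N" for j
    using exponents_less_iff[OF exps, of N j] that by (cases "j = N") auto
  have split: "(\<Sum>j<M. g j) = (\<Sum>j<N. g j) + (\<Sum>j\<in>{N..<M}. g j)" for g :: "nat \<Rightarrow> complex"
    using sum.atLeastLessThan_concat[of 0 N M g] \<open>N \<le> M\<close> by (simp add: atLeast0LessThan)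
  have "mellin r (remainder N) s = mellin r (remainder M) s
      + (\<Sum>j\<in>{N..<M}. \<Sum>k\<le>1. trace_coeff j k * mellin_tail r (\<alpha> j) k s)"
  proof (rule mellin_add_power_logs)
    show "1 < Re s + \<alpha> j" if "j \<in> {N..<M}" for j using mono[of j] s that by auto
    show "(\<lambda>x. exp (- s * of_real (ln x)) * remainder M x) integrable_on {r..}"
      using s mono[OF \<open>N \<le> M\<close>] by (intro remainder_mellin(1)[OF M]) auto
    show "remainder N x = remainder M x + (\<Sum>j\<in>{N..<M}. \<Sum>k\<le>1. trace_coeff j k * power_log (- \<alpha> j) k x)" if "x \<ge> r" for x
      using that r trace_sum_of_real[OF J_less[OF N], of x] trace_sum_of_real[OF J_less[OF M], of x]
      unfolding remainder_def by (simp add: split)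
  qed simp
  then show ?thesis unfolding ray_part_def split by simp
qed

lemma ray_part_mellin:
  assumes N: "good N" and s: "Re s > 1"
  shows "mellin r (\<lambda>x. f (- of_real x)) s = ray_part N s"
  unfolding ray_part_def
proof (rule mellin_add_power_logs)
  have "\<alpha> j > 0" for j
    using exps exponents_less_iff[OF exps, of 0 j] by (cases "j = 0") (auto simp: exponents_def)
  then show "1 < Re s + \<alpha> j" for j using s by (simp add: add_strict_increasing2 order.strict_trans)
  show "(\<lambda>x. exp (- s * of_real (ln x)) * remainder N x) integrable_on {r..}"
    using s N by (intro remainder_mellin(1)) (auto simp: good_def)
  show "f (- of_real x) = remainder N x + (\<Sum>j<N. \<Sum>k\<le>1. trace_coeff j k * power_log (- \<alpha> j) k x)" if "x \<ge> r" for x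
    using that r trace_sum_of_real[OF J_less[OF N], of x] unfolding remainder_def by simp
qed simp

text \<open>The shape \<open>a + t * (b - a)\<close> of the arc from \<open>pi\<close> to
  \<open>- pi\<close>. The logarithm built from it is followed continuously, so its values at the
  two ends differ although the points coincide.\<close>

definition angle :: "real \<Rightarrow> real" where
  "angle t = pi + t * (- pi - pi)"

abbreviation circle_log :: "real \<Rightarrow> complex" where
  "circle_log t \<equiv> Complex (ln r) (angle t)"

abbreviation circle_point :: "real \<Rightarrow> complex" where
  "circle_point t \<equiv> rcis r (angle t)"

definition circle_part :: "complex \<Rightarrow> complex" where
  "circle_part s = integral {0..1} (\<lambda>t. \<i> * of_real (- pi - pi) * circle_point t *
     (exp (- s * circle_log t) * f (circle_point t)))"

lemma circle_point_in_region: "circle_point t \<in> U"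
  using sector_sub r by (auto simp: sector_region_def)

lemma circle_log_vd: "(circle_log has_vector_derivative \<i> * of_real (- pi - pi)) (at t within S)"
  unfolding angle_def Complex_eq by (auto intro!: derivative_eq_intros simp: has_vector_derivative_def scaleR_conv_of_real algebra_simps)

lemma circle_point_vd: "(circle_point has_vector_derivative \<i> * of_real (- pi - pi) * circle_point t) (at t within S)"
proof -
  have eq: "circle_point t = exp (circle_log t)" for t
    unfolding Complex_eq exp_add exp_of_real rcis_def cis_conv_exp using r by simp
  have "((exp \<circ> circle_log) has_vector_derivative \<i> * of_real (- pi - pi) * exp (circle_log t)) (at t within S)"
    by (rule field_vector_diff_chain_within[OF circle_log_vd has_field_derivative_at_within[OF DERIV_exp]])
  then show ?thesis unfolding o_def eq[symmetric] .
qed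

lemma L_circle_vd:
  "((\<lambda>t. L (circle_point t)) has_vector_derivative
     - (\<i> * of_real (- pi - pi) * circle_point t * f (circle_point t))) (at t within S)"
  using field_vector_diff_chain_within[OF circle_point_vd has_field_derivative_at_within[OF deriv_L[OF circle_point_in_region]], of t S]
  by (simp add: o_def)

lemma circle_ends: "circle_point 0 = - of_real r" "circle_point 1 = - of_real r"
  by (simp_all add: angle_def rcis_def complex_eq_iff)

lemma circle_continuous:
  "continuous_on A circle_point" "continuous_on A circle_log" "continuous_on A (\<lambda>t. f (circle_point t))"
proof -
  show c: "continuous_on A circle_point"
    by (rule continuous_on_vector_derivative) (rule circle_point_vd)
  show "continuous_on A circle_log"
    by (rule continuous_on_vector_derivative) (rule circle_log_vd)
  show "continuous_on A (\<lambda>t. f (circle_point t))"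
    by (rule continuous_on_compose2[OF holomorphic_on_imp_continuous_on[OF f_holomorphic] c])
       (use circle_point_in_region in auto)
qed

lemma circle_part_deriv:
  "(circle_part has_field_derivative integral {0..1} (\<lambda>t. \<i> * of_real (- pi - pi) * circle_point t *
     (exp (- s * circle_log t) * f (circle_point t)) * - circle_log t)) (at s)"
proof -
  have "((\<lambda>s. integral (cbox 0 1) (\<lambda>t. \<i> * of_real (- pi - pi) * circle_point t *
     (exp (- s * circle_log t) * f (circle_point t)))) has_field_derivative
     integral (cbox 0 1) (\<lambda>t. \<i> * of_real (- pi - pi) * circle_point t *
     (exp (- s * circle_log t) * f (circle_point t)) * - circle_log t)) (at s within UNIV)"
  proof (rule leibniz_rule_field_derivative)
    show "((\<lambda>s. \<i> * of_real (- pi - pi) * circle_point t * (exp (- s * circle_log t) * f (circle_point t)))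
      has_field_derivative \<i> * of_real (- pi - pi) * circle_point t *
     (exp (- s * circle_log t) * f (circle_point t)) * - circle_log t) (at s within UNIV)" for s t
      by (auto intro!: derivative_eq_intros)
    show "(\<lambda>t. \<i> * of_real (- pi - pi) * circle_point t * (exp (- s * circle_log t) * f (circle_point t)))
      integrable_on cbox 0 1" for s
      by (intro integrable_continuous continuous_intros circle_continuous)
    have f2: "continuous_on (UNIV \<times> cbox 0 1) (\<lambda>p::complex \<times> real. g (snd p))" if "continuous_on UNIV g" for g :: "real \<Rightarrow> complex"
      by (rule continuous_on_compose2[OF that]) (auto intro!: continuous_intros)
    show "continuous_on (UNIV \<times> cbox 0 1) (\<lambda>(s, t). \<i> * of_real (- pi - pi) * circle_point t *
     (exp (- s * circle_log t) * f (circle_point t)) * - circle_log t)"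
      unfolding case_prod_unfold
      by (intro continuous_intros f2 circle_continuous)
  qed auto
  then show ?thesis by (simp add: circle_part_def[abs_def])
qed

text \<open>At \<open>s = 0\<close> the weight is 1, and \<open>f\<close> has the primitive
  \<open>- L\<close> along a closed circle.\<close>

lemma circle_part_0: "circle_part 0 = 0"
proof -
  have "((\<lambda>t. - (\<i> * of_real (- pi - pi) * circle_point t * f (circle_point t))) has_integral
      L (circle_point 1) - L (circle_point 0)) {0..1}"
    by (rule fundamental_theorem_of_calculus) (use L_circle_vd in auto)
  from has_integral_neg[OF this] show ?thesis
    unfolding circle_part_def by (intro integral_unique) (simp only: circle_ends diff_self, simp)
qed

text \<open>The mean value property. Cauchy's formula is applied to \<open>L (- z)\<close>, because
  the reversed circle starting at \<open>- r\<close> is the negative of the standard one starting at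
  \<open>r\<close>.\<close>

lemma L_circle_mean: "((\<lambda>t. L (circle_point t)) has_integral L 0) {0..1}"
proof -
  have neg: "- z \<in> U" if "cmod z \<le> r" for z
    using that sector_sub r by (auto simp: sector_region_def)
  have hol: "(\<lambda>z. L (- z)) holomorphic_on cball 0 r"
    by (rule holomorphic_on_compose_gen[OF _ L_holomorphic, unfolded o_def])
       (auto intro!: holomorphic_intros neg)
  have "((\<lambda>u. L (- u) / (u - 0)) has_contour_integral 2 * of_real pi * \<i> * L (- 0)) (circlepath 0 r)"
    by (rule Cauchy_integral_circlepath) (use r hol in \<open>auto intro: holomorphic_on_imp_continuous_on holomorphic_on_subset\<close>)
  then have "((\<lambda>t. L (- circlepath 0 r t) / (circlepath 0 r t - 0) * vector_derivative (circlepath 0 r) (at t within {0..1}))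
      has_integral 2 * of_real pi * \<i> * L 0) {0..1}"
    by (simp add: has_contour_integral_def)
  then have "((\<lambda>t. 2 * of_real pi * \<i> * L (circle_point (1 - t))) has_integral 2 * of_real pi * \<i> * L 0) {0..1}"
  proof (rule has_integral_eq[rotated])
    fix t :: real assume t: "t \<in> {0..1}"
    have nz: "of_real r * exp (2 * of_real pi * \<i> * of_real t) \<noteq> (0::complex)" using r by simp
    have "angle (1 - t) = 2 * pi * t - pi" by (simp add: angle_def algebra_simps)
    then have "circle_point (1 - t) = of_real r * (cis (2 * pi * t) * cis (- pi))"
      by (simp only: rcis_def cis_mult) simp
    also have "cis (- pi) = - 1" by (simp add: complex_eq_iff)
    also have "of_real r * (cis (2 * pi * t) * - 1) = - circlepath 0 r t"
      by (simp add: circlepath cis_conv_exp mult_ac)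
    finally have p: "circle_point (1 - t) = - circlepath 0 r t" .
    show "L (- circlepath 0 r t) / (circlepath 0 r t - 0) * vector_derivative (circlepath 0 r) (at t within {0..1})
        = 2 * of_real pi * \<i> * L (circle_point (1 - t))"
      unfolding p using vector_derivative_circlepath01[of t 0 r] t nz by (simp add: circlepath)
  qed
  from has_integral_mult_right[OF this, of "1 / (2 * of_real pi * \<i>)"]
  have "((\<lambda>t. L (circle_point (1 - t))) has_integral L 0) {0..1}" by simp
  from integral_reverse_unit_interval[OF this] show ?thesis by simp
qed

text \<open>Differentiation brings down the logarithm, and integration by parts moves the derivative
  off \<open>L\<close>. The jump of the logarithm around the circle gives the term
  \<open>L (- r)\<close>, the mean value of \<open>L\<close> gives \<open>L 0\<close>.\<close>

lemma circle_part_deriv_0: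
  "(circle_part has_field_derivative 2 * of_real pi * \<i> * (L 0 - L (- of_real r))) (at 0)"
proof -
  let ?c = "\<i> * complex_of_real (- pi - pi)"
  have "((\<lambda>t. circle_log t * - (?c * circle_point t * f (circle_point t)) + ?c * L (circle_point t)) has_integral
      circle_log 1 * L (circle_point 1) - circle_log 0 * L (circle_point 0)) {0..1}"
    by (rule fundamental_theorem_of_calculus)
       (simp, rule has_vector_derivative_mult[OF circle_log_vd L_circle_vd])
  from has_integral_diff[OF this has_integral_mult_right[OF L_circle_mean, of ?c]]
  have "((\<lambda>t. circle_log t * - (?c * circle_point t * f (circle_point t))) has_integral
      circle_log 1 * L (circle_point 1) - circle_log 0 * L (circle_point 0) - ?c * L 0) {0..1}"
    by simp
  also have "circle_log 1 * L (circle_point 1) - circle_log 0 * L (circle_point 0) - ?c * L 0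
      = (circle_log 1 - circle_log 0) * L (- of_real r) - ?c * L 0"
    unfolding circle_ends by (simp only: left_diff_distrib)
  also have "circle_log 1 - circle_log 0 = ?c"
    by (simp add: angle_def Complex_eq algebra_simps)
  finally have "integral {0..1} (\<lambda>t. circle_log t * - (?c * circle_point t * f (circle_point t)))
      = ?c * L (- of_real r) - ?c * L 0"
    by (rule integral_unique)
  moreover have "(\<lambda>t. circle_log t * - (?c * circle_point t * f (circle_point t)))
      = (\<lambda>t. ?c * circle_point t * (exp (- 0 * circle_log t) * f (circle_point t)) * - circle_log t)"
    by (simp add: fun_eq_iff mult_ac)
  ultimately have "integral {0..1} (\<lambda>t. ?c * circle_point t * (exp (- 0 * circle_log t) * f (circle_point t)) * - circle_log t)
      = 2 * of_real pi * \<i> * (L 0 - L (- of_real r))"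
    by (simp add: algebra_simps)
  with circle_part_deriv[of 0] show ?thesis by simp
qed

definition zeta_branch :: "nat \<Rightarrow> complex \<Rightarrow> complex" where
  "zeta_branch N s = sin (of_real pi * s) / of_real pi * ray_part N s
     + \<i> / (2 * of_real pi) * circle_part s"

lemma zeta_branch_integral:
  assumes N: "good N" and s: "Re s > 1"
  shows "zeta_branch N s = \<i> / (2 * of_real pi) *
    ray_arc_integral r pi (- pi) (\<lambda>x \<theta>. exp (- s * Complex (ln x) \<theta>) * f (rcis x \<theta>))"
proof -
  have ray: "integral {r..} (\<lambda>x. cis \<theta> * (exp (- s * Complex (ln x) \<theta>) * f (rcis x \<theta>)))
      = - exp (- s * (\<i> * of_real \<theta>)) * ray_part N s" if \<theta>: "\<theta> \<in> {pi, - pi}" for \<theta>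
  proof -
    have p: "cis \<theta> = - 1" "rcis x \<theta> = - of_real x" for x
      using \<theta> by (auto simp: rcis_def complex_eq_iff)
    have "integral {r..} (\<lambda>x. cis \<theta> * (exp (- s * Complex (ln x) \<theta>) * f (rcis x \<theta>)))
      = integral {r..} (\<lambda>x. - exp (- s * (\<i> * of_real \<theta>)) * (exp (- s * of_real (ln x)) * f (- of_real x)))"
      unfolding p Complex_eq distrib_left exp_add by (intro arg_cong[where f = "integral _"] ext) simp
    also have "\<dots> = - exp (- s * (\<i> * of_real \<theta>)) * mellin r (\<lambda>x. f (- of_real x)) s"
      unfolding mellin_def by (rule integral_mult_right)
    finally show ?thesis unfolding ray_part_mellin[OF N s] .
  qed
  have "ray_arc_integral r pi (- pi) (\<lambda>x \<theta>. exp (- s * Complex (ln x) \<theta>) * f (rcis x \<theta>))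
    = exp (- s * (\<i> * of_real pi)) * ray_part N s + circle_part s - exp (- s * (\<i> * of_real (- pi))) * ray_part N s"
    using ray[of pi] ray[of "- pi"] unfolding ray_arc_integral_def circle_part_def angle_def
    by (simp only: insert_iff simp_thms minus_mult_left[symmetric]) simp
  also have "\<dots> = (exp (- (\<i> * (of_real pi * s))) - exp (\<i> * (of_real pi * s))) * ray_part N s + circle_part s"
    by (simp add: algebra_simps)
  also have "exp (- (\<i> * (of_real pi * s))) - exp (\<i> * (of_real pi * s)) = - (2 * \<i>) * sin (of_real pi * s)"
    by (simp add: sin_exp_eq field_simps)
  finally have eq: "ray_arc_integral r pi (- pi) (\<lambda>x \<theta>. exp (- s * Complex (ln x) \<theta>) * f (rcis x \<theta>))
    = - (2 * \<i>) * sin (of_real pi * s) * ray_part N s + circle_part s" .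
  show ?thesis unfolding zeta_branch_def eq by (simp add: field_simps)
qed

lemma sin_over_pi_analytic: "(\<lambda>s. sin (of_real pi * s) / of_real pi) analytic_on A"
  by (rule analytic_on_subset[of _ UNIV]) (auto simp: analytic_on_open intro!: holomorphic_intros)

lemma circle_part_holomorphic: "circle_part holomorphic_on A"
  using circle_part_deriv by (meson DERIV_subset holomorphic_onI field_differentiable_def subset_UNIV)

lemma remainder_mellin_analytic:
  assumes "good N" "1 - \<alpha> N < Re s"
  shows "mellin r (remainder N) analytic_on {s}"
proof -
  have "mellin r (remainder N) holomorphic_on {s. 1 - \<alpha> N < Re s}"
    using remainder_mellin(2)[OF assms(1)] by (auto simp: holomorphic_on_open open_halfspace_Re_gt)
  then show ?thesis
    using assms(2) open_halfspace_Re_gt[of "1 - \<alpha> N"] by (auto simp: analytic_at)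
qed

lemma circle_part_analytic: "circle_part analytic_on A"
  by (rule analytic_on_subset[of _ UNIV]) (auto simp: analytic_on_open circle_part_holomorphic)

lemma zeta_branch_meromorphic:
  assumes "good N" "1 - \<alpha> N < Re s"
  shows "zeta_branch N meromorphic_on {s}"
  unfolding zeta_branch_def[abs_def] ray_part_def[abs_def]
  by (intro meromorphic_on_add meromorphic_on_mult meromorphic_on_sum meromorphic_on_const
      mellin_tail_meromorphic analytic_on_imp_meromorphic_on sin_over_pi_analytic circle_part_analytic
      remainder_mellin_analytic assms)

lemma zeta_branch_analytic:
  assumes N: "good N" and s: "1 - \<alpha> N < Re s" "\<And>j. s + of_real (\<alpha> j) \<noteq> 1"
  shows "zeta_branch N analytic_on {s}"
  unfolding zeta_branch_def[abs_def] ray_part_def[abs_def]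
  by (intro analytic_on_add analytic_on_mult analytic_on_sum analytic_on_const
      mellin_tail_analytic sin_over_pi_analytic circle_part_analytic remainder_mellin_analytic assms)

text \<open>The branches agree wherever two of them are defined, so the choice of \<open>N\<close> is immaterial.\<close>

definition zeta_raw :: "complex \<Rightarrow> complex" where
  "zeta_raw s = zeta_branch (LEAST N. good N \<and> 1 - \<alpha> N < Re s) s"

lemma exists_good: "\<exists>N. good N \<and> 1 - \<alpha> N < x"
proof -
  obtain N where "good N \<and> \<alpha> N > 1 - x"
    using eventually_happens'[OF sequentially_bot
        eventually_conj[OF eventually_good exponents_eventually_gt[OF exps, of "1 - x"]]] by blast
  then show ?thesis by (intro exI[of _ N]) auto
qed

lemma zeta_raw_eq:
  assumes "good N" "1 - \<alpha> N < Re s"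
  shows "zeta_raw s = zeta_branch N s"
proof -
  let ?P = "\<lambda>N. good N \<and> 1 - \<alpha> N < Re s"
  have "?P (Least ?P)" by (rule LeastI[of ?P N]) (use assms in simp)
  moreover have "Least ?P \<le> N" by (rule Least_le) (use assms in simp)
  ultimately have "ray_part (Least ?P) s = ray_part N s"
    using assms by (intro ray_part_eq) auto
  then show ?thesis by (simp add: zeta_raw_def zeta_branch_def)
qed

lemma eventually_zeta_raw_eq:
  assumes "good N" "1 - \<alpha> N < Re s"
  shows "\<forall>\<^sub>F w in nhds s. zeta_raw w = zeta_branch N w"
proof -
  have "\<forall>\<^sub>F w in nhds s. w \<in> {w. 1 - \<alpha> N < Re w}"
    using assms(2) by (intro eventually_nhds_in_open open_halfspace_Re_gt) simp
  then show ?thesis by eventually_elim (simp add: zeta_raw_eq[OF assms(1)])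
qed

text \<open>At the points \<open>1 - \<alpha> j\<close>, among them 0, the raw function takes values
  that come from division by zero. They are replaced by the limit or, at a pole, by 0, as
  \<open>nicely_meromorphic_on\<close> prescribes.\<close>

definition zeta :: "complex \<Rightarrow> complex" where
  "zeta = remove_sings zeta_raw"

lemma zeta_nicely_meromorphic: "zeta nicely_meromorphic_on UNIV"
  unfolding zeta_def
proof (rule remove_sings_nicely_meromorphic, subst meromorphic_on_meromorphic_at, rule ballI)
  fix s :: complex
  obtain N where N: "good N" "1 - \<alpha> N < Re s" using exists_good by blast
  have "\<forall>\<^sub>F w in at s. zeta_raw w = zeta_branch N w"
    using eventually_zeta_raw_eq[OF N] by (simp add: eventually_nhds_conv_at)
  then have "zeta_raw meromorphic_on {s} \<longleftrightarrow> zeta_branch N meromorphic_on {s}"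
    by (intro meromorphic_on_cong) auto
  then show "zeta_raw meromorphic_on {s}" using zeta_branch_meromorphic[OF N] by simp
qed

lemma zeta_eq_branch:
  assumes N: "good N" and s: "Re s > 1"
  shows "zeta s = zeta_branch N s"
proof -
  have N': "1 - \<alpha> N < Re s" using N s by (simp add: good_def)
  have "\<alpha> j > 0" for j
    using exps exponents_less_iff[OF exps, of 0 j] by (cases "j = 0") (auto simp: exponents_def)
  then have "s + of_real (\<alpha> j) \<noteq> 1" for j
    using s by (auto simp: complex_eq_iff) (smt (verit))
  then have an: "zeta_branch N analytic_on {s}" by (intro zeta_branch_analytic N N')
  have "zeta s = remove_sings (zeta_branch N) s"
    unfolding zeta_def using eventually_zeta_raw_eq[OF N N']
    by (intro remove_sings_cong refl) (simp add: eventually_nhds_conv_at)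
  also have "\<dots> = zeta_branch N s" by (rule remove_sings_at_analytic[OF an])
  finally show ?thesis .
qed

lemma zeta_integral:
  assumes "Re s > 1"
  shows "zeta s = \<i> / (2 * of_real pi) *
    ray_arc_integral r pi (- pi) (\<lambda>x \<theta>. exp (- s * Complex (ln x) \<theta>) * f (rcis x \<theta>))"
proof -
  obtain N where N: "good N" using exists_good by blast
  show ?thesis unfolding zeta_eq_branch[OF N assms] by (rule zeta_branch_integral[OF N assms])
qed

section \<open>The zeta function near 0\<close>

text \<open>The ray integral without the term of index \<open>J\<close>, which alone among the
  explicit terms is singular at 0.\<close>

definition regular_part :: "nat \<Rightarrow> complex \<Rightarrow> complex" where
  "regular_part N s = mellin r (remainder N) s + (\<Sum>j\<in>{..<N} - {J}. \<Sum>k\<le>1. b j k * mellin_tail r (\<alpha> j) k s)"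

definition zeta_near_0 :: "nat \<Rightarrow> complex \<Rightarrow> complex" where
  "zeta_near_0 N s = b J 0 * exp (- s * of_real (ln r)) * sin_quotient s
     + sin (of_real pi * s) / of_real pi * regular_part N s + \<i> / (2 * of_real pi) * circle_part s"

text \<open>The half-plane of the branch without the candidate poles other than 0; it is a
  neighbourhood of 0 because \<open>\<alpha> j\<close> differs from 1 for \<open>j\<close> other
  than \<open>J\<close>.\<close>

definition near_0 :: "nat \<Rightarrow> complex set" where
  "near_0 N = {s. 1 - \<alpha> N < Re s} - (\<lambda>j. of_real (1 - \<alpha> j)) ` ({..<N} - {J})"

lemma near_0:
  assumes "good N"
  shows "open (near_0 N)" "0 \<in> near_0 N"
proof -
  show "open (near_0 N)"
    unfolding near_0_def by (intro open_Diff open_halfspace_Re_gt finite_imp_closed) auto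
  have "0 \<notin> (\<lambda>j. complex_of_real (1 - \<alpha> j)) ` ({..<N} - {J})"
  proof
    assume "0 \<in> (\<lambda>j. complex_of_real (1 - \<alpha> j)) ` ({..<N} - {J})"
    then show False
    proof (rule imageE)
      fix j assume "0 = complex_of_real (1 - \<alpha> j)" "j \<in> {..<N} - {J}"
      then have "1 - \<alpha> j = 0" "j \<noteq> J" by (metis of_real_eq_0_iff, blast)
      then show False using exponents_neq_1[OF exps, of j] by simp
    qed
  qed
  then show "0 \<in> near_0 N" using assms by (simp add: near_0_def good_def)
qed

lemma regular_part_analytic:
  assumes "good N" "s \<in> near_0 N"
  shows "regular_part N analytic_on {s}"
  unfolding regular_part_def[abs_def]
proof (intro analytic_on_add analytic_on_sum analytic_on_mult analytic_on_const mellin_tail_analytic)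
  show "mellin r (remainder N) analytic_on {s}"
    using assms by (intro remainder_mellin_analytic) (auto simp: near_0_def)
  fix j assume j: "j \<in> {..<N} - {J}"
  show "s + of_real (\<alpha> j) \<noteq> 1"
  proof
    assume "s + of_real (\<alpha> j) = 1"
    then have "s = of_real (1 - \<alpha> j)" by (simp add: eq_diff_eq)
    then show False using j assms(2) unfolding near_0_def by blast
  qed
qed

lemma zeta_near_0_holomorphic:
  assumes "good N"
  shows "zeta_near_0 N holomorphic_on near_0 N"
proof -
  have "regular_part N holomorphic_on near_0 N"
    using regular_part_analytic[OF assms] analytic_imp_holomorphic analytic_on_analytic_at by blast
  then show ?thesis
    unfolding zeta_near_0_def[abs_def]
    by (intro holomorphic_intros sin_quotient_holomorphic circle_part_holomorphic) auto
qed

text \<open>The point 0 is excluded because there the singular term of the branch is a division by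
  zero.\<close>

lemma zeta_branch_near_0:
  assumes N: "good N" and s: "s \<noteq> 0"
  shows "zeta_branch N s = zeta_near_0 N s"
proof -
  have "mellin_tail r (\<alpha> J) 0 s = exp (- s * of_real (ln r)) / s"
    using exps by (simp add: mellin_tail_def exponents_def)
  then have ray: "ray_part N s = b J 0 * (exp (- s * of_real (ln r)) / s) + regular_part N s"
    unfolding ray_part_def regular_part_def sum_trace_coeff[OF J_less[OF N]] by simp
  then show ?thesis
    using s unfolding zeta_branch_def zeta_near_0_def sin_quotient_def ray by (simp add: field_simps)
qed

lemma zeta_eq_near_0:
  assumes N: "good N" and s: "s \<in> near_0 N"
  shows "zeta s = zeta_near_0 N s"
proof -
  have N': "1 - \<alpha> N < Re s" using s by (simp add: near_0_def)
  have "\<forall>\<^sub>F w in at s. w \<noteq> 0"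
  proof (cases "s = 0")
    case False
    then show ?thesis using tendsto_imp_eventually_ne[OF tendsto_ident_at, of s 0 UNIV] by simp
  qed (simp add: eventually_at_filter)
  moreover have "\<forall>\<^sub>F w in at s. zeta_raw w = zeta_branch N w"
    using eventually_zeta_raw_eq[OF N N'] by (simp add: eventually_nhds_conv_at)
  ultimately have "\<forall>\<^sub>F w in at s. zeta_raw w = zeta_near_0 N w"
    by eventually_elim (simp add: zeta_branch_near_0[OF N])
  then have "zeta s = remove_sings (zeta_near_0 N) s"
    unfolding zeta_def by (intro remove_sings_cong refl)
  also have "zeta_near_0 N analytic_on {s}"
    using zeta_near_0_holomorphic[OF N] near_0(1)[OF N] s by (auto simp: analytic_at)
  then have "remove_sings (zeta_near_0 N) s = zeta_near_0 N s" by (rule remove_sings_at_analytic)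
  finally show ?thesis .
qed

text \<open>At \<open>s = 0\<close> the tail is the continued integral of the term from
  \<open>r\<close> to infinity: minus the antiderivative at \<open>r\<close>, with no contribution
  from infinity.\<close>

lemma phase_coeff_tail:
  assumes "j \<noteq> J"
  shows "(\<Sum>k\<le>1. b j k * mellin_tail r (\<alpha> j) k 0) = - (\<Sum>k\<le>1. phase_coeff j k * power_log (1 - \<alpha> j) k r)"
proof -
  define c where "c = complex_of_real (1 - \<alpha> j)"
  define E where "E = exp (c * of_real (ln r))"
  have c: "c \<noteq> 0" "0 + of_real (\<alpha> j) - 1 = - c" "1 - 0 - of_real (\<alpha> j) = c"
    using exponents_neq_1[OF exps assms] by (auto simp: c_def)
  have "complex_of_real (r powr (1 - \<alpha> j)) = E"
    using r by (simp add: E_def c_def powr_def exp_of_real[symmetric] del: of_real_diff)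
  then have p: "power_log (1 - \<alpha> j) k r = E * of_real (ln r) ^ k" for k
    by (simp add: power_log_def)
  have t: "mellin_tail r (\<alpha> j) k 0 = E * (if k = 0 then 1 / (- c) else of_real (ln r) / (- c) + 1 / (- c)\<^sup>2)" for k
    unfolding mellin_tail_def c(2,3) E_def ..
  have two: "(\<Sum>k\<le>1. g k) = g 0 + g (Suc 0)" for g :: "nat \<Rightarrow> complex" by (simp add: add.commute)
  show ?thesis
    unfolding two p t phase_coeff_def c_def[symmetric] using c(1)
    by (simp add: field_simps power2_eq_square)
qed

text \<open>The remainder integrates to the limit \<open>phase_const\<close> minus
  \<open>L (- r)\<close> plus \<open>phase_sum N r\<close>. The tails remove the power terms of that
  phase sum and leave its logarithm.\<close>

lemma regular_part_0:
  assumes N: "good N"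
  shows "regular_part N 0 = phase_const - L (- of_real r) + b J 0 * of_real (ln r)"
proof -
  define H where "H x = L (- of_real x) - phase_sum N (of_real x)" for x :: real
  have a: "\<alpha> N > 1" using N by (simp add: good_def)
  have ftc: "integral {r..X} (\<lambda>x. exp (- 0 * of_real (ln x)) * remainder N x) = H X - H r" if "X \<ge> r" for X
  proof (rule integral_unique, rule fundamental_theorem_of_calculus[OF that])
    fix x assume "x \<in> {r..X}"
    then have x: "x \<ge> r" "x > 0" using r by auto
    have "((\<lambda>x. - complex_of_real x) has_vector_derivative - 1) (at x within {r..X})"
      by (auto intro!: derivative_eq_intros)
    from field_vector_diff_chain_within[OF this has_field_derivative_at_within[OF deriv_L[OF neg_real_in_region(1)[OF x(1)]]]]
    have 1: "((\<lambda>x. L (- of_real x)) has_vector_derivative f (- of_real x)) (at x within {r..X})"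
      by (simp add: o_def)
    have "(phase_sum N has_field_derivative trace_sum N (of_real x)) (at (of_real x))"
      by (rule phase_sum_deriv) (use x in \<open>simp add: complex_nonpos_Reals_iff\<close>)
    from has_vector_derivative_real_field[OF this]
    have "((\<lambda>x. phase_sum N (of_real x)) has_vector_derivative trace_sum N (of_real x)) (at x within {r..X})" .
    from has_vector_derivative_diff[OF 1 this]
    show "(H has_vector_derivative exp (- 0 * of_real (ln x)) * remainder N x) (at x within {r..X})"
      by (simp add: H_def[abs_def] remainder_def)
  qed
  have "(H \<longlongrightarrow> phase_const) at_top"
  proof (rule LIM_zero_cancel)
    define \<eta> where "\<eta> = (\<alpha> N - 1) / 2"
    have \<eta>: "\<eta> > 0" "1 - \<alpha> N + \<eta> < 0" using a by (auto simp: \<eta>_def field_simps)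
    obtain B R where R: "R \<ge> 1" and B: "\<And>z. cmod z \<ge> R \<Longrightarrow> Re z \<le> cmod z * cos m \<Longrightarrow>
        cmod (L z - phase_sum N (- z) - phase_const) \<le> B * cmod z powr (1 - \<alpha> N + \<eta>)"
      using phase_const_bound[OF N \<eta>] by blast
    show "((\<lambda>x. H x - phase_const) \<longlongrightarrow> 0) at_top"
    proof (rule Lim_null_comparison)
      show "\<forall>\<^sub>F x in at_top. norm (H x - phase_const) \<le> B * x powr (1 - \<alpha> N + \<eta>)"
        using eventually_ge_at_top[of R]
      proof eventually_elim
        case (elim x)
        have "0 \<le> x * cos m" using elim R cos_m by (intro mult_nonneg_nonneg) auto
        then show ?case using B[of "- of_real x"] elim R by (simp add: H_def)
      qed
      have "((\<lambda>x::real. x powr (1 - \<alpha> N + \<eta>)) \<longlongrightarrow> 0) at_top" using \<eta>(2) by real_asymp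
      from tendsto_mult_right_zero[OF this] show "((\<lambda>x. B * x powr (1 - \<alpha> N + \<eta>)) \<longlongrightarrow> 0) at_top" .
    qed
  qed
  then have "((\<lambda>X. H X - H r) \<longlongrightarrow> phase_const - H r) at_top" by (intro tendsto_diff tendsto_const)
  moreover have "\<forall>\<^sub>F X in at_top. H X - H r = integral {r..X} (\<lambda>x. exp (- 0 * of_real (ln x)) * remainder N x)"
    using eventually_ge_at_top[of r] by eventually_elim (simp only: ftc)
  ultimately have lim: "((\<lambda>X. integral {r..X} (\<lambda>x. exp (- 0 * of_real (ln x)) * remainder N x)) \<longlongrightarrow> phase_const - H r) at_top"
    by (rule Lim_transform_eventually)
  have mell: "mellin r (remainder N) 0 = phase_const - H r"
    using a by (intro tendsto_unique[OF trivial_limit_at_top_linorder remainder_mellin(3)[OF N] lim]) auto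
  have "(\<Sum>j\<in>{..<N} - {J}. \<Sum>k\<le>1. b j k * mellin_tail r (\<alpha> j) k 0)
      = (\<Sum>j\<in>{..<N} - {J}. - (\<Sum>k\<le>1. phase_coeff j k * power_log (1 - \<alpha> j) k r))"
    by (intro sum.cong refl phase_coeff_tail) auto
  also have "\<dots> = - power_log_sum (\<lambda>j. 1 - \<alpha> j) J phase_coeff N (of_real r)"
    unfolding power_log_sum_of_real[OF r(1)] by (rule sum_negf)
  finally have tails: "(\<Sum>j\<in>{..<N} - {J}. \<Sum>k\<le>1. b j k * mellin_tail r (\<alpha> j) k 0)
      = - power_log_sum (\<lambda>j. 1 - \<alpha> j) J phase_coeff N (of_real r)" .
  show ?thesis
    unfolding regular_part_def mell tails H_def phase_sum_def using r by (simp add: Ln_of_real)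
qed

lemma zeta_at_0:
  "zeta analytic_on {0}" "zeta 0 = b J 0" "deriv zeta 0 = phase_const - L 0"
proof -
  obtain N where N: "good N" using exists_good by blast
  note W = near_0[OF N]
  have hol: "zeta holomorphic_on near_0 N"
    by (rule holomorphic_transform[OF zeta_near_0_holomorphic[OF N]]) (simp add: zeta_eq_near_0[OF N])
  then show "zeta analytic_on {0}" using W by (auto simp: analytic_at)
  show "zeta 0 = b J 0"
    by (simp add: zeta_eq_near_0[OF N W(2)] zeta_near_0_def sin_quotient_def circle_part_0)
  have "regular_part N holomorphic_on near_0 N"
    using regular_part_analytic[OF N] analytic_imp_holomorphic analytic_on_analytic_at by blast
  then obtain D where D: "(regular_part N has_field_derivative D) (at 0)"
    using W by (auto simp: holomorphic_on_open)
  have e: "((\<lambda>s. b J 0 * exp (- s * of_real (ln r))) has_field_derivative - b J 0 * of_real (ln r)) (at 0)"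
    by (auto intro!: derivative_eq_intros)
  have sn: "((\<lambda>s. sin (of_real pi * s) / of_real pi) has_field_derivative 1) (at 0)"
    by (auto intro!: derivative_eq_intros)
  \<comment> \<open>The radius drops out: \<open>ln r\<close> from the exponential cancels the
    logarithm in \<open>regular_part_0\<close>, and \<open>L (- r)\<close> cancels between ray and
    circle.\<close>
  have "(zeta_near_0 N has_field_derivative
      (- b J 0 * of_real (ln r)) * sin_quotient 0 + 0 * (b J 0 * exp (- 0 * of_real (ln r)))
      + (1 * regular_part N 0 + D * (sin (of_real pi * 0) / of_real pi))
      + \<i> / (2 * of_real pi) * (2 * of_real pi * \<i> * (L 0 - L (- of_real r)))) (at 0)"
    unfolding zeta_near_0_def[abs_def]
    by (intro DERIV_add DERIV_mult e sin_quotient_deriv_0 sn D DERIV_cmult circle_part_deriv_0)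
  also have "(- b J 0 * of_real (ln r)) * sin_quotient 0 + 0 * (b J 0 * exp (- 0 * of_real (ln r)))
      + (1 * regular_part N 0 + D * (sin (of_real pi * 0) / of_real pi))
      + \<i> / (2 * of_real pi) * (2 * of_real pi * \<i> * (L 0 - L (- of_real r))) = phase_const - L 0"
    unfolding regular_part_0[OF N] by (simp add: sin_quotient_def)
  finally have "(zeta has_field_derivative phase_const - L 0) (at 0)"
    by (rule has_field_derivative_transform_within_open[OF _ W]) (simp add: zeta_eq_near_0[OF N])
  then show "deriv zeta 0 = phase_const - L 0" by (rule DERIV_imp_deriv)
qed

end

lemma remove_sings_nicely_meromorphic_eq:
  assumes "f nicely_meromorphic_on A" "z \<in> A"
  shows "remove_sings f z = f z"
  using assms unfolding nicely_meromorphic_on_def by (metis remove_sings_at_pole remove_sings_eqI)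

text \<open>The difference vanishes off isolated points by the identity theorem, and the
  normalization of the values at singularities settles those points. This is the uniqueness behind
  the definite description in \<open>rel_zeta\<close>.\<close>

lemma nicely_meromorphic_on_UNIV_eqI:
  assumes f: "f nicely_meromorphic_on UNIV" and g: "g nicely_meromorphic_on UNIV"
    and A: "open A" "A \<noteq> {}" and eq: "\<And>z. z \<in> A \<Longrightarrow> f z = g z"
  shows "f = g"
proof
  fix z
  let ?d = "\<lambda>z. f z - g z"
  have mero: "?d meromorphic_on UNIV"
    using f g by (intro meromorphic_on_diff) (auto simp: nicely_meromorphic_on_def)
  have zero: "remove_sings ?d z = 0" if "z \<in> A" for z
  proof (rule remove_sings_eqI)
    have "\<forall>\<^sub>F w in at z. ?d w = 0"
      using eventually_at_in_open[OF A(1) that] by eventually_elim (simp add: eq)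
    then show "?d \<midarrow>z\<rightarrow> 0" by (rule tendsto_eventually)
  qed
  have "remove_sings ?d constant_on UNIV"
    by (rule constant_on_extend_nicely_meromorphic_on[OF remove_sings_nicely_meromorphic[OF mero], of A])
       (use zero A in \<open>auto simp: constant_on_def\<close>)
  then have all: "remove_sings ?d w = 0" for w
    using zero A(2) by (metis UNIV_I constant_on_def ex_in_conv)
  have "isolated_singularity_at ?d z"
    using mero by (auto simp: meromorphic_on_altdef)
  from eventually_remove_sings_eq_at[OF this] have "\<forall>\<^sub>F w in at z. f w = g w"
    by eventually_elim (simp add: all)
  then have "remove_sings f z = remove_sings g z" by (intro remove_sings_cong refl)
  then show "f z = g z"
    using remove_sings_nicely_meromorphic_eq[OF f] remove_sings_nicely_meromorphic_eq[OF g] by simp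
qed

theorem theorem2p10:
  fixes A1 A2 :: "('a::complex_hilbert \<times> 'a) set"
    and \<H> :: "complex \<Rightarrow> 'a set" and S :: "complex \<Rightarrow> 'a \<Rightarrow> 'a" and L :: "complex \<Rightarrow> complex"
    and \<alpha> :: "nat \<Rightarrow> real" and J :: nat and b :: "nat \<Rightarrow> nat \<Rightarrow> complex"
    and \<delta> \<rho> r r' \<phi> \<psi> :: real
  assumes comparable: "zeta_comparable \<delta> \<rho> A1 A2 \<H> S L \<alpha> J b"
    and positive: "positive_operator A1" "positive_operator A2"
    and delta: "\<delta> > pi / 2"
    and power_contour: "0 < r" "r < \<rho>"
    and heat_contour: "0 < r'" "r' < \<rho>" "0 < \<phi>" "pi - \<delta> < \<phi>" "\<phi> < pi / 2"
      "0 < \<psi>" "pi - \<delta> < \<psi>" "\<psi> < pi / 2"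
  shows "(\<forall>s. Re s > 1 \<longrightarrow>
            trace_class (power_minus r A1 s - power_minus r A2 s) \<and>
            rel_zeta r A1 A2 s = Tr (power_minus r A1 s - power_minus r A2 s))
       \<and> rel_zeta r A1 A2 nicely_meromorphic_on UNIV \<and> rel_zeta r A1 A2 analytic_on {0}
       \<and> (\<exists>c d a. expansion_at_infinity \<alpha> J (\<lambda>\<mu>. L (- of_real \<mu>)) c d a)
       \<and> (\<forall>t>0. trace_class (heat_op r' \<phi> \<psi> A1 t - heat_op r' \<phi> \<psi> A2 t))
       \<and> (\<forall>\<epsilon>>0. heat_integrand r' \<phi> \<psi> A1 A2 absolutely_integrable_on {\<epsilon>..})
       \<and> (\<exists>c'. expansion_at_zero \<alpha> J (heat_cutoff r' \<phi> \<psi> A1 A2)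
            (L 0 - LIM_at_infinity \<alpha> J (\<lambda>\<mu>. L (- of_real \<mu>))
               - rel_zeta r A1 A2 0 * deriv Gamma 1)
            (rel_zeta r A1 A2 0) c')
       \<and> log_det_heat \<alpha> J r' \<phi> \<psi> A1 A2
           = L 0 - LIM_at_infinity \<alpha> J (\<lambda>\<mu>. L (- of_real \<mu>))
               - rel_zeta r A1 A2 0 * deriv Gamma 1
       \<and> det_zeta r A1 A2
           = det_heat \<alpha> J r' \<phi> \<psi> A1 A2 * exp (rel_zeta r A1 A2 0 * deriv Gamma 1)"
proof -
  have cl: "closed_operator A1" "closed_operator A2"
    and cut: "spectral_cut \<delta> \<rho> A1" "spectral_cut \<delta> \<rho> A2"
    and region: "\<And>z. z \<in> cut_region \<delta> \<rho> \<Longrightarrow> trace_class (resolvent A1 z - resolvent A2 z) \<and>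
      (L has_field_derivative - Tr (resolvent A1 z - resolvent A2 z)) (at z)"
    and exps: "exponents \<alpha> J"
    and asym: "resolvent_trace_expansion (cut_region \<delta> \<rho>) \<alpha> J b (\<lambda>z. Tr (resolvent A1 z - resolvent A2 z))"
    using comparable unfolding zeta_comparable_def by blast+
  \<comment> \<open>One half-angle such that both heat rays stay outside the open sector and, being
    larger than \<open>pi - \<delta>\<close>, one for which the complement of that sector lies in
    the cut region.\<close>
  define m where "m = min \<phi> \<psi>"
  \<comment> \<open>A disc containing the circles of both contours and still smaller than the one of
    radius \<rho>.\<close>
  define \<sigma> where "\<sigma> = max r r'"
  define f where "f z = Tr (resolvent A1 z - resolvent A2 z)" for z
  define K where "K = sector_region m \<sigma>"
  have angles: "0 < m" "m < pi / 2" "m \<le> \<phi>" "m \<le> \<psi>" "pi - \<delta> < m"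
    using heat_contour by (auto simp: m_def)
  have pos: "0 < \<delta>" "0 < \<rho>" using cut(1) unfolding spectral_cut_def by blast+
  have radii: "0 < \<sigma>" "\<sigma> < \<rho>" "r \<le> \<sigma>" "r' \<le> \<sigma>" using power_contour heat_contour by (auto simp: \<sigma>_def)
  have K: "K \<subseteq> cut_region \<delta> \<rho>"
    unfolding K_def using angles radii pos by (intro sector_region_subset) auto
  have "0 \<in> cut_region \<delta> \<rho>" using pos by (simp add: cut_region_def)
  then have tc0: "trace_class (resolvent A1 0 - resolvent A2 0)" using region by blast
  have "\<exists>M C. resolvent_pair (resolvent A1) (resolvent A2) K M C"
    by (rule resolvent_pair_exists[OF cl positive cut tc0 _ K])
       (auto simp: K_def closed_sector_region cnj_sector_region)
  then obtain M C where "resolvent_pair (resolvent A1) (resolvent A2) K M C" by blast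
  then interpret rp: resolvent_pair "resolvent A1" "resolvent A2" K M C .
  interpret scattering_phase "cut_region \<delta> \<rho>" L f C m \<sigma> \<alpha> J b
  proof
    show "open (cut_region \<delta> \<rho>)" by (rule open_cut_region[OF pos])
    show "sector_region m \<sigma> \<subseteq> cut_region \<delta> \<rho>" using K by (simp add: K_def)
    show "(L has_field_derivative - f z) (at z)" if "z \<in> cut_region \<delta> \<rho>" for z
      using region[OF that] by (simp add: f_def)
    show "cmod (f z) \<le> C" if "z \<in> sector_region m \<sigma>" for z
      unfolding f_def by (rule norm_Tr_le[OF rp.trace]) (use that in \<open>simp add: K_def\<close>)
    show "resolvent_trace_expansion (cut_region \<delta> \<rho>) \<alpha> J b f"
      using asym by (simp add: f_def[abs_def])
  qed (use angles radii exps in auto)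
  interpret Z: zeta_phase "cut_region \<delta> \<rho>" L f C m \<sigma> \<alpha> J b r
    by unfold_locales (use power_contour radii in auto)
  interpret H: heat_phase "cut_region \<delta> \<rho>" L f C m \<sigma> \<alpha> J b \<phi> "2 * pi - \<psi>"
    by unfold_locales (use angles heat_contour in auto)
  have K_circle: "rcis x \<theta> \<in> K" if "0 \<le> x" "x \<le> \<sigma>" for x \<theta>
    using that by (simp add: K_def sector_region_def)
  have K_ray: "rcis x \<theta> \<in> K" if "0 \<le> x" "cos \<theta> \<le> cos m" for x \<theta>
    using that mult_left_mono[OF that(2,1)] by (simp add: K_def sector_region_def)

  have power: "trace_class (power_minus r A1 s - power_minus r A2 s) \<and>
      Tr (power_minus r A1 s - power_minus r A2 s) = Z.zeta s" if s: "Re s > 1" for s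
  proof -
    let ?w = "\<lambda>x \<theta>. exp (- s * Complex (ln x) \<theta>)"
    have c: "continuous_on {r..} (\<lambda>x. ?w x \<theta>)" for \<theta>
      unfolding Complex_eq using power_contour by (intro continuous_intros) auto
    have i: "(\<lambda>x. cmod (?w x \<theta>)) integrable_on {r..}" for \<theta>
    proof (rule integrable_cong[THEN iffD1])
      show "(\<lambda>x. exp (Im s * \<theta>) * x powr (- Re s)) integrable_on {r..}"
        using power_contour s by (intro powr_integrable_halfline) auto
      show "exp (Im s * \<theta>) * x powr (- Re s) = cmod (?w x \<theta>)" if "x \<in> {r..}" for x
        using that power_contour by (simp add: powr_def exp_add[symmetric])
    qed
    have arc: "continuous_on {0..1} (\<lambda>t. ?w r (pi + t * (- pi - pi)))"
      unfolding Complex_eq by (intro continuous_intros)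
    have "- 1 \<le> cos m" by simp
    then have ray: "rcis x pi \<in> K" "rcis x (- pi) \<in> K" if "x \<ge> r" for x
      using that power_contour by (auto intro!: K_ray)
    have circ: "rcis r (pi + t * (- pi - pi)) \<in> K" for t
      using power_contour radii by (intro K_circle) auto
    note * = rp.contour_trace[of r ?w pi "- pi", OF c i c i arc ray circ, of "\<i> / (2 * of_real pi)"]
    show ?thesis
      unfolding power_minus_def Z.zeta_integral[OF s] f_def using * by (intro conjI)
  qed
  have rel_zeta: "rel_zeta r A1 A2 = Z.zeta"
    unfolding rel_zeta_def
  proof (rule the_equality)
    show "Z.zeta nicely_meromorphic_on UNIV \<and>
        (\<forall>s. Re s > 1 \<longrightarrow> Z.zeta s = Tr (power_minus r A1 s - power_minus r A2 s))"
      using Z.zeta_nicely_meromorphic power by simp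
    fix g assume g: "g nicely_meromorphic_on UNIV \<and>
        (\<forall>s. Re s > 1 \<longrightarrow> g s = Tr (power_minus r A1 s - power_minus r A2 s))"
    show "g = Z.zeta"
    proof (rule nicely_meromorphic_on_UNIV_eqI[OF conjunct1[OF g] Z.zeta_nicely_meromorphic])
      show "open {s. 1 < Re s}" by (rule open_halfspace_Re_gt)
      have "2 \<in> {s. 1 < Re s}" by simp
      then show "{s. 1 < Re s} \<noteq> {}" by blast
      show "g s = Z.zeta s" if "s \<in> {s. 1 < Re s}" for s using g power that by simp
    qed
  qed

  have heat: "trace_class (heat_op r' \<phi> \<psi> A1 t - heat_op r' \<phi> \<psi> A2 t) \<and>
      Tr (heat_op r' \<phi> \<psi> A1 t - heat_op r' \<phi> \<psi> A2 t) = H.heat t" if t: "t > 0" for t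
  proof -
    let ?w = "\<lambda>x \<theta>. exp (- of_real t * rcis x \<theta>)"
    have c: "continuous_on {r'..} (\<lambda>x. ?w x \<theta>)" for \<theta>
      unfolding rcis_def by (intro continuous_intros)
    have cos: "0 < cos \<phi>" "cos \<phi> \<le> cos m" "0 < cos \<psi>" "cos \<psi> \<le> cos m" "cos (2 * pi - \<psi>) = cos \<psi>"
      using angles heat_contour by (auto intro!: cos_gt_zero cos_monotone_0_pi_le simp: cos_diff)
    have i: "(\<lambda>x. cmod (?w x \<theta>)) integrable_on {r'..}" if "0 < cos \<theta>" for \<theta>
      using has_integral_exp_minus_to_infinity[of "t * cos \<theta>" r'] that t
      by (simp add: has_integral_integrable mult_ac)
    have i1: "(\<lambda>x. cmod (?w x \<phi>)) integrable_on {r'..}" by (rule i) (rule cos)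
    have i2: "(\<lambda>x. cmod (?w x (2 * pi - \<psi>))) integrable_on {r'..}" by (rule i) (simp only: cos)
    have arc: "continuous_on {0..1} (\<lambda>u. ?w r' (\<phi> + u * (2 * pi - \<psi> - \<phi>)))"
      unfolding rcis_def cis_conv_exp by (intro continuous_intros)
    have ray: "rcis x \<phi> \<in> K" "rcis x (2 * pi - \<psi>) \<in> K" if "x \<ge> r'" for x
      using that heat_contour cos by (auto intro!: K_ray)
    have circ: "rcis r' (\<phi> + u * (2 * pi - \<psi> - \<phi>)) \<in> K" for u
      using heat_contour radii by (intro K_circle) auto
    note * = rp.contour_trace[of r' ?w \<phi> "2 * pi - \<psi>", OF c i1 c i2 arc ray circ, of "\<i> / (2 * of_real pi)"]
    show ?thesis
      unfolding heat_op_def H.heat_radius[OF heat_contour(1) t] H.hankel_def f_def using * by (intro conjI)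
  qed
  have integrand: "heat_integrand r' \<phi> \<psi> A1 A2 t = - (1 / of_real t) * H.heat t" if "t > 0" for t
    using heat[OF that] by (simp add: heat_integrand_def)
  have integrable: "heat_integrand r' \<phi> \<psi> A1 A2 absolutely_integrable_on {\<epsilon>..}"
    and cutoff: "heat_cutoff r' \<phi> \<psi> A1 A2 \<epsilon> = H.heat_primitive \<epsilon>" if \<epsilon>: "\<epsilon> > 0" for \<epsilon>
  proof -
    have eq: "- (1 / of_real t) * H.heat t = heat_integrand r' \<phi> \<psi> A1 A2 t" if "t \<in> {\<epsilon>..}" for t
      using integrand[of t] that \<epsilon> by simp
    show "heat_integrand r' \<phi> \<psi> A1 A2 absolutely_integrable_on {\<epsilon>..}"
      by (rule set_integrable_cong[THEN iffD1, OF refl refl eq H.heat_over_t(1)[OF \<epsilon>]])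
    show "heat_cutoff r' \<phi> \<psi> A1 A2 \<epsilon> = H.heat_primitive \<epsilon>"
      unfolding heat_cutoff_def H.heat_over_t(2)[OF \<epsilon>, symmetric] by (rule integral_cong) (simp only: eq)
  qed

  have lim: "LIM_at_infinity \<alpha> J (\<lambda>\<mu>. L (- of_real \<mu>)) = phase_const"
    by (rule LIM_at_infinity_eq[OF exps expansion_at_infinity_L])
  have expansion: "expansion_at_zero \<alpha> J (heat_cutoff r' \<phi> \<psi> A1 A2)
      (L 0 - phase_const - b J 0 * deriv Gamma 1) (b J 0) H.heat_coeff"
    by (rule H.heat_cutoff_expansion[OF cutoff])
  have log_det: "log_det_heat \<alpha> J r' \<phi> \<psi> A1 A2 = L 0 - phase_const - b J 0 * deriv Gamma 1"
    unfolding log_det_heat_def by (rule LIM_at_zero_eq[OF exps expansion])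
  \<comment> \<open>Both sides equal \<open>exp (L 0 - phase_const)\<close>.\<close>
  have det: "det_zeta r A1 A2 = det_heat \<alpha> J r' \<phi> \<psi> A1 A2 * exp (b J 0 * deriv Gamma 1)"
    unfolding det_zeta_def det_heat_def log_det rel_zeta Z.zeta_at_0(3) exp_add[symmetric] by simp
  show ?thesis
    unfolding rel_zeta lim log_det Z.zeta_at_0(2)
    using power heat integrable det expansion expansion_at_infinity_L Z.zeta_nicely_meromorphic Z.zeta_at_0(1)
    by (intro conjI allI impI exI) simp_all
qed

end
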